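(* For every real number $\alpha\ge 0$ there exists a Sidon automorphism (Sidon rank one construction) $T$ such that for natural numbers $n\ge 1$: the tensor power $T^{\otimes n}$ has singular spectrum if $n\le 1+\alpha/2$, and Lebesgue spectrum if $n>1+\alpha/2$; moreover, $T^{\otimes n}$ is conservative if $n\le 1+\alpha$ and dissipative if $n>1+\alpha$.
   Context: Rank one constructions. Fix a natural number $h_1$, a sequence of natural numbers $r_j$, $j\ge1$, and a sequence of vectors of non-negative integers $\bar s_j=(s_j(1),\dots,s_j(r_j))$ (spacer parameters). At stage $j$ one has disjoint half-intervals of equal length $E_j,TE_j,\dots,T^{h_j-1}E_j$, where $T$ acts as a translation on $E_j,\dots,T^{h_j-2}E_j$; this family, and also its union $X_j$, is called the tower of stage $j$. Represent $E_j$ as a disjoint union of $r_j$ half-intervals $E_j^1,\dots,E_j^{r_j}$ of the same length. For $1\le i\le r_j$ the column $X_{i,j}$ is the union of $E_j^i,TE_j^i,\dots,T^{h_j-1}E_j^i$. Above each column $X_{i,j}$ add $s_j(i)$ new disjoint half-intervals of the same measure as $E_j^i$, obtaining $E_j^i,TE_j^i,\dots,T^{h_j+s_j(i)-1}E_j^i$ (all these sets are disjoint). Put $E_{j+1}=E_j^1$ and, for $i<r_j$, $T^{h_j+s_j(i)}E_j^i=E_j^{i+1}$. The result is the tower of stage $j+1$: $E_{j+1},TE_{j+1},\dots,T^{h_{j+1}-1}E_{j+1}$, with $h_{j+1}=h_jr_j+\sum_{i=1}^{r_j}s_j(i)$. The partial definition of $T$ at stage $j$ is kept at all later stages. This yields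 an invertible transformation $T$ of $X=\bigcup_jX_j$ preserving the Lebesgue measure $\mu$ on $X$ (finite or sigma-finite). Sidon: a rank one construction $T$ is called Sidon if for every $j$ and every $m$ with $h_j<m\le h_{j+1}$ the intersection $T^mX_j\cap X_j$ is contained in a single column $X_{i,j}$ of $X_j$. The tensor power $T^{\otimes n}$ is the product transformation $T\times\cdots\times T$ ($n$ factors) on $(X^n,\mu^n)$; the same symbol denotes the induced unitary operator on $L_2(X^n,\mu^n)$. The spectrum is singular if the maximal spectral type of this operator, a measure on the unit circle, is singular with respect to Lebesgue measure on the circle, and Lebesgue if the maximal spectral type is equivalent to Lebesgue measure on the circle. A measurable set $W$ is wandering for $S$ if the sets $S^mW$, $m\in\mathbb Z$, are pairwise disjoint. $S$ is conservative if there is no wandering set of positive measure, and dissipative if, up to a null set, the whole space is $\bigcup_{m\in\mathbb Z}S^mW$ for some wandering set $W$. *)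

theory Defs
  imports "HOL-Analysis.Analysis"
begin

section \<open>Spectral types of invertible measure-preserving transformations\<close>

text \<open>Integer iterates of a bijection \<open>S\<close> of \<open>space M\<close>.\<close>

definition iterate_int :: "'a measure \<Rightarrow> ('a \<Rightarrow> 'a) \<Rightarrow> int \<Rightarrow> 'a \<Rightarrow> 'a" where
  "iterate_int M S m =
     (if 0 \<le> m then S ^^ nat m else inv_into (space M) S ^^ nat (- m))"

text \<open>Elements of \<open>L\<^sub>2\<close> are represented by functions; everything below depends only on
  their classes modulo null sets.\<close>

definition L2 :: "'a measure \<Rightarrow> ('a \<Rightarrow> complex) set" where
  "L2 M = {f \<in> borel_measurable M. integrable M (\<lambda>x. (cmod (f x))\<^sup>2)}"

definition L2_inner :: "'a measure \<Rightarrow> ('a \<Rightarrow> complex) \<Rightarrow> ('a \<Rightarrow> complex) \<Rightarrow> complex" where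
  "L2_inner M f g = (\<integral>x. f x * cnj (g x) \<partial>M)"

text \<open>The \<open>m\<close>-th power of the unitary operator \<open>f \<mapsto> f \<circ> S\<close> on \<open>L2 M\<close>.\<close>

definition koopman_power ::
    "'a measure \<Rightarrow> ('a \<Rightarrow> 'a) \<Rightarrow> int \<Rightarrow> ('a \<Rightarrow> complex) \<Rightarrow> 'a \<Rightarrow> complex" where
  "koopman_power M S m f = (\<lambda>x. f (iterate_int M S m x))"

definition circle_borel :: "complex measure" where
  "circle_borel = restrict_space borel (sphere 0 1)"

definition circle_lebesgue :: "complex measure" where
  "circle_lebesgue = distr (restrict_space lborel {0..<2 * pi}) circle_borel cis"

definition spectral_measure ::
    "'a measure \<Rightarrow> ('a \<Rightarrow> 'a) \<Rightarrow> ('a \<Rightarrow> complex) \<Rightarrow> complex measure \<Rightarrow> bool" where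
  "spectral_measure M S f \<sigma> \<longleftrightarrow>
     finite_measure \<sigma> \<and> sets \<sigma> = sets circle_borel \<and>
     (\<forall>m::int. (\<integral>z. z powi m \<partial>\<sigma>) = L2_inner M (koopman_power M S m f) f)"

text \<open>A measure of maximal spectral type dominates the spectral measures of all vectors and
  is equivalent to the spectral measure of some vector; this determines it up to equivalence.
  Note that \<open>absolutely_continuous \<sigma> \<nu>\<close> is \<open>\<nu> \<lless> \<sigma>\<close>.\<close>

definition maximal_spectral_type ::
    "'a measure \<Rightarrow> ('a \<Rightarrow> 'a) \<Rightarrow> complex measure \<Rightarrow> bool" where
  "maximal_spectral_type M S \<sigma> \<longleftrightarrow>
     finite_measure \<sigma> \<and> sets \<sigma> = sets circle_borel \<and>
     (\<forall>f\<in>L2 M. \<forall>\<nu>. spectral_measure M S f \<nu> \<longrightarrow> absolutely_continuous \<sigma> \<nu>) \<and>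
     (\<exists>f\<in>L2 M. \<exists>\<nu>. spectral_measure M S f \<nu> \<and> absolutely_continuous \<nu> \<sigma>)"

definition mutually_singular :: "'a measure \<Rightarrow> 'a measure \<Rightarrow> bool" where
  "mutually_singular M N \<longleftrightarrow>
     (\<exists>A \<in> sets M \<inter> sets N. emeasure M A = 0 \<and> emeasure N (space N - A) = 0)"

definition singular_spectrum :: "'a measure \<Rightarrow> ('a \<Rightarrow> 'a) \<Rightarrow> bool" where
  "singular_spectrum M S \<longleftrightarrow>
     (\<exists>\<sigma>. maximal_spectral_type M S \<sigma> \<and> mutually_singular \<sigma> circle_lebesgue)"

definition lebesgue_spectrum :: "'a measure \<Rightarrow> ('a \<Rightarrow> 'a) \<Rightarrow> bool" where
  "lebesgue_spectrum M S \<longleftrightarrow>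
     (\<exists>\<sigma>. maximal_spectral_type M S \<sigma> \<and>
        absolutely_continuous \<sigma> circle_lebesgue \<and> absolutely_continuous circle_lebesgue \<sigma>)"


section \<open>Conservativity and dissipativity\<close>

definition wandering :: "'a measure \<Rightarrow> ('a \<Rightarrow> 'a) \<Rightarrow> 'a set \<Rightarrow> bool" where
  "wandering M S W \<longleftrightarrow>
     W \<in> sets M \<and> disjoint_family (\<lambda>m::int. iterate_int M S m ` W)"

definition conservative :: "'a measure \<Rightarrow> ('a \<Rightarrow> 'a) \<Rightarrow> bool" where
  "conservative M S \<longleftrightarrow> \<not> (\<exists>W. wandering M S W \<and> emeasure M W > 0)"

definition dissipative :: "'a measure \<Rightarrow> ('a \<Rightarrow> 'a) \<Rightarrow> bool" where
  "dissipative M S \<longleftrightarrow>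
     (\<exists>W. wandering M S W \<and> space M - (\<Union>m::int. iterate_int M S m ` W) \<in> null_sets M)"


section \<open>Tensor powers\<close>

definition tensor_space :: "nat \<Rightarrow> 'a measure \<Rightarrow> (nat \<Rightarrow> 'a) measure" where
  "tensor_space n M = PiM {..<n} (\<lambda>_. M)"

definition tensor_power :: "nat \<Rightarrow> ('a \<Rightarrow> 'a) \<Rightarrow> (nat \<Rightarrow> 'a) \<Rightarrow> (nat \<Rightarrow> 'a)" where
  "tensor_power n T = (\<lambda>x. \<lambda>i\<in>{..<n}. T (x i))"


section \<open>Rank one constructions\<close>

definition half_interval :: "real \<Rightarrow> real set \<Rightarrow> bool" where
  "half_interval w A \<longleftrightarrow> 0 < w \<and> (\<exists>a. A = {a..<a + w})"

definition tower :: "(nat \<Rightarrow> nat) \<Rightarrow> (nat \<Rightarrow> real set) \<Rightarrow> (real \<Rightarrow> real) \<Rightarrow> nat \<Rightarrow> real set" where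
  "tower h E T j = (\<Union>k<h j. (T ^^ k) ` E j)"

definition column ::
    "(nat \<Rightarrow> nat) \<Rightarrow> (nat \<Rightarrow> nat \<Rightarrow> real set) \<Rightarrow> (real \<Rightarrow> real) \<Rightarrow> nat \<Rightarrow> nat \<Rightarrow> real set" where
  "column h B T j i = (\<Union>k<h j. (T ^^ k) ` B j i)"

definition phase_set :: "(nat \<Rightarrow> nat) \<Rightarrow> (nat \<Rightarrow> real set) \<Rightarrow> (real \<Rightarrow> real) \<Rightarrow> real set" where
  "phase_set h E T = (\<Union>j\<in>{1..}. tower h E T j)"

definition phase_space :: "(nat \<Rightarrow> nat) \<Rightarrow> (nat \<Rightarrow> real set) \<Rightarrow> (real \<Rightarrow> real) \<Rightarrow> real measure" where
  "phase_space h E T = restrict_space lborel (phase_set h E T)"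

text \<open>Stages \<open>j\<close> and columns \<open>i\<close> are numbered from \<open>1\<close>; values at \<open>0\<close> play no role.
  \<open>B j i\<close> is the base \<open>E\<^sub>j\<^sup>i\<close> of the \<open>i\<close>-th column of stage \<open>j\<close>, and \<open>s j i\<close> is the number of
  spacers put above that column.  The spacers \<open>(T ^^ (h j + k)) ` B j i\<close>, \<open>k < s j i\<close>, are
  exactly the levels of tower \<open>j + 1\<close> that are not levels of a column of stage \<open>j\<close>; that they
  are new, and translates of \<open>B j i\<close>, is thus part of \<open>levels_disjoint\<close> and \<open>translation\<close>
  at stage \<open>j + 1\<close>.

  If all but finitely many \<open>r j\<close> were \<open>1\<close>, the stages would not determine an invertible
  transformation: \<open>r_infinitely_often\<close> says that the length of \<open>E j\<close> tends to \<open>0\<close>, so that the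
  stages determine \<open>T\<close> and its inverse except at a single point each.  The values there are
  subject to \<open>bij\<close>; by the choice of the position of \<open>B j 1\<close> and \<open>B j (r j)\<close> in \<open>E j\<close> every
  sequence of parameters has a realization in which \<open>T\<close> is a bijection everywhere.\<close>

locale rank_one_construction =
  fixes h :: "nat \<Rightarrow> nat"
    and r :: "nat \<Rightarrow> nat"
    and s :: "nat \<Rightarrow> nat \<Rightarrow> nat"
    and E :: "nat \<Rightarrow> real set"
    and B :: "nat \<Rightarrow> nat \<Rightarrow> real set"
    and T :: "real \<Rightarrow> real"
  assumes h_1: "1 \<le> h 1"
    and r_pos: "\<And>j. 1 \<le> j \<Longrightarrow> 1 \<le> r j"
    and r_infinitely_often: "infinite {j. 2 \<le> r j}"
    and h_Suc: "\<And>j. 1 \<le> j \<Longrightarrow> h (j + 1) = h j * r j + (\<Sum>i = 1..r j. s j i)"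
    and base: "\<And>j. 1 \<le> j \<Longrightarrow> \<exists>w. half_interval w (E j)"
    and levels_disjoint: "\<And>j. 1 \<le> j \<Longrightarrow> disjoint_family_on (\<lambda>k. (T ^^ k) ` E j) {..<h j}"
    and translation: "\<And>j k. 1 \<le> j \<Longrightarrow> k + 1 < h j \<Longrightarrow> \<exists>c. \<forall>x\<in>(T ^^ k) ` E j. T x = x + c"
    and cut: "\<And>j. 1 \<le> j \<Longrightarrow> E j = (\<Union>i\<in>{1..r j}. B j i)"
    and cut_disjoint: "\<And>j. 1 \<le> j \<Longrightarrow> disjoint_family_on (B j) {1..r j}"
    and cut_equal: "\<And>j. 1 \<le> j \<Longrightarrow> \<exists>w. \<forall>i\<in>{1..r j}. half_interval w (B j i)"
    and next_base: "\<And>j. 1 \<le> j \<Longrightarrow> E (j + 1) = B j 1"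
    and stack: "\<And>j i. 1 \<le> j \<Longrightarrow> 1 \<le> i \<Longrightarrow> i < r j \<Longrightarrow>
                  (T ^^ (h j + s j i)) ` B j i = B j (i + 1)"
    and bij: "bij_betw T (phase_set h E T) (phase_set h E T)"

definition sidon ::
    "(nat \<Rightarrow> nat) \<Rightarrow> (nat \<Rightarrow> nat) \<Rightarrow> (nat \<Rightarrow> real set) \<Rightarrow> (nat \<Rightarrow> nat \<Rightarrow> real set) \<Rightarrow>
     (real \<Rightarrow> real) \<Rightarrow> bool" where
  "sidon h r E B T \<longleftrightarrow>
     (\<forall>j\<ge>1. \<forall>m. h j < m \<and> m \<le> h (j + 1) \<longrightarrow>
        (\<exists>i\<in>{1..r j}. (T ^^ m) ` tower h E T j \<inter> tower h E T j \<subseteq> column h B T j i))"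

end

theory Submission
  imports Defs "HOL-Probability.Probability"
begin

text \<open>Copies of the tower of stage \<open>j\<close>, of height \<open>H j\<close>, are placed in the next tower at the heights
  \<open>P j i = 4 * H j * (8 ^ i - 1)\<close>, \<open>i < r j\<close>. Since these grow geometrically, the time \<open>m\<close> determines the
  pair of copies between which \<open>T ^^ m\<close> can move a point, which gives the Sidon property, and the spectral
  measures of the cells (products of levels) of the \<open>n\<close>-th tensor power are Riesz products with factors
  \<open>1 + \<Sum>i\<noteq>l. r j powi (- n) * z powi (P j i - P j l)\<close>.
  Up to null sets such a product is equivalent to Lebesgue measure if the energy \<open>\<Sum>j. r j powi (2 - 2 * n)\<close>
  converges and singular if it diverges.
  A return of \<open>n\<close> coordinates to the tower of stage \<open>j\<close> at a time between \<open>H j\<close> and \<open>H (Suc j)\<close> requires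
  all of them to be in the same column, which has probability \<open>r j powi (1 - n)\<close>. If the sum of these
  probabilities converges, almost every point returns finitely often by Borel-Cantelli; if it diverges,
  a wandering set has density at most one half in every cell and hence is null.
  The choice \<open>r j \<sim> j powr (1 / \<alpha>)\<close> (for \<open>\<alpha> = 0\<close>: \<open>r j = 2 ^ Suc j\<close>) puts the two thresholds at
  \<open>1 + \<alpha> / 2\<close> and \<open>1 + \<alpha>\<close>.\<close>

section \<open>Square integrable functions\<close>

text \<open>Because a time determines the pair of copies, the recursion for the correlations never
  adds two nonzero terms. Taking n-th powers therefore commutes with it: the n-th powers of the
  correlations of a level are again Riesz coefficients, with \<open>r j ^ n\<close> in place of
  \<open>r j\<close>. In particular the squares of the coefficients for \<open>n\<close> are the
  coefficients for \<open>2 * n\<close>, and their sum is the value at 1 of a product with factors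
  at most \<open>1 + energy n k\<close>; this is the origin of the energy series. The obstacle on
  the spectral side is that cells of different stages have different spectral measures
  \<open>lam n j\<close>. Consecutive ones differ by one factor, which has finitely many zeros, and
  unboundedness of \<open>r\<close> excludes atoms; hence they all have the same null sets and stage
  0 represents the maximal spectral type. The base 8 leaves room for sums of three powers, which
  occur in the second moments, without a carry. The factor \<open>4 * H j\<close> leaves room for
  errors of a few tower heights, so that an approximate gap still determines the exact one.\<close>

lemma le_sqrt_mult_if_scaled_le:
  fixes x a b :: real
  assumes "\<And>t. t > 0 \<Longrightarrow> x \<le> (t * a + b / t) / 2" "a \<ge> 0" "b \<ge> 0"
  shows "x \<le> sqrt a * sqrt b"
proof (rule field_le_epsilon)
  fix e :: real assume e: "e > 0"
  show "x \<le> sqrt a * sqrt b + e"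
  proof (cases "a = 0 \<or> b = 0")
    case False
    hence "a > 0" "b > 0" using assms by auto
    \<comment> \<open>This \<open>t\<close> minimizes the right-hand side. If \<open>a\<close> or
      \<open>b\<close> vanishes there is no minimizer, and \<open>t\<close> is taken very large or
      very small instead.\<close>
    define t where "t = sqrt b / sqrt a"
    have "t * a = sqrt b * sqrt a" "b / t = sqrt b * sqrt a"
      using \<open>a > 0\<close> \<open>b > 0\<close> by (simp_all add: t_def field_simps)
    moreover have "t > 0" using \<open>a > 0\<close> \<open>b > 0\<close> by (simp add: t_def)
    ultimately show ?thesis using assms(1)[of t] e by (simp add: mult.commute)
  next
    case True
    then show ?thesis
    proof
      assume "a = 0"
      define q where "q = b / ((b + 1) / e)"
      have "q \<le> e" using e assms(3) by (simp add: q_def field_simps)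
      moreover have "x \<le> q / 2"
        using assms(1)[of "(b + 1) / e"] e assms(3) \<open>a = 0\<close> by (simp add: q_def)
      ultimately have "x \<le> e" using e by linarith
      then show ?thesis using \<open>a = 0\<close> by simp
    next
      assume "b = 0"
      define q where "q = e / (a + 1) * a"
      have "q \<le> e" using e assms(2) by (simp add: q_def field_simps)
      moreover have "x \<le> q / 2"
        using assms(1)[of "e / (a + 1)"] e assms(2) \<open>b = 0\<close> by (simp add: q_def)
      ultimately have "x \<le> e" using e by linarith
      then show ?thesis using \<open>b = 0\<close> by simp
    qed
  qed
qed

lemma L2_measurable: "f \<in> L2 M \<Longrightarrow> f \<in> borel_measurable M"
  by (simp add: L2_def)

lemma L2_integrable: "f \<in> L2 M \<Longrightarrow> integrable M (\<lambda>x. (cmod (f x))\<^sup>2)"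
  by (simp add: L2_def)

lemma L2_add:
  assumes "f \<in> L2 M" "g \<in> L2 M"
  shows "(\<lambda>x. f x + g x) \<in> L2 M"
proof -
  have [measurable]: "f \<in> borel_measurable M" "g \<in> borel_measurable M"
    using assms by (auto simp: L2_def)
  have "(cmod (f x + g x))\<^sup>2 \<le> 2 * (cmod (f x))\<^sup>2 + 2 * (cmod (g x))\<^sup>2" for x
  proof -
    have "(cmod (f x + g x))\<^sup>2 \<le> (cmod (f x) + cmod (g x))\<^sup>2"
      by (intro power_mono norm_triangle_ineq) auto
    also have "\<dots> \<le> 2 * (cmod (f x))\<^sup>2 + 2 * (cmod (g x))\<^sup>2"
      using sum_squares_bound[of "cmod (f x)" "cmod (g x)"] by (simp add: power2_sum)
    finally show ?thesis .
  qed
  moreover have "integrable M (\<lambda>x. 2 * (cmod (f x))\<^sup>2 + 2 * (cmod (g x))\<^sup>2)"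
    using assms by (auto simp: L2_def)
  ultimately have "integrable M (\<lambda>x. (cmod (f x + g x))\<^sup>2)"
    by (elim Bochner_Integration.integrable_bound) (auto simp: abs_of_nonneg)
  then show ?thesis by (simp add: L2_def)
qed

lemma L2_scale: "f \<in> L2 M \<Longrightarrow> (\<lambda>x. c * f x) \<in> L2 M"
  by (auto simp: L2_def norm_mult power_mult_distrib)

lemma L2_zero: "(\<lambda>x. 0) \<in> L2 M"
  by (simp add: L2_def)

lemma L2_diff: "f \<in> L2 M \<Longrightarrow> g \<in> L2 M \<Longrightarrow> (\<lambda>x. f x - g x) \<in> L2 M"
  using L2_add[of f M "\<lambda>x. - 1 * g x"] L2_scale[of g M "-1"] by simp

lemma L2_sum: "(\<And>i. i \<in> I \<Longrightarrow> f i \<in> L2 M) \<Longrightarrow> (\<lambda>x. \<Sum>i\<in>I. f i x) \<in> L2 M"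
  by (induction I rule: infinite_finite_induct) (auto simp: L2_zero intro: L2_add)

lemma L2_indicator:
  "A \<in> sets M \<Longrightarrow> emeasure M A < \<infinity> \<Longrightarrow> (indicator A :: _ \<Rightarrow> complex) \<in> L2 M"
proof -
  assume A: "A \<in> sets M" "emeasure M A < \<infinity>"
  have "(\<lambda>x. (cmod (indicator A x))\<^sup>2) = indicator A"
    by (auto simp: fun_eq_iff indicator_def)
  then show ?thesis using A by (simp add: L2_def less_top)
qed

lemma L2_indicator_integral:
  "A \<in> sets M \<Longrightarrow> (\<integral>x. (cmod (indicator A x))\<^sup>2 \<partial>M) = measure M A"
proof -
  assume A: "A \<in> sets M"
  have "(\<lambda>x. (cmod (indicator A x))\<^sup>2) = indicator A"
    by (auto simp: fun_eq_iff indicator_def)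
  then show ?thesis using A sets.sets_into_space[OF A] by (simp add: Int_absorb2)
qed

lemma L2_prod_integrable:
  assumes "f \<in> L2 M" "g \<in> L2 M"
  shows "integrable M (\<lambda>x. f x * cnj (g x))"
proof -
  have [measurable]: "f \<in> borel_measurable M" "g \<in> borel_measurable M"
    using assms by (auto simp: L2_def)
  have [measurable]: "(\<lambda>x. cnj (g x)) \<in> borel_measurable M"
    using borel_measurable_continuous_onI[OF continuous_on_cnj[OF continuous_on_id]]
    by (rule measurable_compose_rev) simp
  have "integrable M (\<lambda>x. (cmod (f x))\<^sup>2 + (cmod (g x))\<^sup>2)"
    using assms by (auto simp: L2_def)
  then show ?thesis
  proof (rule Bochner_Integration.integrable_bound)
    show "AE x in M. norm (f x * cnj (g x)) \<le> norm ((cmod (f x))\<^sup>2 + (cmod (g x))\<^sup>2)"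
    proof (rule AE_I2)
      fix x
      have "2 * (cmod (f x) * cmod (g x)) \<le> (cmod (f x))\<^sup>2 + (cmod (g x))\<^sup>2"
        using sum_squares_bound[of "cmod (f x)" "cmod (g x)"] by simp
      moreover have "0 \<le> cmod (f x) * cmod (g x)" by (intro mult_nonneg_nonneg norm_ge_zero)
      ultimately have "cmod (f x) * cmod (g x) \<le> (cmod (f x))\<^sup>2 + (cmod (g x))\<^sup>2" by linarith
      then show "norm (f x * cnj (g x)) \<le> norm ((cmod (f x))\<^sup>2 + (cmod (g x))\<^sup>2)"
        by (simp add: norm_mult)
    qed
  qed measurable
qed

lemma L2_cauchy_schwarz:
  assumes "f \<in> L2 M" "g \<in> L2 M"
  shows "cmod (\<integral>x. f x * cnj (g x) \<partial>M) \<le>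
    sqrt (\<integral>x. (cmod (f x))\<^sup>2 \<partial>M) * sqrt (\<integral>x. (cmod (g x))\<^sup>2 \<partial>M)"
proof (rule le_sqrt_mult_if_scaled_le)
  fix t :: real assume t: "t > 0"
  have "cmod (\<integral>x. f x * cnj (g x) \<partial>M) \<le> (\<integral>x. cmod (f x * cnj (g x)) \<partial>M)"
    by (rule integral_norm_bound)
  also have "\<dots> \<le> (\<integral>x. (t * (cmod (f x))\<^sup>2 + (cmod (g x))\<^sup>2 / t) / 2 \<partial>M)"
  proof (rule integral_mono)
    show "integrable M (\<lambda>x. cmod (f x * cnj (g x)))"
      using L2_prod_integrable[OF assms] by (rule integrable_norm)
    show "integrable M (\<lambda>x. (t * (cmod (f x))\<^sup>2 + (cmod (g x))\<^sup>2 / t) / 2)"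
      using assms by (auto simp: L2_def)
    fix x
    have "0 \<le> (t * cmod (f x) - cmod (g x))\<^sup>2 / t" using t by simp
    also have "\<dots> = t * (cmod (f x))\<^sup>2 + (cmod (g x))\<^sup>2 / t - 2 * (cmod (f x) * cmod (g x))"
      using t by (simp add: power2_diff field_simps power2_eq_square)
    finally show "cmod (f x * cnj (g x)) \<le> (t * (cmod (f x))\<^sup>2 + (cmod (g x))\<^sup>2 / t) / 2"
      by (simp add: norm_mult)
  qed
  also have "\<dots> = (t * (\<integral>x. (cmod (f x))\<^sup>2 \<partial>M) + (\<integral>x. (cmod (g x))\<^sup>2 \<partial>M) / t) / 2"
    using assms by (subst integral_divide_zero, subst Bochner_Integration.integral_add) (auto simp: L2_def)
  finally show "cmod (\<integral>x. f x * cnj (g x) \<partial>M) \<le>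
      (t * (\<integral>x. (cmod (f x))\<^sup>2 \<partial>M) + (\<integral>x. (cmod (g x))\<^sup>2 \<partial>M) / t) / 2" .
qed auto

text \<open>Replaces the triangle inequality of the norm: with squared norms and a factor 2, the
  later epsilon estimates need no square roots.\<close>

lemma L2_add_integral_le:
  assumes "f \<in> L2 M" "g \<in> L2 M"
  shows "(\<integral>x. (cmod (f x + g x))\<^sup>2 \<partial>M) \<le>
    2 * (\<integral>x. (cmod (f x))\<^sup>2 \<partial>M) + 2 * (\<integral>x. (cmod (g x))\<^sup>2 \<partial>M)"
proof -
  have "(\<integral>x. (cmod (f x + g x))\<^sup>2 \<partial>M) \<le> (\<integral>x. 2 * (cmod (f x))\<^sup>2 + 2 * (cmod (g x))\<^sup>2 \<partial>M)"
  proof (rule integral_mono)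
    show "integrable M (\<lambda>x. (cmod (f x + g x))\<^sup>2)" using L2_add[OF assms] by (rule L2_integrable)
    show "integrable M (\<lambda>x. 2 * (cmod (f x))\<^sup>2 + 2 * (cmod (g x))\<^sup>2)"
      using assms by (auto simp: L2_def)
    fix x
    have "(cmod (f x + g x))\<^sup>2 \<le> (cmod (f x) + cmod (g x))\<^sup>2"
      by (intro power_mono norm_triangle_ineq) auto
    also have "\<dots> \<le> 2 * (cmod (f x))\<^sup>2 + 2 * (cmod (g x))\<^sup>2"
      using sum_squares_bound[of "cmod (f x)" "cmod (g x)"] by (simp add: power2_sum)
    finally show "(cmod (f x + g x))\<^sup>2 \<le> 2 * (cmod (f x))\<^sup>2 + 2 * (cmod (g x))\<^sup>2" .
  qed
  also have "\<dots> = 2 * (\<integral>x. (cmod (f x))\<^sup>2 \<partial>M) + 2 * (\<integral>x. (cmod (g x))\<^sup>2 \<partial>M)"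
    using assms by (subst Bochner_Integration.integral_add) (auto simp: L2_def)
  finally show ?thesis .
qed

section \<open>Density of a linear space of functions in \<open>L2\<close>\<close>

definition L2_approximable :: "'a measure \<Rightarrow> ('a \<Rightarrow> complex) set \<Rightarrow> ('a \<Rightarrow> complex) \<Rightarrow> bool" where
  "L2_approximable M G f \<longleftrightarrow> f \<in> L2 M \<and> (\<forall>e>0. \<exists>g\<in>G. (\<integral>x. (cmod (f x - g x))\<^sup>2 \<partial>M) < e)"

lemma L2_approximable_limit:
  assumes "G \<subseteq> L2 M" "f \<in> L2 M"
    and "\<And>e. e > 0 \<Longrightarrow> \<exists>g. L2_approximable M G g \<and> (\<integral>x. (cmod (f x - g x))\<^sup>2 \<partial>M) < e"
  shows "L2_approximable M G f"
  unfolding L2_approximable_def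
proof (intro conjI allI impI)
  fix e :: real assume e: "e > 0"
  obtain g where g: "L2_approximable M G g" "(\<integral>x. (cmod (f x - g x))\<^sup>2 \<partial>M) < e / 4"
    using assms(3)[of "e / 4"] e by auto
  then obtain k where k: "k \<in> G" "(\<integral>x. (cmod (g x - k x))\<^sup>2 \<partial>M) < e / 4"
    unfolding L2_approximable_def using e by (metis divide_pos_pos zero_less_numeral)
  have "g \<in> L2 M" "k \<in> L2 M" using g k assms(1) by (auto simp: L2_approximable_def)
  then have "(\<integral>x. (cmod ((f x - g x) + (g x - k x)))\<^sup>2 \<partial>M) \<le>
      2 * (\<integral>x. (cmod (f x - g x))\<^sup>2 \<partial>M) + 2 * (\<integral>x. (cmod (g x - k x))\<^sup>2 \<partial>M)"
    by (intro L2_add_integral_le L2_diff assms)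
  also have "\<dots> < e" using g k by linarith
  finally show "\<exists>g\<in>G. (\<integral>x. (cmod (f x - g x))\<^sup>2 \<partial>M) < e" using k by auto
qed fact

lemma L2_approximable_add:
  assumes "G \<subseteq> L2 M" "L2_approximable M G f" "L2_approximable M G g"
    and "\<And>f g. f \<in> G \<Longrightarrow> g \<in> G \<Longrightarrow> (\<lambda>x. f x + g x) \<in> G"
  shows "L2_approximable M G (\<lambda>x. f x + g x)"
  unfolding L2_approximable_def
proof (intro conjI allI impI)
  show "(\<lambda>x. f x + g x) \<in> L2 M"
    using assms by (auto simp: L2_approximable_def intro: L2_add)
  fix e :: real assume e: "e > 0"
  then have e4: "e / 4 > 0" by simp
  obtain k where k: "k \<in> G" "(\<integral>x. (cmod (f x - k x))\<^sup>2 \<partial>M) < e / 4"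
    using assms(2) e4 unfolding L2_approximable_def by blast
  obtain l where l: "l \<in> G" "(\<integral>x. (cmod (g x - l x))\<^sup>2 \<partial>M) < e / 4"
    using assms(3) e4 unfolding L2_approximable_def by blast
  have "(\<integral>x. (cmod ((f x - k x) + (g x - l x)))\<^sup>2 \<partial>M) \<le>
      2 * (\<integral>x. (cmod (f x - k x))\<^sup>2 \<partial>M) + 2 * (\<integral>x. (cmod (g x - l x))\<^sup>2 \<partial>M)"
    using assms k l by (intro L2_add_integral_le L2_diff) (auto simp: L2_approximable_def)
  also have "\<dots> < e" using k l by linarith
  finally have "(\<integral>x. (cmod ((f x + g x) - (k x + l x)))\<^sup>2 \<partial>M) < e"
    by (simp add: algebra_simps)
  then show "\<exists>h\<in>G. (\<integral>x. (cmod ((f x + g x) - h x))\<^sup>2 \<partial>M) < e"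
    using assms(4)[OF k(1) l(1)] by (intro bexI[of _ "\<lambda>x. k x + l x"]) auto
qed

lemma L2_approximable_scale:
  assumes "L2_approximable M G f" and "\<And>f c. f \<in> G \<Longrightarrow> (\<lambda>x. c * f x) \<in> G"
  shows "L2_approximable M G (\<lambda>x. c * f x)"
  unfolding L2_approximable_def
proof (intro conjI allI impI)
  show "(\<lambda>x. c * f x) \<in> L2 M" using assms by (auto simp: L2_approximable_def intro: L2_scale)
  fix e :: real assume e: "e > 0"
  define d where "d = (cmod c)\<^sup>2 + 1"
  have d: "d > 0" by (simp add: d_def add_nonneg_pos)
  then obtain k where k: "k \<in> G" "(\<integral>x. (cmod (f x - k x))\<^sup>2 \<partial>M) < e / d"
    using assms e unfolding L2_approximable_def by (metis divide_pos_pos)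
  have "(\<integral>x. (cmod (c * f x - c * k x))\<^sup>2 \<partial>M) = (cmod c)\<^sup>2 * (\<integral>x. (cmod (f x - k x))\<^sup>2 \<partial>M)"
    by (simp add: right_diff_distrib[symmetric] norm_mult power_mult_distrib)
  also have "\<dots> \<le> d * (\<integral>x. (cmod (f x - k x))\<^sup>2 \<partial>M)"
    by (intro mult_right_mono) (auto simp: d_def)
  also have "\<dots> < e" using k(2) d by (simp add: field_simps)
  finally show "\<exists>h\<in>G. (\<integral>x. (cmod (c * f x - h x))\<^sup>2 \<partial>M) < e"
    using assms(2)[OF k(1)] by (intro bexI[of _ "\<lambda>x. c * k x"]) auto
qed

text \<open>Dominated convergence with majorant \<open>9 * |f|^2\<close>. The factor 2 in the
  hypothesis is the one that comes with the approximation of measurable functions by simple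
  functions.\<close>

lemma L2_approximable_dominated:
  fixes s :: "nat \<Rightarrow> 'a \<Rightarrow> complex"
  assumes "G \<subseteq> L2 M" "f \<in> L2 M" "\<And>i. L2_approximable M G (s i)"
    and lim: "\<And>x. x \<in> space M \<Longrightarrow> (\<lambda>i. s i x) \<longlonglongrightarrow> f x"
    and bound: "\<And>i x. x \<in> space M \<Longrightarrow> cmod (s i x) \<le> 2 * cmod (f x)"
  shows "L2_approximable M G f"
proof (rule L2_approximable_limit[OF assms(1,2)])
  fix e :: real assume e: "e > 0"
  have [measurable]: "f \<in> borel_measurable M" "\<And>i. s i \<in> borel_measurable M"
    using assms by (auto simp: L2_approximable_def L2_def)
  have "(\<lambda>i. \<integral>x. (cmod (f x - s i x))\<^sup>2 \<partial>M) \<longlonglongrightarrow> (\<integral>x. 0 \<partial>M)"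
  proof (rule integral_dominated_convergence[where w = "\<lambda>x. 9 * (cmod (f x))\<^sup>2"])
    show "integrable M (\<lambda>x. 9 * (cmod (f x))\<^sup>2)" using assms(2) by (auto simp: L2_def)
    show "AE x in M. (\<lambda>i. (cmod (f x - s i x))\<^sup>2) \<longlonglongrightarrow> 0"
    proof (rule AE_I2)
      fix x assume "x \<in> space M"
      have "(\<lambda>i. (cmod (f x - s i x))\<^sup>2) \<longlonglongrightarrow> (cmod (f x - f x))\<^sup>2"
        by (intro tendsto_intros lim) fact
      then show "(\<lambda>i. (cmod (f x - s i x))\<^sup>2) \<longlonglongrightarrow> 0" by simp
    qed
    show "AE x in M. norm ((cmod (f x - s i x))\<^sup>2) \<le> 9 * (cmod (f x))\<^sup>2" for i
    proof (rule AE_I2)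
      fix x assume "x \<in> space M"
      have "cmod (f x - s i x) \<le> 3 * cmod (f x)"
        using norm_triangle_ineq4[of "f x" "s i x"] bound[OF \<open>x \<in> space M\<close>, of i] by linarith
      then have "(cmod (f x - s i x))\<^sup>2 \<le> (3 * cmod (f x))\<^sup>2" by (intro power_mono) auto
      then show "norm ((cmod (f x - s i x))\<^sup>2) \<le> 9 * (cmod (f x))\<^sup>2"
        by (simp add: power_mult_distrib)
    qed
  qed auto
  then have "eventually (\<lambda>i. (\<integral>x. (cmod (f x - s i x))\<^sup>2 \<partial>M) < e) sequentially"
    using e by (intro order_tendstoD(2)[of _ "\<integral>x. 0 \<partial>M"]) auto
  then obtain i where "(\<integral>x. (cmod (f x - s i x))\<^sup>2 \<partial>M) < e"
    by (auto simp: eventually_sequentially)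
  then show "\<exists>g. L2_approximable M G g \<and> (\<integral>x. (cmod (f x - g x))\<^sup>2 \<partial>M) < e"
    using assms(3) by blast
qed

text \<open>The pi-lambda argument is run inside each \<open>\<Omega> J\<close>, where complements
  and countable unions stay of finite measure although \<open>M\<close> itself may be infinite. Sets
  of finite measure and then simple functions follow by dominated convergence.\<close>

theorem L2_approximable_by_generator:
  fixes \<Omega> :: "nat \<Rightarrow> 'a set"
  assumes G: "G \<subseteq> L2 M" "(\<lambda>x. 0) \<in> G"
    and add: "\<And>f g. f \<in> G \<Longrightarrow> g \<in> G \<Longrightarrow> (\<lambda>x. f x + g x) \<in> G"
    and scale: "\<And>f c. f \<in> G \<Longrightarrow> (\<lambda>x. c * f x) \<in> G"
    and \<Omega>: "\<And>J. \<Omega> J \<in> sets M" "\<And>J. emeasure M (\<Omega> J) < \<infinity>" "incseq \<Omega>" "(\<Union>J. \<Omega> J) = space M"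
      "\<And>J. indicator (\<Omega> J) \<in> G"
    and gen: "Int_stable \<C>" "\<C> \<subseteq> Pow (space M)" "sets M = sigma_sets (space M) \<C>"
      "\<And>C J. C \<in> \<C> \<Longrightarrow> indicator (C \<inter> \<Omega> J) \<in> G"
    and f: "f \<in> L2 M"
  shows "L2_approximable M G f"
proof -
  have GA: "L2_approximable M G g" if "g \<in> G" for g
    using that G(1) by (auto simp: L2_approximable_def intro!: bexI[of _ g])
  have finite_part: "L2_approximable M G (indicator (D \<inter> \<Omega> J))" if "D \<in> sets M" for D J
  proof -
    have "D \<in> sigma_sets (space M) \<C>" using that gen(3) by simp
    then show ?thesis
  proof (induction D rule: sigma_sets_induct_disjoint[OF gen(1,2), consumes 1, case_names basic empty compl union])
    case (basic A)
    then show ?case by (intro GA gen(4))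
  next
    case empty
    have "(indicator ({} \<inter> \<Omega> J) :: 'a \<Rightarrow> complex) = (\<lambda>x. 0)" by (auto simp: indicator_def)
    then show ?case using GA G(2) by simp
  next
    case (compl A)
    have "L2_approximable M G (\<lambda>x. indicator (\<Omega> J) x + (- 1) * indicator (A \<inter> \<Omega> J) x)"
      by (intro L2_approximable_add L2_approximable_scale G GA add scale \<Omega> compl)
    moreover have "(\<lambda>x. indicator (\<Omega> J) x + (- 1) * indicator (A \<inter> \<Omega> J) x :: complex) =
        indicator ((space M - A) \<inter> \<Omega> J)"
      using sets.sets_into_space[OF \<Omega>(1)[of J]] by (auto simp: indicator_def fun_eq_iff)
    ultimately show ?case by simp
  next
    case (union A)
    have A: "A i \<in> sets M" for i using union(2) gen(3) by auto
    have fin: "L2_approximable M G (indicator ((\<Union>i<N. A i) \<inter> \<Omega> J))" for N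
    proof (induction N)
      case 0
      have "(indicator ((\<Union>i<0. A i) \<inter> \<Omega> J) :: 'a \<Rightarrow> complex) = (\<lambda>x. 0)" by (auto simp: indicator_def)
      then show ?case using GA G(2) by simp
    next
      case (Suc N)
      have "L2_approximable M G (\<lambda>x. indicator ((\<Union>i<N. A i) \<inter> \<Omega> J) x + indicator (A N \<inter> \<Omega> J) x)"
        by (intro L2_approximable_add Suc union G add)
      moreover have "(\<lambda>x. indicator ((\<Union>i<N. A i) \<inter> \<Omega> J) x + indicator (A N \<inter> \<Omega> J) x :: complex) =
          indicator ((\<Union>i<Suc N. A i) \<inter> \<Omega> J)"
      proof
        fix x
        have "x \<notin> A N" if "x \<in> A i" "i < N" for i
          using union(1) that unfolding disjoint_family_on_def by (metis IntI UNIV_I empty_iff less_irrefl)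
        then show "indicator ((\<Union>i<N. A i) \<inter> \<Omega> J) x + indicator (A N \<inter> \<Omega> J) x =
          (indicator ((\<Union>i<Suc N. A i) \<inter> \<Omega> J) x :: complex)"
          by (auto simp: indicator_def less_Suc_eq)
      qed
      ultimately show ?case by simp
    qed
    show ?case
    proof (rule L2_approximable_dominated[OF G(1) _ fin])
      have "emeasure M ((\<Union>i. A i) \<inter> \<Omega> J) \<le> emeasure M (\<Omega> J)"
        using \<Omega>(1) by (intro emeasure_mono) auto
      then show "(indicator ((\<Union>i. A i) \<inter> \<Omega> J) :: 'a \<Rightarrow> complex) \<in> L2 M"
        using A \<Omega>(1,2)[of J] by (intro L2_indicator) (auto simp: less_top intro: le_less_trans)
      fix x
      show "(\<lambda>N. indicator ((\<Union>i<N. A i) \<inter> \<Omega> J) x :: complex) \<longlonglongrightarrow> indicator ((\<Union>i. A i) \<inter> \<Omega> J) x"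
      proof (cases "x \<in> (\<Union>i. A i)")
        case True
        then obtain k where k: "x \<in> A k" by auto
        show ?thesis
          by (rule tendsto_eventually, rule eventually_sequentiallyI[of "Suc k"])
             (use k in \<open>auto simp: indicator_def Suc_le_eq\<close>)
      qed (auto simp: indicator_def)
      show "cmod (indicator ((\<Union>i<N. A i) \<inter> \<Omega> J) x) \<le> 2 * cmod (indicator ((\<Union>i. A i) \<inter> \<Omega> J) x)" for N
        by (auto simp: indicator_def)
    qed
  qed
  qed
  have finite_meas: "L2_approximable M G (indicator D)" if D: "D \<in> sets M" "emeasure M D < \<infinity>" for D
  proof (rule L2_approximable_dominated[OF G(1) L2_indicator[OF D] finite_part[OF D(1)]])
    fix x assume x: "x \<in> space M"
    then obtain k where k: "x \<in> \<Omega> k" using \<Omega>(4) by auto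
    show "(\<lambda>N. indicator (D \<inter> \<Omega> N) x :: complex) \<longlonglongrightarrow> indicator D x"
      by (rule tendsto_eventually, rule eventually_sequentiallyI[of k])
         (use k \<Omega>(3) in \<open>auto simp: indicator_def incseq_def\<close>)
    show "cmod (indicator (D \<inter> \<Omega> N) x) \<le> 2 * cmod (indicator D x)" for N
      by (auto simp: indicator_def)
  qed
  have [measurable]: "f \<in> borel_measurable M" using f by (simp add: L2_def)
  obtain s where s: "\<And>i. simple_function M (s i)" "\<And>x. x \<in> space M \<Longrightarrow> (\<lambda>i. s i x) \<longlonglongrightarrow> f x"
      "\<And>i x. x \<in> space M \<Longrightarrow> dist (s i x) 0 \<le> 2 * dist (f x) 0"
    using borel_measurable_implies_sequence_metric[of f M 0] \<open>f \<in> borel_measurable M\<close> by blast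
  \<comment> \<open>The simple functions are controlled on \<open>space M\<close> only; setting them
    to 0 outside makes \<open>t i\<close> literally a finite combination of indicators.\<close>
  define t where "t i x = (if x \<in> space M then s i x else 0)" for i x
  have t: "L2_approximable M G (t i)" for i
  proof -
    define Y where "Y = s i ` space M - {0}"
    have "finite Y" using s(1)[of i] by (auto simp: simple_function_def Y_def)
    define D where "D y = s i -` {y} \<inter> space M" for y
    have DM: "D y \<in> sets M" for y using s(1) unfolding D_def by (rule simple_functionD)
    have ind: "L2_approximable M G (indicator (D y))" if "y \<in> Y" for y
    proof (rule finite_meas[OF DM])
      \<comment> \<open>Where \<open>s i\<close> takes the value \<open>y \<noteq> 0\<close>, the
        bound by \<open>2 * |f|\<close> gives \<open>|f| \<ge> |y| / 2\<close>; Markov's inequality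
        then shows that this level set has finite measure.\<close>
      define c where "c = (cmod y / 2)\<^sup>2"
      have "c > 0" using that by (auto simp: c_def Y_def)
      have "emeasure M {x \<in> space M. c \<le> (cmod (f x))\<^sup>2} \<le> ennreal (1 / c) * (\<integral>\<^sup>+x. ennreal ((cmod (f x))\<^sup>2) \<partial>M)"
      proof -
        have "emeasure M {x \<in> space M. c \<le> (cmod (f x))\<^sup>2} = emeasure M {x \<in> space M. 1 \<le> ennreal (1 / c) * ennreal ((cmod (f x))\<^sup>2)}"
          using \<open>c > 0\<close> by (auto simp: ennreal_mult[symmetric] field_simps ennreal_1[symmetric] simp del: ennreal_1 intro!: arg_cong[where f = "emeasure M"])
        also have "\<dots> \<le> ennreal (1 / c) * (\<integral>\<^sup>+x. ennreal ((cmod (f x))\<^sup>2) * indicator (space M) x \<partial>M)"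
          using nn_integral_Markov_inequality[where u = "\<lambda>x. ennreal ((cmod (f x))\<^sup>2)" and M = M
              and A = "space M" and c = "ennreal (1 / c)"] by simp
        also have "(\<integral>\<^sup>+x. ennreal ((cmod (f x))\<^sup>2) * indicator (space M) x \<partial>M) = (\<integral>\<^sup>+x. ennreal ((cmod (f x))\<^sup>2) \<partial>M)"
          by (intro nn_integral_cong) auto
        finally show ?thesis .
      qed
      also have "\<dots> < \<infinity>"
        using L2_integrable[OF f] by (simp add: ennreal_mult_less_top integrable_iff_bounded)
      finally have "emeasure M {x \<in> space M. c \<le> (cmod (f x))\<^sup>2} < \<infinity>" .
      moreover have "D y \<subseteq> {x \<in> space M. c \<le> (cmod (f x))\<^sup>2}"
      proof
        fix x assume "x \<in> D y"
        then have "x \<in> space M" "cmod y / 2 \<le> cmod (f x)" using s(3)[of x i] by (auto simp: D_def)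
        then show "x \<in> {x \<in> space M. c \<le> (cmod (f x))\<^sup>2}"
          unfolding c_def by (auto intro!: power_mono)
      qed
      moreover have "{x \<in> space M. c \<le> (cmod (f x))\<^sup>2} \<in> sets M" by measurable
      ultimately show "emeasure M (D y) < \<infinity>"
        by (meson emeasure_mono le_less_trans)
    qed
    from \<open>finite Y\<close> ind have "L2_approximable M G (\<lambda>x. \<Sum>y\<in>Y. y * indicator (D y) x)"
    proof (induction Y rule: finite_induct)
      case empty
      then show ?case using GA G(2) by simp
    next
      case (insert y Y)
      have "L2_approximable M G (\<lambda>x. y * indicator (D y) x + (\<Sum>y\<in>Y. y * indicator (D y) x))"
        using insert by (intro L2_approximable_add L2_approximable_scale G add scale) auto
      then show ?case by (simp only: sum.insert[OF insert(1,2)])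
    qed
    moreover have "(\<lambda>x. \<Sum>y\<in>Y. y * indicator (D y) x) = t i"
    proof
      fix x
      show "(\<Sum>y\<in>Y. y * indicator (D y) x) = t i x"
      proof (cases "x \<in> space M")
        case True
        have "(\<Sum>y\<in>Y. y * indicator (D y) x) = (\<Sum>y\<in>Y. if y = s i x then y else 0)"
          using True by (intro sum.cong) (auto simp: D_def indicator_def)
        also have "\<dots> = s i x" using \<open>finite Y\<close> True by (auto simp: Y_def)
        finally show ?thesis using True by (simp add: t_def)
      qed (auto simp: t_def D_def indicator_def)
    qed
    ultimately show ?thesis by (simp only:)
  qed
  show ?thesis
    by (rule L2_approximable_dominated[OF G(1) f t]) (use s in \<open>auto simp: t_def\<close>)
qed

section \<open>Measures on the circle\<close>

lemma space_circle_borel: "sets \<kappa> = sets circle_borel \<Longrightarrow> space \<kappa> = sphere 0 1"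
  by (drule sets_eq_imp_space_eq) (simp add: circle_borel_def space_restrict_space)

lemma circle_continuous_measurable:
  fixes f :: "complex \<Rightarrow> 'b::topological_space"
  assumes "continuous_on (sphere 0 1) f" "sets \<kappa> = sets circle_borel"
  shows "f \<in> borel_measurable \<kappa>"
proof -
  have "f \<in> borel_measurable circle_borel"
    unfolding circle_borel_def by (rule borel_measurable_continuous_on_restrict) fact
  then show ?thesis using measurable_cong_sets[OF assms(2) refl] by blast
qed

lemma circle_continuous_integrable:
  fixes f :: "complex \<Rightarrow> 'b::{banach,second_countable_topology}"
  assumes "continuous_on (sphere 0 1) f" "sets \<kappa> = sets circle_borel" "finite_measure \<kappa>"
  shows "integrable \<kappa> f"
proof -
  have "bounded (f ` sphere 0 1)"
    by (intro compact_imp_bounded compact_continuous_image assms) auto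
  then obtain B where "\<And>z. z \<in> sphere 0 1 \<Longrightarrow> norm (f z) \<le> B"
    unfolding bounded_iff by blast
  then show ?thesis
    using assms space_circle_borel[OF assms(2)]
    by (intro finite_measure.integrable_const_bound[where B = B] AE_I2
        circle_continuous_measurable) auto
qed

lemma continuous_on_circle_powi [continuous_intros]: "continuous_on (sphere 0 1) (\<lambda>z::complex. z powi k)"
  by (auto intro!: continuous_intros)

lemma circle_powi_cnj:
  "z \<in> sphere 0 1 \<Longrightarrow> z powi k * cnj (z powi l) = (z::complex) powi (k - l)"
proof -
  assume "z \<in> sphere 0 1"
  then have z: "cmod z = 1" "z \<noteq> 0" by auto
  have "z * cnj z = 1" using complex_norm_square[of z] z by simp
  then have "cnj z = inverse z" by (rule inverse_unique[symmetric])
  then have "cnj (z powi l) = z powi (- l)"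
    by (auto simp: power_int_def)
  then show ?thesis using z power_int_add[of z k "- l"] by simp
qed

section \<open>Trigonometric polynomials on the circle\<close>

definition trig_poly :: "(complex \<Rightarrow> complex) \<Rightarrow> bool" where
  "trig_poly q \<longleftrightarrow> (\<exists>(I::int set) c. finite I \<and> (\<forall>z\<in>sphere 0 1. q z = (\<Sum>k\<in>I. c k * z powi k)))"

lemma trig_poly_monomial: "trig_poly (\<lambda>z. c * z powi k)"
  unfolding trig_poly_def by (intro exI[of _ "{k}"] exI[of _ "\<lambda>_. c"]) auto

lemma trig_poly_const: "trig_poly (\<lambda>z. c)"
  using trig_poly_monomial[of c 0] by simp

lemma trig_poly_add:
  assumes "trig_poly p" "trig_poly q"
  shows "trig_poly (\<lambda>z. p z + q z)"
proof -
  obtain I c J d where I: "finite I" "\<And>z. z \<in> sphere 0 1 \<Longrightarrow> p z = (\<Sum>k\<in>I. c k * z powi k)"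
    and J: "finite J" "\<And>z. z \<in> sphere 0 1 \<Longrightarrow> q z = (\<Sum>k\<in>J. d k * z powi k)"
    using assms unfolding trig_poly_def by metis
  define c' where "c' k = (if k \<in> I then c k else 0)" for k
  define d' where "d' k = (if k \<in> J then d k else 0)" for k
  have "p z + q z = (\<Sum>k\<in>I \<union> J. (c' k + d' k) * z powi k)" if "z \<in> sphere 0 1" for z
  proof -
    have "(\<Sum>k\<in>I. c k * z powi k) = (\<Sum>k\<in>I \<union> J. c' k * z powi k)"
      using I(1) J(1) by (intro sum.mono_neutral_cong_left) (auto simp: c'_def)
    moreover have "(\<Sum>k\<in>J. d k * z powi k) = (\<Sum>k\<in>I \<union> J. d' k * z powi k)"
      using I(1) J(1) by (intro sum.mono_neutral_cong_left) (auto simp: d'_def)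
    ultimately show ?thesis using I(2) J(2) that by (simp add: distrib_right sum.distrib)
  qed
  then show ?thesis unfolding trig_poly_def using I(1) J(1) by (intro exI[of _ "I \<union> J"]) auto
qed

lemma trig_poly_sum: "(\<And>i. i \<in> I \<Longrightarrow> trig_poly (f i)) \<Longrightarrow> trig_poly (\<lambda>z. \<Sum>i\<in>I. f i z)"
  by (induction I rule: infinite_finite_induct) (auto intro: trig_poly_const trig_poly_add)

lemma trig_poly_cong:
  "trig_poly p \<Longrightarrow> (\<And>z. z \<in> sphere 0 1 \<Longrightarrow> p z = q z) \<Longrightarrow> trig_poly q"
  unfolding trig_poly_def by simp

lemma trig_poly_mult:
  assumes "trig_poly p" "trig_poly q"
  shows "trig_poly (\<lambda>z. p z * q z)"
proof -
  obtain I c J d where I: "finite I" "\<And>z. z \<in> sphere 0 1 \<Longrightarrow> p z = (\<Sum>k\<in>I. c k * z powi k)"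
    and J: "finite J" "\<And>z. z \<in> sphere 0 1 \<Longrightarrow> q z = (\<Sum>k\<in>J. d k * z powi k)"
    using assms unfolding trig_poly_def by metis
  have "trig_poly (\<lambda>z. \<Sum>k\<in>I. \<Sum>l\<in>J. (c k * d l) * z powi (k + l))"
    by (intro trig_poly_sum trig_poly_monomial)
  then show ?thesis
  proof (rule trig_poly_cong)
    fix z :: complex assume "z \<in> sphere 0 1"
    then have "z \<noteq> 0" by auto
    then show "(\<Sum>k\<in>I. \<Sum>l\<in>J. (c k * d l) * z powi (k + l)) = p z * q z"
      using I(2) J(2) \<open>z \<in> sphere 0 1\<close>
      by (simp add: sum_product power_int_add mult_ac)
  qed
qed

lemma trig_poly_continuous:
  assumes "trig_poly q" shows "continuous_on (sphere 0 1) q"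
proof -
  obtain I c where I: "finite I" "\<And>z. z \<in> sphere 0 1 \<Longrightarrow> q z = (\<Sum>k\<in>I. c k * z powi k)"
    using assms unfolding trig_poly_def by metis
  have "continuous_on (sphere 0 1) (\<lambda>z. \<Sum>k\<in>I. c k * z powi k)"
    by (intro continuous_intros)
  then show ?thesis by (rule continuous_on_eq) (rule I(2)[symmetric])
qed

text \<open>On the circle the real and imaginary parts of \<open>z\<close> are combinations of
  \<open>z\<close> and its inverse, so real polynomials of the plane restrict to trigonometric ones.
  This lets the Stone-Weierstrass theorem deliver uniform approximation by trigonometric
  polynomials.\<close>

lemma trig_poly_real_polynomial:
  assumes "real_polynomial_function p"
  shows "trig_poly (\<lambda>z. complex_of_real (p z))"
  using assms
proof induction
  case (linear f)
  have "trig_poly (\<lambda>z. (of_real (f 1) / 2 - \<i> * of_real (f \<i>) / 2) * z powi 1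
      + (of_real (f 1) / 2 + \<i> * of_real (f \<i>) / 2) * z powi (-1))"
    by (intro trig_poly_add trig_poly_monomial)
  then show ?case
  proof (rule trig_poly_cong)
    fix z :: complex assume "z \<in> sphere 0 1"
    then have z: "z powi (-1) = cnj z"
      using circle_powi_cnj[of z 0 1] by simp
    have "f z = f (Re z *\<^sub>R 1 + Im z *\<^sub>R \<i>)"
      by (intro arg_cong[where f = f]) (simp add: complex_eq_iff)
    also have "\<dots> = Re z * f 1 + Im z * f \<i>"
      using linear by (simp add: linear_add linear_scale bounded_linear.linear)
    finally have "complex_of_real (f z) = of_real (f 1) * of_real (Re z) + of_real (f \<i>) * of_real (Im z)"
      by simp
    also have "of_real (Re z) = (z + cnj z) / 2" by (simp add: complex_eq_iff)
    also have "of_real (Im z) = - \<i> * (z - cnj z) / 2" by (simp add: complex_eq_iff)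
    finally show "(of_real (f 1) / 2 - \<i> * of_real (f \<i>) / 2) * z powi 1
      + (of_real (f 1) / 2 + \<i> * of_real (f \<i>) / 2) * z powi (-1) = complex_of_real (f z)"
      unfolding z by (simp add: field_simps)
  qed
next
  case (const c)
  show ?case by (rule trig_poly_const)
next
  case (add f g)
  then show ?case by (simp add: trig_poly_add)
next
  case (mult f g)
  then show ?case by (simp add: trig_poly_mult)
qed

lemma trig_poly_uniform_approx:
  fixes f :: "complex \<Rightarrow> real"
  assumes "continuous_on (sphere 0 1) f" "e > 0"
  obtains q where "trig_poly q" "\<And>z. z \<in> sphere 0 1 \<Longrightarrow> cmod (complex_of_real (f z) - q z) < e"
proof -
  obtain g where g: "real_polynomial_function g" "\<And>z. z \<in> sphere 0 1 \<Longrightarrow> \<bar>f z - g z\<bar> < e"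
    using Stone_Weierstrass_real_polynomial_function[OF compact_sphere assms] by metis
  show ?thesis
    using that[OF trig_poly_real_polynomial[OF g(1)]] g(2)
    by (simp only: of_real_diff[symmetric] norm_of_real)
qed

section \<open>Approximation of indicators on the circle\<close>

lemma circle_L2_continuous:
  assumes "continuous_on (sphere 0 1) f" "sets \<kappa> = sets circle_borel" "finite_measure \<kappa>"
  shows "f \<in> L2 \<kappa>"
  unfolding L2_def using assms
  by (auto intro!: circle_continuous_measurable circle_continuous_integrable continuous_intros)

lemma finite_measure_L2_indicator:
  "finite_measure \<kappa> \<Longrightarrow> A \<in> sets \<kappa> \<Longrightarrow> (indicator A :: _ \<Rightarrow> complex) \<in> L2 \<kappa>"
  by (intro L2_indicator) (auto simp: finite_measure.emeasure_finite less_top[symmetric])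

lemma circle_inner_approx:
  assumes \<kappa>: "finite_measure \<kappa>" "sets \<kappa> = sets circle_borel" and A: "A \<in> sets \<kappa>" and e: "e > 0"
  obtains K where "compact K" "K \<subseteq> A" "K \<in> sets \<kappa>" "measure \<kappa> (A - K) < e"
proof -
  interpret finite_measure \<kappa> by fact
  have sp: "space \<kappa> = sphere 0 1" by (rule space_circle_borel) fact
  have sets_iff: "B \<in> sets \<kappa> \<longleftrightarrow> B \<in> sets borel \<and> B \<subseteq> sphere 0 1" for B
    unfolding \<kappa>(2) circle_borel_def by (subst sets_restrict_space_iff) auto
  have id [measurable]: "(\<lambda>x. x) \<in> \<kappa> \<rightarrow>\<^sub>M borel"
    using circle_continuous_measurable[OF continuous_on_id \<kappa>(2)] .
  \<comment> \<open>Inner regularity is applied to the image measure on the whole plane; Borel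
    subsets of the circle keep their measure.\<close>
  define \<kappa>' where "\<kappa>' = distr \<kappa> borel (\<lambda>x. x)"
  have em: "emeasure \<kappa>' B = emeasure \<kappa> B" if "B \<in> sets borel" "B \<subseteq> sphere 0 1" for B
    using that sp unfolding \<kappa>'_def by (subst emeasure_distr) (auto simp: Int_absorb2)
  have "\<exists>K. compact K \<and> K \<subseteq> A \<and> measure \<kappa> A - e < measure \<kappa> K"
  proof (cases "measure \<kappa> A = 0")
    case True
    then show ?thesis using e by (intro exI[of _ "{}"]) auto
  next
    case False
    then have pos: "measure \<kappa> A > 0" by (simp add: zero_less_measure_iff)
    have "ennreal (measure \<kappa> A - e) < ennreal (measure \<kappa> A)"
      using pos e by (intro ennreal_lessI) auto
    also have "\<dots> = emeasure \<kappa>' A" using A em[of A] by (simp add: sets_iff emeasure_eq_measure)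
    also have "\<dots> = (SUP K \<in> {K. K \<subseteq> A \<and> compact K}. emeasure \<kappa>' K)"
    proof (rule inner_regular)
      show "sets \<kappa>' = sets borel" by (simp add: \<kappa>'_def)
      have "emeasure \<kappa>' (space \<kappa>') = emeasure \<kappa> (space \<kappa>)"
        unfolding \<kappa>'_def by (subst emeasure_distr) auto
      then show "emeasure \<kappa>' (space \<kappa>') \<noteq> \<infinity>" by simp
      show "A \<in> sets borel" using A by (simp add: sets_iff)
    qed
    finally obtain K where K: "K \<subseteq> A" "compact K" "ennreal (measure \<kappa> A - e) < emeasure \<kappa>' K"
      unfolding less_SUP_iff by auto
    have "emeasure \<kappa>' K = ennreal (measure \<kappa> K)"
      using K A em[of K] by (auto simp: sets_iff emeasure_eq_measure borel_compact)
    then have "ennreal (measure \<kappa> A - e) < ennreal (measure \<kappa> K)" using K(3) by simp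
    then have "measure \<kappa> A - e < measure \<kappa> K"
      by (meson ennreal_leI not_less)
    then show ?thesis using K(1,2) by blast
  qed
  then obtain K where K: "compact K" "K \<subseteq> A" "measure \<kappa> A - e < measure \<kappa> K" by blast
  have "K \<in> sets \<kappa>" using K A by (auto simp: sets_iff borel_compact)
  moreover have "measure \<kappa> (A - K) < e"
    using K A \<open>K \<in> sets \<kappa>\<close> by (simp add: finite_measure_Diff)
  ultimately show ?thesis using that K by blast
qed

text \<open>A compact set is closed, so off \<open>K\<close> the distance is positive and the tent
  function vanishes for large \<open>n\<close>. All differences lie between 0 and 1, and the measure
  is finite.\<close>

lemma circle_indicator_compact_approx:
  assumes \<kappa>: "finite_measure \<kappa>" "sets \<kappa> = sets circle_borel" and K: "compact K" "K \<in> sets \<kappa>" "K \<noteq> {}"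
  shows "(\<lambda>n. \<integral>z. (cmod (indicator K z - complex_of_real (max 0 (1 - real n * infdist z K))))\<^sup>2 \<partial>\<kappa>) \<longlonglongrightarrow> 0"
proof -
  interpret finite_measure \<kappa> by fact
  have "(\<lambda>n. \<integral>z. (cmod (indicator K z - complex_of_real (max 0 (1 - real n * infdist z K))))\<^sup>2 \<partial>\<kappa>) \<longlonglongrightarrow> (\<integral>z. 0 \<partial>\<kappa>)"
  proof (rule integral_dominated_convergence[where w = "\<lambda>_. 1"])
    show "(\<lambda>z. (cmod (indicator K z - complex_of_real (max 0 (1 - real n * infdist z K))))\<^sup>2) \<in> borel_measurable \<kappa>" for n
    proof -
      have [measurable]: "(\<lambda>z. complex_of_real (max 0 (1 - real n * infdist z K))) \<in> borel_measurable \<kappa>"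
        by (intro circle_continuous_measurable continuous_intros \<kappa>)
      show ?thesis using K(2) by measurable
    qed
    show "AE z in \<kappa>. norm ((cmod (indicator K z - complex_of_real (max 0 (1 - real n * infdist z K))))\<^sup>2) \<le> 1" for n
    proof (rule AE_I2)
      fix z
      have 0: "0 \<le> real n * infdist z K" by (simp add: infdist_nonneg)
      have "cmod (indicator K z - complex_of_real (max 0 (1 - real n * infdist z K))) \<le> 1"
        using K(1) 0 by (cases "z \<in> K") (auto simp: max_def norm_minus_commute simp flip: of_real_diff of_real_mult)
      then show "norm ((cmod (indicator K z - complex_of_real (max 0 (1 - real n * infdist z K))))\<^sup>2) \<le> 1"
        by (simp add: power_le_one)
    qed
    show "AE z in \<kappa>. (\<lambda>n. (cmod (indicator K z - complex_of_real (max 0 (1 - real n * infdist z K))))\<^sup>2) \<longlonglongrightarrow> 0"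
    proof (rule AE_I2)
      fix z
      show "(\<lambda>n. (cmod (indicator K z - complex_of_real (max 0 (1 - real n * infdist z K))))\<^sup>2) \<longlonglongrightarrow> 0"
      proof (cases "z \<in> K")
        case False
        then have "infdist z K > 0"
          using K in_closed_iff_infdist_zero[of K z] compact_imp_closed infdist_nonneg[of z K] by force
        then obtain N where N: "1 < real N * infdist z K" using ex_less_of_nat_mult by blast
        have "max 0 (1 - real n * infdist z K) = 0" if "n \<ge> N" for n
        proof -
          have "real N * infdist z K \<le> real n * infdist z K"
            using that by (intro mult_right_mono infdist_nonneg) auto
          then show ?thesis using N by simp
        qed
        then show ?thesis using False
          by (intro tendsto_eventually eventually_sequentiallyI[of N]) auto
      qed auto
    qed
  qed auto
  then show ?thesis by simp
qed

text \<open>Bookkeeping along the chain from the indicator of \<open>A\<close> to that of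
  \<open>K\<close>, to \<open>f\<close>, to \<open>q\<close>: two times \<open>e / 8\<close> and
  twice four times \<open>e / 16\<close> stay below \<open>e\<close>.\<close>

lemma L2_approx_chain:
  assumes \<kappa>: "finite_measure \<kappa>" "sets \<kappa> = sets circle_borel"
    and AK: "A \<in> sets \<kappa>" "K \<in> sets \<kappa>" "K \<subseteq> A" "measure \<kappa> (A - K) < e / 8"
    and f: "continuous_on (sphere 0 1) f" "(\<integral>z. (cmod (indicator K z - f z))\<^sup>2 \<partial>\<kappa>) < e / 16"
    and q: "continuous_on (sphere 0 1) q" "\<And>z. z \<in> sphere 0 1 \<Longrightarrow> cmod (f z - q z) < d"
      "d\<^sup>2 * measure \<kappa> (space \<kappa>) < e / 16"
  shows "(\<integral>z. (cmod (indicator A z - q z))\<^sup>2 \<partial>\<kappa>) < e"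
proof -
  interpret finite_measure \<kappa> by fact
  have sp: "space \<kappa> = sphere 0 1" by (rule space_circle_borel) fact
  note L = finite_measure_L2_indicator[OF \<kappa>(1)] circle_L2_continuous[OF _ \<kappa>(2,1)]
  have "(\<integral>z. (cmod ((indicator A z - indicator K z) + (indicator K z - q z)))\<^sup>2 \<partial>\<kappa>)
    \<le> 2 * (\<integral>z. (cmod (indicator A z - indicator K z))\<^sup>2 \<partial>\<kappa>)
      + 2 * (\<integral>z. (cmod (indicator K z - q z))\<^sup>2 \<partial>\<kappa>)"
    using AK f q by (intro L2_add_integral_le L2_diff L)
  moreover have "(\<integral>z. (cmod ((indicator K z - f z) + (f z - q z)))\<^sup>2 \<partial>\<kappa>)
    \<le> 2 * (\<integral>z. (cmod (indicator K z - f z))\<^sup>2 \<partial>\<kappa>) + 2 * (\<integral>z. (cmod (f z - q z))\<^sup>2 \<partial>\<kappa>)"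
    using AK f q by (intro L2_add_integral_le L2_diff L)
  moreover have "(\<integral>z. (cmod (f z - q z))\<^sup>2 \<partial>\<kappa>) \<le> (\<integral>z. d\<^sup>2 \<partial>\<kappa>)"
    using f q sp
    by (intro integral_mono L2_integrable L2_diff L power_mono) (auto simp: less_imp_le)
  moreover have "(\<integral>z. d\<^sup>2 \<partial>\<kappa>) < e / 16" using q(3) by (simp add: mult.commute)
  moreover have "(\<integral>z. (cmod (indicator A z - indicator K z))\<^sup>2 \<partial>\<kappa>) = measure \<kappa> (A - K)"
  proof -
    have "(\<lambda>z. (cmod (indicator A z - indicator K z))\<^sup>2) = (\<lambda>z. (cmod (indicator (A - K) z))\<^sup>2)"
      using AK(3) by (auto simp: fun_eq_iff indicator_def)
    then show ?thesis using AK by (simp only: L2_indicator_integral sets.Diff)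
  qed
  moreover have "0 \<le> measure \<kappa> (A - K)" by simp
  ultimately show ?thesis using AK(4) f(2) unfolding add_diff_eq diff_add_cancel by linarith
qed

text \<open>One polynomial has to serve two measures at once, because it is always the integrals of
  the same polynomial that are compared. Hence the compact sets found for the two measures are
  united.\<close>

theorem trig_poly_L2_approx:
  assumes \<kappa>: "finite_measure \<kappa>" "sets \<kappa> = sets circle_borel"
    and \<kappa>': "finite_measure \<kappa>'" "sets \<kappa>' = sets circle_borel"
    and A: "A \<in> sets circle_borel" and e: "e > 0"
  obtains q where "trig_poly q" "(\<integral>z. (cmod (indicator A z - q z))\<^sup>2 \<partial>\<kappa>) < e"
    "(\<integral>z. (cmod (indicator A z - q z))\<^sup>2 \<partial>\<kappa>') < e"
proof -
  have e8: "e / 8 > 0" using e by simp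
  have AA: "A \<in> sets \<kappa>" "A \<in> sets \<kappa>'" using A \<kappa> \<kappa>' by auto
  obtain K where K: "compact K" "K \<subseteq> A" "K \<in> sets \<kappa>" "measure \<kappa> (A - K) < e / 8"
    using circle_inner_approx[OF \<kappa> AA(1) e8] .
  obtain K' where K': "compact K'" "K' \<subseteq> A" "K' \<in> sets \<kappa>'" "measure \<kappa>' (A - K') < e / 8"
    using circle_inner_approx[OF \<kappa>' AA(2) e8] .
  define L where "L = K \<union> K'"
  have L: "compact L" "L \<subseteq> A" "L \<in> sets \<kappa>" "L \<in> sets \<kappa>'"
    using K K' \<kappa> \<kappa>' by (auto simp: L_def)
  have mL: "measure \<kappa> (A - L) < e / 8"
  proof -
    have "measure \<kappa> (A - L) \<le> measure \<kappa> (A - K)"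
      using AA K L by (intro finite_measure.finite_measure_mono \<kappa>) (auto simp: L_def)
    then show ?thesis using K by simp
  qed
  have mL': "measure \<kappa>' (A - L) < e / 8"
  proof -
    have "measure \<kappa>' (A - L) \<le> measure \<kappa>' (A - K')"
      using AA K' L by (intro finite_measure.finite_measure_mono \<kappa>') (auto simp: L_def)
    then show ?thesis using K' by simp
  qed
  have "\<exists>f. continuous_on (sphere 0 1) f \<and>
      (\<integral>z. (cmod (indicator L z - complex_of_real (f z)))\<^sup>2 \<partial>\<kappa>) < e / 16 \<and>
      (\<integral>z. (cmod (indicator L z - complex_of_real (f z)))\<^sup>2 \<partial>\<kappa>') < e / 16"
  proof (cases "L = {}")
    case True
    then show ?thesis using e by (intro exI[of _ "\<lambda>_. 0"]) auto
  next
    case False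
    have "eventually (\<lambda>n. (\<integral>z. (cmod (indicator L z - complex_of_real (max 0 (1 - real n * infdist z L))))\<^sup>2 \<partial>\<kappa>) < e / 16) sequentially"
      using e by (intro order_tendstoD(2)[OF circle_indicator_compact_approx] \<kappa> L False) auto
    moreover have "eventually (\<lambda>n. (\<integral>z. (cmod (indicator L z - complex_of_real (max 0 (1 - real n * infdist z L))))\<^sup>2 \<partial>\<kappa>') < e / 16) sequentially"
      using e by (intro order_tendstoD(2)[OF circle_indicator_compact_approx] \<kappa>' L False) auto
    ultimately obtain n where
      "(\<integral>z. (cmod (indicator L z - complex_of_real (max 0 (1 - real n * infdist z L))))\<^sup>2 \<partial>\<kappa>) < e / 16"
      "(\<integral>z. (cmod (indicator L z - complex_of_real (max 0 (1 - real n * infdist z L))))\<^sup>2 \<partial>\<kappa>') < e / 16"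
      using eventually_happens'[OF sequentially_bot eventually_conj] by blast
    then show ?thesis
      by (intro exI[of _ "\<lambda>z. max 0 (1 - real n * infdist z L)"]) (auto intro!: continuous_intros)
  qed
  then obtain f where f: "continuous_on (sphere 0 1) f"
      "(\<integral>z. (cmod (indicator L z - complex_of_real (f z)))\<^sup>2 \<partial>\<kappa>) < e / 16"
      "(\<integral>z. (cmod (indicator L z - complex_of_real (f z)))\<^sup>2 \<partial>\<kappa>') < e / 16" by blast
  define m where "m = measure \<kappa> (space \<kappa>) + measure \<kappa>' (space \<kappa>') + 1"
  have m: "m > 0" by (simp add: m_def add_nonneg_pos)
  define d where "d = sqrt (e / (32 * m))"
  have d: "d > 0" using e m by (simp add: d_def)
  have d2: "d\<^sup>2 * m = e / 32" using e m by (simp add: d_def)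
  have "d\<^sup>2 * measure \<kappa> (space \<kappa>) \<le> d\<^sup>2 * m" "d\<^sup>2 * measure \<kappa>' (space \<kappa>') \<le> d\<^sup>2 * m"
    by (intro mult_left_mono; simp add: m_def)+
  then have dm: "d\<^sup>2 * measure \<kappa> (space \<kappa>) < e / 16" "d\<^sup>2 * measure \<kappa>' (space \<kappa>') < e / 16"
    using d2 e by auto
  obtain q where q: "trig_poly q" "\<And>z. z \<in> sphere 0 1 \<Longrightarrow> cmod (complex_of_real (f z) - q z) < d"
    using trig_poly_uniform_approx[OF f(1) d] by blast
  have fc: "continuous_on (sphere 0 1) (\<lambda>z. complex_of_real (f z))"
    by (intro continuous_intros f)
  have "(\<integral>z. (cmod (indicator A z - q z))\<^sup>2 \<partial>\<kappa>) < e"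
    by (rule L2_approx_chain[OF \<kappa> AA(1) L(3) L(2) mL fc f(2) trig_poly_continuous[OF q(1)] q(2) dm(1)])
  moreover have "(\<integral>z. (cmod (indicator A z - q z))\<^sup>2 \<partial>\<kappa>') < e"
    by (rule L2_approx_chain[OF \<kappa>' AA(2) L(4) L(2) mL' fc f(3) trig_poly_continuous[OF q(1)] q(2) dm(2)])
  ultimately show ?thesis using that q(1) by blast
qed

lemma trig_poly_integral_approx:
  assumes \<kappa>: "finite_measure \<kappa>" "sets \<kappa> = sets circle_borel"
    and A: "A \<in> sets circle_borel" and q: "trig_poly q"
  shows "cmod (of_real (measure \<kappa> A) - (\<integral>z. q z \<partial>\<kappa>)) \<le>
    sqrt (\<integral>z. (cmod (indicator A z - q z))\<^sup>2 \<partial>\<kappa>) * sqrt (measure \<kappa> (space \<kappa>))"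
proof -
  interpret finite_measure \<kappa> by fact
  note L = finite_measure_L2_indicator[OF \<kappa>(1)] circle_L2_continuous[OF _ \<kappa>(2,1)]
  have A': "A \<in> sets \<kappa>" using A \<kappa> by simp
  have one: "(\<lambda>_. 1) \<in> L2 \<kappa>" by (intro L continuous_intros)
  have "cmod (\<integral>z. (indicator A z - q z) * cnj 1 \<partial>\<kappa>) \<le>
      sqrt (\<integral>z. (cmod (indicator A z - q z))\<^sup>2 \<partial>\<kappa>) * sqrt (\<integral>z. (cmod 1)\<^sup>2 \<partial>\<kappa>)"
    by (intro L2_cauchy_schwarz L2_diff one L A' trig_poly_continuous q)
  also have "(\<integral>z. (indicator A z - q z) * cnj 1 \<partial>\<kappa>) = (\<integral>z. indicator A z - q z \<partial>\<kappa>)" by simp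
  also have "\<dots> = (\<integral>z. indicator A z \<partial>\<kappa>) - (\<integral>z. q z \<partial>\<kappa>)"
  proof (rule Bochner_Integration.integral_diff)
    have "integrable \<kappa> (\<lambda>z. complex_of_real (indicator A z))"
      using A' by (intro integrable_of_real integrable_real_indicator) (auto simp: less_top[symmetric])
    then show "integrable \<kappa> (indicator A :: _ \<Rightarrow> complex)"
      by (rule Bochner_Integration.integrable_cong[THEN iffD1, rotated 2]) (auto simp: indicator_def)
    show "integrable \<kappa> q" by (intro circle_continuous_integrable trig_poly_continuous q \<kappa>)
  qed
  also have "(\<integral>z. indicator A z \<partial>\<kappa>) = (\<integral>z. complex_of_real (indicator A z) \<partial>\<kappa>)"
    by (intro Bochner_Integration.integral_cong) (auto simp: indicator_def)
  also have "\<dots> = of_real (measure \<kappa> A)"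
    using A' sets.sets_into_space[OF A'] by (simp add: Int_absorb2)
  finally show ?thesis by simp
qed

lemma trig_poly_integral_eq:
  assumes \<kappa>: "finite_measure \<kappa>" "sets \<kappa> = sets circle_borel"
    and q: "\<And>z. z \<in> sphere 0 1 \<Longrightarrow> q z = (\<Sum>k\<in>I. c k * z powi k)" and I: "finite (I :: int set)"
  shows "(\<integral>z. q z \<partial>\<kappa>) = (\<Sum>k\<in>I. c k * (\<integral>z. z powi k \<partial>\<kappa>))"
proof -
  have "(\<integral>z. q z \<partial>\<kappa>) = (\<integral>z. (\<Sum>k\<in>I. c k * z powi k) \<partial>\<kappa>)"
    using q space_circle_borel[OF \<kappa>(2)] by (intro Bochner_Integration.integral_cong) auto
  also have "\<dots> = (\<Sum>k\<in>I. \<integral>z. c k * z powi k \<partial>\<kappa>)"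
    by (intro Bochner_Integration.integral_sum circle_continuous_integrable continuous_intros \<kappa>)
  finally show ?thesis by simp
qed

lemma small_multiple_imp_zero:
  fixes x :: real
  assumes "\<And>e. e > 0 \<Longrightarrow> x \<le> c * sqrt e" "x \<ge> 0" "c \<ge> 0"
  shows "x = 0"
proof (rule ccontr)
  assume "x \<noteq> 0"
  then have "x > 0" using assms by simp
  define e where "e = (x / (2 * (c + 1)))\<^sup>2"
  have "e > 0" "sqrt e = x / (2 * (c + 1))" using \<open>x > 0\<close> assms(3) by (simp_all add: e_def)
  then have "x \<le> c * (x / (2 * (c + 1)))" using assms(1)[of e] by simp
  also have "\<dots> \<le> x / 2" using assms(3) \<open>x > 0\<close> by (simp add: field_simps)
  finally show False using \<open>x > 0\<close> by simp
qed

text \<open>Uniqueness of Fourier coefficients: integrals of trigonometric polynomials agree, and a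
  common polynomial approximates the indicator of \<open>A\<close> for both measures.\<close>

theorem circle_measure_eqI:
  assumes \<kappa>: "finite_measure \<kappa>" "sets \<kappa> = sets circle_borel"
    and \<kappa>': "finite_measure \<kappa>'" "sets \<kappa>' = sets circle_borel"
    and A: "A \<in> sets circle_borel"
    and eq: "\<And>m::int. (\<integral>z. z powi m \<partial>\<kappa>) = (\<integral>z. z powi m \<partial>\<kappa>')"
  shows "measure \<kappa> A = measure \<kappa>' A"
proof -
  let ?c = "sqrt (measure \<kappa> (space \<kappa>)) + sqrt (measure \<kappa>' (space \<kappa>'))"
  have "\<bar>measure \<kappa> A - measure \<kappa>' A\<bar> = 0"
  proof (rule small_multiple_imp_zero)
    fix e :: real assume "e > 0"
    obtain q where q: "trig_poly q" "(\<integral>z. (cmod (indicator A z - q z))\<^sup>2 \<partial>\<kappa>) < e"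
        "(\<integral>z. (cmod (indicator A z - q z))\<^sup>2 \<partial>\<kappa>') < e"
      using trig_poly_L2_approx[OF \<kappa> \<kappa>' A \<open>e > 0\<close>] .
    obtain I c where I: "finite I" "\<And>z. z \<in> sphere 0 1 \<Longrightarrow> q z = (\<Sum>k\<in>I. c k * z powi k)"
      using q(1) unfolding trig_poly_def by metis
    have "(\<integral>z. q z \<partial>\<kappa>) = (\<integral>z. q z \<partial>\<kappa>')"
      using trig_poly_integral_eq[OF \<kappa> I(2,1)] trig_poly_integral_eq[OF \<kappa>' I(2,1)] eq by simp
    moreover have "cmod (of_real (measure \<kappa> A) - (\<integral>z. q z \<partial>\<kappa>)) \<le> sqrt e * sqrt (measure \<kappa> (space \<kappa>))"
      using q(2) by (intro order.trans[OF trig_poly_integral_approx[OF \<kappa> A q(1)]] mult_right_mono) auto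
    moreover have "cmod (of_real (measure \<kappa>' A) - (\<integral>z. q z \<partial>\<kappa>')) \<le> sqrt e * sqrt (measure \<kappa>' (space \<kappa>'))"
      using q(3) by (intro order.trans[OF trig_poly_integral_approx[OF \<kappa>' A q(1)]] mult_right_mono) auto
    moreover have "cmod (of_real (measure \<kappa> A - measure \<kappa>' A)) \<le>
        cmod (of_real (measure \<kappa> A) - (\<integral>z. q z \<partial>\<kappa>)) + cmod (of_real (measure \<kappa>' A) - (\<integral>z. q z \<partial>\<kappa>))"
      using norm_triangle_ineq4[of "of_real (measure \<kappa> A) - (\<integral>z. q z \<partial>\<kappa>)" "of_real (measure \<kappa>' A) - (\<integral>z. q z \<partial>\<kappa>)"]
      by simp
    ultimately show "\<bar>measure \<kappa> A - measure \<kappa>' A\<bar> \<le> ?c * sqrt e"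
      unfolding norm_of_real by (simp add: algebra_simps)
  qed auto
  then show ?thesis by simp
qed


section \<open>Invertible measure-preserving transformations\<close>

text \<open>Measurability of the inverse is a separate requirement, since in a general measure space
  a measurable bijection need not map measurable sets to measurable sets.\<close>

locale automorphism =
  fixes M :: "'a measure" and S :: "'a \<Rightarrow> 'a"
  assumes S_measurable [measurable]: "S \<in> M \<rightarrow>\<^sub>M M"
    and S_bij: "bij_betw S (space M) (space M)"
    and inv_measurable [measurable]: "inv_into (space M) S \<in> M \<rightarrow>\<^sub>M M"
    and distr_S: "distr M M S = M"
begin

abbreviation V :: "int \<Rightarrow> 'a \<Rightarrow> 'a" where "V \<equiv> iterate_int M S"

lemma S_inv: "x \<in> space M \<Longrightarrow> S (inv_into (space M) S x) = x"
  using S_bij by (simp add: bij_betw_inv_into_right)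

lemma inv_S: "x \<in> space M \<Longrightarrow> inv_into (space M) S (S x) = x"
  using S_bij by (simp add: bij_betw_inv_into_left)

lemma V_measurable [measurable]: "V m \<in> M \<rightarrow>\<^sub>M M"
  by (auto simp: iterate_int_def intro!: measurable_compose_n)

lemma V_space [simp]: "x \<in> space M \<Longrightarrow> V m x \<in> space M"
  using V_measurable by (rule measurable_space)

lemma V_0 [simp]: "V 0 x = x"
  by (simp add: iterate_int_def)

lemma V_Suc:
  assumes "x \<in> space M" shows "V (m + 1) x = S (V m x)"
proof (cases "0 \<le> m")
  case True
  then show ?thesis by (simp add: iterate_int_def nat_add_distrib)
next
  case False
  define k where "k = nat (- (m + 1))"
  have m: "m = - int (Suc k)" using False by (simp add: k_def)
  have "V (- int k) x \<in> space M" using assms by simp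
  moreover have "V m x = inv_into (space M) S (V (- int k) x)"
    unfolding m iterate_int_def by (cases "k = 0") (simp_all add: nat_add_distrib)
  moreover have "m + 1 = - int k" using m by simp
  ultimately show ?thesis using S_inv by simp
qed

lemma V_pred:
  assumes "x \<in> space M" shows "V (m - 1) x = inv_into (space M) S (V m x)"
  using V_Suc[OF assms, of "m - 1"] inv_S[of "V (m - 1) x"] assms by simp

lemma V_add:
  assumes "x \<in> space M" shows "V (m + n) x = V m (V n x)"
proof (induction m rule: int_induct[where k = 0])
  case base
  then show ?case by simp
next
  case (step1 i)
  have "i + 1 + n = (i + n) + 1" by simp
  then show ?case using step1 assms by (simp only: V_Suc V_space)
next
  case (step2 i)
  have "i - 1 + n = (i + n) - 1" by simp
  then show ?case using step2 assms by (simp only: V_pred V_space)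
qed

lemma V_neg [simp]: "x \<in> space M \<Longrightarrow> V (- m) (V m x) = x" "x \<in> space M \<Longrightarrow> V m (V (- m) x) = x"
  using V_add[of x "- m" m] V_add[of x m "- m"] by simp_all

lemma V_of_nat: "V (int k) = S ^^ k"
  by (simp add: iterate_int_def)

lemma distr_inv: "distr M M (inv_into (space M) S) = M"
proof -
  have "distr M M (inv_into (space M) S) = distr (distr M M S) M (inv_into (space M) S)"
    by (simp add: distr_S)
  also have "\<dots> = distr M M (inv_into (space M) S \<circ> S)" by (rule distr_distr) measurable
  also have "\<dots> = distr M M (\<lambda>x. x)" by (rule distr_cong) (auto simp: inv_S)
  also have "\<dots> = M" by (rule distr_id2) simp
  finally show ?thesis .
qed

lemma distr_V: "distr M M (V m) = M"
proof (induction m rule: int_induct[where k = 0])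
  case base
  have "distr M M (V 0) = distr M M (\<lambda>x. x)" by (rule distr_cong) auto
  then show ?case by (simp add: distr_id2)
next
  case (step1 i)
  have "distr M M (V (i + 1)) = distr M M (S \<circ> V i)" by (rule distr_cong) (auto simp: V_Suc)
  also have "\<dots> = distr (distr M M (V i)) M S" by (rule distr_distr[symmetric]) measurable
  finally show ?case using step1 distr_S by simp
next
  case (step2 i)
  have "distr M M (V (i - 1)) = distr M M (inv_into (space M) S \<circ> V i)"
    by (rule distr_cong) (auto simp: V_pred)
  also have "\<dots> = distr (distr M M (V i)) M (inv_into (space M) S)"
    by (rule distr_distr[symmetric]) measurable
  finally show ?case using step2 distr_inv by simp
qed

lemma V_image: "A \<subseteq> space M \<Longrightarrow> V m ` A = V (- m) -` A \<inter> space M"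
proof (intro equalityI subsetI)
  fix y assume A: "A \<subseteq> space M" and "y \<in> V (- m) -` A \<inter> space M"
  then have "y = V m (V (- m) y)" "V (- m) y \<in> A" by auto
  then show "y \<in> V m ` A" by blast
qed auto

lemma V_image_sets [measurable (raw)]: "A \<in> sets M \<Longrightarrow> V m ` A \<in> sets M"
  using sets.sets_into_space[of A M] by (simp add: V_image)

lemma emeasure_V_vimage: "A \<in> sets M \<Longrightarrow> emeasure M (V m -` A \<inter> space M) = emeasure M A"
  using emeasure_distr[OF V_measurable, of A m] by (simp add: distr_V)

lemma emeasure_V_image: "A \<in> sets M \<Longrightarrow> emeasure M (V m ` A) = emeasure M A"
  using sets.sets_into_space[of A M] by (simp add: V_image emeasure_V_vimage)

lemma integral_V:
  fixes f :: "'a \<Rightarrow> 'b::{banach, second_countable_topology}"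
  assumes "f \<in> borel_measurable M" shows "(\<integral>x. f (V m x) \<partial>M) = (\<integral>x. f x \<partial>M)"
  using integral_distr[OF V_measurable assms, of m] by (simp add: distr_V)

lemma L2_V:
  assumes "f \<in> L2 M" shows "(\<lambda>x. f (V m x)) \<in> L2 M"
proof -
  have [measurable]: "f \<in> borel_measurable M" using assms by (rule L2_measurable)
  have "integrable (distr M M (V m)) (\<lambda>x. (cmod (f x))\<^sup>2)"
    using L2_integrable[OF assms] by (simp add: distr_V)
  then have "integrable M (\<lambda>x. (cmod (f (V m x)))\<^sup>2)"
    by (subst (asm) integrable_distr_eq) measurable
  then show ?thesis by (simp add: L2_def)
qed

lemma inner_V:
  assumes "f \<in> L2 M" "g \<in> L2 M"
  shows "(\<integral>x. f (V k x) * cnj (g (V l x)) \<partial>M) = (\<integral>x. f (V (k - l) x) * cnj (g x) \<partial>M)"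
proof -
  have "(\<integral>x. f (V k x) * cnj (g (V l x)) \<partial>M) =
      (\<integral>x. (\<lambda>y. f (V (k - l) y) * cnj (g y)) (V l x) \<partial>M)"
    by (intro Bochner_Integration.integral_cong) (auto simp: V_add[symmetric])
  also have "\<dots> = (\<integral>y. f (V (k - l) y) * cnj (g y) \<partial>M)"
    by (intro integral_V borel_measurable_integrable L2_prod_integrable L2_V assms)
  finally show ?thesis .
qed

text \<open>The functional calculus is isometric because both sides are the same quadratic form in
  the coefficients. The scalar \<open>w\<close> allows a normalized \<open>\<nu>\<close>: all cells
  of a stage will share one probability measure, scaled by the measure of a cell.\<close>

lemma spectral_isometry:
  assumes f: "f \<in> L2 M" and \<nu>: "finite_measure \<nu>" "sets \<nu> = sets circle_borel"
    and coeff: "\<And>m. L2_inner M (koopman_power M S m f) f = of_real w * (\<integral>z. z powi m \<partial>\<nu>)"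
    and I: "finite I"
  shows "(\<integral>x. (cmod (\<Sum>k\<in>I. c k * f (V k x)))\<^sup>2 \<partial>M) = w * (\<integral>z. (cmod (\<Sum>k\<in>I. c k * z powi k))\<^sup>2 \<partial>\<nu>)"
proof -
  have "complex_of_real (\<integral>x. (cmod (\<Sum>k\<in>I. c k * f (V k x)))\<^sup>2 \<partial>M) =
      (\<integral>x. (\<Sum>k\<in>I. c k * f (V k x)) * cnj (\<Sum>l\<in>I. c l * f (V l x)) \<partial>M)"
    unfolding integral_complex_of_real[symmetric] complex_norm_square ..
  also have "\<dots> = (\<integral>x. (\<Sum>k\<in>I. \<Sum>l\<in>I. (c k * cnj (c l)) * (f (V k x) * cnj (f (V l x)))) \<partial>M)"
    by (simp add: sum_product mult_ac)
  also have "\<dots> = (\<Sum>k\<in>I. \<integral>x. (\<Sum>l\<in>I. (c k * cnj (c l)) * (f (V k x) * cnj (f (V l x)))) \<partial>M)"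
    by (intro Bochner_Integration.integral_sum Bochner_Integration.integrable_sum integrable_mult_right
        L2_prod_integrable L2_V f)
  also have "\<dots> = (\<Sum>k\<in>I. \<Sum>l\<in>I. \<integral>x. (c k * cnj (c l)) * (f (V k x) * cnj (f (V l x))) \<partial>M)"
    by (intro sum.cong refl Bochner_Integration.integral_sum integrable_mult_right L2_prod_integrable L2_V f)
  also have "\<dots> = (\<Sum>k\<in>I. \<Sum>l\<in>I. (c k * cnj (c l)) * (\<integral>x. f (V k x) * cnj (f (V l x)) \<partial>M))"
    by (simp only: integral_mult_right_zero)
  also have "\<dots> = (\<Sum>k\<in>I. \<Sum>l\<in>I. (c k * cnj (c l)) * (of_real w * (\<integral>z. z powi (k - l) \<partial>\<nu>)))"
    using coeff by (simp add: inner_V[OF f f] L2_inner_def koopman_power_def)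
  also have "\<dots> = of_real w * (\<Sum>k\<in>I. \<Sum>l\<in>I. (c k * cnj (c l)) * (\<integral>z. z powi (k - l) \<partial>\<nu>))"
    by (simp add: sum_distrib_left mult_ac)
  also have "(\<Sum>k\<in>I. \<Sum>l\<in>I. (c k * cnj (c l)) * (\<integral>z. z powi (k - l) \<partial>\<nu>)) =
      (\<Sum>k\<in>I. \<Sum>l\<in>I. \<integral>z. (c k * cnj (c l)) * z powi (k - l) \<partial>\<nu>)"
    by (simp only: integral_mult_right_zero)
  also have "\<dots> = (\<Sum>k\<in>I. \<integral>z. (\<Sum>l\<in>I. (c k * cnj (c l)) * z powi (k - l)) \<partial>\<nu>)"
    by (intro sum.cong refl Bochner_Integration.integral_sum[symmetric] circle_continuous_integrable
        continuous_intros \<nu>)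
  also have "\<dots> = (\<integral>z. (\<Sum>k\<in>I. \<Sum>l\<in>I. (c k * cnj (c l)) * z powi (k - l)) \<partial>\<nu>)"
    by (intro Bochner_Integration.integral_sum[symmetric] circle_continuous_integrable
        continuous_intros \<nu>)
  also have "\<dots> = (\<integral>z. (\<Sum>k\<in>I. c k * z powi k) * cnj (\<Sum>l\<in>I. c l * z powi l) \<partial>\<nu>)"
  proof (intro Bochner_Integration.integral_cong refl)
    fix z assume "z \<in> space \<nu>"
    then have "z \<in> sphere 0 1" using space_circle_borel[OF \<nu>(2)] by simp
    show "(\<Sum>k\<in>I. \<Sum>l\<in>I. (c k * cnj (c l)) * z powi (k - l)) =
        (\<Sum>k\<in>I. c k * z powi k) * cnj (\<Sum>l\<in>I. c l * z powi l)"
      unfolding circle_powi_cnj[OF \<open>z \<in> sphere 0 1\<close>, symmetric] cnj_sum sum_product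
      by (simp add: mult_ac)
  qed
  also have "\<dots> = of_real (\<integral>z. (cmod (\<Sum>k\<in>I. c k * z powi k))\<^sup>2 \<partial>\<nu>)"
    unfolding integral_complex_of_real[symmetric] complex_norm_square ..
  finally show ?thesis by (simp only: of_real_mult[symmetric] of_real_eq_iff)
qed

text \<open>For a trigonometric polynomial \<open>q\<close> close to the indicator of \<open>A\<close>, the vector \<open>q(U) f\<close> is almost
  orthogonal to all \<open>g i\<close>, hence almost orthogonal to \<open>f\<close>, while \<open>\<langle>q(U) f, f\<rangle>\<close> is almost \<open>\<nu>(A)\<close>.\<close>

theorem spectral_measure_null:
  assumes f: "f \<in> L2 M" and spec: "spectral_measure M S f \<nu>" and A: "A \<in> sets circle_borel"
    and approx: "\<And>e. e > 0 \<Longrightarrow> \<exists>(I::'i set) c g w \<sigma>. finite I \<and> finite_measure \<sigma> \<and> sets \<sigma> = sets circle_borel \<and>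
      measure \<sigma> A = 0 \<and> (\<forall>i\<in>I. g i \<in> L2 M \<and>
        (\<forall>m. L2_inner M (koopman_power M S m (g i)) (g i) = of_real w * (\<integral>z. z powi m \<partial>\<sigma>))) \<and>
      (\<integral>x. (cmod (f x - (\<Sum>i\<in>I. c i * g i x)))\<^sup>2 \<partial>M) < e"
  shows "measure \<nu> A = 0"
proof -
  have \<nu>: "finite_measure \<nu>" "sets \<nu> = sets circle_borel"
    and coeff: "\<And>m. (\<integral>z. z powi m \<partial>\<nu>) = L2_inner M (koopman_power M S m f) f"
    using spec by (auto simp: spectral_measure_def)
  define a where "a = measure \<nu> A"
  have "a \<le> sqrt (2 * a + 2) * sqrt e" if e: "e > 0" for e
  proof -
    obtain I :: "'i set" and c g w \<sigma> where I: "finite I" and \<sigma>: "finite_measure \<sigma>" "sets \<sigma> = sets circle_borel"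
      and null: "measure \<sigma> A = 0" and g: "\<And>i. i \<in> I \<Longrightarrow> g i \<in> L2 M"
      and gc: "\<And>i m. i \<in> I \<Longrightarrow> L2_inner M (koopman_power M S m (g i)) (g i) = of_real w * (\<integral>z. z powi m \<partial>\<sigma>)"
      and ge: "(\<integral>x. (cmod (f x - (\<Sum>i\<in>I. c i * g i x)))\<^sup>2 \<partial>M) < e"
      using approx[OF e] by blast
    define h where "h x = (\<Sum>i\<in>I. c i * g i x)" for x
    have h: "h \<in> L2 M" unfolding h_def by (intro L2_sum L2_scale g)
    \<comment> \<open>Collects the constants in front of \<open>sqrt d\<close>. It depends on the
      approximating combination and hence on \<open>e\<close>, so \<open>d\<close> has to tend to 0
      while \<open>e\<close> is still fixed.\<close>
    define C where "C = sqrt (measure \<nu> (space \<nu>)) +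
      (\<Sum>i\<in>I. cmod (c i)) * sqrt (\<integral>x. (cmod (f x))\<^sup>2 \<partial>M) * sqrt \<bar>w\<bar>"
    have C: "C \<ge> 0" unfolding C_def by (intro add_nonneg_nonneg mult_nonneg_nonneg sum_nonneg) auto
    have "a \<le> sqrt (2 * a + 2 * d) * sqrt e + C * sqrt d" if d: "d > 0" for d
    proof -
      obtain q where q: "trig_poly q" "(\<integral>z. (cmod (indicator A z - q z))\<^sup>2 \<partial>\<nu>) < d"
          "(\<integral>z. (cmod (indicator A z - q z))\<^sup>2 \<partial>\<sigma>) < d"
        using trig_poly_L2_approx[OF \<nu> \<sigma> A d] .
      obtain J b where J: "finite J" "\<And>z. z \<in> sphere 0 1 \<Longrightarrow> q z = (\<Sum>k\<in>J. b k * z powi k)"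
        using q(1) unfolding trig_poly_def by metis
      define qf where "qf x = (\<Sum>k\<in>J. b k * f (V k x))" for x
      have qf: "qf \<in> L2 M" unfolding qf_def by (intro L2_sum L2_scale L2_V f)
      have "(\<integral>x. (cmod (qf x))\<^sup>2 \<partial>M) = (\<integral>z. (cmod (q z))\<^sup>2 \<partial>\<nu>)"
      proof -
        have "(\<integral>z. (cmod (q z))\<^sup>2 \<partial>\<nu>) = (\<integral>z. (cmod (\<Sum>k\<in>J. b k * z powi k))\<^sup>2 \<partial>\<nu>)"
          using J(2) space_circle_borel[OF \<nu>(2)] by (intro Bochner_Integration.integral_cong) auto
        then show ?thesis
          using spectral_isometry[OF f \<nu>, of 1 J b] J(1) coeff by (simp add: qf_def)
      qed
      also have "\<dots> \<le> 2 * a + 2 * d"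
      proof -
        have A': "A \<in> sets \<nu>" using A \<nu> by simp
        have iA: "indicator A \<in> L2 \<nu>" using finite_measure_L2_indicator[OF \<nu>(1) A'] .
        have qL: "q \<in> L2 \<nu>" by (intro circle_L2_continuous trig_poly_continuous q \<nu>)
        have "(\<integral>z. (cmod (indicator A z + (q z - indicator A z)))\<^sup>2 \<partial>\<nu>) \<le>
          2 * (\<integral>z. (cmod (indicator A z))\<^sup>2 \<partial>\<nu>) + 2 * (\<integral>z. (cmod (q z - indicator A z))\<^sup>2 \<partial>\<nu>)"
          by (intro L2_add_integral_le L2_diff iA qL)
        then show ?thesis
          using q(2) unfolding L2_indicator_integral[OF A'] a_def by (simp add: norm_minus_commute)
      qed
      finally have qf_norm: "(\<integral>x. (cmod (qf x))\<^sup>2 \<partial>M) \<le> 2 * a + 2 * d" .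
      have inner_f: "(\<integral>x. qf x * cnj (f x) \<partial>M) = (\<integral>z. q z \<partial>\<nu>)"
      proof -
        have "(\<integral>x. qf x * cnj (f x) \<partial>M) = (\<integral>x. (\<Sum>k\<in>J. b k * (f (V k x) * cnj (f x))) \<partial>M)"
          by (simp add: qf_def sum_distrib_right mult.assoc)
        also have "\<dots> = (\<Sum>k\<in>J. b k * (\<integral>x. f (V k x) * cnj (f x) \<partial>M))"
          by (subst Bochner_Integration.integral_sum)
             (auto intro!: integrable_mult_right L2_prod_integrable L2_V f)
        also have "\<dots> = (\<Sum>k\<in>J. b k * (\<integral>z. z powi k \<partial>\<nu>))"
          by (simp add: coeff L2_inner_def koopman_power_def)
        finally show ?thesis using trig_poly_integral_eq[OF \<nu> J(2,1)] by simp
      qed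
      have g_small: "cmod (\<integral>x. qf x * cnj (g i x) \<partial>M) \<le> sqrt (\<integral>x. (cmod (f x))\<^sup>2 \<partial>M) * sqrt (\<bar>w\<bar> * d)"
        if i: "i \<in> I" for i
      proof -
        \<comment> \<open>The adjoint of \<open>q(U)\<close> applied to \<open>g i\<close>. Moving
          the polynomial to \<open>g i\<close> turns its norm into an integral against
          \<open>\<sigma>\<close>, and there \<open>q\<close> is small because \<open>A\<close> is a
          null set.\<close>
        define G where "G x = (\<Sum>k\<in>uminus ` J. cnj (b (- k)) * g i (V k x))" for x
        have G: "G \<in> L2 M" unfolding G_def by (intro L2_sum L2_scale L2_V g i)
        have G_eq: "G x = (\<Sum>k\<in>J. cnj (b k) * g i (V (- k) x))" for x
          unfolding G_def by (subst sum.reindex) (auto intro: inj_onI)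
        have "(\<integral>x. qf x * cnj (g i x) \<partial>M) = (\<integral>x. (\<Sum>k\<in>J. b k * (f (V k x) * cnj (g i x))) \<partial>M)"
          by (simp add: qf_def sum_distrib_right mult.assoc)
        also have "\<dots> = (\<Sum>k\<in>J. b k * (\<integral>x. f (V k x) * cnj (g i (V 0 x)) \<partial>M))"
          using g[OF i] by (subst Bochner_Integration.integral_sum)
             (auto intro!: integrable_mult_right L2_prod_integrable L2_V f)
        also have "\<dots> = (\<Sum>k\<in>J. b k * (\<integral>x. f (V 0 x) * cnj (g i (V (- k) x)) \<partial>M))"
          by (simp only: inner_V[OF f g[OF i]]) simp
        also have "\<dots> = (\<integral>x. (\<Sum>k\<in>J. b k * (f x * cnj (g i (V (- k) x)))) \<partial>M)"
          using g[OF i] by (subst Bochner_Integration.integral_sum)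
             (auto intro!: integrable_mult_right L2_prod_integrable L2_V f)
        also have "\<dots> = (\<integral>x. f x * cnj (G x) \<partial>M)"
          by (simp add: G_eq sum_distrib_left mult_ac)
        also have "cmod \<dots> \<le> sqrt (\<integral>x. (cmod (f x))\<^sup>2 \<partial>M) * sqrt (\<integral>x. (cmod (G x))\<^sup>2 \<partial>M)"
          by (intro L2_cauchy_schwarz f G)
        also have "(\<integral>x. (cmod (G x))\<^sup>2 \<partial>M) = w * (\<integral>z. (cmod (\<Sum>k\<in>uminus ` J. cnj (b (- k)) * z powi k))\<^sup>2 \<partial>\<sigma>)"
          unfolding G_def using J(1) by (intro spectral_isometry[OF g[OF i] \<sigma> gc[OF i]]) auto
        also have "(\<integral>z. (cmod (\<Sum>k\<in>uminus ` J. cnj (b (- k)) * z powi k))\<^sup>2 \<partial>\<sigma>) = (\<integral>z. (cmod (q z))\<^sup>2 \<partial>\<sigma>)"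
        proof (intro Bochner_Integration.integral_cong refl)
          fix z assume "z \<in> space \<sigma>"
          then have z: "z \<in> sphere 0 1" using space_circle_borel[OF \<sigma>(2)] by simp
          have "(\<Sum>k\<in>uminus ` J. cnj (b (- k)) * z powi k) = (\<Sum>k\<in>J. cnj (b k) * z powi (- k))"
            by (subst sum.reindex) (auto intro: inj_onI)
          also have "\<dots> = cnj (q z)"
            using circle_powi_cnj[OF z, of 0] by (simp add: J(2)[OF z])
          finally show "(cmod (\<Sum>k\<in>uminus ` J. cnj (b (- k)) * z powi k))\<^sup>2 = (cmod (q z))\<^sup>2" by simp
        qed
        finally have le: "cmod (\<integral>x. qf x * cnj (g i x) \<partial>M) \<le>
            sqrt (\<integral>x. (cmod (f x))\<^sup>2 \<partial>M) * sqrt (w * (\<integral>z. (cmod (q z))\<^sup>2 \<partial>\<sigma>))" .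
        have "w * (\<integral>z. (cmod (q z))\<^sup>2 \<partial>\<sigma>) \<le> \<bar>w\<bar> * d"
        proof -
          have A': "A \<in> sets \<sigma>" using A \<sigma> by simp
          have "A \<in> null_sets \<sigma>"
            using null A' finite_measure.emeasure_eq_measure[OF \<sigma>(1), of A] by (intro null_setsI) auto
          then have "AE z in \<sigma>. z \<notin> A" by (rule AE_not_in)
          have "(\<integral>z. (cmod (q z))\<^sup>2 \<partial>\<sigma>) = (\<integral>z. (cmod (indicator A z - q z))\<^sup>2 \<partial>\<sigma>)"
          proof (rule integral_cong_AE)
            have "q \<in> borel_measurable \<sigma>"
              by (intro circle_continuous_measurable trig_poly_continuous q \<sigma>)
            then show "(\<lambda>z. (cmod (q z))\<^sup>2) \<in> borel_measurable \<sigma>"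
              "(\<lambda>z. (cmod (indicator A z - q z))\<^sup>2) \<in> borel_measurable \<sigma>"
              using A' by measurable
            show "AE z in \<sigma>. (cmod (q z))\<^sup>2 = (cmod (indicator A z - q z))\<^sup>2"
              using \<open>AE z in \<sigma>. z \<notin> A\<close> by eventually_elim simp
          qed
          then have "(\<integral>z. (cmod (q z))\<^sup>2 \<partial>\<sigma>) \<le> d" using q(3) by simp
          moreover have "(\<integral>z. (cmod (q z))\<^sup>2 \<partial>\<sigma>) \<ge> 0" by simp
          ultimately show ?thesis by (intro mult_mono) auto
        qed
        then show ?thesis
          by (intro order.trans[OF le] mult_left_mono real_sqrt_le_mono) auto
      qed
      have inner_h: "cmod (\<integral>x. qf x * cnj (h x) \<partial>M) \<le>
          (\<Sum>i\<in>I. cmod (c i)) * (sqrt (\<integral>x. (cmod (f x))\<^sup>2 \<partial>M) * sqrt (\<bar>w\<bar> * d))"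
      proof -
        have "(\<integral>x. qf x * cnj (h x) \<partial>M) = (\<integral>x. (\<Sum>i\<in>I. cnj (c i) * (qf x * cnj (g i x))) \<partial>M)"
          by (simp add: h_def sum_distrib_left mult_ac)
        also have "\<dots> = (\<Sum>i\<in>I. cnj (c i) * (\<integral>x. qf x * cnj (g i x) \<partial>M))"
          by (subst Bochner_Integration.integral_sum)
             (auto intro!: integrable_mult_right L2_prod_integrable qf g)
        also have "cmod \<dots> \<le> (\<Sum>i\<in>I. cmod (c i) * (sqrt (\<integral>x. (cmod (f x))\<^sup>2 \<partial>M) * sqrt (\<bar>w\<bar> * d)))"
        proof (rule sum_norm_le)
          fix i assume i: "i \<in> I"
          show "cmod (cnj (c i) * (\<integral>x. qf x * cnj (g i x) \<partial>M)) \<le>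
              cmod (c i) * (sqrt (\<integral>x. (cmod (f x))\<^sup>2 \<partial>M) * sqrt (\<bar>w\<bar> * d))"
            unfolding norm_mult complex_mod_cnj by (intro mult_left_mono g_small i) auto
        qed
        finally show ?thesis by (simp add: sum_distrib_right)
      qed
      have "cmod (\<integral>x. qf x * cnj (f x - h x) \<partial>M) \<le>
          sqrt (\<integral>x. (cmod (qf x))\<^sup>2 \<partial>M) * sqrt (\<integral>x. (cmod (f x - h x))\<^sup>2 \<partial>M)"
        by (intro L2_cauchy_schwarz qf L2_diff f h)
      also have "\<dots> \<le> sqrt (2 * a + 2 * d) * sqrt e"
        using qf_norm ge d by (intro mult_mono real_sqrt_le_mono) (auto simp: h_def a_def)
      finally have inner_fh: "cmod (\<integral>x. qf x * cnj (f x - h x) \<partial>M) \<le> sqrt (2 * a + 2 * d) * sqrt e" .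
      have split: "(\<integral>x. qf x * cnj (f x) \<partial>M) = (\<integral>x. qf x * cnj (f x - h x) \<partial>M) + (\<integral>x. qf x * cnj (h x) \<partial>M)"
      proof -
        have "(\<integral>x. qf x * cnj (f x - h x) \<partial>M) + (\<integral>x. qf x * cnj (h x) \<partial>M) =
            (\<integral>x. qf x * cnj (f x - h x) + qf x * cnj (h x) \<partial>M)"
          by (intro Bochner_Integration.integral_add[symmetric] L2_prod_integrable qf L2_diff f h)
        then show ?thesis by (simp add: algebra_simps)
      qed
      have "cmod (of_real a - (\<integral>z. q z \<partial>\<nu>)) \<le> sqrt d * sqrt (measure \<nu> (space \<nu>))"
        using q(2) unfolding a_def
        by (intro order.trans[OF trig_poly_integral_approx[OF \<nu> A q(1)]] mult_right_mono) auto
      moreover have "cmod (of_real a) \<le> cmod (of_real a - (\<integral>z. q z \<partial>\<nu>)) + cmod (\<integral>z. q z \<partial>\<nu>)"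
        using norm_triangle_ineq[of "of_real a - (\<integral>z. q z \<partial>\<nu>)" "\<integral>z. q z \<partial>\<nu>"] by simp
      moreover have "cmod (\<integral>z. q z \<partial>\<nu>) \<le>
          cmod (\<integral>x. qf x * cnj (f x - h x) \<partial>M) + cmod (\<integral>x. qf x * cnj (h x) \<partial>M)"
        unfolding inner_f[symmetric] split by (rule norm_triangle_ineq)
      moreover have "a = cmod (of_real a)" by (simp add: a_def)
      ultimately have "a \<le> sqrt d * sqrt (measure \<nu> (space \<nu>)) + (sqrt (2 * a + 2 * d) * sqrt e +
          (\<Sum>i\<in>I. cmod (c i)) * (sqrt (\<integral>x. (cmod (f x))\<^sup>2 \<partial>M) * sqrt (\<bar>w\<bar> * d)))"
        using inner_h inner_fh by linarith
      then show ?thesis by (simp add: C_def real_sqrt_mult algebra_simps)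
    qed
    note bound = this
    have lim: "((\<lambda>d. sqrt (2 * a + 2 * d) * sqrt e + C * sqrt d) \<longlongrightarrow> sqrt (2 * a + 2 * 0) * sqrt e + C * sqrt 0) (at_right 0)"
      by (intro tendsto_intros)
    have "a \<le> sqrt (2 * a + 2 * 0) * sqrt e + C * sqrt 0"
      by (rule tendsto_lowerbound[OF lim]) (auto intro!: bound eventually_at_rightI[of 0 1])
    also have "\<dots> \<le> sqrt (2 * a + 2) * sqrt e" using e by simp
    finally show ?thesis .
  qed
  then have "a = 0"
    by (intro small_multiple_imp_zero[where c = "sqrt (2 * a + 2)"]) (auto simp: a_def)
  then show ?thesis by (simp add: a_def)
qed

end

section \<open>Lacunary blocks and the coefficients of Riesz products\<close>

lemma digits8_unique:
  fixes c d :: "nat \<Rightarrow> nat"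
  assumes "(\<Sum>k<N. c k * 8 ^ k) = (\<Sum>k<N. d k * 8 ^ k)" "\<And>k. c k < 8" "\<And>k. d k < 8" "k < N"
  shows "c k = d k"
  using assms
proof (induction N arbitrary: c d k)
  case (Suc N)
  have c: "(\<Sum>k<Suc N. c k * 8 ^ k) = c 0 + 8 * (\<Sum>k<N. c (Suc k) * 8 ^ k)"
    by (simp add: sum.lessThan_Suc_shift sum_distrib_left mult_ac del: sum.lessThan_Suc)
  have d: "(\<Sum>k<Suc N. d k * 8 ^ k) = d 0 + 8 * (\<Sum>k<N. d (Suc k) * 8 ^ k)"
    by (simp add: sum.lessThan_Suc_shift sum_distrib_left mult_ac del: sum.lessThan_Suc)
  have eq: "c 0 + 8 * (\<Sum>k<N. c (Suc k) * 8 ^ k) = d 0 + 8 * (\<Sum>k<N. d (Suc k) * 8 ^ k)"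
    using Suc.prems(1) unfolding c d .
  then have "(c 0 + 8 * (\<Sum>k<N. c (Suc k) * 8 ^ k)) mod 8 = (d 0 + 8 * (\<Sum>k<N. d (Suc k) * 8 ^ k)) mod 8"
    by simp
  then have 0: "c 0 = d 0" using Suc.prems(2)[of 0] Suc.prems(3)[of 0] by simp
  then have "(\<Sum>k<N. c (Suc k) * 8 ^ k) = (\<Sum>k<N. d (Suc k) * 8 ^ k)" using eq by simp
  then have "c (Suc k) = d (Suc k)" if "k < N" for k
    using Suc.IH[of "\<lambda>k. c (Suc k)" "\<lambda>k. d (Suc k)" k] Suc.prems(2,3) that by blast
  then show ?case using 0 Suc.prems(4) by (cases k) auto
qed simp

text \<open>With three powers on each side every base 8 digit is at most 3, so no carry occurs and
  the digits can be compared one by one.\<close>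

lemma pow8_sum3:
  assumes "(8::nat) ^ a + 8 ^ b + 8 ^ c = 8 ^ d + 8 ^ e + 8 ^ f"
  shows "(of_bool (a = k) + of_bool (b = k) + of_bool (c = k) :: nat) =
    of_bool (d = k) + of_bool (e = k) + of_bool (f = k)"
proof -
  define N where "N = a + b + c + d + e + f + k + 1"
  have expand: "(\<Sum>k<N. (of_bool (a = k) + of_bool (b = k) + of_bool (c = k)) * (8::nat) ^ k) = 8 ^ a + 8 ^ b + 8 ^ c"
    if "a < N" "b < N" "c < N" for a b c
  proof -
    have "(\<Sum>k<N. of_bool (a = k) * (8::nat) ^ k) = 8 ^ a" if "a < N" for a
    proof -
      have "(\<Sum>k<N. of_bool (a = k) * (8::nat) ^ k) = (\<Sum>k<N. if k = a then 8 ^ k else 0)"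
        by (intro sum.cong) auto
      then show ?thesis using that by simp
    qed
    then show ?thesis using that by (simp add: distrib_right sum.distrib)
  qed
  have small: "of_bool (a = k) + of_bool (b = k) + of_bool (c = k) < (8::nat)" for a b c k :: nat
    by simp
  have lt: "a < N" "b < N" "c < N" "d < N" "e < N" "f < N" "k < N" by (simp_all add: N_def)
  have "(\<Sum>k<N. (of_bool (a = k) + of_bool (b = k) + of_bool (c = k)) * (8::nat) ^ k) =
      (\<Sum>k<N. (of_bool (d = k) + of_bool (e = k) + of_bool (f = k)) * 8 ^ k)"
    unfolding expand[OF lt(1,2,3)] expand[OF lt(4,5,6)] by (rule assms)
  then show ?thesis by (rule digits8_unique[OF _ small small lt(7)])
qed

lemma pow8_mem:
  assumes "(8::nat) ^ a + 8 ^ b + 8 ^ c = 8 ^ d + 8 ^ e + 8 ^ f"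
  shows "a = d \<or> a = e \<or> a = f"
proof (rule ccontr)
  assume "\<not> ?thesis"
  then show False using pow8_sum3[OF assms, of a] by simp
qed

lemma pow8_sum2:
  assumes "(8::nat) ^ a + 8 ^ b = 8 ^ d + 8 ^ e"
  shows "a = d \<and> b = e \<or> a = e \<and> b = d"
proof -
  have "(8::nat) ^ a + 8 ^ b + 8 ^ Suc a = 8 ^ d + 8 ^ e + 8 ^ Suc a" using assms by simp
  then have "a = d \<or> a = e \<or> a = Suc a" by (rule pow8_mem)
  then have "a = d \<or> a = e" by simp
  then show ?thesis using assms by auto
qed

text \<open>The equation expresses that three gaps add up to zero. If neither crossed equality
  holds, \<open>i\<close> can only match \<open>a\<close> and \<open>l\<close> only
  \<open>b\<close>; cancelling them leaves \<open>8 ^ i' = 8 ^ l'\<close>.\<close>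

lemma pow8_sum3_cross:
  assumes eq: "(8::nat) ^ i + 8 ^ i' + 8 ^ b = 8 ^ l + 8 ^ l' + 8 ^ a" and "i \<noteq> l" "i' \<noteq> l'"
  shows "i = l' \<or> l = i'"
proof (rule ccontr)
  assume neg: "\<not> ?thesis"
  have "i = a" using pow8_mem[OF eq] neg assms(2) by simp
  moreover have "l = b" using pow8_mem[OF eq[symmetric]] neg assms(2) by auto
  ultimately have "(8::nat) ^ i' = 8 ^ l'" using eq by simp
  then show False using assms(3) by simp
qed

text \<open>The algebraic reason why powers of correlations are again Riesz coefficients: a sum with
  at most one nonzero term commutes with powers.\<close>

lemma sum_power_single:
  fixes f :: "'a \<Rightarrow> real"
  assumes "finite X" "\<And>x y. x \<in> X \<Longrightarrow> y \<in> X \<Longrightarrow> f x \<noteq> 0 \<Longrightarrow> f y \<noteq> 0 \<Longrightarrow> x = y" "n \<ge> 1"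
  shows "(\<Sum>x\<in>X. f x) ^ n = (\<Sum>x\<in>X. f x ^ n)"
proof (cases "\<exists>x\<in>X. f x \<noteq> 0")
  case True
  then obtain x where x: "x \<in> X" "f x \<noteq> 0" by blast
  then have 0: "f y = 0" if "y \<in> X" "y \<noteq> x" for y using assms(2)[of x y] that by auto
  have "(\<Sum>x\<in>X. f x) = (\<Sum>y\<in>{x}. f y)"
    using x 0 assms(1) by (intro sum.mono_neutral_right) auto
  moreover have "(\<Sum>x\<in>X. f x ^ n) = (\<Sum>y\<in>{x}. f y ^ n)"
    using x 0 assms(1,3) by (intro sum.mono_neutral_right) auto
  ultimately show ?thesis by simp
next
  case False
  then show ?thesis using assms(3) by simp
qed

lemma mult_abs_le_iff: "0 \<le> k \<Longrightarrow> k * \<bar>x\<bar> \<le> h \<longleftrightarrow> k * x \<le> h \<and> - h \<le> k * x" for k x h :: int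
proof -
  assume "0 \<le> k"
  then have "k * \<bar>x\<bar> = \<bar>k * x\<bar>" by (simp add: abs_mult)
  then show ?thesis by (auto simp: abs_le_iff)
qed

lemma abs_diff_small:
  fixes x y h :: int
  assumes "8 * \<bar>x\<bar> \<le> h" "8 * \<bar>y\<bar> \<le> h" "0 < h"
  shows "\<bar>x - y\<bar> < 4 * h"
proof -
  have "8 * x \<le> h" "- h \<le> 8 * x" "8 * y \<le> h" "- h \<le> 8 * y"
    using assms by (simp_all add: mult_abs_le_iff)
  then show ?thesis using assms(3) unfolding abs_less_iff by linarith
qed

lemma abs_add_le:
  fixes x y h h' :: int
  assumes "16 * \<bar>x\<bar> \<le> h" "16 * \<bar>y\<bar> \<le> h"
  shows "8 * \<bar>x + y\<bar> \<le> h"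
proof -
  have *: "16 * x \<le> h" "- h \<le> 16 * x" "16 * y \<le> h" "- h \<le> 16 * y"
    using assms by (simp_all add: mult_abs_le_iff)
  have "8 * (x + y) \<le> h" using * by presburger
  moreover have "- h \<le> 8 * (x + y)" using * by presburger
  ultimately show ?thesis by (simp add: mult_abs_le_iff)
qed

section \<open>Heights, positions of copies and their gaps\<close>

locale lacunary =
  fixes r :: "nat \<Rightarrow> nat"
  assumes r_ge2: "\<And>j. 2 \<le> r j"
begin

primrec H :: "nat \<Rightarrow> nat" where
  "H 0 = 1"
| "H (Suc j) = 8 * H j * 8 ^ r j"

declare H.simps(2) [simp del]

text \<open>Subtracting 1 puts the first copy at height 0. The factor 4 provides slack: a number
  known up to an error below \<open>4 * H j\<close> still determines the gap.\<close>

definition P :: "nat \<Rightarrow> nat \<Rightarrow> nat" where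
  "P j i = 4 * H j * (8 ^ i - 1)"

definition off_diagonal :: "nat \<Rightarrow> (nat \<times> nat) set" where
  "off_diagonal k = {(i, l). i < r k \<and> l < r k \<and> i \<noteq> l}"

definition gap :: "nat \<Rightarrow> nat \<times> nat \<Rightarrow> int" where
  "gap k p = int (P k (fst p)) - int (P k (snd p))"

lemma r_pos [simp]: "0 < r j"
  using r_ge2[of j] by simp

lemma H_pos [simp]: "0 < H j"
  by (induction j) (auto simp: H.simps(2))

lemma int_H_pos: "0 < int (H j)"
  by simp

lemma H_Suc_ge: "512 * H j \<le> H (Suc j)"
proof -
  have "(8::nat) ^ 2 \<le> 8 ^ r j" using r_ge2 by (intro power_increasing) auto
  then have "8 * H j * 8 ^ 2 \<le> 8 * H j * 8 ^ r j" by (intro mult_left_mono) auto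
  then show ?thesis by (simp add: H.simps(2))
qed

lemma H_mono: "j \<le> k \<Longrightarrow> H j \<le> H k"
proof (induction k rule: dec_induct)
  case (step k)
  then show ?case using H_Suc_ge[of k] by linarith
qed simp

lemma H_ge: "k < H k"
proof (induction k)
  case (Suc k)
  then show ?case using H_Suc_ge[of k] by linarith
qed simp

lemma H_dvd: "j \<le> k \<Longrightarrow> H j dvd H k"
proof (induction k rule: dec_induct)
  case (step k)
  then show ?case by (simp add: H.simps(2) dvd_mult2)
qed simp

lemma P_0 [simp]: "P j 0 = 0"
  by (simp add: P_def)

lemma P_dvd: "4 * H j dvd P j i"
  by (simp add: P_def)

text \<open>The copies occupy only the lowest sixteenth of the next tower. The large empty part
  above keeps the gaps of a stage small compared with the next height and lets every point move
  upwards for a long time.\<close>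

lemma P_bound: "i < r j \<Longrightarrow> 16 * P j i + 64 * H j \<le> H (Suc j)"
proof -
  assume "i < r j"
  then have "(8::nat) ^ Suc i \<le> 8 ^ r j" by (intro power_increasing) auto
  then have "8 * H j * 8 ^ Suc i \<le> 8 * H j * 8 ^ r j" by (intro mult_left_mono) auto
  then have *: "64 * H j * 8 ^ i \<le> H (Suc j)" by (simp add: H.simps(2))
  have "(8::nat) ^ i - 1 + 1 = 8 ^ i" by simp
  then have "64 * H j * 8 ^ i = 64 * H j * (8 ^ i - 1) + 64 * H j"
    by (metis distrib_left mult.right_neutral)
  then show ?thesis using * by (simp add: P_def)
qed

lemma int_P: "int (P j i) = 4 * int (H j) * (8 ^ i - 1)"
  by (simp add: P_def of_nat_diff)

lemma gap_eq: "gap k (i, l) = 4 * int (H k) * (8 ^ i - 8 ^ l)"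
  by (simp add: gap_def int_P algebra_simps)

lemma gap_dvd: "4 * int (H k) dvd gap k p"
  by (cases p) (simp add: gap_eq)

lemma gap_zero [simp]: "gap k (i, i) = 0"
  by (simp add: gap_eq)

lemma gap_bound: "p \<in> off_diagonal k \<Longrightarrow> 16 * \<bar>gap k p\<bar> \<le> int (H (Suc k))"
proof -
  assume "p \<in> off_diagonal k"
  then have "16 * P k (fst p) \<le> H (Suc k)" "16 * P k (snd p) \<le> H (Suc k)"
    using P_bound[of "fst p" k] P_bound[of "snd p" k] by (auto simp: off_diagonal_def)
  then have "16 * int (P k (fst p)) \<le> int (H (Suc k))" "16 * int (P k (snd p)) \<le> int (H (Suc k))"
    by linarith+
  then have "16 * gap k p \<le> int (H (Suc k))" "- int (H (Suc k)) \<le> 16 * gap k p"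
    unfolding gap_def right_diff_distrib by simp_all
  then show ?thesis by (simp add: mult_abs_le_iff)
qed

lemma finite_off_diagonal [simp]: "finite (off_diagonal k)"
  by (rule finite_subset[of _ "{..<r k} \<times> {..<r k}"]) (auto simp: off_diagonal_def)

lemma zero_notin_off_diagonal [simp]: "(i, i) \<notin> off_diagonal k"
  by (simp add: off_diagonal_def)

lemma card_off_diagonal: "card (off_diagonal k) = r k * r k - r k"
proof -
  have "off_diagonal k = {..<r k} \<times> {..<r k} - (\<lambda>i. (i, i)) ` {..<r k}"
    by (auto simp: off_diagonal_def)
  moreover have "card ((\<lambda>i. (i, i)) ` {..<r k}) = r k" by (subst card_image) (auto intro: inj_onI)
  moreover have "(\<lambda>i. (i, i)) ` {..<r k} \<subseteq> {..<r k} \<times> {..<r k}" by auto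
  ultimately show ?thesis by (simp add: card_Diff_subset card_cartesian_product)
qed

lemma gap_eq_iff:
  assumes "i \<noteq> l \<or> i' \<noteq> l'"
  shows "gap k (i, l) = gap k (i', l') \<longleftrightarrow> i = i' \<and> l = l'"
proof
  assume "gap k (i, l) = gap k (i', l')"
  then have "H k = 0 \<or> (8::int) ^ i - 8 ^ l = 8 ^ i' - 8 ^ l'" by (simp add: gap_eq)
  then have "(8::int) ^ i - 8 ^ l = 8 ^ i' - 8 ^ l'" using H_pos[of k] by simp
  then have "int (8 ^ i + 8 ^ l') = int (8 ^ i' + 8 ^ l)" by simp
  then have "(8::nat) ^ i + 8 ^ l' = 8 ^ i' + 8 ^ l" by (simp only: of_nat_eq_iff)
  then show "i = i' \<and> l = l'" using pow8_sum2 assms by blast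
qed simp

lemma gap_inj: "p \<in> insert (0, 0) (off_diagonal k) \<Longrightarrow> p' \<in> insert (0, 0) (off_diagonal k) \<Longrightarrow>
    gap k p = gap k p' \<Longrightarrow> p = p'"
proof -
  assume *: "p \<in> insert (0, 0) (off_diagonal k)" "p' \<in> insert (0, 0) (off_diagonal k)" "gap k p = gap k p'"
  show "p = p'"
  proof (cases "fst p = snd p \<and> fst p' = snd p'")
    case True
    then show ?thesis using *(1,2) by (auto simp: off_diagonal_def)
  next
    case False
    then show ?thesis
      using gap_eq_iff[of "fst p" "snd p" "fst p'" "snd p'" k] *(3) by (auto simp: prod_eq_iff)
  qed
qed

lemma dvd_small_zero: "4 * int (H k) dvd m \<Longrightarrow> \<bar>m\<bar> < 4 * int (H k) \<Longrightarrow> m = 0"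
  using dvd_imp_le_int[of m "4 * int (H k)"] by fastforce

text \<open>Gaps are multiples of \<open>4 * H k\<close>, so closeness forces equality, and equal
  gaps are told apart by their base 8 digits. The pair \<open>(0, 0)\<close> stands for the gap
  0.\<close>

lemma gap_sep:
  assumes "p \<in> insert (0, 0) (off_diagonal k)" "p' \<in> insert (0, 0) (off_diagonal k)"
    "\<bar>gap k p - gap k p'\<bar> < 4 * int (H k)"
  shows "p = p'"
proof -
  have "gap k p - gap k p' = 0" using gap_dvd assms(3) by (intro dvd_small_zero dvd_diff)
  then show ?thesis using gap_inj assms by simp
qed

text \<open>The Fourier coefficient of the product of the factors of the stages from
  \<open>j\<close> to \<open>j + t - 1\<close>, see \<open>integral_powi_riesz\<close>. For
  \<open>n = 1\<close> it is also the normalized number of pairs of copies of tower \<open>j\<close>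
  in tower \<open>j + t\<close> at distance \<open>m\<close>, see \<open>cnt_A\<close>.\<close>

primrec A :: "nat \<Rightarrow> nat \<Rightarrow> nat \<Rightarrow> int \<Rightarrow> real" where
  "A n j 0 m = (if m = 0 then 1 else 0)"
| "A n j (Suc t) m = A n j t m + (\<Sum>p\<in>off_diagonal (j + t). A n j t (m + gap (j + t) p)) / r (j + t) ^ n"

text \<open>Treats the constant term 1 of a factor as the gap of \<open>(0, 0)\<close>, so that the
  recursion becomes one sum over mutually separated shifts.\<close>

definition weight :: "nat \<Rightarrow> nat \<Rightarrow> nat \<times> nat \<Rightarrow> real" where
  "weight n k p = (if p = (0, 0) then 1 else 1 / r k ^ n)"

lemma A_Suc_weight:
  "A n j (Suc t) m =
    (\<Sum>p\<in>insert (0, 0) (off_diagonal (j + t)). weight n (j + t) p * A n j t (m + gap (j + t) p))"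
proof -
  have "(\<Sum>p\<in>off_diagonal (j + t). weight n (j + t) p * A n j t (m + gap (j + t) p)) =
      (\<Sum>p\<in>off_diagonal (j + t). A n j t (m + gap (j + t) p) / r (j + t) ^ n)"
    by (intro sum.cong) (auto simp: weight_def off_diagonal_def)
  then show ?thesis by (simp add: weight_def sum_divide_distrib)
qed

lemma A_nonneg: "0 \<le> A n j t m"
  by (induction t arbitrary: m) (auto intro!: add_nonneg_nonneg divide_nonneg_nonneg sum_nonneg)

text \<open>A gap of stage \<open>j + t\<close> is at most a sixteenth of the next height, and all
  earlier frequencies together are smaller than another sixteenth.\<close>

lemma A_support: "A n j t m \<noteq> 0 \<Longrightarrow> 8 * \<bar>m\<bar> \<le> int (H (j + t))"
proof (induction t arbitrary: m)
  case 0
  then show ?case by (simp split: if_splits)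
next
  case (Suc t)
  have Hs: "512 * int (H (j + t)) \<le> int (H (Suc (j + t)))" using H_Suc_ge[of "j + t"] by linarith
  from Suc.prems obtain p where p: "p \<in> insert (0, 0) (off_diagonal (j + t))" "A n j t (m + gap (j + t) p) \<noteq> 0"
    unfolding A_Suc_weight by (metis (no_types, lifting) mult_zero_right sum.neutral)
  have "8 * \<bar>m + gap (j + t) p\<bar> \<le> int (H (j + t))" using Suc.IH p(2) .
  moreover have "16 * \<bar>gap (j + t) p\<bar> \<le> int (H (Suc (j + t)))"
    using p(1) gap_bound[of p "j + t"] by (auto simp: gap_def)
  then have "16 * \<bar>- gap (j + t) p\<bar> \<le> int (H (Suc (j + t)))" by simp
  moreover have "16 * \<bar>m + gap (j + t) p\<bar> \<le> int (H (Suc (j + t)))"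
    using \<open>8 * \<bar>m + gap (j + t) p\<bar> \<le> int (H (j + t))\<close> Hs int_H_pos[of "j + t"] by linarith
  ultimately have "8 * \<bar>(m + gap (j + t) p) + - gap (j + t) p\<bar> \<le> int (H (Suc (j + t)))" by (intro abs_add_le)
  then show ?case by simp
qed

text \<open>A nonzero gap of stage \<open>j + t\<close> has size at least
  \<open>4 * H (j + t)\<close> and shifts \<open>m\<close> out of the support of the earlier
  coefficients. Hence each coefficient is eventually constant in \<open>t\<close>.\<close>

lemma A_Suc_eq:
  assumes "8 * \<bar>m\<bar> \<le> int (H (j + t))"
  shows "A n j (Suc t) m = A n j t m"
proof -
  have "A n j t (m + gap (j + t) p) = 0" if p: "p \<in> off_diagonal (j + t)" for p
  proof (rule ccontr)
    assume "A n j t (m + gap (j + t) p) \<noteq> 0"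
    then have "8 * \<bar>m + gap (j + t) p\<bar> \<le> int (H (j + t))" by (rule A_support)
    then have "\<bar>(m + gap (j + t) p) - m\<bar> < 4 * int (H (j + t))"
      using assms int_H_pos by (rule abs_diff_small)
    then have "\<bar>gap (j + t) p - gap (j + t) (0, 0)\<bar> < 4 * int (H (j + t))" by simp
    then have "p = (0, 0)" using p by (intro gap_sep) auto
    then show False using p by simp
  qed
  then show ?thesis by simp
qed

lemma A_stable:
  assumes "8 * \<bar>m\<bar> \<le> int (H (j + t))" "t \<le> t'"
  shows "A n j t' m = A n j t m"
  using assms(2)
proof (induction t' rule: dec_induct)
  case (step t')
  have "H (j + t) \<le> H (j + t')" using step by (intro H_mono) simp
  then have "A n j (Suc t') m = A n j t' m" using assms by (intro A_Suc_eq) linarith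
  then show ?case using step by simp
qed simp

text \<open>The stable value of \<open>A n j t m\<close>. The stage \<open>t = 8 * |m|\<close> is
  late enough because \<open>k < H k\<close>.\<close>

definition a :: "nat \<Rightarrow> nat \<Rightarrow> int \<Rightarrow> real" where
  "a n j m = A n j (nat (8 * \<bar>m\<bar>)) m"

lemma A_eq_a:
  assumes "8 * \<bar>m\<bar> \<le> int (H (j + t))" shows "A n j t m = a n j m"
proof -
  define s where "s = nat (8 * \<bar>m\<bar>)"
  have s: "8 * \<bar>m\<bar> \<le> int (H (j + s))" using H_ge[of "j + s"] by (simp add: s_def)
  show ?thesis
  proof (cases "t \<le> s")
    case True
    then show ?thesis using A_stable[OF assms True, of n] by (simp add: a_def s_def)
  next
    case False
    then show ?thesis using A_stable[OF s, of t n] by (simp add: a_def s_def)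
  qed
qed

lemma eventually_A_eq_a: "eventually (\<lambda>t. A n j t m = a n j m) sequentially"
proof (rule eventually_sequentiallyI[of "nat (8 * \<bar>m\<bar>)"])
  fix t assume "t \<ge> nat (8 * \<bar>m\<bar>)"
  then show "A n j t m = a n j m" using H_ge[of "j + t"] by (intro A_eq_a) linarith
qed

lemma a_nonneg: "0 \<le> a n j m"
  by (simp add: a_def A_nonneg)

lemma A_at_0: "A n j t 0 = 1"
  using A_stable[of 0 j 0 t n] by simp

lemma a_at_0 [simp]: "a n j 0 = 1"
  by (simp add: a_def)

text \<open>Shifts of the support by different gaps are disjoint, so the recursion has at most one
  nonzero summand and the power can be taken termwise. Through this the correlations of a product of
  \<open>n\<close> levels become Riesz coefficients.\<close>

lemma A_power: "n \<ge> 1 \<Longrightarrow> A n j t m = A 1 j t m ^ n"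
proof (induction t arbitrary: m)
  case (Suc t)
  let ?k = "j + t"
  have "(\<Sum>p\<in>insert (0, 0) (off_diagonal ?k). weight 1 ?k p * A 1 j t (m + gap ?k p)) ^ n =
      (\<Sum>p\<in>insert (0, 0) (off_diagonal ?k). (weight 1 ?k p * A 1 j t (m + gap ?k p)) ^ n)"
  proof (rule sum_power_single)
    fix p p' assume p: "p \<in> insert (0, 0) (off_diagonal ?k)" "p' \<in> insert (0, 0) (off_diagonal ?k)"
      "weight 1 ?k p * A 1 j t (m + gap ?k p) \<noteq> 0" "weight 1 ?k p' * A 1 j t (m + gap ?k p') \<noteq> 0"
    then have "8 * \<bar>m + gap ?k p\<bar> \<le> int (H ?k)" "8 * \<bar>m + gap ?k p'\<bar> \<le> int (H ?k)"
      by (auto intro!: A_support)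
    then have "\<bar>(m + gap ?k p) - (m + gap ?k p')\<bar> < 4 * int (H ?k)"
      using int_H_pos by (rule abs_diff_small)
    then have "\<bar>gap ?k p - gap ?k p'\<bar> < 4 * int (H ?k)" by simp
    then show "p = p'" using p by (intro gap_sep)
  qed (use Suc in auto)
  also have "\<dots> = (\<Sum>p\<in>insert (0, 0) (off_diagonal ?k). weight n ?k p * A n j t (m + gap ?k p))"
    using Suc by (intro sum.cong) (auto simp: weight_def power_mult_distrib power_divide)
  finally show ?case unfolding A_Suc_weight ..
qed auto

lemma a_power: "n \<ge> 1 \<Longrightarrow> a n j m = a 1 j m ^ n"
  unfolding a_def by (rule A_power)

lemma off_diagonal_swap: "(\<Sum>p\<in>off_diagonal k. f (gap k p)) = (\<Sum>p\<in>off_diagonal k. f (- gap k p))"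
  by (rule sum.reindex_bij_witness[of _ prod.swap prod.swap]) (auto simp: off_diagonal_def gap_def)

lemma A_uminus: "A n j t (- m) = A n j t m"
proof (induction t arbitrary: m)
  case (Suc t)
  have "(\<Sum>p\<in>off_diagonal (j + t). A n j t (- m + gap (j + t) p)) =
      (\<Sum>p\<in>off_diagonal (j + t). A n j t (- (m + gap (j + t) p)))"
    using off_diagonal_swap[of "\<lambda>x. A n j t (- m + x)" "j + t"] by simp
  then show ?case using Suc by (simp only: A.simps)
qed simp

lemma a_uminus: "a n j (- m) = a n j m"
  by (simp add: a_def A_uminus)

text \<open>The definition peels off the last factor. Peeling off the first one instead, which is
  possible because the two summations commute, relates the coefficients of stage \<open>j\<close> to
  those of stage \<open>Suc j\<close>.\<close>

lemma A_Suc_left: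
  "A n j (Suc t) m = A n (Suc j) t m + (\<Sum>p\<in>off_diagonal j. A n (Suc j) t (m + gap j p)) / r j ^ n"
proof (induction t arbitrary: m)
  case 0
  then show ?case by simp
next
  case (Suc t)
  let ?F = "\<lambda>m. \<Sum>p\<in>off_diagonal j. A n (Suc j) t (m + gap j p)"
  let ?G = "\<lambda>m. \<Sum>q\<in>off_diagonal (Suc j + t). A n (Suc j) t (m + gap (Suc j + t) q)"
  have swap: "(\<Sum>q\<in>off_diagonal (Suc j + t). ?F (m + gap (Suc j + t) q)) =
      (\<Sum>p\<in>off_diagonal j. ?G (m + gap j p))"
    by (subst sum.swap) (simp add: add_ac)
  have "A n j (Suc (Suc t)) m = A n j (Suc t) m +
      (\<Sum>q\<in>off_diagonal (Suc j + t). A n j (Suc t) (m + gap (Suc j + t) q)) / r (Suc j + t) ^ n"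
    by (subst A.simps(2)) simp
  also have "\<dots> = A n (Suc j) t m + ?F m / r j ^ n +
      (?G m + (\<Sum>q\<in>off_diagonal (Suc j + t). ?F (m + gap (Suc j + t) q)) / r j ^ n) / r (Suc j + t) ^ n"
    unfolding Suc.IH by (simp add: sum.distrib sum_divide_distrib)
  also have "\<dots> = (A n (Suc j) t m + ?G m / r (Suc j + t) ^ n) +
      (?F m + (\<Sum>p\<in>off_diagonal j. ?G (m + gap j p)) / r (Suc j + t) ^ n) / r j ^ n"
    unfolding swap by (simp add: add_divide_distrib mult.commute)
  also have "\<dots> = A n (Suc j) (Suc t) m + (\<Sum>p\<in>off_diagonal j. A n (Suc j) (Suc t) (m + gap j p)) / r j ^ n"
    by (simp add: sum.distrib sum_divide_distrib)
  finally show ?case .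
qed

lemma a_Suc_left:
  "a n j m = a n (Suc j) m + (\<Sum>p\<in>off_diagonal j. a n (Suc j) (m + gap j p)) / r j ^ n"
proof -
  have "eventually (\<lambda>t. A n j t m = a n j m \<and> A n (Suc j) t m = a n (Suc j) m \<and>
      (\<forall>p\<in>off_diagonal j. A n (Suc j) t (m + gap j p) = a n (Suc j) (m + gap j p))) sequentially"
    by (intro eventually_conj eventually_A_eq_a eventually_ball_finite ballI) auto
  then obtain T where T: "\<And>t. t \<ge> T \<Longrightarrow> A n j t m = a n j m \<and> A n (Suc j) t m = a n (Suc j) m \<and>
      (\<forall>p\<in>off_diagonal j. A n (Suc j) t (m + gap j p) = a n (Suc j) (m + gap j p))"
    by (auto simp: eventually_sequentially)
  have "a n j m = A n j (Suc T) m" using T[of "Suc T"] by simp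
  also have "\<dots> = a n (Suc j) m + (\<Sum>p\<in>off_diagonal j. a n (Suc j) (m + gap j p)) / r j ^ n"
    unfolding A_Suc_left using T[of T] by simp
  finally show ?thesis .
qed

text \<open>The coefficients are nonnegative and their total is the value of the product at 1, where
  a factor is at most \<open>1 + r ^ 2 / r ^ n\<close>.\<close>

lemma sum_A_le:
  assumes "finite I"
  shows "(\<Sum>m\<in>I. A n j t m) \<le> (\<Prod>k<t. 1 + real (r (j + k)) ^ 2 / r (j + k) ^ n)"
  using assms
proof (induction t arbitrary: I)
  case 0
  have "(\<Sum>m\<in>I. A n j 0 m) = (if 0 \<in> I then 1 else 0)" using 0 by simp
  then show ?case by simp
next
  case (Suc t)
  let ?k = "j + t"
  let ?B = "\<Prod>k<t. 1 + real (r (j + k)) ^ 2 / r (j + k) ^ n"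
  have B: "0 \<le> ?B" by (intro prod_nonneg) auto
  have shift: "(\<Sum>m\<in>I. A n j t (m + g)) \<le> ?B" for g
  proof -
    have "(\<Sum>m\<in>I. A n j t (m + g)) = (\<Sum>m\<in>(\<lambda>m. m + g) ` I. A n j t m)"
      by (subst sum.reindex) (auto intro: inj_onI)
    then show ?thesis using Suc.IH[of "(\<lambda>m. m + g) ` I"] Suc.prems by simp
  qed
  have "(\<Sum>m\<in>I. A n j (Suc t) m) =
      (\<Sum>m\<in>I. A n j t m) + (\<Sum>p\<in>off_diagonal ?k. \<Sum>m\<in>I. A n j t (m + gap ?k p)) / r ?k ^ n"
    by (subst sum.swap) (simp add: sum.distrib sum_divide_distrib)
  also have "\<dots> \<le> ?B + (\<Sum>p\<in>off_diagonal ?k. ?B) / r ?k ^ n"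
    using Suc by (intro add_mono divide_right_mono sum_mono shift) auto
  also have "\<dots> \<le> ?B + (real (r ?k) ^ 2 * ?B) / r ?k ^ n"
  proof -
    have "real (card (off_diagonal ?k)) \<le> real (r ?k) ^ 2"
      unfolding card_off_diagonal power2_eq_square of_nat_mult[symmetric] of_nat_le_iff by simp
    then show ?thesis using B by (intro add_mono divide_right_mono order.refl) (auto intro: mult_right_mono)
  qed
  also have "\<dots> = (\<Prod>k<Suc t. 1 + real (r (j + k)) ^ 2 / r (j + k) ^ n)"
    by (simp add: algebra_simps)
  finally show ?case .
qed

text \<open>Stages before \<open>k\<close> produce only frequencies below \<open>4 * H k\<close> in
  size, and stages after \<open>k\<close> do not reach this range; so on multiples of
  \<open>4 * H k\<close> only the factor of stage \<open>k\<close> is seen.\<close>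

lemma a_at_stage:
  assumes "j \<le> k" "4 * int (H k) dvd m" "8 * \<bar>m\<bar> \<le> int (H (Suc k))"
  shows "a n j m = of_bool (m = 0) + (\<Sum>p\<in>off_diagonal k. of_bool (m + gap k p = 0)) / r k ^ n"
proof -
  define t where "t = k - j"
  have k: "k = j + t" using assms(1) by (simp add: t_def)
  have *: "A n j t x = of_bool (x = 0)" if "4 * int (H k) dvd x" for x
  proof (cases "x = 0")
    case False
    have "A n j t x = 0"
    proof (rule ccontr)
      assume "A n j t x \<noteq> 0"
      then have "8 * \<bar>x\<bar> \<le> int (H k)" unfolding k by (rule A_support)
      then have "\<bar>x - 0\<bar> < 4 * int (H k)" using int_H_pos by (intro abs_diff_small) auto
      then have "\<bar>x\<bar> < 4 * int (H k)" by simp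
      then show False using dvd_small_zero that False by blast
    qed
    then show ?thesis using False by simp
  qed (simp add: A_at_0)
  have "a n j m = A n j (Suc t) m" using assms k by (intro A_eq_a[symmetric]) simp
  also have "\<dots> = of_bool (m = 0) + (\<Sum>p\<in>off_diagonal k. of_bool (m + gap k p = 0)) / r k ^ n"
    using * assms(2) gap_dvd by (simp add: k[symmetric] dvd_add)
  finally show ?thesis .
qed

lemma sum_gap_cancel:
  assumes "p \<in> off_diagonal k"
  shows "(\<Sum>p'\<in>off_diagonal k. of_bool (gap k p + gap k p' = 0)) = (1::real)"
proof -
  have swap: "prod.swap p \<in> off_diagonal k" using assms by (auto simp: off_diagonal_def)
  have "(\<Sum>p'\<in>off_diagonal k. of_bool (gap k p + gap k p' = 0)) =
      (\<Sum>p'\<in>off_diagonal k. if p' = prod.swap p then 1 else (0::real))"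
  proof (rule sum.cong)
    fix p' assume p': "p' \<in> off_diagonal k"
    have "gap k p' = gap k (prod.swap p) \<longleftrightarrow> p' = prod.swap p" using gap_inj p' swap by blast
    moreover have "gap k p + gap k p' = 0 \<longleftrightarrow> gap k p' = gap k (prod.swap p)"
      by (auto simp: gap_def)
    ultimately show "of_bool (gap k p + gap k p' = 0) = (if p' = prod.swap p then 1 else (0::real))" by simp
  qed simp
  also have "\<dots> = 1" using swap by simp
  finally show ?thesis .
qed

lemma gap_nonzero: "p \<in> off_diagonal k \<Longrightarrow> gap k p \<noteq> 0"
  using gap_inj[of p k "(0, 0)"] by auto

lemma a_gap:
  assumes "j \<le> k" "p \<in> off_diagonal k"
  shows "a n j (gap k p) = 1 / r k ^ n"
proof -
  have "8 * \<bar>gap k p\<bar> \<le> int (H (Suc k))" using gap_bound[OF assms(2)] by linarith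
  then show ?thesis
    using a_at_stage[OF assms(1) gap_dvd, of p n] gap_nonzero[OF assms(2)] sum_gap_cancel[OF assms(2)] by simp
qed

text \<open>Lacunarity makes factors of different stages uncorrelated: the only gap of stage
  \<open>k'\<close> that brings the sum back into the earlier support is the opposite of
  \<open>gap k' p'\<close>, and it leaves the coefficient at \<open>gap k p\<close>.\<close>

lemma a_gap_gap_different:
  assumes "j \<le> k" "k < k'" "p \<in> off_diagonal k" "p' \<in> off_diagonal k'"
  shows "a n j (gap k p + gap k' p') = 1 / r k ^ n * (1 / r k' ^ n)"
proof -
  define t where "t = k' - j"
  have k': "k' = j + t" using assms by (simp add: t_def)
  have sm: "8 * \<bar>gap k p\<bar> \<le> int (H k')"
    using gap_bound[OF assms(3)] H_mono[of "Suc k" k'] assms(2) by linarith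
  have big: "512 * H k' \<le> H (Suc k')" by (rule H_Suc_ge)
  have "8 * \<bar>gap k p + gap k' p'\<bar> \<le> int (H (Suc k'))"
  proof (rule abs_add_le[OF _ gap_bound[OF assms(4)]])
    show "16 * \<bar>gap k p\<bar> \<le> int (H (Suc k'))" using sm big int_H_pos[of k'] by linarith
  qed
  then have "8 * \<bar>gap k p + gap k' p'\<bar> \<le> int (H (j + Suc t))" by (simp add: k')
  then have "a n j (gap k p + gap k' p') = A n j (Suc t) (gap k p + gap k' p')" by (rule A_eq_a[symmetric])
  also have "\<dots> = (\<Sum>q\<in>insert (0, 0) (off_diagonal k'). weight n k' q * A n j t (gap k p + gap k' p' + gap k' q))"
    unfolding A_Suc_weight k'[symmetric] ..
  also have "\<dots> = (\<Sum>q\<in>{prod.swap p'}. weight n k' q * A n j t (gap k p + gap k' p' + gap k' q))"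
  proof (rule sum.mono_neutral_right)
    show "{prod.swap p'} \<subseteq> insert (0, 0) (off_diagonal k')" using assms(4) by (auto simp: off_diagonal_def)
    show "\<forall>q\<in>insert (0, 0) (off_diagonal k') - {prod.swap p'}. weight n k' q * A n j t (gap k p + gap k' p' + gap k' q) = 0"
    proof (rule ballI, rule ccontr)
      fix q assume q: "q \<in> insert (0, 0) (off_diagonal k') - {prod.swap p'}"
        and "weight n k' q * A n j t (gap k p + gap k' p' + gap k' q) \<noteq> 0"
      then have "A n j t (gap k p + gap k' p' + gap k' q) \<noteq> 0" by simp
      then have "8 * \<bar>gap k p + gap k' p' + gap k' q\<bar> \<le> int (H k')" unfolding k' by (rule A_support)
      then have "\<bar>(gap k p + gap k' p' + gap k' q) - gap k p\<bar> < 4 * int (H k')"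
        using sm int_H_pos by (rule abs_diff_small)
      moreover have "gap k' p' = - gap k' (prod.swap p')" by (simp add: gap_def)
      ultimately have "\<bar>gap k' q - gap k' (prod.swap p')\<bar> < 4 * int (H k')" by simp
      moreover have "prod.swap p' \<in> insert (0, 0) (off_diagonal k')" using assms(4) by (auto simp: off_diagonal_def)
      ultimately have "q = prod.swap p'" using q by (intro gap_sep) auto
      then show False using q by simp
    qed
  qed simp
  also have "\<dots> = weight n k' (prod.swap p') * A n j t (gap k p)" by (simp add: gap_def)
  also have "A n j t (gap k p) = a n j (gap k p)" using sm unfolding k' by (rule A_eq_a)
  also have "weight n k' (prod.swap p') = 1 / r k' ^ n"
    using assms(4) by (auto simp: weight_def off_diagonal_def)
  finally show ?thesis using a_gap[OF assms(1,3)] by simp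
qed

text \<open>The first term comes from opposite gaps. Any other contribution requires that two gaps
  add up to a third, which forces the two pairs to share an index crosswise. This is the input for
  the variance of a single factor.\<close>

lemma a_gap_gap_same:
  assumes "j \<le> k" "(i, l) \<in> off_diagonal k" "(i', l') \<in> off_diagonal k"
  shows "a n j (gap k (i, l) + gap k (i', l')) \<le>
    of_bool (i = l' \<and> l = i') + (of_bool (i = l') + of_bool (l = i')) / r k ^ n"
proof -
  let ?m = "gap k (i, l) + gap k (i', l')"
  have nz: "i \<noteq> l" "i' \<noteq> l'" using assms(2,3) by (auto simp: off_diagonal_def)
  have "8 * \<bar>?m\<bar> \<le> int (H (Suc k))"
    by (intro abs_add_le gap_bound assms)
  then have a: "a n j ?m = of_bool (?m = 0) + (\<Sum>p\<in>off_diagonal k. of_bool (?m + gap k p = 0)) / r k ^ n"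
    by (intro a_at_stage assms dvd_add gap_dvd)
  have "i = l' \<and> l = i'" if "?m = 0"
  proof -
    have "gap k (i, l) = gap k (l', i')" using that by (simp add: gap_def)
    then show ?thesis using gap_eq_iff[of i l l' i' k] nz by simp
  qed
  then have 1: "of_bool (?m = 0) \<le> (of_bool (i = l' \<and> l = i') :: real)" by auto
  have 2: "(\<Sum>p\<in>off_diagonal k. of_bool (?m + gap k p = 0)) \<le> (of_bool (i = l') + of_bool (l = i') :: real)"
  proof (cases "\<exists>p\<in>off_diagonal k. ?m + gap k p = 0")
    case True
    then obtain p where p: "p \<in> off_diagonal k" "?m + gap k p = 0" by blast
    have "(\<Sum>q\<in>off_diagonal k. of_bool (?m + gap k q = 0)) = (\<Sum>q\<in>{p}. of_bool (?m + gap k q = 0) :: real)"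
    proof (rule sum.mono_neutral_right)
      show "\<forall>q\<in>off_diagonal k - {p}. of_bool (?m + gap k q = 0) = (0::real)"
      proof
        fix q assume q: "q \<in> off_diagonal k - {p}"
        then have "gap k q \<noteq> gap k p" using gap_inj[of q k p] p(1) by auto
        then show "of_bool (?m + gap k q = 0) = (0::real)" using p(2) by auto
      qed
    qed (use p in auto)
    also have "\<dots> = 1" using p by simp
    also have "\<dots> \<le> of_bool (i = l') + of_bool (l = i')"
    proof -
      obtain b c where bc: "p = (b, c)" "b \<noteq> c" using p(1) by (auto simp: off_diagonal_def)
      have "4 * int (H k) * ((8 ^ i - 8 ^ l) + (8 ^ i' - 8 ^ l') + (8 ^ b - 8 ^ c)) = 0"
        using p(2) by (simp add: bc gap_eq algebra_simps)
      then have "(8::int) ^ i - 8 ^ l + (8 ^ i' - 8 ^ l') + (8 ^ b - 8 ^ c) = 0"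
        using H_pos[of k] by (simp del: H_pos)
      then have "(8::int) ^ i + 8 ^ i' + 8 ^ b = 8 ^ l + 8 ^ l' + 8 ^ c" by linarith
      then have "int (8 ^ i + 8 ^ i' + 8 ^ b) = int (8 ^ l + 8 ^ l' + 8 ^ c)" by simp
      then have "(8::nat) ^ i + 8 ^ i' + 8 ^ b = 8 ^ l + 8 ^ l' + 8 ^ c" by (simp only: of_nat_eq_iff)
      then have "i = l' \<or> l = i'" using nz bc by (intro pow8_sum3_cross) auto
      then show ?thesis by auto
    qed
    finally show ?thesis .
  next
    case False
    then show ?thesis by simp
  qed
  show ?thesis unfolding a by (intro add_mono 1 divide_right_mono 2) simp
qed

end

section \<open>Riesz products\<close>

lemma sets_circle_lebesgue [simp]: "sets circle_lebesgue = sets circle_borel"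
  by (simp add: circle_lebesgue_def)

lemma cis_measurable_circle [measurable]: "cis \<in> borel \<rightarrow>\<^sub>M circle_borel"
proof -
  have "continuous_on UNIV cis" by (intro continuous_intros)
  then have "cis \<in> borel \<rightarrow>\<^sub>M borel" by (rule borel_measurable_continuous_onI)
  then show ?thesis unfolding circle_borel_def by (intro measurable_restrict_space2) auto
qed

lemma cis_measurable_interval [measurable]: "cis \<in> restrict_space lborel S \<rightarrow>\<^sub>M circle_borel"
  by (rule measurable_restrict_space1) simp

lemma finite_circle_lebesgue: "finite_measure circle_lebesgue"
proof (rule finite_measureI)
  have "emeasure circle_lebesgue (space circle_lebesgue) = emeasure (restrict_space lborel {0..<2 * pi}) {0..<2 * pi}"
  proof -
    have "sphere 0 1 \<in> sets circle_borel"
      using sets.top[of circle_borel] space_circle_borel[of circle_borel] by simp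
    then show ?thesis
      unfolding space_circle_borel[OF sets_circle_lebesgue] unfolding circle_lebesgue_def
      by (subst emeasure_distr[OF cis_measurable_interval])
         (auto simp: space_restrict_space intro!: arg_cong[where f = "emeasure _"])
  qed
  also have "\<dots> = emeasure lborel {0..<2 * pi}" by (subst emeasure_restrict_space) auto
  also have "\<dots> < \<infinity>" by simp
  finally show "emeasure circle_lebesgue (space circle_lebesgue) \<noteq> \<infinity>" by simp
qed

lemma integral_circle_lebesgue:
  fixes f :: "complex \<Rightarrow> 'b::{banach, second_countable_topology}"
  assumes "f \<in> borel_measurable circle_borel"
  shows "(\<integral>z. f z \<partial>circle_lebesgue) = (\<integral>x. indicator {0..<2 * pi} x *\<^sub>R f (cis x) \<partial>lborel)"
  unfolding circle_lebesgue_def using assms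
  by (subst integral_distr, measurable, subst integral_restrict_space) auto

lemma integral_circle_lebesgue_powi:
  "(\<integral>z. z powi m \<partial>circle_lebesgue) = (if m = 0 then of_real (2 * pi) else 0)"
proof -
  have "(\<integral>z. z powi m \<partial>circle_lebesgue) = (\<integral>x. indicator {0..<2 * pi} x *\<^sub>R (cis x powi m) \<partial>lborel)"
    by (intro integral_circle_lebesgue circle_continuous_measurable continuous_intros) simp
  also have "\<dots> = (\<integral>x. indicator {0..2 * pi} x *\<^sub>R (cis x powi m) \<partial>lborel)"
  proof (rule integral_cong_AE)
    have c: "(\<lambda>x. cis x powi m) \<in> borel_measurable borel"
      by (intro borel_measurable_continuous_onI continuous_intros) auto
    then show "(\<lambda>x. indicator {0..<2 * pi} x *\<^sub>R (cis x powi m)) \<in> borel_measurable lborel"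
      "(\<lambda>x. indicator {0..2 * pi} x *\<^sub>R (cis x powi m)) \<in> borel_measurable lborel" by measurable
    have "AE x in lborel. x \<noteq> 2 * pi" by (rule AE_lborel_singleton)
    then show "AE x in lborel. indicator {0..<2 * pi} x *\<^sub>R (cis x powi m) = indicator {0..2 * pi} x *\<^sub>R (cis x powi m)"
      by eventually_elim (auto simp: indicator_def)
  qed
  also have "\<dots> = (if m = 0 then of_real (2 * pi) else 0)"
  proof (cases "m = 0")
    case True
    then show ?thesis by (simp add: scaleR_conv_of_real)
  next
    case False
    define F where "F x = cis (real_of_int m * x) / (\<i> * of_int m)" for x
    have "((\<lambda>x. cis (real_of_int m * x)) has_vector_derivative
        (real_of_int m *\<^sub>R (\<i> * cis (real_of_int m * x)))) (at x within {0..2 * pi})" for x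
      unfolding has_vector_derivative_def
      by (auto intro!: derivative_eq_intros simp: scaleR_conv_of_real algebra_simps fun_eq_iff)
    then have "(F has_vector_derivative (real_of_int m *\<^sub>R (\<i> * cis (real_of_int m * x))) / (\<i> * of_int m))
        (at x within {0..2 * pi})" for x
      unfolding F_def by (rule has_vector_derivative_divide)
    then have d: "(F has_vector_derivative cis x powi m) (at x within {0..2 * pi})" for x
      using False by (simp add: scaleR_conv_of_real cis_power_int)
    have "integral\<^sup>L lborel (\<lambda>x. indicator {0..2 * pi} x *\<^sub>R (cis x powi m)) = F (2 * pi) - F 0"
      by (rule integral_FTC_atLeastAtMost) (auto intro!: d continuous_intros)
    also have "F (2 * pi) = F 0"
      using cis_multiple_2pi[of "real_of_int m"] unfolding F_def by (simp add: mult_ac)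
    finally show ?thesis using False by simp
  qed
  finally show ?thesis .
qed

context lacunary
begin

text \<open>The diagonal terms of the square cancel against \<open>r k / r k ^ n\<close>, which
  leaves 1 plus the off-diagonal frequencies. In this form, for \<open>n \<ge> 1\<close>, the factor
  is visibly a sum of two nonnegative terms, and so are its zeros located.\<close>

definition factor :: "nat \<Rightarrow> nat \<Rightarrow> complex \<Rightarrow> real" where
  "factor n k z = 1 - r k / r k ^ n + (cmod (\<Sum>i<r k. z ^ P k i))\<^sup>2 / r k ^ n"

lemma factor_nonneg: "n \<ge> 1 \<Longrightarrow> 0 \<le> factor n k z"
proof -
  assume "n \<ge> 1"
  then have "real (r k) ^ 1 \<le> real (r k) ^ n" using r_pos[of k] by (intro power_increasing) linarith+
  then have "real (r k) / r k ^ n \<le> 1" by simp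
  then show ?thesis by (simp add: factor_def)
qed

lemma factor_eq:
  assumes z: "z \<in> sphere 0 1"
  shows "complex_of_real (factor n k z) = 1 + (\<Sum>p\<in>off_diagonal k. z powi gap k p) / r k ^ n"
proof -
  have "complex_of_real ((cmod (\<Sum>i<r k. z ^ P k i))\<^sup>2) = (\<Sum>i<r k. z powi int (P k i)) * cnj (\<Sum>l<r k. z powi int (P k l))"
    unfolding complex_norm_square by simp
  also have "\<dots> = (\<Sum>i<r k. \<Sum>l<r k. z powi gap k (i, l))"
    unfolding cnj_sum sum_product circle_powi_cnj[OF z] by (simp add: gap_def)
  also have "\<dots> = (\<Sum>p\<in>{..<r k} \<times> {..<r k}. z powi gap k p)" by (simp add: sum.cartesian_product)
  also have "\<dots> = (\<Sum>p\<in>off_diagonal k \<union> (\<lambda>i. (i, i)) ` {..<r k}. z powi gap k p)"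
    by (rule sum.cong) (auto simp: off_diagonal_def)
  also have "\<dots> = (\<Sum>p\<in>off_diagonal k. z powi gap k p) + (\<Sum>p\<in>(\<lambda>i. (i, i)) ` {..<r k}. z powi gap k p)"
    by (rule sum.union_disjoint) (simp, simp, auto simp: off_diagonal_def)
  also have "(\<Sum>p\<in>(\<lambda>i. (i, i)) ` {..<r k}. z powi gap k p) = of_nat (r k)"
    by (subst sum.reindex) (auto intro: inj_onI)
  finally have "complex_of_real ((cmod (\<Sum>i<r k. z ^ P k i))\<^sup>2) =
      (\<Sum>p\<in>off_diagonal k. z powi gap k p) + of_nat (r k)" .
  then show ?thesis unfolding factor_def by (simp add: add_divide_distrib)
qed

lemma continuous_on_factor [continuous_intros]: "continuous_on S (factor n k)"
  unfolding factor_def by (intro continuous_intros) auto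

section \<open>Partial products and their weak limits\<close>

definition riesz :: "nat \<Rightarrow> nat \<Rightarrow> nat \<Rightarrow> complex \<Rightarrow> real" where
  "riesz n j t z = (\<Prod>k<t. factor n (j + k) z)"

lemma riesz_nonneg: "n \<ge> 1 \<Longrightarrow> 0 \<le> riesz n j t z"
  unfolding riesz_def by (intro prod_nonneg) (auto intro: factor_nonneg)

lemma continuous_on_riesz [continuous_intros]: "continuous_on S (riesz n j t)"
  unfolding riesz_def by (intro continuous_intros)

lemma powi_shift: "z \<in> sphere 0 1 \<Longrightarrow> (z::complex) powi m * z powi l = z powi (m + l)"
  by (subst power_int_add) auto

lemma integral_powi_riesz:
  "(\<integral>z. z powi m * of_real (riesz n j t z) \<partial>circle_lebesgue) = of_real (2 * pi * A n j t m)"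
proof (induction t arbitrary: m)
  case 0
  then show ?case by (simp add: riesz_def integral_circle_lebesgue_powi)
next
  case (Suc t)
  let ?k = "j + t"
  let ?g = "\<lambda>m z. z powi m * complex_of_real (riesz n j t z)"
  have int: "integrable circle_lebesgue (?g m)" for m
    by (intro circle_continuous_integrable continuous_intros finite_circle_lebesgue) simp
  have "(\<integral>z. z powi m * of_real (riesz n j (Suc t) z) \<partial>circle_lebesgue) =
      (\<integral>z. ?g m z + (\<Sum>p\<in>off_diagonal ?k. ?g (m + gap ?k p) z) / r ?k ^ n \<partial>circle_lebesgue)"
  proof (intro Bochner_Integration.integral_cong refl)
    fix z assume "z \<in> space circle_lebesgue"
    then have z: "z \<in> sphere 0 1" using space_circle_borel[OF sets_circle_lebesgue] by simp
    have "z powi m * of_real (riesz n j (Suc t) z) = ?g m z * of_real (factor n ?k z)"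
      by (simp add: riesz_def mult_ac)
    also have "\<dots> = ?g m z + (\<Sum>p\<in>off_diagonal ?k. ?g (m + gap ?k p) z) / r ?k ^ n"
      unfolding factor_eq[OF z]
      by (simp add: distrib_left sum_distrib_left sum_divide_distrib powi_shift[OF z, symmetric] mult_ac)
    finally show "z powi m * of_real (riesz n j (Suc t) z) =
        ?g m z + (\<Sum>p\<in>off_diagonal ?k. ?g (m + gap ?k p) z) / r ?k ^ n" .
  qed
  also have "\<dots> = (\<integral>z. ?g m z \<partial>circle_lebesgue) +
      (\<integral>z. (\<Sum>p\<in>off_diagonal ?k. ?g (m + gap ?k p) z) / r ?k ^ n \<partial>circle_lebesgue)"
    by (intro Bochner_Integration.integral_add Bochner_Integration.integrable_divide
        Bochner_Integration.integrable_sum int)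
  also have "(\<integral>z. (\<Sum>p\<in>off_diagonal ?k. ?g (m + gap ?k p) z) / r ?k ^ n \<partial>circle_lebesgue) =
      (\<Sum>p\<in>off_diagonal ?k. \<integral>z. ?g (m + gap ?k p) z \<partial>circle_lebesgue) / r ?k ^ n"
    using int by (simp add: Bochner_Integration.integral_sum)
  also have "(\<integral>z. ?g m z \<partial>circle_lebesgue) + (\<Sum>p\<in>off_diagonal ?k. \<integral>z. ?g (m + gap ?k p) z \<partial>circle_lebesgue) / r ?k ^ n =
      of_real (2 * pi * A n j (Suc t) m)"
    unfolding Suc.IH by (simp add: algebra_simps sum_distrib_left)
  finally show ?case .
qed

text \<open>The normalized partial product is carried over to an interval of the line, where
  tightness and Levy's continuity theorem apply; its Fourier coefficients are the values of the
  characteristic function at integers.\<close>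

definition riesz_distribution :: "nat \<Rightarrow> nat \<Rightarrow> nat \<Rightarrow> real measure" where
  "riesz_distribution n j t =
    density lborel (\<lambda>x. ennreal (indicator {0..<2 * pi} x * riesz n j t (cis x) / (2 * pi)))"

lemma riesz_cis_measurable [measurable]: "(\<lambda>x. riesz n j t (cis x)) \<in> borel_measurable borel"
proof (rule borel_measurable_continuous_onI)
  have "continuous_on UNIV (riesz n j t \<circ> cis)"
    by (intro continuous_on_compose continuous_intros)
  then show "continuous_on UNIV (\<lambda>x. riesz n j t (cis x))" by (simp add: comp_def)
qed

lemma integral_riesz_distribution:
  assumes "n \<ge> 1"
  shows "(\<integral>x. cis x powi m \<partial>riesz_distribution n j t) = of_real (A n j t m)"
proof -
  have c: "(\<lambda>x. cis x powi m) \<in> borel_measurable borel"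
    by (intro borel_measurable_continuous_onI continuous_intros) auto
  have "(\<integral>x. cis x powi m \<partial>riesz_distribution n j t) =
      (\<integral>x. (indicator {0..<2 * pi} x * riesz n j t (cis x) / (2 * pi)) *\<^sub>R (cis x powi m) \<partial>lborel)"
    unfolding riesz_distribution_def using c riesz_nonneg[OF assms]
    by (subst integral_density) auto
  also have "\<dots> = (\<integral>x. indicator {0..<2 * pi} x *\<^sub>R (cis x powi m * of_real (riesz n j t (cis x))) / of_real (2 * pi) \<partial>lborel)"
    by (intro Bochner_Integration.integral_cong refl) (simp add: scaleR_conv_of_real mult_ac)
  also have "\<dots> = (\<integral>x. indicator {0..<2 * pi} x *\<^sub>R (cis x powi m * of_real (riesz n j t (cis x))) \<partial>lborel) / of_real (2 * pi)"
    by (rule integral_divide_zero)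
  also have "(\<integral>x. indicator {0..<2 * pi} x *\<^sub>R (cis x powi m * of_real (riesz n j t (cis x))) \<partial>lborel) =
      (\<integral>z. z powi m * of_real (riesz n j t z) \<partial>circle_lebesgue)"
    by (rule integral_circle_lebesgue[symmetric])
       (intro circle_continuous_measurable continuous_intros, simp)
  also have "\<dots> / of_real (2 * pi) = of_real (A n j t m)"
    unfolding integral_powi_riesz by simp
  finally show ?thesis .
qed

lemma real_distribution_riesz:
  assumes "n \<ge> 1" shows "real_distribution (riesz_distribution n j t)"
proof -
  let ?f = "\<lambda>x. indicator {0..<2 * pi} x * riesz n j t (cis x) / (2 * pi)"
  have "bounded ((\<lambda>x. riesz n j t (cis x)) ` {0..2 * pi})"
  proof (intro compact_imp_bounded compact_continuous_image)
    have "continuous_on {0..2 * pi} (riesz n j t \<circ> cis)"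
      by (intro continuous_on_compose continuous_intros)
    then show "continuous_on {0..2 * pi} (\<lambda>x. riesz n j t (cis x))" by (simp add: comp_def)
  qed auto
  then obtain B where B: "\<And>x. x \<in> {0..2 * pi} \<Longrightarrow> \<bar>riesz n j t (cis x)\<bar> \<le> B"
    unfolding bounded_iff real_norm_def by blast
  have int: "integrable lborel ?f"
  proof (rule Bochner_Integration.integrable_bound)
    show "integrable lborel (\<lambda>x. indicator {0..<2 * pi} x * (B / (2 * pi)))" by simp
    show "AE x in lborel. norm (?f x) \<le> norm (indicator {0..<2 * pi} x * (B / (2 * pi)))"
    proof (rule AE_I2)
      fix x
      show "norm (?f x) \<le> norm (indicator {0..<2 * pi} x * (B / (2 * pi)))"
        using B[of x] by (auto simp: indicator_def intro!: divide_right_mono)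
    qed
  qed measurable
  have nn: "0 \<le> ?f x" for x using riesz_nonneg[OF assms] by simp
  have "complex_of_real (\<integral>x. ?f x \<partial>lborel) = (\<integral>x. of_real (?f x) \<partial>lborel)" by (rule integral_complex_of_real[symmetric])
  also have "\<dots> = (\<integral>x. cis x powi 0 \<partial>riesz_distribution n j t)"
    unfolding riesz_distribution_def using nn
    by (subst integral_density) (auto simp: scaleR_conv_of_real)
  also have "\<dots> = 1" unfolding integral_riesz_distribution[OF assms] by (simp add: A_at_0)
  finally have 1: "(\<integral>x. ?f x \<partial>lborel) = 1" by (simp only: of_real_eq_1_iff)
  have "prob_space (riesz_distribution n j t)"
  proof
    have "emeasure (riesz_distribution n j t) (space (riesz_distribution n j t)) = (\<integral>\<^sup>+x. ennreal (?f x) \<partial>lborel)"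
      unfolding riesz_distribution_def by (subst emeasure_density) auto
    also have "\<dots> = ennreal (\<integral>x. ?f x \<partial>lborel)" using int nn by (intro nn_integral_eq_integral) auto
    finally show "emeasure (riesz_distribution n j t) (space (riesz_distribution n j t)) = 1"
      unfolding 1 by simp
  qed
  then show ?thesis
    unfolding real_distribution_def real_distribution_axioms_def
    by (simp add: riesz_distribution_def)
qed

lemma tight_riesz:
  assumes "n \<ge> 1" shows "tight (riesz_distribution n j)"
  unfolding tight_def
proof (intro conjI allI impI)
  show "real_distribution (riesz_distribution n j t)" for t using assms by (rule real_distribution_riesz)
  fix e :: real assume e: "e > 0"
  show "\<exists>a b. a < b \<and> (\<forall>t. 1 - e < measure (riesz_distribution n j t) {a<..b})"
  \<comment> \<open>Tightness uses intervals that are open on the left; starting at -1 keeps the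
    point 0 inside.\<close>
  proof (rule exI[of _ "-1"], rule exI[of _ "2 * pi"], intro conjI allI)
    show "- 1 < 2 * pi" using pi_gt_zero by linarith
    fix t
    interpret real_distribution "riesz_distribution n j t" using assms by (rule real_distribution_riesz)
    have "AE x in riesz_distribution n j t. x \<in> {-1<..2 * pi}"
      unfolding riesz_distribution_def by (subst AE_density) (auto simp: indicator_def)
    then have "prob {-1<..2 * pi} = 1" by (subst prob_eq_1) auto
    then show "1 - e < prob {-1<..2 * pi}" using e by simp
  qed
qed

text \<open>A weak limit of the partial products along a subsequence. Each coefficient is eventually
  constant, so the limit inherits the stable values.\<close>

theorem riesz_measure_exists:
  assumes n: "n \<ge> 1"
  shows "\<exists>\<mu>. finite_measure \<mu> \<and> sets \<mu> = sets circle_borel \<and> (\<forall>m. (\<integral>z. z powi m \<partial>\<mu>) = of_real (a n j m))"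
proof -
  obtain s M where s: "strict_mono s" and M: "real_distribution M"
    and conv: "weak_conv_m (riesz_distribution n j \<circ> id \<circ> s) M"
    using tight_imp_convergent_subsubsequence[OF tight_riesz[OF n, of j] strict_mono_id] by blast
  interpret M: real_distribution M by fact
  have char_powi: "char N (real_of_int m) = (\<integral>x. cis x powi m \<partial>N)" for N m
    unfolding char_def by (intro Bochner_Integration.integral_cong refl) (subst cis_power_int, subst cis_conv_exp, simp)
  have coeff: "(\<integral>x. cis x powi m \<partial>M) = of_real (a n j m)" for m
  proof -
    have "(\<lambda>i. char ((riesz_distribution n j \<circ> id \<circ> s) i) (real_of_int m)) \<longlonglongrightarrow> char M (real_of_int m)"
      using conv M by (intro levy_continuity1) (auto simp: comp_def intro: real_distribution_riesz[OF n])
    then have "(\<lambda>i. complex_of_real (A n j (s i) m)) \<longlonglongrightarrow> (\<integral>x. cis x powi m \<partial>M)"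
      unfolding char_powi by (simp add: integral_riesz_distribution[OF n])
    moreover have "(\<lambda>i. complex_of_real (A n j (s i) m)) \<longlonglongrightarrow> of_real (a n j m)"
    proof (rule tendsto_eventually)
      have "eventually (\<lambda>i. A n j (s i) m = a n j m) sequentially"
        using filterlim_subseq[OF s] eventually_A_eq_a by (rule eventually_compose_filterlim[rotated])
      then show "eventually (\<lambda>i. complex_of_real (A n j (s i) m) = of_real (a n j m)) sequentially"
        by eventually_elim simp
    qed
    ultimately show ?thesis by (rule LIMSEQ_unique)
  qed
  \<comment> \<open>Pushing forward by \<open>cis\<close> identifies the end points of the interval,
    so possible mass of the weak limit at \<open>2 * pi\<close> does no harm.\<close>
  define \<mu> where "\<mu> = distr M circle_borel cis"
  have cisM: "cis \<in> M \<rightarrow>\<^sub>M circle_borel" using cis_measurable_circle by simp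
  interpret \<mu>: prob_space \<mu> unfolding \<mu>_def by (rule M.prob_space_distr) fact
  have "(\<integral>z. z powi m \<partial>\<mu>) = of_real (a n j m)" for m
    unfolding \<mu>_def coeff[symmetric]
    by (rule integral_distr[OF cisM]) (intro circle_continuous_measurable continuous_intros, simp)
  moreover have "sets \<mu> = sets circle_borel" by (simp add: \<mu>_def)
  ultimately show ?thesis using \<mu>.finite_measure_axioms by blast
qed

text \<open>Any choice is as good as another: by \<open>circle_measure_eqI\<close> two such measures
  agree on all measurable sets.\<close>

definition lam :: "nat \<Rightarrow> nat \<Rightarrow> complex measure" where
  "lam n j = (SOME \<mu>. finite_measure \<mu> \<and> sets \<mu> = sets circle_borel \<and> (\<forall>m. (\<integral>z. z powi m \<partial>\<mu>) = of_real (a n j m)))"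

lemma
  assumes "n \<ge> 1"
  shows finite_lam: "finite_measure (lam n j)" and sets_lam: "sets (lam n j) = sets circle_borel"
    and lam_coeff: "(\<integral>z. z powi m \<partial>lam n j) = of_real (a n j m)"
  using someI_ex[OF riesz_measure_exists[OF assms, of j]] unfolding lam_def[symmetric] by auto


lemma prob_lam: "n \<ge> 1 \<Longrightarrow> measure (lam n j) (space (lam n j)) = 1"
proof -
  assume n: "n \<ge> 1"
  have "(\<integral>z. 1 \<partial>lam n j) = complex_of_real (measure (lam n j) (space (lam n j)))"
    by (simp add: scaleR_conv_of_real)
  moreover have "(\<integral>z. 1 \<partial>lam n j) = (1::complex)" using lam_coeff[OF n, of j 0] by simp
  ultimately show ?thesis by (metis of_real_eq_1_iff)
qed

lemma prob_space_lam: "n \<ge> 1 \<Longrightarrow> prob_space (lam n j)"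
  using prob_lam finite_lam[of n j] finite_measure.emeasure_eq_measure[of "lam n j"]
  by (intro prob_spaceI) simp

text \<open>Multiplying \<open>lam n (Suc j)\<close> by the factor of stage \<open>j\<close>
  produces the coefficients of stage \<open>j\<close>, by \<open>a_Suc_left\<close>; uniqueness of
  Fourier coefficients gives the equality.\<close>

lemma lam_factor:
  assumes n: "n \<ge> 1" and Y: "Y \<in> sets circle_borel"
  shows "emeasure (lam n j) Y = (\<integral>\<^sup>+z. ennreal (factor n j z) * indicator Y z \<partial>lam n (Suc j))"
proof -
  define \<kappa> where "\<kappa> = density (lam n (Suc j)) (\<lambda>z. ennreal (factor n j z))"
  have f: "factor n j \<in> borel_measurable (lam n (Suc j))"
    by (intro circle_continuous_measurable continuous_intros sets_lam n)
  have fi: "integrable (lam n (Suc j)) (factor n j)"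
    by (intro circle_continuous_integrable continuous_intros sets_lam finite_lam n)
  have "emeasure \<kappa> (space \<kappa>) = (\<integral>\<^sup>+z. ennreal (factor n j z) \<partial>lam n (Suc j))"
    unfolding \<kappa>_def using f by (subst emeasure_density) (auto intro!: nn_integral_cong)
  also have "\<dots> < \<infinity>" using fi factor_nonneg[OF n]
    by (subst nn_integral_eq_integral) auto
  finally have fin: "finite_measure \<kappa>" by (intro finite_measureI) simp
  have sets: "sets \<kappa> = sets circle_borel" using sets_lam[OF n] by (simp add: \<kappa>_def)
  have "(\<integral>z. z powi m \<partial>\<kappa>) = (\<integral>z. z powi m \<partial>lam n j)" for m
  proof -
    have int: "integrable (lam n (Suc j)) (\<lambda>z. z powi l)" for l
      by (intro circle_continuous_integrable continuous_intros sets_lam finite_lam n)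
    have "(\<integral>z. z powi m \<partial>\<kappa>) = (\<integral>z. factor n j z *\<^sub>R (z powi m) \<partial>lam n (Suc j))"
      unfolding \<kappa>_def
    proof (rule integral_density[OF _ f])
      show "(\<lambda>z. z powi m) \<in> borel_measurable (lam n (Suc j))"
        by (intro circle_continuous_measurable continuous_intros sets_lam n)
    qed (use factor_nonneg[OF n] in auto)
    also have "\<dots> = (\<integral>z. z powi m + (\<Sum>p\<in>off_diagonal j. z powi (m + gap j p)) / r j ^ n \<partial>lam n (Suc j))"
    proof (intro Bochner_Integration.integral_cong refl)
      fix z assume "z \<in> space (lam n (Suc j))"
      then have z: "z \<in> sphere 0 1" using space_circle_borel[OF sets_lam[OF n]] by simp
      show "factor n j z *\<^sub>R (z powi m) = z powi m + (\<Sum>p\<in>off_diagonal j. z powi (m + gap j p)) / r j ^ n"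
        unfolding scaleR_conv_of_real factor_eq[OF z] powi_shift[OF z, symmetric]
        by (simp add: distrib_left sum_distrib_left sum_divide_distrib mult_ac)
    qed
    also have "\<dots> = (\<integral>z. z powi m \<partial>lam n (Suc j)) +
        (\<integral>z. (\<Sum>p\<in>off_diagonal j. z powi (m + gap j p)) / r j ^ n \<partial>lam n (Suc j))"
      by (intro Bochner_Integration.integral_add Bochner_Integration.integrable_divide
          Bochner_Integration.integrable_sum int)
    also have "(\<integral>z. (\<Sum>p\<in>off_diagonal j. z powi (m + gap j p)) / r j ^ n \<partial>lam n (Suc j)) =
        (\<Sum>p\<in>off_diagonal j. \<integral>z. z powi (m + gap j p) \<partial>lam n (Suc j)) / r j ^ n"
      using int by (simp add: Bochner_Integration.integral_sum)
    also have "(\<integral>z. z powi m \<partial>lam n (Suc j)) + \<dots> = of_real (a n j m)"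
      unfolding lam_coeff[OF n] a_Suc_left[of n j m] by simp
    finally show ?thesis unfolding lam_coeff[OF n] .
  qed
  then have "measure \<kappa> Y = measure (lam n j) Y"
    by (rule circle_measure_eqI[OF fin sets finite_lam[OF n] sets_lam[OF n] Y])
  moreover have "emeasure \<kappa> Y = ennreal (measure \<kappa> Y)"
    using finite_measure.emeasure_eq_measure[OF fin] .
  moreover have "emeasure (lam n j) Y = ennreal (measure (lam n j) Y)"
    using finite_measure.emeasure_eq_measure[OF finite_lam[OF n]] .
  ultimately have "emeasure (lam n j) Y = emeasure \<kappa> Y" by simp
  also have "\<dots> = (\<integral>\<^sup>+z. ennreal (factor n j z) * indicator Y z \<partial>lam n (Suc j))"
    unfolding \<kappa>_def using f Y sets_lam[OF n] by (intro emeasure_density) auto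
  finally show ?thesis .
qed

text \<open>A factor is a sum of two nonnegative terms, so a zero of it is a root of the polynomial
  with exponents \<open>P k i\<close>, which is nonzero because its constant coefficient is
  1.\<close>

lemma finite_factor_zeros:
  assumes n: "n \<ge> 1"
  shows "finite {z. factor n k z = 0}"
proof -
  define Q where "Q = (\<Sum>i<r k. monom (1::complex) (P k i))"
  have "coeff Q (P k 0) \<noteq> 0"
  proof -
    have "P k i \<noteq> 0" if "i \<noteq> 0" for i
      using that H_pos[of k] power_increasing[of 1 i "8::nat"] by (simp add: P_def del: H_pos)
    then have "P k i = P k 0 \<longleftrightarrow> i = 0" for i by (cases "i = 0") auto
    then have "coeff Q (P k 0) = (\<Sum>i<r k. if i = 0 then 1 else 0)"
      unfolding Q_def coeff_sum coeff_monom by simp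
    then show ?thesis by simp
  qed
  then have "Q \<noteq> 0" by auto
  then have fin: "finite {z. poly Q z = 0}" by (rule poly_roots_finite)
  have "poly Q z = 0" if "factor n k z = 0" for z
  proof -
    have "real (r k) ^ 1 \<le> real (r k) ^ n" using r_pos[of k] n by (intro power_increasing) linarith+
    then have 1: "real (r k) / r k ^ n \<le> 1" by simp
    have 2: "0 \<le> (cmod (\<Sum>i<r k. z ^ P k i))\<^sup>2 / r k ^ n" by simp
    have "(cmod (\<Sum>i<r k. z ^ P k i))\<^sup>2 / r k ^ n = 0"
      using that 1 2 unfolding factor_def by linarith
    then have "(\<Sum>i<r k. z ^ P k i) = 0" using r_pos[of k] by simp
    then show ?thesis by (simp add: Q_def poly_sum poly_monom)
  qed
  then show ?thesis using fin by (elim finite_subset[rotated]) auto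
qed

text \<open>A point mass at \<open>z\<close> is bounded by testing against the normalized sums \<open>\<Sum>i<r k. (w / z) ^ P k i\<close>,
  whose \<open>L\<^sub>2\<close> norms tend to \<open>0\<close>.\<close>

lemma lam_no_atoms:
  assumes n: "n \<ge> 1" and unbounded: "\<And>N. \<exists>k\<ge>j. N \<le> r k" and z: "z \<in> sphere 0 1"
  shows "measure (lam n j) {z} = 0"
proof (rule ccontr)
  assume "measure (lam n j) {z} \<noteq> 0"
  then have pos: "measure (lam n j) {z} > 0" by (simp add: zero_less_measure_iff)
  obtain N :: nat where N: "2 / measure (lam n j) {z} < N" using reals_Archimedean2 by blast
  obtain k where k: "k \<ge> j" "N \<le> r k" using unbounded by blast
  let ?R = "real (r k)"
  have R: "?R > 0" by simp
  interpret prob_space "lam n j" using n by (rule prob_space_lam)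
  have sp: "space (lam n j) = sphere 0 1" by (intro space_circle_borel sets_lam n)
  \<comment> \<open>The summands are rotated so that all of them equal 1 at \<open>w = z\<close>.
    There \<open>F\<close> has the value \<open>(r k)^2\<close>, while its integral is at most
    \<open>2 * r k\<close>.\<close>
  define F where "F w = (cmod (\<Sum>i<r k. (1 / z ^ P k i) * w powi int (P k i)))\<^sup>2" for w
  have F_int: "integrable (lam n j) F"
    unfolding F_def by (intro circle_continuous_integrable continuous_intros sets_lam finite_lam n)
  have z1: "cmod z = 1" "z \<noteq> 0" using z by auto
  have "F z = ?R\<^sup>2" using z1 by (simp add: F_def)
  have zs: "{z} \<in> sets (lam n j)"
  proof -
    have "{z} = {z} \<inter> sphere 0 1" using z by auto
    moreover have "{z} \<inter> sphere 0 1 \<in> sets circle_borel"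
      unfolding circle_borel_def by (subst sets_restrict_space_iff) auto
    ultimately show ?thesis using sets_lam[OF n] by simp
  qed
  have "?R\<^sup>2 * measure (lam n j) {z} = (\<integral>w. ?R\<^sup>2 * indicator {z} w \<partial>lam n j)"
    using zs sp z by simp
  also have "\<dots> \<le> (\<integral>w. F w \<partial>lam n j)"
  proof (rule integral_mono)
    show "integrable (lam n j) (\<lambda>w. ?R\<^sup>2 * indicator {z} w)"
      using zs by (intro integrable_mult_right integrable_real_indicator) (auto simp: less_top[symmetric])
    show "?R\<^sup>2 * indicator {z} w \<le> F w" for w
      using \<open>F z = ?R\<^sup>2\<close> by (cases "w = z") (auto simp: F_def)
  qed (rule F_int)
  also have "\<dots> \<le> 2 * ?R"
  proof -
    let ?c = "\<lambda>p. (1 / z ^ P k (fst p)) * cnj (1 / z ^ P k (snd p))"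
    have "complex_of_real (\<integral>w. F w \<partial>lam n j) = (\<integral>w. of_real (F w) \<partial>lam n j)"
      by (rule integral_complex_of_real[symmetric])
    also have "\<dots> = (\<integral>w. (\<Sum>p\<in>{..<r k} \<times> {..<r k}. ?c p * w powi gap k p) \<partial>lam n j)"
    proof (intro Bochner_Integration.integral_cong refl)
      fix w assume "w \<in> space (lam n j)"
      then have w: "w \<in> sphere 0 1" using sp by simp
      show "of_real (F w) = (\<Sum>p\<in>{..<r k} \<times> {..<r k}. ?c p * w powi gap k p)"
        unfolding F_def complex_norm_square cnj_sum sum_product sum.cartesian_product
        by (intro sum.cong refl) (auto simp: gap_def circle_powi_cnj[OF w, symmetric] mult_ac)
    qed
    also have "\<dots> = (\<Sum>p\<in>{..<r k} \<times> {..<r k}. \<integral>w. ?c p * w powi gap k p \<partial>lam n j)"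
      by (intro Bochner_Integration.integral_sum circle_continuous_integrable continuous_intros sets_lam finite_lam n)
    also have "\<dots> = (\<Sum>p\<in>{..<r k} \<times> {..<r k}. ?c p * of_real (a n j (gap k p)))"
      by (simp add: lam_coeff[OF n])
    finally have eq: "complex_of_real (\<integral>w. F w \<partial>lam n j) = \<dots>" .
    have "\<bar>\<integral>w. F w \<partial>lam n j\<bar> = cmod (\<Sum>p\<in>{..<r k} \<times> {..<r k}. ?c p * of_real (a n j (gap k p)))"
      unfolding eq[symmetric] by simp
    also have "\<dots> \<le> (\<Sum>p\<in>{..<r k} \<times> {..<r k}. of_bool (fst p = snd p) + 1 / ?R)"
    proof (rule sum_norm_le)
      fix p assume p: "p \<in> {..<r k} \<times> {..<r k}"
      have "cmod (?c p * of_real (a n j (gap k p))) = a n j (gap k p)"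
        using z1 a_nonneg[of n j "gap k p"] by (simp add: norm_mult norm_divide norm_power)
      also have "\<dots> \<le> of_bool (fst p = snd p) + 1 / ?R"
      proof (cases "fst p = snd p")
        case True
        then have "gap k p = 0" by (cases p) simp
        then show ?thesis using True by simp
      next
        case False
        then have "p \<in> off_diagonal k" using p by (auto simp: off_diagonal_def)
        then have "a n j (gap k p) = 1 / ?R ^ n" using a_gap k by simp
        also have "\<dots> \<le> 1 / ?R ^ 1"
          using r_pos[of k] n by (intro divide_left_mono power_increasing) (auto simp: Suc_le_eq[symmetric])
        finally show ?thesis using False by simp
      qed
      finally show "cmod (?c p * of_real (a n j (gap k p))) \<le> of_bool (fst p = snd p) + 1 / ?R" .
    qed
    also have "\<dots> = ?R + ?R"
    proof -
      have "{..<r k} \<times> {..<r k} \<inter> {p. fst p = snd p} = (\<lambda>i. (i, i)) ` {..<r k}" by auto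
      moreover have "card ((\<lambda>i. (i, i)) ` {..<r k}) = r k" by (subst card_image) (auto intro: inj_onI)
      ultimately show ?thesis unfolding sum.distrib using R by (simp add: power2_eq_square)
    qed
    finally show ?thesis by simp
  qed
  finally have "?R * measure (lam n j) {z} \<le> 2" using R by (simp add: power2_eq_square)
  moreover have "2 < real N * measure (lam n j) {z}" using N pos by (simp add: field_simps)
  moreover have "real N * measure (lam n j) {z} \<le> ?R * measure (lam n j) {z}"
    using k by (intro mult_right_mono) auto
  ultimately show False by linarith
qed

text \<open>The density of \<open>lam n j\<close> with respect to \<open>lam n (Suc j)\<close>
  vanishes only at finitely many points, and these carry no mass.\<close>

lemma lam_null_Suc:
  assumes n: "n \<ge> 1" and unbounded: "\<And>N. \<exists>k\<ge>Suc j. N \<le> r k"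
    and Y: "Y \<in> sets circle_borel" "measure (lam n j) Y = 0"
  shows "measure (lam n (Suc j)) Y = 0"
proof -
  have Y': "Y \<in> sets (lam n (Suc j))" using Y sets_lam[OF n] by simp
  have sp: "space (lam n (Suc j)) = sphere 0 1" by (intro space_circle_borel sets_lam n)
  have f: "factor n j \<in> borel_measurable (lam n (Suc j))"
    by (intro circle_continuous_measurable continuous_intros sets_lam n)
  have "(\<integral>\<^sup>+z. ennreal (factor n j z) * indicator Y z \<partial>lam n (Suc j)) = 0"
    using lam_factor[OF n Y(1), of j] Y(2) finite_measure.emeasure_eq_measure[OF finite_lam[OF n], of j Y] by simp
  then have "AE z in lam n (Suc j). ennreal (factor n j z) * indicator Y z = 0"
    using f Y' by (subst (asm) nn_integral_0_iff_AE) auto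
  moreover have "AE z in lam n (Suc j). factor n j z \<noteq> 0"
  proof -
    let ?Z = "{z \<in> sphere 0 1. factor n j z = 0}"
    have fin: "finite ?Z" by (rule finite_subset[OF _ finite_factor_zeros[OF n, of j]]) auto
    have null: "{z} \<in> null_sets (lam n (Suc j))" if "z \<in> sphere 0 1" for z
    proof (rule null_setsI)
      show "emeasure (lam n (Suc j)) {z} = 0"
        using lam_no_atoms[OF n unbounded that] finite_measure.emeasure_eq_measure[OF finite_lam[OF n]] by simp
      have "{z} = {z} \<inter> sphere 0 1" using that by auto
      moreover have "{z} \<inter> sphere 0 1 \<in> sets circle_borel"
        unfolding circle_borel_def by (subst sets_restrict_space_iff) auto
      ultimately show "{z} \<in> sets (lam n (Suc j))" using sets_lam[OF n] by simp
    qed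
    have "(\<Union>z\<in>?Z. {z}) \<in> null_sets (lam n (Suc j))"
      using fin null by (intro null_sets_UN') (auto simp: countable_finite)
    then have "?Z \<in> null_sets (lam n (Suc j))" by simp
    then have "AE z in lam n (Suc j). z \<notin> ?Z" by (rule AE_not_in)
    moreover have "AE z in lam n (Suc j). z \<in> sphere 0 1" using AE_space[of "lam n (Suc j)"] unfolding sp .
    ultimately show ?thesis by eventually_elim auto
  qed
  ultimately have "AE z in lam n (Suc j). z \<notin> Y"
  proof eventually_elim
    case (elim z)
    then show ?case using factor_nonneg[OF n, of j z]
      by (auto simp: indicator_def ennreal_eq_0_iff split: if_splits)
  qed
  then have "emeasure (lam n (Suc j)) {z \<in> space (lam n (Suc j)). z \<in> Y} = 0" by (rule emeasure_eq_0_AE)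
  moreover have "{z \<in> space (lam n (Suc j)). z \<in> Y} = Y" using sets.sets_into_space[OF Y'] by auto
  ultimately have "emeasure (lam n (Suc j)) Y = 0" by simp
  then show ?thesis by (simp add: measure_def)
qed

text \<open>Transfers null sets from stage 0 to every stage, so that one measure can dominate the
  spectral measures of all cells.\<close>

lemma lam_null:
  assumes "n \<ge> 1" "\<And>j N. \<exists>k\<ge>j. N \<le> r k" "Y \<in> sets circle_borel" "measure (lam n 0) Y = 0"
  shows "measure (lam n j) Y = 0"
  by (induction j) (use assms lam_null_Suc in auto)

end

section \<open>Comparison of the Riesz measures with Lebesgue measure\<close>

lemma parseval_circle:
  assumes I: "finite I" and q: "\<And>z. z \<in> sphere 0 1 \<Longrightarrow> q z = (\<Sum>k\<in>I. c k * z powi k)"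
  shows "(\<integral>z. (cmod (q z))\<^sup>2 \<partial>circle_lebesgue) = 2 * pi * (\<Sum>k\<in>I. (cmod (c k))\<^sup>2)"
proof -
  have "complex_of_real (\<integral>z. (cmod (q z))\<^sup>2 \<partial>circle_lebesgue) = (\<integral>z. q z * cnj (q z) \<partial>circle_lebesgue)"
    unfolding integral_complex_of_real[symmetric] complex_norm_square ..
  also have "\<dots> = (\<integral>z. (\<Sum>k\<in>I. \<Sum>l\<in>I. (c k * cnj (c l)) * z powi (k - l)) \<partial>circle_lebesgue)"
  proof (intro Bochner_Integration.integral_cong refl)
    fix z assume "z \<in> space circle_lebesgue"
    then have z: "z \<in> sphere 0 1" using space_circle_borel[OF sets_circle_lebesgue] by simp
    show "q z * cnj (q z) = (\<Sum>k\<in>I. \<Sum>l\<in>I. (c k * cnj (c l)) * z powi (k - l))"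
      unfolding q[OF z] cnj_sum sum_product circle_powi_cnj[OF z, symmetric] by (simp add: mult_ac)
  qed
  also have "\<dots> = (\<Sum>k\<in>I. \<integral>z. (\<Sum>l\<in>I. (c k * cnj (c l)) * z powi (k - l)) \<partial>circle_lebesgue)"
    by (intro Bochner_Integration.integral_sum circle_continuous_integrable continuous_intros
        finite_circle_lebesgue sets_circle_lebesgue)
  also have "\<dots> = (\<Sum>k\<in>I. \<Sum>l\<in>I. \<integral>z. (c k * cnj (c l)) * z powi (k - l) \<partial>circle_lebesgue)"
    by (intro sum.cong refl Bochner_Integration.integral_sum circle_continuous_integrable continuous_intros
        finite_circle_lebesgue sets_circle_lebesgue)
  also have "\<dots> = (\<Sum>k\<in>I. \<Sum>l\<in>I. if k = l then (c k * cnj (c k)) * of_real (2 * pi) else 0)"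
    unfolding integral_mult_right_zero integral_circle_lebesgue_powi by (intro sum.cong refl) auto
  also have "\<dots> = of_real (2 * pi * (\<Sum>k\<in>I. (cmod (c k))\<^sup>2))"
    using I by (simp add: complex_norm_square[symmetric] sum_distrib_left mult.commute)
  finally show ?thesis by (simp only: of_real_eq_iff)
qed

lemma integral_trig_poly_lebesgue:
  assumes I: "finite I" and q: "\<And>z. z \<in> sphere 0 1 \<Longrightarrow> q z = (\<Sum>k\<in>I. c k * z powi k)"
  shows "(\<integral>z. q z \<partial>circle_lebesgue) = of_real (2 * pi) * (\<Sum>k\<in>I. if k = 0 then c k else 0)"
proof -
  have "(\<integral>z. q z \<partial>circle_lebesgue) = (\<Sum>k\<in>I. c k * (\<integral>z. z powi k \<partial>circle_lebesgue))"
    using finite_circle_lebesgue sets_circle_lebesgue q I by (rule trig_poly_integral_eq)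
  then show ?thesis
    unfolding integral_circle_lebesgue_powi sum_distrib_left by (simp add: if_distrib mult.commute cong: if_cong)
qed

context lacunary
begin

text \<open>Bounds the sum of the squared nonconstant coefficients of one factor: fewer than
  \<open>r ^ 2\<close> gaps, each with coefficient \<open>1 / r ^ n\<close>.\<close>

definition energy :: "nat \<Rightarrow> nat \<Rightarrow> real" where
  "energy n k = real (r k) ^ 2 / real (r k) ^ (2 * n)"

lemma energy_pos: "0 < energy n k"
  by (simp add: energy_def)

text \<open>Squares of the coefficients for \<open>n\<close> are coefficients for
  \<open>2 * n\<close>, whose sum is controlled by \<open>sum_A_le\<close>. The frequency 0
  contributes exactly the 1 that is subtracted.\<close>

lemma sum_a_square_le:
  assumes n: "n \<ge> 1" and summ: "summable (energy n)" and I: "finite I"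
  shows "(\<Sum>m\<in>I - {0}. (a n j m)\<^sup>2) \<le> exp (\<Sum>k. energy n (k + j)) - 1"
proof -
  have "eventually (\<lambda>t. \<forall>m\<in>insert 0 I. A (2 * n) j t m = a (2 * n) j m) sequentially"
    using I by (intro eventually_ball_finite ballI eventually_A_eq_a) auto
  then obtain t where t: "\<forall>m\<in>insert 0 I. A (2 * n) j t m = a (2 * n) j m"
    by (auto simp: eventually_sequentially)
  have "(\<Sum>m\<in>I - {0}. (a n j m)\<^sup>2) = (\<Sum>m\<in>I - {0}. a (2 * n) j m)"
    using n a_power[of n j] a_power[of "2 * n" j] by (simp add: power_mult[symmetric] mult.commute)
  also have "\<dots> = (\<Sum>m\<in>insert 0 I. a (2 * n) j m) - 1"
    using I by (simp add: sum.insert_remove)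
  also have "(\<Sum>m\<in>insert 0 I. a (2 * n) j m) = (\<Sum>m\<in>insert 0 I. A (2 * n) j t m)"
    using t by (intro sum.cong) auto
  also have "\<dots> \<le> (\<Prod>k<t. 1 + energy n (j + k))"
    using sum_A_le[of "insert 0 I" "2 * n" j t] I unfolding energy_def by simp
  also have "\<dots> \<le> (\<Prod>k<t. exp (energy n (j + k)))"
    using energy_pos[of n] by (intro prod_mono) (auto simp: exp_ge_add_one_self add_nonneg_nonneg less_imp_le)
  also have "\<dots> = exp (\<Sum>k<t. energy n (k + j))" by (simp add: exp_sum add.commute)
  also have "\<dots> \<le> exp (\<Sum>k. energy n (k + j))"
  proof -
    have "summable (\<lambda>k. energy n (k + j))" using summ by (simp add: summable_iff_shift)
    then show ?thesis using energy_pos[of n] by (intro exp_le_cancel_iff[THEN iffD2] sum_le_suminf) (auto simp: less_imp_le)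
  qed
  finally show ?thesis by simp
qed

text \<open>The two integrals differ only in the nonzero frequencies. Cauchy-Schwarz pairs the
  coefficients of \<open>q\<close>, summed by Parseval, with those of the Riesz measure, summed by
  the energy.\<close>

lemma lam_lebesgue_trig_poly:
  assumes n: "n \<ge> 1" and summ: "summable (energy n)" and q: "trig_poly q"
  shows "cmod ((\<integral>z. q z \<partial>lam n j) - (\<integral>z. q z \<partial>circle_lebesgue) / of_real (2 * pi)) \<le>
    sqrt ((\<integral>z. (cmod (q z))\<^sup>2 \<partial>circle_lebesgue) / (2 * pi)) * sqrt (exp (\<Sum>k. energy n (k + j)) - 1)"
proof -
  obtain I c where I: "finite I" "\<And>z. z \<in> sphere 0 1 \<Longrightarrow> q z = (\<Sum>k\<in>I. c k * z powi k)"
    using q unfolding trig_poly_def by metis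
  have 1: "(\<integral>z. q z \<partial>lam n j) = (\<Sum>k\<in>I. c k * of_real (a n j k))"
    using trig_poly_integral_eq[OF finite_lam[OF n] sets_lam[OF n] I(2,1)] lam_coeff[OF n] by simp
  have 2: "(\<integral>z. q z \<partial>circle_lebesgue) / of_real (2 * pi) = (\<Sum>k\<in>I. if k = 0 then c k else 0)"
  proof -
    have "(\<integral>z. q z \<partial>circle_lebesgue) = of_real (2 * pi) * (\<Sum>k\<in>I. if k = 0 then c k else 0)"
      using I by (rule integral_trig_poly_lebesgue)
    then show ?thesis by simp
  qed
  have "(\<integral>z. q z \<partial>lam n j) - (\<integral>z. q z \<partial>circle_lebesgue) / of_real (2 * pi) =
      (\<Sum>k\<in>I. if k = 0 then 0 else c k * of_real (a n j k))"
    unfolding 1 2 sum_subtractf[symmetric] by (intro sum.cong) auto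
  also have "\<dots> = (\<Sum>k\<in>I - {0}. c k * of_real (a n j k))"
    using I(1) by (intro sum.mono_neutral_cong_right) auto
  also have "cmod \<dots> \<le> (\<Sum>k\<in>I - {0}. cmod (c k) * a n j k)"
    using a_nonneg[of n j] by (intro sum_norm_le) (simp add: norm_mult)
  also have "\<dots> \<le> sqrt (\<Sum>k\<in>I - {0}. (cmod (c k))\<^sup>2) * sqrt (\<Sum>k\<in>I - {0}. (a n j k)\<^sup>2)"
    unfolding real_sqrt_mult[symmetric]
    by (intro real_le_rsqrt Cauchy_Schwarz_ineq_sum)
  also have "\<dots> \<le> sqrt (\<Sum>k\<in>I. (cmod (c k))\<^sup>2) * sqrt (exp (\<Sum>k. energy n (k + j)) - 1)"
    using I(1) by (intro mult_mono real_sqrt_le_mono sum_a_square_le n summ sum_mono2) (auto intro: sum_nonneg)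
  also have "(\<Sum>k\<in>I. (cmod (c k))\<^sup>2) = (\<integral>z. (cmod (q z))\<^sup>2 \<partial>circle_lebesgue) / (2 * pi)"
  proof -
    have "(\<integral>z. (cmod (q z))\<^sup>2 \<partial>circle_lebesgue) = 2 * pi * (\<Sum>k\<in>I. (cmod (c k))\<^sup>2)"
      using I by (rule parseval_circle)
    then show ?thesis by simp
  qed
  finally show ?thesis .
qed

text \<open>The polynomial estimate carried over to indicators. Only the energy from stage
  \<open>j\<close> on enters, so the error factor becomes small for late stages.\<close>

lemma lam_lebesgue_estimate:
  assumes n: "n \<ge> 1" and summ: "summable (energy n)" and Y: "Y \<in> sets circle_borel"
  shows "\<bar>measure (lam n j) Y - measure circle_lebesgue Y / (2 * pi)\<bar> \<le>
    sqrt (measure circle_lebesgue Y / pi) * sqrt (exp (\<Sum>k. energy n (k + j)) - 1)"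
proof -
  let ?L = circle_lebesgue
  let ?m = "measure ?L Y"
  let ?E = "sqrt (exp (\<Sum>k. energy n (k + j)) - 1)"
  let ?x = "\<bar>measure (lam n j) Y - ?m / (2 * pi)\<bar>"
  define C where "C = 1 + sqrt (measure ?L (space ?L)) / (2 * pi)"
  have "0 \<le> (\<Sum>k. energy n (k + j))"
    using energy_pos[of n] summ by (intro suminf_nonneg) (auto simp: less_imp_le summable_iff_shift)
  then have E: "?E \<ge> 0" by simp
  have bound: "?x \<le> C * sqrt d + sqrt ((?m + d) / pi) * ?E" if d: "d > 0" for d
  proof -
    obtain q where q: "trig_poly q" "(\<integral>z. (cmod (indicator Y z - q z))\<^sup>2 \<partial>lam n j) < d"
        "(\<integral>z. (cmod (indicator Y z - q z))\<^sup>2 \<partial>?L) < d"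
      using trig_poly_L2_approx[OF finite_lam[OF n] sets_lam[OF n] finite_circle_lebesgue sets_circle_lebesgue Y d] .
    have "cmod (of_real (measure (lam n j) Y) - (\<integral>z. q z \<partial>lam n j)) \<le>
        sqrt (\<integral>z. (cmod (indicator Y z - q z))\<^sup>2 \<partial>lam n j)"
      using trig_poly_integral_approx[OF finite_lam[OF n] sets_lam[OF n] Y q(1), of j]
      unfolding prob_lam[OF n] by simp
    also have "\<dots> \<le> sqrt d" using q(2) by simp
    finally have 1: "cmod (of_real (measure (lam n j) Y) - (\<integral>z. q z \<partial>lam n j)) \<le> sqrt d" .
    have "cmod (of_real ?m - (\<integral>z. q z \<partial>?L)) \<le> sqrt d * sqrt (measure ?L (space ?L))"
      using q(3) by (intro order.trans[OF trig_poly_integral_approx[OF finite_circle_lebesgue sets_circle_lebesgue Y q(1)]]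
          mult_right_mono) auto
    then have "cmod (of_real ?m - (\<integral>z. q z \<partial>?L)) / (2 * pi) \<le> sqrt d * sqrt (measure ?L (space ?L)) / (2 * pi)"
      by (intro divide_right_mono) auto
    moreover have "cmod (of_real ?m - (\<integral>z. q z \<partial>?L)) / (2 * pi) =
        cmod ((\<integral>z. q z \<partial>?L) / of_real (2 * pi) - of_real (?m / (2 * pi)))"
    proof -
      have "(\<integral>z. q z \<partial>?L) / of_real (2 * pi) - of_real (?m / (2 * pi)) =
          ((\<integral>z. q z \<partial>?L) - of_real ?m) / of_real (2 * pi)"
        by (simp add: diff_divide_distrib)
      then show ?thesis by (simp add: norm_divide norm_minus_commute norm_mult)
    qed
    ultimately have 2: "cmod ((\<integral>z. q z \<partial>?L) / of_real (2 * pi) - of_real (?m / (2 * pi))) \<le>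
        sqrt d * sqrt (measure ?L (space ?L)) / (2 * pi)" by simp
    have "(\<integral>z. (cmod (q z))\<^sup>2 \<partial>?L) \<le> 2 * ?m + 2 * d"
    proof -
      have Y': "Y \<in> sets ?L" using Y by simp
      have iY: "indicator Y \<in> L2 ?L" using finite_measure_L2_indicator[OF finite_circle_lebesgue Y'] .
      have qL: "q \<in> L2 ?L"
        by (intro circle_L2_continuous trig_poly_continuous q finite_circle_lebesgue sets_circle_lebesgue)
      have "(\<integral>z. (cmod (indicator Y z + (q z - indicator Y z)))\<^sup>2 \<partial>?L) \<le>
        2 * (\<integral>z. (cmod (indicator Y z))\<^sup>2 \<partial>?L) + 2 * (\<integral>z. (cmod (q z - indicator Y z))\<^sup>2 \<partial>?L)"
        by (intro L2_add_integral_le L2_diff iY qL)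
      then show ?thesis
        using q(3) unfolding L2_indicator_integral[OF Y'] by (simp add: norm_minus_commute)
    qed
    then have "(\<integral>z. (cmod (q z))\<^sup>2 \<partial>?L) / (2 * pi) \<le> (2 * ?m + 2 * d) / (2 * pi)"
      by (intro divide_right_mono) auto
    also have "\<dots> = (?m + d) / pi" by (simp add: field_simps)
    finally have "sqrt ((\<integral>z. (cmod (q z))\<^sup>2 \<partial>?L) / (2 * pi)) * ?E \<le> sqrt ((?m + d) / pi) * ?E"
      using E by (intro mult_right_mono real_sqrt_le_mono)
    then have 3: "cmod ((\<integral>z. q z \<partial>lam n j) - (\<integral>z. q z \<partial>?L) / of_real (2 * pi)) \<le> sqrt ((?m + d) / pi) * ?E"
      using lam_lebesgue_trig_poly[OF n summ q(1), of j] by linarith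
    have "?x = cmod (of_real (measure (lam n j) Y - ?m / (2 * pi)))" by (simp only: norm_of_real)
    also have "of_real (measure (lam n j) Y - ?m / (2 * pi)) =
        (of_real (measure (lam n j) Y) - (\<integral>z. q z \<partial>lam n j)) +
        (((\<integral>z. q z \<partial>lam n j) - (\<integral>z. q z \<partial>?L) / of_real (2 * pi)) +
        ((\<integral>z. q z \<partial>?L) / of_real (2 * pi) - of_real (?m / (2 * pi))))" by simp
    also have "cmod \<dots> \<le> sqrt d + (sqrt ((?m + d) / pi) * ?E + sqrt d * sqrt (measure ?L (space ?L)) / (2 * pi))"
      by (intro norm_triangle_mono 1 2 3)
    also have "\<dots> = C * sqrt d + sqrt ((?m + d) / pi) * ?E" by (simp add: C_def algebra_simps)
    finally show ?thesis .
  qed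
  have lim: "((\<lambda>d. C * sqrt d + sqrt ((?m + d) / pi) * ?E) \<longlongrightarrow> C * sqrt 0 + sqrt ((?m + 0) / pi) * ?E) (at_right 0)"
    by (intro tendsto_intros) auto
  have "?x \<le> C * sqrt 0 + sqrt ((?m + 0) / pi) * ?E"
    by (rule tendsto_lowerbound[OF lim]) (auto intro!: bound eventually_at_rightI[of 0 1])
  then show ?thesis by simp
qed

text \<open>One direction is the estimate for a set of Lebesgue measure 0. Conversely, a null set of
  \<open>lam n 0\<close> is null for every \<open>lam n j\<close>; its normalized Lebesgue measure
  \<open>x\<close> then satisfies \<open>x \<le> sqrt (2 * x) * sqrt (exp s - 1)\<close>, where the
  tail energy \<open>s\<close> can be made arbitrarily small.\<close>

theorem lam_equivalent_lebesgue:
  assumes n: "n \<ge> 1" and summ: "summable (energy n)" and unbounded: "\<And>j N. \<exists>k\<ge>j. N \<le> r k"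
  shows "absolutely_continuous (lam n 0) circle_lebesgue" "absolutely_continuous circle_lebesgue (lam n 0)"
proof -
  have null_iff: "Y \<in> null_sets \<kappa> \<longleftrightarrow> Y \<in> sets circle_borel \<and> measure \<kappa> Y = 0"
    if "finite_measure \<kappa>" "sets \<kappa> = sets circle_borel" for \<kappa> Y
    using that finite_measure.emeasure_eq_measure[OF that(1), of Y] by (auto simp: null_sets_def)
  note null_lam = null_iff[OF finite_lam[OF n, of 0] sets_lam[OF n, of 0]]
  note null_leb = null_iff[OF finite_circle_lebesgue sets_circle_lebesgue]
  show "absolutely_continuous circle_lebesgue (lam n 0)"
    unfolding absolutely_continuous_def null_lam null_leb
  proof safe
    fix Y assume Y: "Y \<in> null_sets circle_lebesgue"
    then have "Y \<in> sets circle_borel" "measure circle_lebesgue Y = 0" using null_leb by auto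
    then show "Y \<in> null_sets (lam n 0)"
      using lam_lebesgue_estimate[OF n summ, of Y 0] null_lam by (simp add: measure_le_0_iff)
  qed
  show "absolutely_continuous (lam n 0) circle_lebesgue"
    unfolding absolutely_continuous_def
  proof safe
    fix Y assume "Y \<in> null_sets (lam n 0)"
    then have Y: "Y \<in> sets circle_borel" "measure (lam n 0) Y = 0" using null_lam by auto
    define x where "x = measure circle_lebesgue Y / (2 * pi)"
    have "x \<le> 0"
    proof (rule field_le_epsilon)
      fix e :: real assume e: "e > 0"
      have "((\<lambda>x. 2 * (exp x - 1)) \<longlongrightarrow> 2 * (exp 0 - 1)) (at (0::real))" by (intro tendsto_intros)
      then have "eventually (\<lambda>x. 2 * (exp x - 1) < e) (at (0::real))"
        using e by (intro order_tendstoD(2)[of _ "2 * (exp 0 - 1)"]) auto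
      then obtain d where d: "d > 0" "\<And>x. x \<noteq> 0 \<Longrightarrow> \<bar>x\<bar> < d \<Longrightarrow> 2 * (exp x - 1) < e"
        unfolding eventually_at by (auto simp: dist_real_def)
      obtain j where j: "norm (\<Sum>k. energy n (k + j)) < d"
        using suminf_exist_split[OF d(1) summ] by blast
      let ?s = "\<Sum>k. energy n (k + j)"
      have exps: "2 * (exp ?s - 1) \<le> e" using d(2)[of ?s] j e by (cases "?s = 0") auto
      have s0: "0 \<le> ?s"
        using energy_pos[of n] summ by (intro suminf_nonneg) (auto simp: less_imp_le summable_iff_shift)
      have "measure (lam n j) Y = 0" using lam_null[OF n unbounded Y] .
      then have "x \<le> sqrt (2 * x) * sqrt (exp ?s - 1)"
        using lam_lebesgue_estimate[OF n summ Y(1), of j] by (simp add: x_def)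
      moreover have x0: "0 \<le> x" by (simp add: x_def)
      ultimately have "x\<^sup>2 \<le> (sqrt (2 * x) * sqrt (exp ?s - 1))\<^sup>2" by (intro power_mono)
      also have "\<dots> = x * (2 * (exp ?s - 1))" using x0 s0 by (simp add: power_mult_distrib)
      also have "\<dots> \<le> x * e" using x0 exps by (intro mult_left_mono)
      finally have "x * x \<le> x * e" by (simp add: power2_eq_square)
      then show "x \<le> 0 + e" using x0 e by (cases "x = 0") auto
    qed
    then have "x * (2 * pi) \<le> 0" by (intro mult_nonpos_nonneg) auto
    then have "measure circle_lebesgue Y \<le> 0" by (simp add: x_def)
    then have "measure circle_lebesgue Y = 0" using measure_nonneg[of circle_lebesgue Y] by linarith
    then show "Y \<in> null_sets circle_lebesgue" using null_leb Y(1) by blast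
  qed
qed

subsection \<open>The singular case\<close>

text \<open>One computation for both Lebesgue measure and \<open>lam n 0\<close>, which enter only
  through their coefficients \<open>c\<close>.\<close>

lemma factor_moments:
  assumes \<kappa>: "finite_measure \<kappa>" "sets \<kappa> = sets circle_borel"
    and c: "\<And>m. (\<integral>z. z powi m \<partial>\<kappa>) = complex_of_real (c m)"
  shows "(\<integral>z. factor n k z - 1 \<partial>\<kappa>) = (\<Sum>p\<in>off_diagonal k. c (gap k p)) / r k ^ n"
    and "(\<integral>z. (factor n k z - 1) * (factor n l z - 1) \<partial>\<kappa>) =
      (\<Sum>p\<in>off_diagonal k. \<Sum>p'\<in>off_diagonal l. c (gap k p + gap l p')) / (r k ^ n * r l ^ n)"
proof -
  have f: "complex_of_real (factor n k z - 1) = (\<Sum>p\<in>off_diagonal k. z powi gap k p) / r k ^ n"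
    if "z \<in> space \<kappa>" for z k
  proof -
    have z: "z \<in> sphere 0 1" using that space_circle_borel[OF \<kappa>(2)] by simp
    show ?thesis using factor_eq[OF z, of n k] by simp
  qed
  have int: "integrable \<kappa> (\<lambda>z. z powi m)" for m
    by (intro circle_continuous_integrable continuous_intros \<kappa>)
  have "complex_of_real (\<integral>z. factor n k z - 1 \<partial>\<kappa>) = (\<integral>z. of_real (factor n k z - 1) \<partial>\<kappa>)"
    by (rule integral_complex_of_real[symmetric])
  also have "\<dots> = (\<integral>z. (\<Sum>p\<in>off_diagonal k. z powi gap k p) / r k ^ n \<partial>\<kappa>)"
    by (intro Bochner_Integration.integral_cong refl f)
  also have "\<dots> = of_real ((\<Sum>p\<in>off_diagonal k. c (gap k p)) / r k ^ n)"
    using int by (simp add: Bochner_Integration.integral_sum c)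
  finally show "(\<integral>z. factor n k z - 1 \<partial>\<kappa>) = (\<Sum>p\<in>off_diagonal k. c (gap k p)) / r k ^ n"
    by (simp only: of_real_eq_iff)
  have "complex_of_real (\<integral>z. (factor n k z - 1) * (factor n l z - 1) \<partial>\<kappa>) =
      (\<integral>z. of_real ((factor n k z - 1) * (factor n l z - 1)) \<partial>\<kappa>)"
    by (rule integral_complex_of_real[symmetric])
  also have "\<dots> = (\<integral>z. (\<Sum>p\<in>off_diagonal k. \<Sum>p'\<in>off_diagonal l. z powi (gap k p + gap l p')) / (r k ^ n * r l ^ n) \<partial>\<kappa>)"
  proof (intro Bochner_Integration.integral_cong refl)
    fix z assume z: "z \<in> space \<kappa>"
    then have z': "z \<in> sphere 0 1" using space_circle_borel[OF \<kappa>(2)] by simp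
    show "complex_of_real ((factor n k z - 1) * (factor n l z - 1)) =
        (\<Sum>p\<in>off_diagonal k. \<Sum>p'\<in>off_diagonal l. z powi (gap k p + gap l p')) / (r k ^ n * r l ^ n)"
      unfolding of_real_mult f[OF z] times_divide_times_eq sum_product powi_shift[OF z'] by simp
  qed
  also have "\<dots> = of_real ((\<Sum>p\<in>off_diagonal k. \<Sum>p'\<in>off_diagonal l. c (gap k p + gap l p')) / (r k ^ n * r l ^ n))"
    using int by (simp add: Bochner_Integration.integral_sum c)
  finally show "(\<integral>z. (factor n k z - 1) * (factor n l z - 1) \<partial>\<kappa>) =
      (\<Sum>p\<in>off_diagonal k. \<Sum>p'\<in>off_diagonal l. c (gap k p + gap l p')) / (r k ^ n * r l ^ n)"
    by (simp only: of_real_eq_iff)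
qed

lemma real_card_off_diagonal: "real (card (off_diagonal k)) = real (r k) ^ 2 - r k"
proof -
  have "r k \<le> r k * r k" by (rule le_square)
  then show ?thesis unfolding card_off_diagonal by (simp add: of_nat_diff power2_eq_square)
qed

text \<open>Centred factors of different stages are orthogonal for Lebesgue measure: a gap of the
  later stage \<open>l\<close> is at least \<open>4 * H l\<close> in size, an earlier one at most a
  sixteenth of \<open>H l\<close>, so they cannot cancel.\<close>

lemma lebesgue_factor_second_moment:
  "(\<integral>z. (factor n k z - 1) * (factor n l z - 1) \<partial>circle_lebesgue) \<le> (if k = l then 2 * pi * energy n k else 0)"
proof -
  have c: "(\<integral>z. z powi m \<partial>circle_lebesgue) = complex_of_real (2 * pi * of_bool (m = 0))" for m
    by (simp add: integral_circle_lebesgue_powi)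
  note eq = factor_moments(2)[OF finite_circle_lebesgue sets_circle_lebesgue c, of n k l]
  have nz: "gap k p + gap l p' \<noteq> 0" if "k < l" "p \<in> off_diagonal k" "p' \<in> off_diagonal l" for k l p p'
  proof
    assume 0: "gap k p + gap l p' = 0"
    have "16 * \<bar>gap k p\<bar> \<le> int (H l)" using gap_bound[OF that(2)] H_mono[of "Suc k" l] that(1) by linarith
    then have "\<bar>gap l p'\<bar> < 4 * int (H l)" using 0 int_H_pos[of l] by (simp add: eq_neg_iff_add_eq_0[symmetric] del: of_nat_0_less_iff)
    then have "gap l p' = 0" by (rule dvd_small_zero[OF gap_dvd])
    then show False using gap_nonzero that(3) by blast
  qed
  show ?thesis
  proof (cases "k = l")
    case True
    have "(\<Sum>p\<in>off_diagonal k. \<Sum>p'\<in>off_diagonal k. 2 * pi * of_bool (gap k p + gap k p' = 0)) =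
        2 * pi * real (card (off_diagonal k))"
    proof -
      have "(\<Sum>p\<in>off_diagonal k. \<Sum>p'\<in>off_diagonal k. of_bool (gap k p + gap k p' = 0)) =
          (\<Sum>p\<in>off_diagonal k. 1::real)"
        by (intro sum.cong refl sum_gap_cancel)
      also have "\<dots> = real (card (off_diagonal k))" by simp
      finally show ?thesis unfolding sum_distrib_left[symmetric] by (rule arg_cong)
    qed
    also have "\<dots> \<le> 2 * pi * real (r k) ^ 2" unfolding real_card_off_diagonal by simp
    finally have "(\<Sum>p\<in>off_diagonal k. \<Sum>p'\<in>off_diagonal k. 2 * pi * of_bool (gap k p + gap k p' = 0)) /
        (real (r k) ^ n * real (r k) ^ n) \<le> 2 * pi * real (r k) ^ 2 / (real (r k) ^ n * real (r k) ^ n)"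
      by (rule divide_right_mono) simp
    moreover have "real (r k) ^ n * real (r k) ^ n = real (r k) ^ (2 * n)"
      by (simp only: power_add[symmetric] mult_2)
    ultimately show ?thesis
      unfolding eq using True by (simp add: energy_def)
  next
    case False
    have "(\<Sum>p\<in>off_diagonal k. \<Sum>p'\<in>off_diagonal l. 2 * pi * of_bool (gap k p + gap l p' = 0)) = 0"
    proof (intro sum.neutral ballI)
      fix p p' assume "p \<in> off_diagonal k" "p' \<in> off_diagonal l"
      then have "gap k p + gap l p' \<noteq> 0"
        using nz[of k l p p'] nz[of l k p' p] False by (metis add.commute linorder_neqE_nat)
      then show "2 * pi * of_bool (gap k p + gap l p' = 0) = 0" by simp
    qed
    then show ?thesis unfolding eq using False by simp
  qed
qed

lemma lam_factor_moment:
  assumes n: "n \<ge> 1"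
  shows "(\<integral>z. factor n k z - 1 \<partial>lam n 0) = (real (r k) ^ 2 - r k) / r k ^ (2 * n)"
proof -
  have "(\<Sum>p\<in>off_diagonal k. a n 0 (gap k p)) = (\<Sum>p\<in>off_diagonal k. 1 / real (r k) ^ n)"
    by (intro sum.cong refl) (simp add: a_gap)
  also have "\<dots> = (real (r k) ^ 2 - r k) / real (r k) ^ n" by (simp add: real_card_off_diagonal)
  finally have "(\<integral>z. factor n k z - 1 \<partial>lam n 0) = (real (r k) ^ 2 - r k) / (real (r k) ^ n * real (r k) ^ n)"
    unfolding factor_moments(1)[OF finite_lam[OF n] sets_lam[OF n] lam_coeff[OF n]] by simp
  then show ?thesis by (simp only: power_add[symmetric] mult_2 of_nat_power)
qed

text \<open>Since \<open>r k \<ge> 2\<close>, at least half of all pairs of columns are off the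
  diagonal.\<close>

lemma lam_factor_moment_ge:
  assumes n: "n \<ge> 1"
  shows "energy n k / 2 \<le> (\<integral>z. factor n k z - 1 \<partial>lam n 0)"
proof -
  have "2 * real (r k) \<le> real (r k) ^ 2" using r_ge2[of k] by (simp add: power2_eq_square)
  then have "real (r k) ^ 2 / 2 \<le> real (r k) ^ 2 - r k" by simp
  then have "real (r k) ^ 2 / 2 / r k ^ (2 * n) \<le> (real (r k) ^ 2 - r k) / r k ^ (2 * n)"
    by (intro divide_right_mono) auto
  then show ?thesis unfolding lam_factor_moment[OF n] energy_def by simp
qed

lemma lam_factor_covariance:
  assumes n: "n \<ge> 1" and "k \<noteq> l"
  shows "(\<integral>z. (factor n k z - 1) * (factor n l z - 1) \<partial>lam n 0) =
    (\<integral>z. factor n k z - 1 \<partial>lam n 0) * (\<integral>z. factor n l z - 1 \<partial>lam n 0)"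
proof -
  have *: "a n 0 (gap k p + gap l p') = 1 / r k ^ n * (1 / r l ^ n)"
    if "p \<in> off_diagonal k" "p' \<in> off_diagonal l" for p p'
  proof (cases "k < l")
    case True
    then show ?thesis using a_gap_gap_different[of 0 k l] that by simp
  next
    case False
    then have "l < k" using assms(2) by simp
    then show ?thesis using a_gap_gap_different[of 0 l k p' p n] that by (simp add: add.commute mult.commute)
  qed
  show ?thesis
    unfolding factor_moments(1)[OF finite_lam[OF n] sets_lam[OF n] lam_coeff[OF n]]
      factor_moments(2)[OF finite_lam[OF n] sets_lam[OF n] lam_coeff[OF n]]
    by (simp add: * a_gap)
qed

text \<open>There are at most \<open>r ^ 2\<close> opposite pairs of gaps and at most
  \<open>2 * r ^ 3\<close> crossed ones, the latter with weight
  \<open>1 / r ^ n \<le> 1 / r\<close>; together this gives the constant 3.\<close>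

lemma lam_factor_second_moment:
  assumes n: "n \<ge> 1"
  shows "(\<integral>z. (factor n k z - 1) * (factor n k z - 1) \<partial>lam n 0) \<le> 3 * energy n k"
proof -
  let ?R = "real (r k)"
  let ?Q = "{..<r k} \<times> {..<r k}"
  have R: "?R \<ge> 1" using r_ge2[of k] by simp
  have sub: "off_diagonal k \<subseteq> ?Q" by (auto simp: off_diagonal_def)
  let ?b = "\<lambda>p p'. of_bool (fst p = snd p' \<and> snd p = fst p') + (of_bool (fst p = snd p') + of_bool (snd p = fst p')) / ?R ^ n"
  have "(\<Sum>p\<in>off_diagonal k. \<Sum>p'\<in>off_diagonal k. a n 0 (gap k p + gap k p')) \<le>
      (\<Sum>p\<in>off_diagonal k. \<Sum>p'\<in>off_diagonal k. ?b p p')"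
  proof (intro sum_mono)
    fix p p' assume "p \<in> off_diagonal k" "p' \<in> off_diagonal k"
    then show "a n 0 (gap k p + gap k p') \<le> ?b p p'"
      using a_gap_gap_same[of 0 k "fst p" "snd p" "fst p'" "snd p'" n] by simp
  qed
  also have "\<dots> \<le> (\<Sum>p\<in>?Q. \<Sum>p'\<in>off_diagonal k. ?b p p')"
    by (intro sum_mono2 sub) (auto intro!: sum_nonneg)
  also have "\<dots> \<le> (\<Sum>p\<in>?Q. \<Sum>p'\<in>?Q. ?b p p')"
    by (intro sum_mono sum_mono2 sub) auto
  also have "\<dots> = (\<Sum>p\<in>?Q. 1 + (?R + ?R) / ?R ^ n)"
  proof (rule sum.cong[OF refl])
    fix p assume p: "p \<in> ?Q"
    have "(\<Sum>p'\<in>?Q. of_bool (fst p = snd p' \<and> snd p = fst p')) = (\<Sum>p'\<in>?Q. if p' = prod.swap p then 1 else (0::real))"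
      by (intro sum.cong) (auto simp: prod_eq_iff)
    also have "\<dots> = 1"
    proof -
      have "prod.swap p \<in> ?Q" using p by auto
      then show ?thesis by simp
    qed
    finally have 1: "(\<Sum>p'\<in>?Q. of_bool (fst p = snd p' \<and> snd p = fst p')) = (1::real)" .
    have "(\<Sum>p'\<in>?Q. of_bool (fst p = snd p')) = (\<Sum>i<r k. \<Sum>l<r k. if l = fst p then 1 else (0::real))"
      unfolding sum.cartesian_product by (intro sum.cong) auto
    then have 2: "(\<Sum>p'\<in>?Q. of_bool (fst p = snd p')) = ?R" using p by auto
    have "(\<Sum>p'\<in>?Q. of_bool (snd p = fst p')) = (\<Sum>i<r k. \<Sum>l<r k. if i = snd p then 1 else (0::real))"
      unfolding sum.cartesian_product by (intro sum.cong) auto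
    also have "\<dots> = (\<Sum>i<r k. if i = snd p then ?R else 0)" by (intro sum.cong) auto
    finally have 3: "(\<Sum>p'\<in>?Q. of_bool (snd p = fst p')) = ?R" using p by auto
    show "(\<Sum>p'\<in>?Q. ?b p p') = 1 + (?R + ?R) / ?R ^ n"
      unfolding sum.distrib sum_divide_distrib[symmetric] 1 2 3 ..
  qed
  also have "\<dots> = ?R\<^sup>2 * (1 + (?R + ?R) / ?R ^ n)" by (simp add: power2_eq_square)
  also have "\<dots> \<le> ?R\<^sup>2 * 3"
  proof (intro mult_left_mono)
    have "?R ^ 1 \<le> ?R ^ n" using R n by (intro power_increasing) auto
    then have "?R / ?R ^ n \<le> 1" using R by simp
    then show "1 + (?R + ?R) / ?R ^ n \<le> 3" unfolding add_divide_distrib by linarith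
  qed simp
  finally have "(\<Sum>p\<in>off_diagonal k. \<Sum>p'\<in>off_diagonal k. a n 0 (gap k p + gap k p')) / (?R ^ n * ?R ^ n) \<le>
      ?R\<^sup>2 * 3 / (?R ^ n * ?R ^ n)" by (intro divide_right_mono) auto
  then show ?thesis
    unfolding factor_moments(2)[OF finite_lam[OF n] sets_lam[OF n] lam_coeff[OF n]] energy_def
    by (simp add: power_add[symmetric] mult_2 mult_2_right mult.commute)
qed

lemma chebyshev_bound:
  assumes \<kappa>: "finite_measure \<kappa>" and g: "integrable \<kappa> (\<lambda>z. (g z)\<^sup>2)" and Y: "Y \<in> sets \<kappa>"
    and far: "\<And>z. z \<in> Y \<Longrightarrow> d \<le> \<bar>g z\<bar>" and d: "(d::real) > 0"
  shows "measure \<kappa> Y \<le> (\<integral>z. (g z)\<^sup>2 \<partial>\<kappa>) / d\<^sup>2"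
proof -
  interpret finite_measure \<kappa> by fact
  have "d\<^sup>2 * measure \<kappa> Y = (\<integral>z. d\<^sup>2 * indicator Y z \<partial>\<kappa>)"
    using Y sets.sets_into_space[OF Y] by (simp add: Int_absorb2)
  also have "\<dots> \<le> (\<integral>z. (g z)\<^sup>2 \<partial>\<kappa>)"
  proof (rule integral_mono)
    show "integrable \<kappa> (\<lambda>z. d\<^sup>2 * indicator Y z)"
      using Y by (intro integrable_mult_right integrable_real_indicator) (auto simp: less_top[symmetric])
    fix z
    show "d\<^sup>2 * indicator Y z \<le> (g z)\<^sup>2"
    proof (cases "z \<in> Y")
      case True
      then have "d\<^sup>2 \<le> \<bar>g z\<bar>\<^sup>2" using far d by (intro power_mono) auto
      then show ?thesis using True by simp
    qed simp
  qed (rule g)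
  finally show ?thesis using d by (simp add: field_simps)
qed

text \<open>For Lebesgue measure the sums \<open>F N\<close> of centred factors have second moment
  of order \<open>S N\<close>; for \<open>lam n 0\<close> they have mean at least
  \<open>S N / 2\<close> and variance of order \<open>S N\<close>. Chebyshev's inequality at the
  threshold \<open>S N / 4\<close> separates the two measures up to errors of order
  \<open>1 / S N\<close>, and along a subsequence with \<open>S N \<ge> 2 ^ i\<close> these are
  summable.\<close>

theorem lam_singular_lebesgue:
  assumes n: "n \<ge> 1" and diverges: "\<not> summable (energy n)"
  shows "mutually_singular (lam n 0) circle_lebesgue"
proof -
  define F where "F N z = (\<Sum>k<N. factor n k z - 1)" for N z
  define S where "S N = (\<Sum>k<N. energy n k)" for N
  define Y where "Y N = {z \<in> sphere 0 1. S N / 4 < F N z}" for N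
  define \<mu> where "\<mu> k = (\<integral>z. factor n k z - 1 \<partial>lam n 0)" for k
  define \<mu>F where "\<mu>F N = (\<Sum>k<N. \<mu> k)" for N
  interpret prob_space "lam n 0" using n by (rule prob_space_lam)
  have sp: "space (lam n 0) = sphere 0 1" by (intro space_circle_borel sets_lam n)
  have spL: "space circle_lebesgue = sphere 0 1" by (intro space_circle_borel sets_circle_lebesgue)
  have Fc [continuous_intros]: "continuous_on (sphere 0 1) (F N)" for N
    unfolding F_def by (intro continuous_intros)
  have Fm [measurable]: "F N \<in> borel_measurable circle_borel" for N
    by (intro circle_continuous_measurable continuous_intros) simp
  have spB: "space circle_borel = sphere 0 1" by (rule space_circle_borel) simp
  have YB: "Y N \<in> sets circle_borel" for N
    unfolding Y_def spB[symmetric] by measurable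
  have int: "integrable \<kappa> (\<lambda>z. (factor n k z - 1) * (factor n l z - 1))" "integrable \<kappa> (\<lambda>z. factor n k z - 1)"
    if "finite_measure \<kappa>" "sets \<kappa> = sets circle_borel" for \<kappa> k l
    using that by (auto intro!: circle_continuous_integrable continuous_intros)
  have F2: "(\<integral>z. (F N z)\<^sup>2 \<partial>\<kappa>) = (\<Sum>k<N. \<Sum>l<N. \<integral>z. (factor n k z - 1) * (factor n l z - 1) \<partial>\<kappa>)"
    if "finite_measure \<kappa>" "sets \<kappa> = sets circle_borel" for \<kappa> N
  proof -
    have "(\<integral>z. (F N z)\<^sup>2 \<partial>\<kappa>) = (\<integral>z. (\<Sum>k<N. \<Sum>l<N. (factor n k z - 1) * (factor n l z - 1)) \<partial>\<kappa>)"
      by (simp add: F_def power2_eq_square sum_product)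
    also have "\<dots> = (\<Sum>k<N. \<integral>z. (\<Sum>l<N. (factor n k z - 1) * (factor n l z - 1)) \<partial>\<kappa>)"
      by (intro Bochner_Integration.integral_sum Bochner_Integration.integrable_sum int that)
    also have "\<dots> = (\<Sum>k<N. \<Sum>l<N. \<integral>z. (factor n k z - 1) * (factor n l z - 1) \<partial>\<kappa>)"
      by (intro sum.cong refl Bochner_Integration.integral_sum int that)
    finally show ?thesis .
  qed
  have leb: "measure circle_lebesgue (Y N) \<le> 32 * pi / S N" if S: "S N > 0" for N
  proof -
    have "(\<integral>z. (F N z)\<^sup>2 \<partial>circle_lebesgue) \<le> (\<Sum>k<N. \<Sum>l<N. if k = l then 2 * pi * energy n k else 0)"
      unfolding F2[OF finite_circle_lebesgue sets_circle_lebesgue]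
      by (intro sum_mono lebesgue_factor_second_moment)
    also have "\<dots> = 2 * pi * S N" by (simp add: S_def sum_distrib_left)
    finally have m2: "(\<integral>z. (F N z)\<^sup>2 \<partial>circle_lebesgue) \<le> 2 * pi * S N" .
    have "measure circle_lebesgue (Y N) \<le> (\<integral>z. (F N z)\<^sup>2 \<partial>circle_lebesgue) / (S N / 4)\<^sup>2"
      using S YB by (intro chebyshev_bound finite_circle_lebesgue circle_continuous_integrable
          continuous_intros sets_circle_lebesgue) (auto simp: Y_def)
    also have "\<dots> \<le> 2 * pi * S N / (S N / 4)\<^sup>2" by (intro divide_right_mono m2) simp
    also have "\<dots> = 32 * pi / S N" using S by (simp add: power2_eq_square field_simps)
    finally show ?thesis .
  qed
  have lam: "measure (lam n 0) (sphere 0 1 - Y N) \<le> 48 / S N" if S: "S N > 0" for N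
  proof -
    have EF: "(\<integral>z. F N z \<partial>lam n 0) = \<mu>F N"
      unfolding F_def \<mu>F_def \<mu>_def by (intro Bochner_Integration.integral_sum int finite_lam sets_lam n)
    have "(\<integral>z. (F N z - \<mu>F N)\<^sup>2 \<partial>lam n 0) = (\<integral>z. (F N z)\<^sup>2 \<partial>lam n 0) - (\<mu>F N)\<^sup>2"
    proof -
      have i: "integrable (lam n 0) (\<lambda>z. (F N z)\<^sup>2)" "integrable (lam n 0) (F N)"
        by (auto intro!: circle_continuous_integrable continuous_intros finite_lam sets_lam n)
      show ?thesis using variance_eq[OF i(2,1)] unfolding EF by simp
    qed
    also have "\<dots> = (\<Sum>k<N. \<Sum>l<N. (\<integral>z. (factor n k z - 1) * (factor n l z - 1) \<partial>lam n 0) - \<mu> k * \<mu> l)"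
      unfolding F2[OF finite_lam[OF n] sets_lam[OF n]]
      unfolding \<mu>F_def power2_eq_square sum_product sum_subtractf ..
    also have "\<dots> \<le> (\<Sum>k<N. \<Sum>l<N. if k = l then 3 * energy n k else 0)"
    proof (intro sum_mono)
      fix k l
      show "(\<integral>z. (factor n k z - 1) * (factor n l z - 1) \<partial>lam n 0) - \<mu> k * \<mu> l \<le> (if k = l then 3 * energy n k else 0)"
      proof (cases "k = l")
        case True
        have "0 \<le> \<mu> k * \<mu> k" by simp
        then have "(\<integral>z. (factor n k z - 1) * (factor n k z - 1) \<partial>lam n 0) - \<mu> k * \<mu> k \<le> 3 * energy n k"
          using lam_factor_second_moment[OF n, of k] by linarith
        then show ?thesis using True by simp
      next
        case False
        then show ?thesis using lam_factor_covariance[OF n False] by (simp add: \<mu>_def)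
      qed
    qed
    also have "\<dots> = 3 * S N" by (simp add: S_def sum_distrib_left)
    finally have m2: "(\<integral>z. (F N z - \<mu>F N)\<^sup>2 \<partial>lam n 0) \<le> 3 * S N" .
    have "S N / 2 \<le> \<mu>F N"
      unfolding S_def \<mu>F_def sum_divide_distrib \<mu>_def by (intro sum_mono lam_factor_moment_ge n)
    have far: "S N / 4 \<le> \<bar>F N z - \<mu>F N\<bar>" if "z \<in> sphere 0 1 - Y N" for z
    proof -
      have "F N z \<le> S N / 4" using that by (auto simp: Y_def)
      then show ?thesis using \<open>S N / 2 \<le> \<mu>F N\<close> S by linarith
    qed
    have "measure (lam n 0) (sphere 0 1 - Y N) \<le> (\<integral>z. (F N z - \<mu>F N)\<^sup>2 \<partial>lam n 0) / (S N / 4)\<^sup>2"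
    proof (rule chebyshev_bound[OF finite_lam[OF n] _ _ far])
      show "integrable (lam n 0) (\<lambda>z. (F N z - \<mu>F N)\<^sup>2)"
        by (intro circle_continuous_integrable continuous_intros finite_lam sets_lam n)
      show "sphere 0 1 - Y N \<in> sets (lam n 0)"
        using YB[of N] sets_lam[OF n, of 0] sets.compl_sets[of "Y N" "lam n 0"] by (simp add: sp)
    qed (use S in auto)
    also have "\<dots> \<le> 3 * S N / (S N / 4)\<^sup>2" by (intro divide_right_mono m2) simp
    also have "\<dots> = 48 / S N" using S by (simp add: power2_eq_square field_simps)
    finally show ?thesis .
  qed
  have "\<exists>N. 2 ^ i \<le> S N" for i :: nat
  proof (rule ccontr)
    assume "\<not> (\<exists>N. 2 ^ i \<le> S N)"
    then have "S N \<le> 2 ^ i" for N by (auto simp: not_le less_imp_le)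
    then have "summable (energy n)"
      using energy_pos[of n] unfolding S_def by (intro summableI_nonneg_bounded[where x = "2 ^ i"]) (auto simp: less_imp_le)
    then show False using diverges by simp
  qed
  then obtain N where N: "\<And>i::nat. 2 ^ i \<le> S (N i)" by metis
  have SN: "S (N i) > 0" for i using N[of i] by (rule less_le_trans[rotated]) simp
  have null1: "limsup (\<lambda>i. Y (N i)) \<in> null_sets circle_lebesgue"
  proof (rule borel_cantelli_limsup1)
    show "Y (N i) \<in> sets circle_lebesgue" for i using YB by simp
    show "emeasure circle_lebesgue (Y (N i)) < \<infinity>" for i
      using finite_measure.emeasure_finite[OF finite_circle_lebesgue] by (simp add: less_top[symmetric])
    have bd: "measure circle_lebesgue (Y (N i)) \<le> 32 * pi * (1 / 2) ^ i" for i
    proof -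
      have "measure circle_lebesgue (Y (N i)) \<le> 32 * pi / S (N i)" by (rule leb[OF SN])
      also have "\<dots> \<le> 32 * pi / 2 ^ i" using N[of i] by (intro divide_left_mono mult_pos_pos SN) auto
      finally show ?thesis by (simp add: power_divide)
    qed
    have sm: "summable (\<lambda>i. 32 * pi * (1 / 2 :: real) ^ i)" by (intro summable_mult summable_geometric) simp
    show "summable (\<lambda>i. measure circle_lebesgue (Y (N i)))"
      by (rule summable_comparison_test'[OF sm, of 0]) (use bd in simp)
  qed
  have null2: "limsup (\<lambda>i. sphere 0 1 - Y (N i)) \<in> null_sets (lam n 0)"
  proof (rule borel_cantelli_limsup1)
    show *: "sphere 0 1 - Y (N i) \<in> sets (lam n 0)" for i
      using YB[of "N i"] sets_lam[OF n, of 0] sets.compl_sets[of "Y (N i)" "lam n 0"] by (simp add: sp)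
    show "emeasure (lam n 0) (sphere 0 1 - Y (N i)) < \<infinity>" for i by (simp add: less_top[symmetric])
    have bd: "measure (lam n 0) (sphere 0 1 - Y (N i)) \<le> 48 * (1 / 2) ^ i" for i
    proof -
      have "measure (lam n 0) (sphere 0 1 - Y (N i)) \<le> 48 / S (N i)" by (rule lam[OF SN])
      also have "\<dots> \<le> 48 / 2 ^ i" using N[of i] by (intro divide_left_mono mult_pos_pos SN) auto
      finally show ?thesis by (simp add: power_divide)
    qed
    have sm: "summable (\<lambda>i. 48 * (1 / 2 :: real) ^ i)" by (intro summable_mult summable_geometric) simp
    show "summable (\<lambda>i. measure (lam n 0) (sphere 0 1 - Y (N i)))"
      by (rule summable_comparison_test'[OF sm, of 0]) (use bd in simp)
  qed
  \<comment> \<open>\<open>Z\<close> is null for Lebesgue measure by the first Borel-Cantelli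
    estimate. The set that \<open>mutually_singular\<close> asks for is its complement, which the
    second estimate makes null for \<open>lam n 0\<close>.\<close>
  define Z where "Z = limsup (\<lambda>i. Y (N i))"
  have ZB: "Z \<in> sets circle_borel" using null1 by (auto simp: Z_def)
  have "sphere 0 1 - Z \<subseteq> limsup (\<lambda>i. sphere 0 1 - Y (N i))"
  proof
    fix x assume x: "x \<in> sphere 0 1 - Z"
    then obtain m where m: "\<And>k. k \<ge> m \<Longrightarrow> x \<notin> Y (N k)" unfolding Z_def limsup_INF_SUP by auto
    have "\<exists>k\<ge>l. x \<in> sphere 0 1 - Y (N k)" for l
      using m x by (intro exI[of _ "max m l"]) auto
    then show "x \<in> limsup (\<lambda>i. sphere 0 1 - Y (N i))" unfolding limsup_INF_SUP by auto
  qed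
  moreover have "sphere 0 1 - Z \<in> sets (lam n 0)"
    using ZB sets_lam[OF n, of 0] sets.compl_sets[of Z "lam n 0"] by (simp add: sp)
  ultimately have "sphere 0 1 - Z \<in> null_sets (lam n 0)" using null2 null_sets_subset by blast
  moreover have "sphere 0 1 - (sphere 0 1 - Z) = Z"
    using sets.sets_into_space[OF ZB] by (auto simp: spB)
  ultimately show ?thesis
    unfolding mutually_singular_def using null1 sets_lam[OF n, of 0]
    by (intro bexI[of _ "sphere 0 1 - Z"]) (auto simp: spL Z_def[symmetric])
qed

end

section \<open>The rank one construction\<close>

context lacunary
begin

primrec width :: "nat \<Rightarrow> real" where
  "width 0 = 1"
| "width (Suc j) = width j / r j"

text \<open>Everything used up to stage \<open>j\<close> lies to the left of
  \<open>top_end j\<close>. Room for a complete tower is reserved, because a spacer at height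
  \<open>m\<close> is put at offset \<open>m * width (Suc j)\<close>; the places belonging to
  heights inside columns stay empty.\<close>

primrec top_end :: "nat \<Rightarrow> real" where
  "top_end 0 = 0"
| "top_end (Suc j) = top_end j + H (Suc j) * width (Suc j)"

definition in_column :: "nat \<Rightarrow> nat \<Rightarrow> nat \<Rightarrow> bool" where
  "in_column j m i \<longleftrightarrow> i < r j \<and> P j i \<le> m \<and> m < P j i + H j"

text \<open>Left end point of level \<open>m\<close> of tower \<open>j\<close>. The base is \<open>[- width j, 0)\<close>, cut from right to left, so
  that no point lies in all bases; new spacers are placed to the right of everything used before.\<close>

primrec lev :: "nat \<Rightarrow> nat \<Rightarrow> real" where
  "lev 0 m = - 1"
| "lev (Suc j) m = (if \<exists>i. in_column j m i
     then let i = (THE i. in_column j m i) in lev j (m - P j i) + (real (r j) - 1 - real i) * width (Suc j)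
     else top_end j + real m * width (Suc j))"

definition level :: "nat \<Rightarrow> nat \<Rightarrow> real set" where
  "level j m = {lev j m..<lev j m + width j}"

lemma width_pos [simp]: "0 < width j"
  by (induction j) auto

lemma width_nonneg [simp]: "0 \<le> width j"
  using width_pos[of j] by linarith

lemma width_nonzero [simp]: "width j \<noteq> 0"
  using width_pos[of j] by linarith

lemma width_eq: "width j = r j * width (Suc j)"
  by simp

declare width.simps(2) [simp del]

lemma P_mono: "i < i' \<Longrightarrow> P j i + 28 * H j \<le> P j i'"
proof -
  assume "i < i'"
  then have "(8::nat) ^ Suc i \<le> 8 ^ i'" by (intro power_increasing) auto
  then have "8 * 8 ^ i \<le> (8::nat) ^ i'" by simp
  moreover have "(1::nat) \<le> 8 ^ i" by simp
  ultimately have "8 ^ i - 1 + 7 \<le> 8 ^ i' - (1::nat)" by linarith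
  then have "4 * H j * (8 ^ i - 1 + 7) \<le> 4 * H j * (8 ^ i' - 1)" by (intro mult_left_mono) auto
  then have "P j i + 4 * H j * 7 \<le> P j i'" by (simp only: P_def distrib_left)
  then show ?thesis by simp
qed

lemma P_block_unique:
  assumes "P j i + q = P j i' + q'" "q < H j" "q' < H j"
  shows "i = i' \<and> q = q'"
  using assms P_mono[of i i' j] P_mono[of i' i j] by (cases i i' rule: linorder_cases) auto

lemma in_column_block: "i < r j \<Longrightarrow> q < H j \<Longrightarrow> in_column j (P j i + q) i"
  by (simp add: in_column_def)

lemma in_column_unique: "in_column j m i \<Longrightarrow> in_column j m i' \<Longrightarrow> i = i'"
  using P_block_unique[of j i "m - P j i" i' "m - P j i'"] by (auto simp: in_column_def)

lemma block_less: "i < r j \<Longrightarrow> q < H j \<Longrightarrow> P j i + q < H (Suc j)"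
  using P_bound[of i j] by simp

lemma lev_block:
  assumes "i < r j" "q < H j"
  shows "lev (Suc j) (P j i + q) = lev j q + (real (r j) - 1 - real i) * width (Suc j)"
proof -
  have "(THE i'. in_column j (P j i + q) i') = i"
    using in_column_block[OF assms] in_column_unique by blast
  then show ?thesis using in_column_block[OF assms] by (auto simp: Let_def)
qed

lemma lev_spacer: "\<nexists>i. in_column j m i \<Longrightarrow> lev (Suc j) m = top_end j + real m * width (Suc j)"
  by simp

declare lev.simps(2) [simp del]

lemma top_end_mono: "top_end j \<le> top_end (Suc j)"
  by (simp add: less_imp_le)

lemma level_block_subset:
  assumes "i < r j" "q < H j" shows "level (Suc j) (P j i + q) \<subseteq> level j q"
proof -
  have "(real (r j) - 1 - real i) * width (Suc j) + width (Suc j) \<le> real (r j) * width (Suc j)"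
    by (simp add: algebra_simps)
  moreover have "0 \<le> (real (r j) - 1 - real i) * width (Suc j)" using assms by simp
  ultimately show ?thesis
    unfolding level_def lev_block[OF assms] using width_eq[of j] by auto
qed

lemma level_cut:
  assumes "q < H j" shows "level j q = (\<Union>i<r j. level (Suc j) (P j i + q))"
proof (intro equalityI subsetI)
  fix x assume x: "x \<in> level j q"
  define u where "u = (x - lev j q) / width (Suc j)"
  have u: "0 \<le> u" "u < r j"
    using x width_eq[of j] by (auto simp: u_def level_def divide_less_eq)
  define k where "k = nat \<lfloor>u\<rfloor>"
  have k: "real k \<le> u" "u < real k + 1" using u unfolding k_def by linarith+
  have kr: "k < r j" using k u by linarith
  \<comment> \<open>Pieces are numbered from right to left, so the \<open>k\<close>-th piece from
    the left belongs to column \<open>r j - 1 - k\<close>.\<close>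
  define i where "i = r j - 1 - k"
  have i: "i < r j" "real (r j) - 1 - real i = real k" using kr by (auto simp: i_def of_nat_diff)
  have "x = lev j q + u * width (Suc j)" using width_pos[of "Suc j"] by (simp add: u_def)
  moreover have "real k * width (Suc j) \<le> u * width (Suc j)" using k by (intro mult_right_mono) auto
  moreover have "u * width (Suc j) < (real k + 1) * width (Suc j)" using k by (intro mult_strict_right_mono) auto
  ultimately have "x \<in> level (Suc j) (P j i + q)"
    unfolding level_def lev_block[OF i(1) assms] i(2) by (simp add: algebra_simps)
  then show "x \<in> (\<Union>i<r j. level (Suc j) (P j i + q))" using i by blast
qed (use level_block_subset assms in auto)

lemma level_range: "m < H j \<Longrightarrow> level j m \<subseteq> {- 1..<top_end j}"
proof (induction j arbitrary: m)
  case 0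
  then show ?case by (auto simp: level_def)
next
  case (Suc j)
  show ?case
  proof (cases "\<exists>i. in_column j m i")
    case True
    then obtain i where i: "in_column j m i" by blast
    then have "m = P j i + (m - P j i)" "i < r j" "m - P j i < H j" by (auto simp: in_column_def)
    then have "level (Suc j) m \<subseteq> level j (m - P j i)" by (metis level_block_subset)
    also have "\<dots> \<subseteq> {- 1..<top_end j}" using \<open>m - P j i < H j\<close> by (rule Suc.IH)
    finally have sub: "level (Suc j) m \<subseteq> {- 1..<top_end j}" .
    show ?thesis
    proof
      fix x assume "x \<in> level (Suc j) m"
      then have "- 1 \<le> x" "x < top_end j" using sub by auto
      then show "x \<in> {- 1..<top_end (Suc j)}" using top_end_mono[of j] by (simp del: top_end.simps(2))
    qed
  next
    case False
    have "- 1 \<le> top_end j"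
    proof (induction j)
      case (Suc j)
      then show ?case using top_end_mono[of j] by linarith
    qed simp
    moreover have "real m * width (Suc j) + width (Suc j) \<le> H (Suc j) * width (Suc j)"
    proof -
      have "(real m + 1) * width (Suc j) \<le> H (Suc j) * width (Suc j)"
        using Suc.prems by (intro mult_right_mono) auto
      then show ?thesis by (simp add: algebra_simps)
    qed
    moreover have "0 \<le> real m * width (Suc j)" by simp
    ultimately have "- 1 \<le> top_end j + real m * width (Suc j)"
      "top_end j + real m * width (Suc j) + width (Suc j) \<le> top_end (Suc j)"
      unfolding top_end.simps(2) by linarith+
    then show ?thesis unfolding level_def lev_spacer[OF False] by (auto simp del: top_end.simps(2))
  qed
qed

lemma separated_intervals:
  fixes a w :: real
  assumes "0 < w" "k \<noteq> (l::int)"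
  shows "{a + of_int k * w..<a + of_int k * w + w} \<inter> {a + of_int l * w..<a + of_int l * w + w} = {}"
proof -
  have "of_int k * w + w \<le> of_int l * w" if "k < l" for k l
  proof -
    have "(of_int k + 1) * w \<le> of_int l * w" using that assms by (intro mult_right_mono) linarith+
    then show ?thesis by (simp add: algebra_simps)
  qed
  then show ?thesis using assms(2) by (cases k l rule: linorder_cases) fastforce+
qed

text \<open>Levels inside columns lie in levels of the old tower, spacers to the right of all of
  them. Two column levels over the same old level are different pieces of one interval.\<close>

lemma level_disjoint: "m < H j \<Longrightarrow> m' < H j \<Longrightarrow> m \<noteq> m' \<Longrightarrow> level j m \<inter> level j m' = {}"
proof (induction j arbitrary: m m')
  case 0
  then show ?case by simp
next
  case (Suc j)
  have mixed: "level (Suc j) k \<inter> level (Suc j) l = {}" if c: "\<exists>i. in_column j k i" "\<nexists>i. in_column j l i" for k l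
  proof -
    obtain i where i: "in_column j k i" using c by blast
    then have "k = P j i + (k - P j i)" "i < r j" "k - P j i < H j" by (auto simp: in_column_def)
    then have "level (Suc j) k \<subseteq> level j (k - P j i)" by (metis level_block_subset)
    also have "\<dots> \<subseteq> {- 1..<top_end j}" using \<open>k - P j i < H j\<close> by (rule level_range)
    finally have "level (Suc j) k \<subseteq> {- 1..<top_end j}" .
    moreover have "level (Suc j) l \<subseteq> {top_end j..}"
      unfolding level_def lev_spacer[OF c(2)] by (auto intro: order.trans[rotated])
    ultimately show ?thesis by force
  qed
  consider "\<exists>i. in_column j m i" "\<exists>i. in_column j m' i" | "\<exists>i. in_column j m i" "\<nexists>i. in_column j m' i"
    | "\<nexists>i. in_column j m i" "\<exists>i. in_column j m' i" | "\<nexists>i. in_column j m i" "\<nexists>i. in_column j m' i" by blast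
  then show ?case
  proof cases
    case 1
    then obtain i i' where i: "in_column j m i" "in_column j m' i'" by blast
    define q q' where "q = m - P j i" and "q' = m' - P j i'"
    have m: "m = P j i + q" "i < r j" "q < H j" "m' = P j i' + q'" "i' < r j" "q' < H j"
      using i by (auto simp: in_column_def q_def q'_def)
    show ?thesis
    proof (cases "q = q'")
      case False
      then have "level j q \<inter> level j q' = {}" using Suc.IH m by blast
      then show ?thesis using level_block_subset[OF m(2,3)] level_block_subset[OF m(5,6)] m(1,4) by blast
    next
      case True
      then have "int (r j) - 1 - int i \<noteq> int (r j) - 1 - int i'" using Suc.prems(3) m by auto
      from separated_intervals[OF width_pos[of "Suc j"] this, of "lev j q"]
      show ?thesis using True unfolding m(1,4) level_def lev_block[OF m(2,3)] lev_block[OF m(5,6)] by simp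
    qed
  next
    case 2
    then show ?thesis by (rule mixed)
  next
    case 3
    then show ?thesis using mixed by blast
  next
    case 4
    have "int m \<noteq> int m'" using Suc.prems by simp
    from separated_intervals[OF width_pos[of "Suc j"] this, of "top_end j"]
    show ?thesis unfolding level_def lev_spacer[OF 4(1)] lev_spacer[OF 4(2)] by simp
  qed
qed

lemma level_unique: "x \<in> level j m \<Longrightarrow> x \<in> level j m' \<Longrightarrow> m < H j \<Longrightarrow> m' < H j \<Longrightarrow> m = m'"
  using level_disjoint by blast

lemma lev_0: "lev j 0 = - width j"
proof (induction j)
  case (Suc j)
  have "lev (Suc j) 0 = lev j 0 + (real (r j) - 1) * width (Suc j)"
    using lev_block[of 0 j 0] by simp
  then show ?case using Suc width_eq[of j] by (simp add: algebra_simps)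
qed simp

lemma level_0: "level j 0 = {- width j..<0}"
  by (simp add: level_def lev_0)

section \<open>Copies of a tower inside later towers\<close>

primrec positions :: "nat \<Rightarrow> nat \<Rightarrow> nat set" where
  "positions j 0 = {0}"
| "positions j (Suc t) = (\<lambda>(i, p). P (j + t) i + p) ` ({..<r (j + t)} \<times> positions j t)"

lemma finite_positions [simp]: "finite (positions j t)"
  by (induction t) auto

lemma positions_bound: "p \<in> positions j t \<Longrightarrow> 8 * p \<le> H (j + t)"
proof (induction t arbitrary: p)
  case (Suc t)
  then obtain i p' where p: "p = P (j + t) i + p'" "i < r (j + t)" "p' \<in> positions j t" by auto
  have "8 * p' \<le> H (j + t)" using Suc.IH p(3) .
  then show ?case using P_bound[OF p(2)] p(1) by simp
qed simp

lemma positions_dvd: "p \<in> positions j t \<Longrightarrow> 4 * H j dvd p"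
proof (induction t arbitrary: p)
  case (Suc t)
  then obtain i p' where p: "p = P (j + t) i + p'" "p' \<in> positions j t" by auto
  have "4 * H j dvd 4 * H (j + t)" by (intro mult_dvd_mono H_dvd) auto
  then have "4 * H j dvd P (j + t) i" using P_dvd dvd_trans by blast
  then show ?case using Suc.IH p by simp
qed simp

lemma positions_less:
  assumes "p \<in> positions j t" "q < H j" shows "p + q < H (j + t)"
proof (cases t)
  case (Suc t')
  have "512 * H (j + t') \<le> H (j + t)" using H_Suc_ge[of "j + t'"] Suc by simp
  moreover have "H j \<le> H (j + t')" by (rule H_mono) simp
  ultimately show ?thesis using positions_bound[OF assms(1)] assms(2) by linarith
qed (use assms in simp)

lemma level_positions: "q < H j \<Longrightarrow> level j q = (\<Union>p\<in>positions j t. level (j + t) (p + q))"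
proof (induction t)
  case (Suc t)
  have "level j q = (\<Union>p\<in>positions j t. level (j + t) (p + q))" using Suc by simp
  also have "\<dots> = (\<Union>p\<in>positions j t. \<Union>i<r (j + t). level (Suc (j + t)) (P (j + t) i + (p + q)))"
    using level_cut positions_less Suc.prems by simp
  also have "\<dots> = (\<Union>p\<in>positions j (Suc t). level (j + Suc t) (p + q))"
    by (auto simp: add.assoc) blast+
  finally show ?case .
qed simp

text \<open>Cutting displaces all levels of a column by the same amount, so the translation between
  two levels is the same in every copy. This is what makes \<open>T\<close> well defined.\<close>

lemma lev_positions_diff:
  assumes "p \<in> positions j t" "q < H j" "q' < H j"
  shows "lev (j + t) (p + q) - lev (j + t) (p + q') = lev j q - lev j q'"
  using assms(1)
proof (induction t arbitrary: p)
  case (Suc t)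
  then obtain i p' where p: "p = P (j + t) i + p'" "i < r (j + t)" "p' \<in> positions j t" by auto
  then show ?case
    using Suc.IH[OF p(3)] lev_block[OF p(2) positions_less[OF p(3) assms(2)]]
      lev_block[OF p(2) positions_less[OF p(3) assms(3)]] by (simp add: add.assoc)
qed simp

definition tower_set :: "nat \<Rightarrow> real set" where
  "tower_set j = (\<Union>q<H j. level j q)"

definition whole :: "real set" where
  "whole = (\<Union>j. tower_set j)"

lemma tower_set_Suc: "tower_set j \<subseteq> tower_set (Suc j)"
proof
  fix x assume "x \<in> tower_set j"
  then obtain q where "q < H j" "x \<in> level j q" by (auto simp: tower_set_def)
  then obtain i where "i < r j" "x \<in> level (Suc j) (P j i + q)" using level_cut by auto
  then show "x \<in> tower_set (Suc j)" using block_less \<open>q < H j\<close> by (auto simp: tower_set_def)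
qed

lemma tower_set_mono: "j \<le> k \<Longrightarrow> tower_set j \<subseteq> tower_set k"
  using tower_set_Suc by (rule lift_Suc_mono_le)

text \<open>The copies of tower \<open>j\<close> lie so low in tower \<open>j + Suc m\<close> that
  \<open>m\<close> further levels remain above each of their levels. Hence any iterate of any point
  is a translation between levels of some late tower.\<close>

lemma positions_deep:
  assumes "p \<in> positions j (Suc m)" "q < H j" shows "p + q + m < H (j + Suc m)"
proof -
  have "512 * H (j + m) \<le> H (j + Suc m)" using H_Suc_ge[of "j + m"] by simp
  moreover have "H j \<le> H (j + m)" by (rule H_mono) simp
  moreover have "m < H (j + m)" using H_ge[of "j + m"] by linarith
  ultimately show ?thesis using positions_bound[OF assms(1)] assms(2) by linarith
qed

lemma level_deep:
  assumes "q < H j" "x \<in> level j q"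
  obtains p where "p \<in> positions j (Suc m)" "x \<in> level (j + Suc m) (p + q)" "p + q + m < H (j + Suc m)"
  using level_positions[OF assms(1), of "Suc m"] assms positions_deep by blast

text \<open>Read off from any tower in which the point is not on the top level;
  \<open>shift_unique\<close> makes the choice immaterial.\<close>

definition shift :: "real \<Rightarrow> real" where
  "shift x = (SOME d. \<exists>k q. q + 1 < H k \<and> x \<in> level k q \<and> d = lev k (q + 1) - lev k q)"

definition T :: "real \<Rightarrow> real" where
  "T x = x + shift x"

lemma shift_unique:
  assumes "q + 1 < H k" "x \<in> level k q" "q' + 1 < H k'" "x \<in> level k' q'"
  shows "lev k (q + 1) - lev k q = lev k' (q' + 1) - lev k' q'"
proof -
  have *: "lev k (q + 1) - lev k q = lev k' (q' + 1) - lev k' q'"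
    if le: "k \<le> k'" and a: "q + 1 < H k" "x \<in> level k q" "q' + 1 < H k'" "x \<in> level k' q'" for k k' q q'
  proof -
    define t where "t = k' - k"
    have k': "k' = k + t" using le by (simp add: t_def)
    have q: "q < H k" using a by simp
    obtain p where p: "p \<in> positions k t" "x \<in> level (k + t) (p + q)"
      using level_positions[OF q, of t] a(2) by blast
    have "q' = p + q" using level_unique[OF a(4)[unfolded k'] p(2)] positions_less[OF p(1) q] a(3) k' by simp
    then show ?thesis
      using lev_positions_diff[OF p(1) a(1) q] by (simp add: k' add.assoc)
  qed
  show ?thesis
  proof (cases "k \<le> k'")
    case True
    then show ?thesis using * assms by blast
  next
    case False
    then have "k' \<le> k" by simp
    from *[OF this assms(3,4,1,2)] show ?thesis ..
  qed
qed

lemma T_level: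
  assumes "q + 1 < H j" "x \<in> level j q"
  shows "T x = x + lev j (q + 1) - lev j q"
proof -
  have "\<exists>d k q. q + 1 < H k \<and> x \<in> level k q \<and> d = lev k (q + 1) - lev k q" using assms by blast
  then have "\<exists>k q. q + 1 < H k \<and> x \<in> level k q \<and> shift x = lev k (q + 1) - lev k q"
    unfolding shift_def by (rule someI_ex)
  then have "shift x = lev j (q + 1) - lev j q" using shift_unique assms by metis
  then show ?thesis by (simp add: T_def)
qed

lemma level_translate: "x \<in> level j q \<Longrightarrow> x + lev j q' - lev j q \<in> level j q'"
  by (auto simp: level_def)

lemma T_power_level:
  assumes "q + k < H j" "x \<in> level j q"
  shows "(T ^^ k) x = x + lev j (q + k) - lev j q" "(T ^^ k) x \<in> level j (q + k)"
proof -
  show "(T ^^ k) x = x + lev j (q + k) - lev j q"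
    using assms
  proof (induction k)
    case (Suc k)
    then have IH: "(T ^^ k) x = x + lev j (q + k) - lev j q" by simp
    then have "(T ^^ k) x \<in> level j (q + k)" using level_translate Suc.prems by simp
    then have "T ((T ^^ k) x) = (T ^^ k) x + lev j (q + k + 1) - lev j (q + k)"
      using Suc.prems by (intro T_level) auto
    then show ?case using IH by simp
  qed simp
  then show "(T ^^ k) x \<in> level j (q + k)" using level_translate assms by simp
qed

lemma T_power_image:
  assumes "q + k < H j" shows "(T ^^ k) ` level j q = level j (q + k)"
proof (intro equalityI subsetI)
  fix y assume y: "y \<in> level j (q + k)"
  define x where "x = y + lev j q - lev j (q + k)"
  have "x \<in> level j q" unfolding x_def by (rule level_translate) fact
  moreover then have "(T ^^ k) x = y" using T_power_level(1)[OF assms] by (simp add: x_def)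
  ultimately show "y \<in> (T ^^ k) ` level j q" by blast
qed (use T_power_level(2)[OF assms] in auto)

text \<open>Copies of tower \<open>j\<close> sit at multiples of \<open>4 * H j\<close>. Within time
  \<open>2 * H j\<close> the heights of the copies before and after differ by less than that, so a
  point can return only inside the same copy.\<close>

lemma return_time:
  assumes "x \<in> level j q" "(T ^^ m) x \<in> level j q'" "q < H j" "q' < H j" "m \<le> 2 * H j"
  shows "q' = q + m"
proof -
  obtain p where p: "p \<in> positions j (Suc m)" "x \<in> level (j + Suc m) (p + q)" "p + q + m < H (j + Suc m)"
    using level_deep[OF assms(3,1)] .
  obtain p' where p': "p' \<in> positions j (Suc m)" "(T ^^ m) x \<in> level (j + Suc m) (p' + q')"
    using level_positions[OF assms(4), of "Suc m"] assms(2) by blast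
  have "(T ^^ m) x \<in> level (j + Suc m) (p + q + m)" by (rule T_power_level(2)[OF p(3,2)])
  then have eq: "p' + q' = p + q + m"
    using level_unique p'(2) positions_less[OF p'(1) assms(4)] p(3) by blast
  have "4 * int (H j) dvd int p' - int p"
    using positions_dvd[OF p(1)] positions_dvd[OF p'(1)] by (metis dvd_diff int_dvd_int_iff of_nat_mult of_nat_numeral)
  moreover have "\<bar>int p' - int p\<bar> < 4 * int (H j)"
  proof -
    have "int p' - int p = int q + int m - int q'" using eq by linarith
    then show ?thesis using assms(3,4,5) by linarith
  qed
  ultimately have "int p' - int p = 0" by (rule dvd_small_zero)
  then show ?thesis using eq by simp
qed

lemma whole_deep:
  assumes "x \<in> whole"
  obtains j q where "x \<in> level j q" "q + m < H j" "k \<le> j"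
proof -
  obtain j where "x \<in> tower_set j" using assms by (auto simp: whole_def)
  then have "x \<in> tower_set (max j k)" using tower_set_mono[of j "max j k"] by auto
  then obtain q where q: "q < H (max j k)" "x \<in> level (max j k) q" by (auto simp: tower_set_def)
  obtain p where "x \<in> level (max j k + Suc m) (p + q)" "p + q + m < H (max j k + Suc m)"
    using level_deep[OF q] by blast
  then show ?thesis using that by (meson le_add1 le_trans max.cobounded2)
qed

lemma width_le: "width j \<le> (1 / 2) ^ j"
proof (induction j)
  case (Suc j)
  have "width (Suc j) \<le> width j / 2"
    unfolding width.simps(2) using r_ge2[of j] by (intro divide_left_mono) auto
  then show ?case using Suc by simp
qed simp

text \<open>The bases \<open>[- width k, 0)\<close> have empty intersection, so every point leaves
  the base at some stage and acquires a preimage. Here cutting from right to left pays off: no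
  exceptional point spoils surjectivity.\<close>

lemma whole_positive_level:
  assumes "x \<in> whole"
  obtains j q where "x \<in> level j (Suc q)" "Suc q < H j"
proof -
  obtain j q where q: "x \<in> level j q" "q < H j" using whole_deep[OF assms, of 0 0] by auto
  show ?thesis
  proof (cases q)
    case 0
    then have "x < 0" using q by (simp add: level_0)
    then obtain k where k: "(1 / 2 :: real) ^ k < - x" using real_arch_pow_inv[of "- x" "1 / 2"] by auto
    have "x \<in> tower_set (j + k)" using q tower_set_mono[of j "j + k"] by (auto simp: tower_set_def)
    then obtain q' where q': "q' < H (j + k)" "x \<in> level (j + k) q'" by (auto simp: tower_set_def)
    have "width (j + k) \<le> (1 / 2) ^ (j + k)" by (rule width_le)
    also have "\<dots> \<le> (1 / 2) ^ k" by (intro power_decreasing) auto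
    finally have w: "width (j + k) \<le> (1 / 2) ^ k" .
    have "q' \<noteq> 0"
    proof
      assume "q' = 0"
      then have "- width (j + k) \<le> x" using q'(2) by (simp add: level_0)
      then show False using w k by linarith
    qed
    then show ?thesis using that q' by (metis not0_implies_Suc)
  next
    case (Suc q')
    then show ?thesis using that q by blast
  qed
qed

lemma level_in_whole: "q < H j \<Longrightarrow> level j q \<subseteq> whole"
  by (auto simp: whole_def tower_set_def)

lemma T_bij: "bij_betw T whole whole"
proof (rule bij_betw_imageI)
  show "inj_on T whole"
  proof (rule inj_onI)
    fix x y assume x: "x \<in> whole" and y: "y \<in> whole" and eq: "T x = T y"
    obtain j where "x \<in> tower_set j" using x by (auto simp: whole_def)
    obtain k q where k: "x \<in> level k q" "q + 1 < H k" using whole_deep[OF x, of 1 0] by blast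
    obtain k' q' where k': "y \<in> level k' q'" "q' + 1 < H k'" "k \<le> k'" using whole_deep[OF y, of 1 k] by blast
    obtain p where p: "p \<in> positions k (k' - k)" "x \<in> level k' (p + q)"
      using level_positions[of q k "k' - k"] k k' by auto
    have pq: "p + q + 1 < H k'" using positions_less[OF p(1) k(2)] k'(3) by (simp add: add.assoc)
    have "(T ^^ 1) x \<in> level k' (p + q + 1)" "(T ^^ 1) y \<in> level k' (q' + 1)"
      using T_power_level(2)[OF pq p(2)] T_power_level(2)[OF k'(2,1)] by simp_all
    then have "p + q + 1 = q' + 1" using eq level_unique[of "T x" k' "p + q + 1" "q' + 1"] pq k'(2) by simp
    then have "p + q = q'" by simp
    then show "x = y" using eq T_level[OF pq p(2)] T_level[OF k'(2,1)] by simp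
  qed
  show "T ` whole = whole"
  proof (intro equalityI subsetI)
    fix y assume "y \<in> T ` whole"
    then obtain x where x: "x \<in> whole" "y = T x" by blast
    obtain k q where k: "x \<in> level k q" "q + 1 < H k" using whole_deep[OF x(1), of 1 0] by blast
    have "(T ^^ 1) x \<in> level k (q + 1)" by (rule T_power_level(2)[OF k(2,1)])
    then show "y \<in> whole" using x(2) level_in_whole[OF k(2)] by auto
  next
    fix y assume "y \<in> whole"
    then obtain j q where q: "y \<in> level j (Suc q)" "Suc q < H j" by (rule whole_positive_level)
    have "y \<in> (T ^^ 1) ` level j q" using T_power_image[of q 1 j] q by simp
    then show "y \<in> T ` whole" using level_in_whole[of q j] q by auto
  qed
qed

section \<open>Measurability and invariance of Lebesgue measure\<close>

lemma level_borel [measurable]: "level j q \<in> sets borel"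
  by (simp add: level_def)

lemma tower_set_borel [measurable]: "tower_set j \<in> sets borel"
  unfolding tower_set_def by (intro sets.finite_UN) auto

lemma whole_borel [measurable]: "whole \<in> sets borel"
  unfolding whole_def by auto

definition space_measure :: "real measure" where
  "space_measure = restrict_space lborel whole"

lemma space_space_measure [simp]: "space space_measure = whole"
  by (simp add: space_measure_def space_restrict_space)

lemma sets_space_measure: "Y \<in> sets space_measure \<longleftrightarrow> Y \<in> sets borel \<and> Y \<subseteq> whole"
  unfolding space_measure_def by (subst sets_restrict_space_iff) auto

lemma emeasure_space_measure: "Y \<in> sets space_measure \<Longrightarrow> emeasure space_measure Y = emeasure lborel Y"
  unfolding space_measure_def by (subst emeasure_restrict_space) (auto simp: sets_restrict_space_iff)

lemma level_sets [measurable]: "q < H j \<Longrightarrow> level j q \<in> sets space_measure"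
  using level_in_whole by (simp add: sets_space_measure)

lemma emeasure_level: "q < H j \<Longrightarrow> emeasure space_measure (level j q) = ennreal (width j)"
  using emeasure_space_measure[OF level_sets] by (simp add: level_def less_imp_le)

lemma emeasure_translate: "Y \<in> sets borel \<Longrightarrow> emeasure lborel {x. x + c \<in> Y} = emeasure lborel (Y :: real set)"
proof -
  assume Y: "Y \<in> sets borel"
  have "emeasure lborel Y = emeasure (distr lborel borel ((+) c)) Y" by (simp add: lborel_distr_plus)
  also have "\<dots> = emeasure lborel ((+) c -` Y \<inter> space lborel)" using Y by (intro emeasure_distr) auto
  also have "(+) c -` Y \<inter> space lborel = {x. x + c \<in> Y}" by (auto simp: add.commute)
  finally show ?thesis ..
qed

text \<open>All levels except the top one; \<open>upper\<close> has all except the base.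
  \<open>T\<close> maps the first union onto the second by translations of levels, and both exhaust
  the space as \<open>j\<close> grows.\<close>

definition bottom :: "nat \<Rightarrow> real set" where
  "bottom j = (\<Union>q<H j - 1. level j q)"

definition upper :: "nat \<Rightarrow> real set" where
  "upper j = (\<Union>q<H j - 1. level j (Suc q))"

lemma bottom_Suc: "bottom j \<subseteq> bottom (Suc j)" and upper_Suc: "upper j \<subseteq> upper (Suc j)"
proof -
  show "bottom j \<subseteq> bottom (Suc j)"
  proof
    fix x assume "x \<in> bottom j"
    then obtain q where q: "q + 1 < H j" "x \<in> level j q" by (auto simp: bottom_def less_diff_conv)
    then obtain i where i: "i < r j" "x \<in> level (Suc j) (P j i + q)" using level_cut[of q j] by auto
    then show "x \<in> bottom (Suc j)" using block_less[OF i(1) q(1)] by (auto simp: bottom_def less_diff_conv intro!: bexI[of _ "P j i + q"])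
  qed
  show "upper j \<subseteq> upper (Suc j)"
  proof
    fix x assume "x \<in> upper j"
    then obtain q where q: "Suc q < H j" "x \<in> level j (Suc q)" by (auto simp: upper_def less_diff_conv)
    then obtain i where i: "i < r j" "x \<in> level (Suc j) (P j i + Suc q)" using level_cut[of "Suc q" j] by auto
    then show "x \<in> upper (Suc j)" using block_less[OF i(1) q(1)] by (auto simp: upper_def less_diff_conv intro!: bexI[of _ "P j i + q"])
  qed
qed

lemma UN_bottom: "(\<Union>j. bottom j) = whole" and UN_upper: "(\<Union>j. upper j) = whole"
proof -
  show "(\<Union>j. bottom j) = whole"
  proof (intro equalityI subsetI)
    fix x assume "x \<in> whole"
    then obtain j q where "x \<in> level j q" "q + 1 < H j" by (rule whole_deep[of x 1 0])
    then have "x \<in> bottom j" by (auto simp: bottom_def less_diff_conv)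
    then show "x \<in> (\<Union>j. bottom j)" by blast
  next
    fix x assume "x \<in> (\<Union>j. bottom j)"
    then obtain j q where "x \<in> level j q" "q + 1 < H j" by (auto simp: bottom_def less_diff_conv)
    then show "x \<in> whole" using level_in_whole[of q j] by auto
  qed
  show "(\<Union>j. upper j) = whole"
  proof (intro equalityI subsetI)
    fix x assume "x \<in> whole"
    then obtain j q where "x \<in> level j (Suc q)" "Suc q < H j" by (rule whole_positive_level)
    then have "x \<in> upper j" by (auto simp: upper_def less_diff_conv)
    then show "x \<in> (\<Union>j. upper j)" by blast
  next
    fix x assume "x \<in> (\<Union>j. upper j)"
    then obtain j q where "x \<in> level j (Suc q)" "Suc q < H j" by (auto simp: upper_def less_diff_conv)
    then show "x \<in> whole" using level_in_whole[of "Suc q" j] by auto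
  qed
qed

lemma T_vimage_level:
  assumes "Suc q < H j" "Y \<subseteq> whole"
  shows "T -` Y \<inter> level j q = {x. x + (lev j (Suc q) - lev j q) \<in> Y \<inter> level j (Suc q)}"
proof (rule set_eqI)
  fix x
  have iff: "x + (lev j (Suc q) - lev j q) \<in> level j (Suc q) \<longleftrightarrow> x \<in> level j q"
    by (auto simp: level_def)
  show "x \<in> T -` Y \<inter> level j q \<longleftrightarrow> x \<in> {x. x + (lev j (Suc q) - lev j q) \<in> Y \<inter> level j (Suc q)}"
  proof (cases "x \<in> level j q")
    case True
    then have "T x = x + (lev j (Suc q) - lev j q)" using T_level[of q j x] assms(1) by simp
    then show ?thesis using iff True by simp
  qed (use iff in simp)
qed

lemma T_vimage_borel:
  assumes "Y \<in> sets space_measure" shows "T -` Y \<inter> whole \<in> sets borel"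
proof -
  have Y: "Y \<in> sets borel" "Y \<subseteq> whole" using assms by (auto simp: sets_space_measure)
  have "T -` Y \<inter> whole = (\<Union>j. \<Union>q<H j - 1. T -` Y \<inter> level j q)"
    unfolding UN_bottom[symmetric] bottom_def by auto
  also have "\<dots> = (\<Union>j. \<Union>q<H j - 1. {x. x + (lev j (Suc q) - lev j q) \<in> Y \<inter> level j (Suc q)})"
    by (intro SUP_cong refl T_vimage_level Y) auto
  also have "\<dots> \<in> sets borel"
  proof (intro sets.countable_UN sets.finite_UN image_subsetI)
    fix j q
    have "(\<lambda>x. x + (lev j (Suc q) - lev j q)) -` (Y \<inter> level j (Suc q)) \<inter> space borel \<in> sets borel"
      using Y by (intro measurable_sets[of _ _ borel]) auto
    then show "{x. x + (lev j (Suc q) - lev j q) \<in> Y \<inter> level j (Suc q)} \<in> sets borel"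
      by (simp add: vimage_def)
  qed
  finally show ?thesis .
qed

text \<open>Level by level the preimage is a translate, so the parts in \<open>bottom j\<close> and
  \<open>upper j\<close> have equal measure. Continuity from below finishes the proof even if the
  measures are infinite.\<close>

lemma emeasure_T_vimage:
  assumes "Y \<in> sets space_measure" shows "emeasure lborel (T -` Y \<inter> whole) = emeasure lborel Y"
proof -
  have Y: "Y \<in> sets borel" "Y \<subseteq> whole" using assms by (auto simp: sets_space_measure)
  have TY: "T -` Y \<inter> whole \<in> sets borel" by (rule T_vimage_borel) fact
  have [measurable]: "bottom j \<in> sets borel" "upper j \<in> sets borel" for j
    unfolding bottom_def upper_def by (intro sets.finite_UN; simp)+
  have bw: "bottom j \<subseteq> whole" "upper j \<subseteq> whole" for j using UN_bottom UN_upper by auto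
  have step: "emeasure lborel (T -` Y \<inter> bottom j) = emeasure lborel (Y \<inter> upper j)" for j
  proof -
    have lev_meas: "T -` Y \<inter> level j q \<in> sets lborel" if "q < H j - 1" for q
    proof -
      have "q < H j" using that by simp
      then have "T -` Y \<inter> level j q = (T -` Y \<inter> whole) \<inter> level j q" using level_in_whole[of q j] by auto
      then show ?thesis using TY by auto
    qed
    have d1: "level j q \<inter> level j q' = {}" if "q < H j - 1" "q' < H j - 1" "q \<noteq> q'" for q q'
      using level_disjoint[of q j q'] that by simp
    have d2: "level j (Suc q) \<inter> level j (Suc q') = {}" if "q < H j - 1" "q' < H j - 1" "q \<noteq> q'" for q q'
      using level_disjoint[of "Suc q" j "Suc q'"] that by simp
    have "emeasure lborel (T -` Y \<inter> bottom j) = emeasure lborel (\<Union>q<H j - 1. T -` Y \<inter> level j q)"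
      by (intro arg_cong[where f = "emeasure lborel"]) (auto simp: bottom_def)
    also have "\<dots> = (\<Sum>q<H j - 1. emeasure lborel (T -` Y \<inter> level j q))"
    proof (rule sum_emeasure[symmetric])
      show "(\<lambda>q. T -` Y \<inter> level j q) ` {..<H j - 1} \<subseteq> sets lborel" using lev_meas by blast
      show "disjoint_family_on (\<lambda>q. T -` Y \<inter> level j q) {..<H j - 1}"
        unfolding disjoint_family_on_def using d1 by blast
    qed simp
    also have "\<dots> = (\<Sum>q<H j - 1. emeasure lborel (Y \<inter> level j (Suc q)))"
    proof (intro sum.cong refl)
      fix q assume "q \<in> {..<H j - 1}"
      then have q: "Suc q < H j" by auto
      show "emeasure lborel (T -` Y \<inter> level j q) = emeasure lborel (Y \<inter> level j (Suc q))"
        unfolding T_vimage_level[OF q Y(2)] using Y(1) by (intro emeasure_translate) auto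
    qed
    also have "\<dots> = emeasure lborel (\<Union>q<H j - 1. Y \<inter> level j (Suc q))"
    proof (rule sum_emeasure)
      show "(\<lambda>q. Y \<inter> level j (Suc q)) ` {..<H j - 1} \<subseteq> sets lborel" using Y(1) by auto
      show "disjoint_family_on (\<lambda>q. Y \<inter> level j (Suc q)) {..<H j - 1}"
        unfolding disjoint_family_on_def using d2 by blast
    qed simp
    also have "\<dots> = emeasure lborel (Y \<inter> upper j)"
      by (intro arg_cong[where f = "emeasure lborel"]) (auto simp: upper_def)
    finally show ?thesis .
  qed
  have TYb: "T -` Y \<inter> bottom j \<in> sets lborel" for j
  proof -
    have "T -` Y \<inter> bottom j = (T -` Y \<inter> whole) \<inter> bottom j" using bw by auto
    then show ?thesis using TY by auto
  qed
  have "emeasure lborel (T -` Y \<inter> whole) = emeasure lborel (\<Union>j. T -` Y \<inter> bottom j)"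
    by (intro arg_cong[where f = "emeasure lborel"]) (auto simp: UN_bottom[symmetric])
  also have "\<dots> = (SUP j. emeasure lborel (T -` Y \<inter> bottom j))"
    using TYb bottom_Suc by (intro SUP_emeasure_incseq[symmetric] incseq_SucI) auto
  also have "\<dots> = (SUP j. emeasure lborel (Y \<inter> upper j))" by (simp add: step)
  also have "\<dots> = emeasure lborel (\<Union>j. Y \<inter> upper j)"
    using Y(1) upper_Suc by (intro SUP_emeasure_incseq incseq_SucI) auto
  also have "(\<Union>j. Y \<inter> upper j) = Y" using Y(2) UN_upper by auto
  finally show ?thesis .
qed

lemma T_image_borel:
  assumes "Y \<in> sets space_measure" shows "T ` Y \<in> sets borel"
proof -
  have Y: "Y \<in> sets borel" "Y \<subseteq> whole" using assms by (auto simp: sets_space_measure)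
  have "Y = (\<Union>j. \<Union>q<H j - 1. Y \<inter> level j q)"
    using Y(2) unfolding UN_bottom[symmetric] bottom_def by blast
  then have "T ` Y = T ` (\<Union>j. \<Union>q<H j - 1. Y \<inter> level j q)" by (rule arg_cong)
  also have "\<dots> = (\<Union>j. \<Union>q<H j - 1. T ` (Y \<inter> level j q))" by (simp only: image_UN)
  also have "\<dots> = (\<Union>j. \<Union>q<H j - 1. {y. y + (lev j q - lev j (Suc q)) \<in> Y \<inter> level j q})"
  proof (intro SUP_cong refl)
    fix j q assume "q \<in> {..<H j - 1}"
    then have q: "q + 1 < H j" by auto
    have "T ` (Y \<inter> level j q) = (\<lambda>x. x + (lev j (Suc q) - lev j q)) ` (Y \<inter> level j q)"
      using T_level[OF q] by (intro image_cong) auto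
    also have "\<dots> = {y. y + (lev j q - lev j (Suc q)) \<in> Y \<inter> level j q}"
      by (auto simp: image_iff intro!: bexI[of _ "_ + (lev j q - lev j (Suc q))"])
    finally show "T ` (Y \<inter> level j q) = {y. y + (lev j q - lev j (Suc q)) \<in> Y \<inter> level j q}" .
  qed
  also have "\<dots> \<in> sets borel"
  proof (intro sets.countable_UN sets.finite_UN image_subsetI)
    fix j q
    have "(\<lambda>x. x + (lev j q - lev j (Suc q))) -` (Y \<inter> level j q) \<inter> space borel \<in> sets borel"
      using Y by (intro measurable_sets[of _ _ borel]) auto
    then show "{y. y + (lev j q - lev j (Suc q)) \<in> Y \<inter> level j q} \<in> sets borel"
      by (simp add: vimage_def)
  qed
  finally show ?thesis .
qed

theorem T_automorphism: "automorphism space_measure T"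
proof
  show T_meas: "T \<in> space_measure \<rightarrow>\<^sub>M space_measure"
  proof (rule measurableI)
    show "T x \<in> space space_measure" if "x \<in> space space_measure" for x
      using that T_bij by (auto simp: bij_betw_def)
    show "T -` Y \<inter> space space_measure \<in> sets space_measure" if "Y \<in> sets space_measure" for Y
      using T_vimage_borel[OF that] by (simp add: sets_space_measure)
  qed
  show "bij_betw T (space space_measure) (space space_measure)" using T_bij by simp
  show "inv_into (space space_measure) T \<in> space_measure \<rightarrow>\<^sub>M space_measure"
  proof (rule measurableI)
    show "inv_into (space space_measure) T x \<in> space space_measure" if "x \<in> space space_measure" for x
      using that bij_betwE[OF bij_betw_inv_into[OF T_bij]] by simp
    fix Y assume Y: "Y \<in> sets space_measure"
    then have "Y \<subseteq> whole" by (simp add: sets_space_measure)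
    have "inv_into whole T -` Y \<inter> whole = T ` Y"
    proof (intro equalityI subsetI)
      fix x assume "x \<in> inv_into whole T -` Y \<inter> whole"
      then show "x \<in> T ` Y" using bij_betw_inv_into_right[OF T_bij, of x] by (auto intro: image_eqI[OF sym])
    next
      fix x assume "x \<in> T ` Y"
      then obtain y where y: "y \<in> Y" "x = T y" by blast
      then have "y \<in> whole" using \<open>Y \<subseteq> whole\<close> by auto
      then show "x \<in> inv_into whole T -` Y \<inter> whole"
        using y bij_betw_inv_into_left[OF T_bij] bij_betwE[OF T_bij] by auto
    qed
    then show "inv_into (space space_measure) T -` Y \<inter> space space_measure \<in> sets space_measure"
      using T_image_borel[OF Y] bij_betwE[OF T_bij] \<open>Y \<subseteq> whole\<close> by (auto simp: sets_space_measure)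
  qed
  show "distr space_measure space_measure T = space_measure"
  proof (rule measure_eqI)
    fix Y assume "Y \<in> sets (distr space_measure space_measure T)"
    then have Y: "Y \<in> sets space_measure" by simp
    have "emeasure (distr space_measure space_measure T) Y = emeasure space_measure (T -` Y \<inter> whole)"
      using emeasure_distr[OF T_meas Y] by simp
    also have "\<dots> = emeasure lborel (T -` Y \<inter> whole)"
      using T_vimage_borel[OF Y] by (intro emeasure_space_measure) (simp add: sets_space_measure)
    also have "\<dots> = emeasure space_measure Y"
      using emeasure_T_vimage[OF Y] emeasure_space_measure[OF Y] by simp
    finally show "emeasure (distr space_measure space_measure T) Y = emeasure space_measure Y" .
  qed simp
qed

end

section \<open>Tensor powers\<close>

lemma space_tensor_space: "space (tensor_space n M) = ({..<n} \<rightarrow>\<^sub>E space M)"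
  by (simp add: tensor_space_def space_PiM)

text \<open>Since the generator contains the whole space, restricting a single coordinate is already
  a box; such cylinders generate the product sigma-algebra.\<close>

lemma tensor_space_sigma_sets:
  assumes gen: "sets M = sigma_sets (space M) \<L>" "\<L> \<subseteq> Pow (space M)" "space M \<in> \<L>"
  shows "sets (tensor_space n M) =
    sigma_sets (space (tensor_space n M)) {Pi\<^sub>E {..<n} F | F. \<forall>i<n. F i \<in> \<L>}" (is "_ = sigma_sets ?\<Omega> ?\<C>")
proof (rule antisym)
  have C_sub: "?\<C> \<subseteq> Pow ?\<Omega>"
  proof
    fix C assume "C \<in> ?\<C>"
    then obtain F where F: "C = Pi\<^sub>E {..<n} F" "\<forall>i<n. F i \<in> \<L>" by blast
    have "C \<subseteq> ({..<n} \<rightarrow>\<^sub>E space M)" unfolding F(1) using F(2) gen(2) by (intro PiE_mono) auto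
    then show "C \<in> Pow ?\<Omega>" by (simp add: space_tensor_space)
  qed
  interpret S: sigma_algebra ?\<Omega> "sigma_sets ?\<Omega> ?\<C>" by (rule sigma_algebra_sigma_sets[OF C_sub])
  have coord: "{f \<in> ?\<Omega>. f i \<in> A} \<in> sigma_sets ?\<Omega> ?\<C>" if i: "i < n" and "A \<in> sigma_sets (space M) \<L>" for i A
    using that(2)
  proof induction
    case (Basic A)
    have A: "A \<subseteq> space M" using Basic gen(2) by auto
    have "{f \<in> ?\<Omega>. f i \<in> A} = Pi\<^sub>E {..<n} (\<lambda>k. if k = i then A else space M)"
    proof (rule set_eqI)
      fix f
      have "f k \<in> space M" if "f \<in> Pi\<^sub>E {..<n} (\<lambda>k. if k = i then A else space M)" "k < n" for k
        using PiE_mem[OF that(1), of k] that(2) A by (auto split: if_splits)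
      then show "f \<in> {f \<in> ?\<Omega>. f i \<in> A} \<longleftrightarrow> f \<in> Pi\<^sub>E {..<n} (\<lambda>k. if k = i then A else space M)"
        unfolding space_tensor_space using i by (auto simp: PiE_iff split: if_splits)
    qed
    also have "\<dots> \<in> ?\<C>" using Basic gen(3) by auto
    finally show ?case by (rule sigma_sets.Basic)
  next
    case Empty
    show ?case by simp
  next
    case (Compl A)
    have "{f \<in> ?\<Omega>. f i \<in> space M - A} = ?\<Omega> - {f \<in> ?\<Omega>. f i \<in> A}"
    proof -
      have "f i \<in> space M" if "f \<in> ?\<Omega>" for f using that i by (auto simp: space_tensor_space)
      then show ?thesis by blast
    qed
    then show ?case using S.compl_sets[OF Compl.IH] by simp
  next
    case (Union A)
    have "{f \<in> ?\<Omega>. f i \<in> (\<Union>k. A k)} = (\<Union>k. {f \<in> ?\<Omega>. f i \<in> A k})" by auto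
    also have "\<dots> \<in> sigma_sets ?\<Omega> ?\<C>" by (intro sigma_sets.Union Union.IH)
    finally show ?case .
  qed
  have "sets (tensor_space n M) =
      sigma_sets ?\<Omega> {{f \<in> ?\<Omega>. f i \<in> A} | i A. i \<in> {..<n} \<and> A \<in> sets M}"
    unfolding tensor_space_def by (simp only: sets_PiM_single space_PiM)
  also have "\<dots> \<subseteq> sigma_sets ?\<Omega> ?\<C>"
  proof (rule S.sigma_sets_subset, rule subsetI)
    fix B assume "B \<in> {{f \<in> ?\<Omega>. f i \<in> A} | i A. i \<in> {..<n} \<and> A \<in> sets M}"
    then obtain i A where B: "B = {f \<in> ?\<Omega>. f i \<in> A}" "i < n" "A \<in> sigma_sets (space M) \<L>"
      using gen(1) by blast
    show "B \<in> sigma_sets ?\<Omega> ?\<C>" unfolding B(1) using B(2,3) by (rule coord)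
  qed
  finally show "sets (tensor_space n M) \<subseteq> sigma_sets ?\<Omega> ?\<C>" .
  have "\<L> \<subseteq> sets M" unfolding gen(1) by (rule sigma_sets_superset_generator)
  then have "?\<C> \<subseteq> sets (tensor_space n M)"
  proof (intro subsetI)
    fix C assume "C \<in> ?\<C>"
    then obtain F where F: "C = Pi\<^sub>E {..<n} F" "\<forall>i<n. F i \<in> \<L>" by blast
    show "C \<in> sets (tensor_space n M)"
      unfolding tensor_space_def F(1) using F(2) \<open>\<L> \<subseteq> sets M\<close> by (intro sets_PiM_I_finite) auto
  qed
  then show "sigma_sets ?\<Omega> ?\<C> \<subseteq> sets (tensor_space n M)"
    by (rule sets.sigma_sets_subset)
qed

locale sigma_finite_automorphism = automorphism M S + sigma_finite_measure M
  for M :: "'a measure" and S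
begin

lemma product_sigma_finite: "product_sigma_finite (\<lambda>_. M)"
  by (rule product_sigma_finite.intro) (rule sigma_finite_measure_axioms)

lemma emeasure_box:
  "(\<And>i. i < n \<Longrightarrow> F i \<in> sets M) \<Longrightarrow>
    emeasure (tensor_space n M) (Pi\<^sub>E {..<n} F) = (\<Prod>i<n. emeasure M (F i))"
  unfolding tensor_space_def by (rule product_sigma_finite.emeasure_PiM[OF product_sigma_finite]) auto

lemma tensor_power_space:
  "x \<in> space (tensor_space n M) \<Longrightarrow> (\<And>y. y \<in> space M \<Longrightarrow> R y \<in> space M) \<Longrightarrow>
    tensor_power n R x \<in> space (tensor_space n M)"
proof -
  assume x: "x \<in> space (tensor_space n M)" and R: "\<And>y. y \<in> space M \<Longrightarrow> R y \<in> space M"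
  have "R (x i) \<in> space M" if "i < n" for i
    using x that by (intro R) (simp add: space_tensor_space PiE_iff)
  then show ?thesis by (simp add: tensor_power_def space_tensor_space)
qed

lemma tensor_power_measurable:
  assumes "R \<in> M \<rightarrow>\<^sub>M M" shows "tensor_power n R \<in> tensor_space n M \<rightarrow>\<^sub>M tensor_space n M"
  unfolding tensor_power_def tensor_space_def
proof (rule measurable_restrict)
  fix i assume "i \<in> {..<n}"
  then have "(\<lambda>x. x i) \<in> Pi\<^sub>M {..<n} (\<lambda>_. M) \<rightarrow>\<^sub>M M" by (rule measurable_component_singleton)
  then show "(\<lambda>x. R (x i)) \<in> Pi\<^sub>M {..<n} (\<lambda>_. M) \<rightarrow>\<^sub>M M" using assms by (rule measurable_compose)
qed

lemma tensor_power_inverse: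
  assumes x: "x \<in> space (tensor_space n M)"
  shows "tensor_power n S (tensor_power n (inv_into (space M) S) x) = x"
    "tensor_power n (inv_into (space M) S) (tensor_power n S x) = x"
proof -
  have xi: "x i \<in> space M" if "i < n" for i using x that by (auto simp: space_tensor_space)
  have xu: "x i = undefined" if "\<not> i < n" for i
    using x that unfolding space_tensor_space by (elim PiE_arb) simp
  show "tensor_power n S (tensor_power n (inv_into (space M) S) x) = x"
    "tensor_power n (inv_into (space M) S) (tensor_power n S x) = x"
    by (rule ext, simp add: tensor_power_def restrict_def xi xu S_inv inv_S)+
qed

lemma tensor_bij: "bij_betw (tensor_power n S) (space (tensor_space n M)) (space (tensor_space n M))"
proof (rule bij_betw_byWitness[where f' = "tensor_power n (inv_into (space M) S)"])
  show "tensor_power n S ` space (tensor_space n M) \<subseteq> space (tensor_space n M)"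
    using tensor_power_space measurable_space[OF S_measurable] by blast
  show "tensor_power n (inv_into (space M) S) ` space (tensor_space n M) \<subseteq> space (tensor_space n M)"
    using tensor_power_space measurable_space[OF inv_measurable] by blast
qed (use tensor_power_inverse in blast)+

lemma tensor_inv_into:
  assumes x: "x \<in> space (tensor_space n M)"
  shows "inv_into (space (tensor_space n M)) (tensor_power n S) x = tensor_power n (inv_into (space M) S) x"
proof (rule inv_into_f_eq)
  show "inj_on (tensor_power n S) (space (tensor_space n M))" using tensor_bij by (simp add: bij_betw_def)
  show "tensor_power n (inv_into (space M) S) x \<in> space (tensor_space n M)"
    using x measurable_space[OF inv_measurable] by (rule tensor_power_space)
qed (rule tensor_power_inverse(1)[OF x])

theorem tensor_automorphism: "automorphism (tensor_space n M) (tensor_power n S)"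
proof
  show m: "tensor_power n S \<in> tensor_space n M \<rightarrow>\<^sub>M tensor_space n M"
    by (rule tensor_power_measurable) measurable
  show "bij_betw (tensor_power n S) (space (tensor_space n M)) (space (tensor_space n M))" by (rule tensor_bij)
  show "inv_into (space (tensor_space n M)) (tensor_power n S) \<in> tensor_space n M \<rightarrow>\<^sub>M tensor_space n M"
    using tensor_power_measurable[OF inv_measurable, of n] tensor_inv_into
    by (subst measurable_cong) auto
  have "distr (tensor_space n M) (tensor_space n M) (tensor_power n S) = PiM {..<n} (\<lambda>_. M)"
  proof (rule product_sigma_finite.PiM_eqI[OF product_sigma_finite])
    show "sets (distr (tensor_space n M) (tensor_space n M) (tensor_power n S)) = sets (PiM {..<n} (\<lambda>_. M))"
      by (simp add: tensor_space_def)
    fix F :: "nat \<Rightarrow> 'a set" assume F: "\<And>i. i \<in> {..<n} \<Longrightarrow> F i \<in> sets M"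
    have F': "F i \<subseteq> space M" if "i < n" for i using F that sets.sets_into_space by auto
    have "tensor_power n S -` Pi\<^sub>E {..<n} F \<inter> space (tensor_space n M) =
        Pi\<^sub>E {..<n} (\<lambda>i. S -` F i \<inter> space M)"
    proof (rule set_eqI)
      fix x
      show "x \<in> tensor_power n S -` Pi\<^sub>E {..<n} F \<inter> space (tensor_space n M) \<longleftrightarrow>
          x \<in> Pi\<^sub>E {..<n} (\<lambda>i. S -` F i \<inter> space M)"
        by (simp add: tensor_power_def space_tensor_space PiE_iff) blast
    qed
    then have "emeasure (distr (tensor_space n M) (tensor_space n M) (tensor_power n S)) (Pi\<^sub>E {..<n} F) =
        emeasure (tensor_space n M) (Pi\<^sub>E {..<n} (\<lambda>i. S -` F i \<inter> space M))"
      using F by (subst emeasure_distr[OF m]) (auto simp: tensor_space_def intro!: sets_PiM_I_finite)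
    also have "\<dots> = (\<Prod>i<n. emeasure M (S -` F i \<inter> space M))"
      using F by (intro emeasure_box) (auto intro: measurable_sets)
    also have "\<dots> = (\<Prod>i<n. emeasure M (F i))"
    proof (rule prod.cong[OF refl])
      fix i assume "i \<in> {..<n}"
      then show "emeasure M (S -` F i \<inter> space M) = emeasure M (F i)"
        using emeasure_distr[OF S_measurable, of "F i"] F distr_S by simp
    qed
    finally show "emeasure (distr (tensor_space n M) (tensor_space n M) (tensor_power n S)) (Pi\<^sub>E {..<n} F) =
        (\<Prod>i<n. emeasure M (F i))" .
  qed simp
  then show "distr (tensor_space n M) (tensor_space n M) (tensor_power n S) = tensor_space n M"
    by (simp add: tensor_space_def)
qed

lemma iterate_tensor:
  assumes x: "x \<in> space (tensor_space n M)"
  shows "iterate_int (tensor_space n M) (tensor_power n S) m x = (\<lambda>i\<in>{..<n}. iterate_int M S m (x i))"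
proof -
  interpret N: automorphism "tensor_space n M" "tensor_power n S" by (rule tensor_automorphism)
  have xi: "x i \<in> space M" if "i < n" for i using x that by (auto simp: space_tensor_space)
  have sp: "(\<lambda>i\<in>{..<n}. V m (x i)) \<in> space (tensor_space n M)" for m
    using xi by (auto simp: space_tensor_space)
  show ?thesis
  proof (induction m rule: int_induct[where k = 0])
    case base
    \<comment> \<open>Points of the product space are extensional, so the restriction to
      \<open>{..<n}\<close> gives back \<open>x\<close> itself.\<close>
    have "x i = undefined" if "\<not> i < n" for i
      using x that unfolding space_tensor_space by (elim PiE_arb) simp
    then show ?case by (intro ext) (simp add: restrict_def)
  next
    case (step1 m)
    then show ?case
      unfolding N.V_Suc[OF x] step1(2)
      by (intro ext) (simp add: V_Suc[OF xi] tensor_power_def restrict_def)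
  next
    case (step2 m)
    then show ?case
      unfolding N.V_pred[OF x] step2(2) tensor_inv_into[OF sp]
      by (intro ext) (simp add: V_pred[OF xi] tensor_power_def restrict_def)
  qed
qed

end

section \<open>Spectral types of the tensor powers\<close>

context lacunary
begin

lemma sigma_finite_space_measure: "sigma_finite_measure space_measure"
  unfolding space_measure_def
  by (rule sigma_finite_measure_restrict_space) (auto intro: lborel.sigma_finite_measure_axioms)

sublocale base: sigma_finite_automorphism space_measure T
  using T_automorphism sigma_finite_space_measure by (simp add: sigma_finite_automorphism_def)

text \<open>The autocorrelation of the set of copies of tower \<open>j\<close> in tower
  \<open>j + t\<close>.\<close>

definition cnt :: "nat \<Rightarrow> nat \<Rightarrow> int \<Rightarrow> real" where
  "cnt j t m = (\<Sum>p\<in>positions j t. \<Sum>p'\<in>positions j t. of_bool (int p' - int p = m))"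

lemma sum_positions_Suc:
  "(\<Sum>p\<in>positions j (Suc t). f p) = (\<Sum>i<r (j + t). \<Sum>p\<in>positions j t. f (P (j + t) i + p))"
proof -
  have "inj_on (\<lambda>(i, p). P (j + t) i + p) ({..<r (j + t)} \<times> positions j t)"
  proof (rule inj_onI, clarify)
    fix i p i' p' assume "p \<in> positions j t" "p' \<in> positions j t" "P (j + t) i + p = P (j + t) i' + p'"
    then show "i = i' \<and> p = p'"
      using P_block_unique[of "j + t" i p i' p'] positions_less[of _ j t 0] by simp
  qed
  then show ?thesis by (simp add: sum.reindex sum.cartesian_product case_prod_unfold)
qed

lemma sum_square_gap:
  "(\<Sum>i<r k. \<Sum>l<r k. f (gap k (i, l))) = real (r k) * f 0 + (\<Sum>p\<in>off_diagonal k. f (gap k p))"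
proof -
  have "(\<Sum>i<r k. \<Sum>l<r k. f (gap k (i, l))) = (\<Sum>p\<in>{..<r k} \<times> {..<r k}. f (gap k p))"
    by (simp add: sum.cartesian_product)
  also have "\<dots> = (\<Sum>p\<in>off_diagonal k \<union> (\<lambda>i. (i, i)) ` {..<r k}. f (gap k p))"
    by (rule sum.cong) (auto simp: off_diagonal_def)
  also have "\<dots> = (\<Sum>p\<in>off_diagonal k. f (gap k p)) + (\<Sum>p\<in>(\<lambda>i. (i, i)) ` {..<r k}. f (gap k p))"
    by (rule sum.union_disjoint) (simp, simp, auto simp: off_diagonal_def)
  also have "(\<Sum>p\<in>(\<lambda>i. (i, i)) ` {..<r k}. f (gap k p)) = real (r k) * f 0"
    by (subst sum.reindex) (auto intro: inj_onI)
  finally show ?thesis by simp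
qed

text \<open>Splitting positions by the last column reproduces the recursion of \<open>A\<close> for
  \<open>n = 1\<close>: equal columns contribute a factor \<open>r\<close>, which turns the new
  width into the old one, and different columns contribute their gaps.\<close>

lemma cnt_A: "cnt j t m * width (j + t) = width j * A 1 j t m"
proof (induction t arbitrary: m)
  case 0
  show ?case by (simp add: cnt_def)
next
  case (Suc t)
  let ?k = "j + t"
  have "cnt j (Suc t) m = (\<Sum>i<r ?k. \<Sum>p\<in>positions j t. \<Sum>l<r ?k. \<Sum>p'\<in>positions j t.
      of_bool (int (P ?k l + p') - int (P ?k i + p) = m))"
    unfolding cnt_def sum_positions_Suc ..
  also have "\<dots> = (\<Sum>i<r ?k. \<Sum>l<r ?k. \<Sum>p\<in>positions j t. \<Sum>p'\<in>positions j t.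
      of_bool (int (P ?k l + p') - int (P ?k i + p) = m))"
    by (intro sum.cong refl sum.swap)
  also have "\<dots> = (\<Sum>i<r ?k. \<Sum>l<r ?k. cnt j t (m + gap ?k (i, l)))"
    unfolding cnt_def by (intro sum.cong refl arg_cong[where f = of_bool]) (auto simp: gap_def)
  also have "\<dots> = real (r ?k) * cnt j t m + (\<Sum>p\<in>off_diagonal ?k. cnt j t (m + gap ?k p))"
    using sum_square_gap[of "\<lambda>g. cnt j t (m + g)" ?k] by simp
  finally have "cnt j (Suc t) m * width (Suc ?k) =
      cnt j t m * (r ?k * width (Suc ?k)) + (\<Sum>p\<in>off_diagonal ?k. cnt j t (m + gap ?k p) * width (Suc ?k))"
    by (simp add: algebra_simps sum_distrib_left)
  also have "(\<Sum>p\<in>off_diagonal ?k. cnt j t (m + gap ?k p) * width (Suc ?k)) =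
      (\<Sum>p\<in>off_diagonal ?k. width j * A 1 j t (m + gap ?k p)) / r ?k"
    unfolding sum_divide_distrib
  proof (rule sum.cong[OF refl])
    fix p
    have "cnt j t (m + gap ?k p) * width (Suc ?k) = cnt j t (m + gap ?k p) * width ?k / r ?k"
      by (simp add: width.simps(2))
    then show "cnt j t (m + gap ?k p) * width (Suc ?k) = width j * A 1 j t (m + gap ?k p) / r ?k"
      by (simp only: Suc.IH)
  qed
  also have "cnt j t m * (r ?k * width (Suc ?k)) = width j * A 1 j t m"
    using Suc.IH[of m] width_eq[of ?k] by (simp only:)
  finally show ?case by (simp add: algebra_simps sum_distrib_left)
qed

text \<open>In a late tower the return set is a union of levels, one for each copy whose translate
  by the time is again a copy; their number is the autocorrelation. A negative time is reduced to a
  positive one by moving the return set along the orbit.\<close>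

lemma emeasure_level_return:
  assumes q: "q < H j"
  shows "emeasure space_measure {x \<in> level j q. base.V m x \<in> level j q} = ennreal (width j * a 1 j m)"
proof -
  have nonneg: "emeasure space_measure {x \<in> level j q. (T ^^ k) x \<in> level j q} = ennreal (width j * a 1 j (int k))" for k
  proof -
    \<comment> \<open>Late enough for two purposes: \<open>k\<close> levels remain above every copy,
      and \<open>8 * k \<le> H (j + t)\<close>, so that the coefficient at \<open>k\<close> is
      already stable.\<close>
    define t where "t = Suc (8 * k)"
    let ?S = "positions j t"
    let ?D = "{p \<in> ?S. p + k \<in> ?S}"
    have deep: "p + q + k < H (j + t)" if "p \<in> ?S" for p
      using positions_deep[OF that[unfolded t_def] q] by (simp add: t_def)
    have less: "p + q < H (j + t)" if "p \<in> ?S" for p using positions_less[OF that q] .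
    have eq: "{x \<in> level j q. (T ^^ k) x \<in> level j q} = (\<Union>p\<in>?D. level (j + t) (p + q))"
    proof (intro equalityI subsetI)
      fix x assume x: "x \<in> {x \<in> level j q. (T ^^ k) x \<in> level j q}"
      obtain p where p: "p \<in> ?S" "x \<in> level (j + t) (p + q)" using level_positions[OF q, of t] x by blast
      obtain p' where p': "p' \<in> ?S" "(T ^^ k) x \<in> level (j + t) (p' + q)" using level_positions[OF q, of t] x by blast
      have "(T ^^ k) x \<in> level (j + t) (p + q + k)" by (rule T_power_level(2)[OF deep[OF p(1)] p(2)])
      then have "p + q + k = p' + q" using level_unique p'(2) deep[OF p(1)] less[OF p'(1)] by blast
      then show "x \<in> (\<Union>p\<in>?D. level (j + t) (p + q))" using p p'(1) by auto
    next
      fix x assume "x \<in> (\<Union>p\<in>?D. level (j + t) (p + q))"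
      then obtain p where p: "p \<in> ?S" "p + k \<in> ?S" "x \<in> level (j + t) (p + q)" by auto
      have "(T ^^ k) x \<in> level (j + t) (p + k + q)"
        using T_power_level(2)[OF deep[OF p(1)] p(3)] by (simp add: add_ac)
      then show "x \<in> {x \<in> level j q. (T ^^ k) x \<in> level j q}"
        using p level_positions[OF q, of t] by blast
    qed
    have "emeasure space_measure {x \<in> level j q. (T ^^ k) x \<in> level j q} =
        (\<Sum>p\<in>?D. emeasure space_measure (level (j + t) (p + q)))"
      unfolding eq
    proof (rule sum_emeasure[symmetric])
      show "(\<lambda>p. level (j + t) (p + q)) ` ?D \<subseteq> sets space_measure" using less level_sets by blast
      show "disjoint_family_on (\<lambda>p. level (j + t) (p + q)) ?D"
        unfolding disjoint_family_on_def using level_disjoint less by (metis (no_types, lifting) add_right_cancel mem_Collect_eq)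
    qed simp
    also have "\<dots> = (\<Sum>p\<in>?D. ennreal (width (j + t)))"
    proof (rule sum.cong[OF refl])
      fix p assume "p \<in> ?D"
      then have "p \<in> ?S" by simp
      then show "emeasure space_measure (level (j + t) (p + q)) = ennreal (width (j + t))"
        by (rule emeasure_level[OF less])
    qed
    also have "\<dots> = ennreal (real (card ?D) * width (j + t))"
      by (simp add: ennreal_mult ennreal_of_nat_eq_real_of_nat)
    finally have em: "emeasure space_measure {x \<in> level j q. (T ^^ k) x \<in> level j q} =
        ennreal (real (card ?D) * width (j + t))" .
    have card: "real (card ?D) = cnt j t (int k)"
    proof -
      have "(\<Sum>p'\<in>?S. of_bool (int p' - int p = int k)) = (of_bool (p + k \<in> ?S) :: real)" for p
      proof -
        have "(\<Sum>p'\<in>?S. of_bool (int p' - int p = int k)) = (\<Sum>p'\<in>?S. if p' = p + k then 1 else (0::real))"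
          by (intro sum.cong) auto
        then show ?thesis by simp
      qed
      then show ?thesis by (simp add: cnt_def Int_def)
    qed
    have "cnt j t (int k) * width (j + t) = width j * a 1 j (int k)"
    proof -
      have "8 * \<bar>int k\<bar> \<le> int (H (j + t))" using H_ge[of "j + t"] by (simp add: t_def)
      then show ?thesis unfolding cnt_A by (simp add: A_eq_a)
    qed
    then show ?thesis unfolding em card by simp
  qed
  show ?thesis
  proof (cases "0 \<le> m")
    case True
    then obtain k where "m = int k" using nonneg_int_cases by blast
    then show ?thesis using nonneg[of k] by (simp add: base.V_of_nat)
  next
    case False
    define k where "k = nat (- m)"
    have m: "m = - int k" using False by (simp add: k_def)
    let ?B = "{x \<in> level j q. base.V (int k) x \<in> level j q}"
    have sub: "level j q \<subseteq> whole" using level_in_whole q by blast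
    have "{x \<in> level j q. base.V m x \<in> level j q} = base.V (int k) ` ?B"
    proof (intro equalityI subsetI)
      fix x assume "x \<in> {x \<in> level j q. base.V m x \<in> level j q}"
      then have "base.V m x \<in> ?B" "x = base.V (int k) (base.V m x)"
        using sub by (auto simp: m)
      then show "x \<in> base.V (int k) ` ?B" by blast
    qed (use sub in \<open>auto simp: m\<close>)
    moreover have "?B \<in> sets space_measure"
    proof -
      have "?B = base.V (int k) -` level j q \<inter> space space_measure \<inter> level j q" using sub by auto
      moreover have "base.V (int k) -` level j q \<inter> space space_measure \<in> sets space_measure"
        by (rule measurable_sets[OF base.V_measurable level_sets[OF q]])
      ultimately show ?thesis using level_sets[OF q] by (simp only: sets.Int)
    qed
    ultimately have "emeasure space_measure {x \<in> level j q. base.V m x \<in> level j q} = emeasure space_measure ?B"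
      by (simp add: base.emeasure_V_image)
    then show ?thesis using nonneg[of k] by (simp add: m base.V_of_nat a_uminus)
  qed
qed

section \<open>Cells of the tensor power\<close>

definition addresses :: "nat \<Rightarrow> nat \<Rightarrow> (nat \<Rightarrow> nat) set" where
  "addresses n j = ({..<n} \<rightarrow>\<^sub>E {..<H j})"

definition cell :: "nat \<Rightarrow> nat \<Rightarrow> (nat \<Rightarrow> nat) \<Rightarrow> (nat \<Rightarrow> real) set" where
  "cell n j q = Pi\<^sub>E {..<n} (\<lambda>i. level j (q i))"

definition tower_power :: "nat \<Rightarrow> nat \<Rightarrow> (nat \<Rightarrow> real) set" where
  "tower_power n j = Pi\<^sub>E {..<n} (\<lambda>_. tower_set j)"

abbreviation MM :: "nat \<Rightarrow> (nat \<Rightarrow> real) measure" where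
  "MM n \<equiv> tensor_space n space_measure"

abbreviation TT :: "nat \<Rightarrow> (nat \<Rightarrow> real) \<Rightarrow> nat \<Rightarrow> real" where
  "TT n \<equiv> tensor_power n T"

lemma finite_addresses [simp]: "finite (addresses n j)"
  unfolding addresses_def by (intro finite_PiE) auto

lemma addresses_less: "q \<in> addresses n j \<Longrightarrow> i < n \<Longrightarrow> q i < H j"
  by (auto simp: addresses_def)

lemma cell_sets: "q \<in> addresses n j \<Longrightarrow> cell n j q \<in> sets (MM n)"
  unfolding cell_def tensor_space_def by (intro sets_PiM_I_finite level_sets addresses_less) auto

lemma emeasure_cell: "q \<in> addresses n j \<Longrightarrow> emeasure (MM n) (cell n j q) = ennreal (width j ^ n)"
  unfolding cell_def using addresses_less
  by (subst base.emeasure_box) (auto simp: emeasure_level ennreal_power)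

lemma cell_unique: "x \<in> cell n j q \<Longrightarrow> x \<in> cell n j q' \<Longrightarrow> q \<in> addresses n j \<Longrightarrow> q' \<in> addresses n j \<Longrightarrow> q = q'"
  unfolding cell_def addresses_def
  by (rule PiE_ext[of q "{..<n}" "\<lambda>_. {..<H j}"]) (auto intro: level_unique)

lemma tower_set_sets [measurable]: "tower_set j \<in> sets space_measure"
  by (auto simp: sets_space_measure whole_def)

lemma tower_power_sets [measurable]: "tower_power n j \<in> sets (MM n)"
  unfolding tower_power_def tensor_space_def by (intro sets_PiM_I_finite) auto

lemma tower_power_cells: "tower_power n j = (\<Union>q\<in>addresses n j. cell n j q)"
proof (intro equalityI subsetI)
  fix x assume x: "x \<in> tower_power n j"
  then have "\<forall>i\<in>{..<n}. \<exists>k. k < H j \<and> x i \<in> level j k"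
    by (auto simp: tower_power_def tower_set_def PiE_iff)
  then obtain q where q: "\<And>i. i < n \<Longrightarrow> q i < H j \<and> x i \<in> level j (q i)" by (metis lessThan_iff)
  have "restrict q {..<n} \<in> addresses n j" "x \<in> cell n j (restrict q {..<n})"
    using q x by (auto simp: addresses_def cell_def tower_power_def PiE_iff)
  then show "x \<in> (\<Union>q\<in>addresses n j. cell n j q)" by blast
next
  fix x assume "x \<in> (\<Union>q\<in>addresses n j. cell n j q)"
  then show "x \<in> tower_power n j"
    by (fastforce simp: addresses_def cell_def tower_power_def tower_set_def PiE_iff)
qed

lemma tower_power_finite: "emeasure (MM n) (tower_power n j) < \<infinity>"
proof -
  have "emeasure (MM n) (tower_power n j) \<le> (\<Sum>q\<in>addresses n j. emeasure (MM n) (cell n j q))"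
    unfolding tower_power_cells by (intro emeasure_subadditive_finite) (auto simp: cell_sets)
  also have "\<dots> < \<infinity>" by (simp add: emeasure_cell ennreal_mult_less_top of_nat_less_top)
  finally show ?thesis .
qed

lemma tower_power_mono: "j \<le> k \<Longrightarrow> tower_power n j \<subseteq> tower_power n k"
  unfolding tower_power_def by (intro PiE_mono tower_set_mono)

lemma UN_tower_power: "(\<Union>j. tower_power n j) = space (MM n)"
proof (intro equalityI subsetI)
  fix x assume x: "x \<in> space (MM n)"
  then have "\<forall>i\<in>{..<n}. \<exists>j. x i \<in> tower_set j" by (auto simp: space_tensor_space PiE_iff whole_def)
  then obtain f where f: "\<And>i. i < n \<Longrightarrow> x i \<in> tower_set (f i)" by (metis lessThan_iff)
  have "x i \<in> tower_set (\<Sum>i<n. f i)" if "i < n" for i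
  proof -
    have "f i \<le> (\<Sum>i<n. f i)" using that by (intro member_le_sum) auto
    then show ?thesis using tower_set_mono f[OF that] by blast
  qed
  then have "x \<in> tower_power n (\<Sum>i<n. f i)"
    using x by (auto simp: tower_power_def space_tensor_space PiE_iff)
  then show "x \<in> (\<Union>j. tower_power n j)" by blast
next
  fix x assume "x \<in> (\<Union>j. tower_power n j)"
  then show "x \<in> space (MM n)"
    by (auto simp: tower_power_def space_tensor_space PiE_iff whole_def)
qed

lemma cell_space: "q \<in> addresses n j \<Longrightarrow> cell n j q \<subseteq> space (MM n)"
  using sets.sets_into_space cell_sets by blast

text \<open>The coordinates move independently, so the correlation of a cell is the
  \<open>n\<close>-th power of that of a level, and \<open>a_power\<close> turns it into a
  coefficient of \<open>lam n j\<close>. The result does not depend on the address.\<close>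

lemma cell_coeff:
  assumes n: "n \<ge> 1" and q: "q \<in> addresses n j"
  shows "L2_inner (MM n) (koopman_power (MM n) (TT n) m (indicator (cell n j q))) (indicator (cell n j q)) =
    of_real (width j ^ n) * (\<integral>z. z powi m \<partial>lam n j)"
proof -
  let ?B = "\<lambda>i. {x \<in> level j (q i). base.V m x \<in> level j (q i)}"
  have sub: "level j (q i) \<subseteq> whole" if "i < n" for i using level_in_whole addresses_less[OF q that] by blast
  have Bs: "?B i \<in> sets space_measure" if "i < n" for i
  proof -
    have "?B i = base.V m -` level j (q i) \<inter> space space_measure \<inter> level j (q i)" using sub[OF that] by auto
    moreover have "base.V m -` level j (q i) \<inter> space space_measure \<in> sets space_measure"
      by (rule measurable_sets[OF base.V_measurable level_sets[OF addresses_less[OF q that]]])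
    ultimately show ?thesis using level_sets[OF addresses_less[OF q that]] by (simp only: sets.Int)
  qed
  have "L2_inner (MM n) (koopman_power (MM n) (TT n) m (indicator (cell n j q))) (indicator (cell n j q)) =
      (\<integral>x. complex_of_real (indicator (Pi\<^sub>E {..<n} ?B) x) \<partial>MM n)"
    unfolding L2_inner_def koopman_power_def
  proof (intro Bochner_Integration.integral_cong refl)
    fix x assume x: "x \<in> space (MM n)"
    have "iterate_int (MM n) (TT n) m x \<in> cell n j q \<and> x \<in> cell n j q \<longleftrightarrow> x \<in> Pi\<^sub>E {..<n} ?B"
      unfolding base.iterate_tensor[OF x] cell_def by (auto simp: PiE_iff)
    then show "indicator (cell n j q) (iterate_int (MM n) (TT n) m x) * cnj (indicator (cell n j q) x) =
        complex_of_real (indicator (Pi\<^sub>E {..<n} ?B) x)"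
      by (auto simp: indicator_def)
  qed
  also have "\<dots> = of_real (measure (MM n) (Pi\<^sub>E {..<n} ?B))"
  proof -
    have "Pi\<^sub>E {..<n} ?B \<in> sets (MM n)"
      unfolding tensor_space_def using Bs by (intro sets_PiM_I_finite) auto
    then show ?thesis using sets.sets_into_space by (simp add: Int_absorb2)
  qed
  also have "emeasure (MM n) (Pi\<^sub>E {..<n} ?B) = ennreal ((width j * a 1 j m) ^ n)"
    using Bs emeasure_level_return addresses_less[OF q] a_nonneg[of 1 j m]
    by (subst base.emeasure_box) (auto simp: ennreal_power)
  then have "measure (MM n) (Pi\<^sub>E {..<n} ?B) = (width j * a 1 j m) ^ n"
    using a_nonneg[of 1 j m] by (simp add: measure_def)
  also have "\<dots> = width j ^ n * a n j m" using a_power[OF n, of j m] by (simp add: power_mult_distrib)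
  finally show ?thesis using lam_coeff[OF n] by simp
qed

section \<open>Generating sets and density of step functions\<close>

definition resolved :: "nat \<Rightarrow> real set \<Rightarrow> bool" where
  "resolved j B \<longleftrightarrow> (\<forall>q<H j. level j q \<subseteq> B \<or> level j q \<inter> B = {})"

text \<open>Resolution is required at all late stages rather than at a single one, so that finitely
  many sets are resolved at a common stage and intersections stay in the family.\<close>

definition resolved_sets :: "real set set" where
  "resolved_sets = {B \<in> sets space_measure. \<exists>j. \<forall>k\<ge>j. resolved k B}"

lemma level_resolved: "q < H j \<Longrightarrow> j \<le> k \<Longrightarrow> resolved k (level j q)"
  unfolding resolved_def
proof (intro allI impI)
  fix q' assume q: "q < H j" "j \<le> k" "q' < H k"
  show "level k q' \<subseteq> level j q \<or> level k q' \<inter> level j q = {}"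
  proof (cases "level k q' \<inter> level j q = {}")
    case False
    then obtain x where x: "x \<in> level k q'" "x \<in> level j q" by blast
    obtain p where p: "p \<in> positions j (k - j)" "x \<in> level (j + (k - j)) (p + q)"
      using level_positions[OF q(1), of "k - j"] x(2) by blast
    then have "q' = p + q" using level_unique[OF x(1)] positions_less[OF p(1) q(1)] q by simp
    then show ?thesis using level_positions[OF q(1), of "k - j"] p q(2) by auto
  qed simp
qed

lemma resolved_Union: "(\<And>B. B \<in> \<B> \<Longrightarrow> resolved k B) \<Longrightarrow> resolved k (\<Union>\<B>)"
  unfolding resolved_def by blast

lemma resolved_Int: "resolved k B \<Longrightarrow> resolved k C \<Longrightarrow> resolved k (B \<inter> C)"
  unfolding resolved_def by blast

lemma tower_set_resolved: "j \<le> k \<Longrightarrow> resolved k (tower_set j)"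
  unfolding tower_set_def using level_resolved by (intro resolved_Union) auto

text \<open>Levels shrink around each point, so an open set meets the space in the countable union
  of the levels it contains. Hence the identity is Borel measurable on the generated
  sigma-algebra.\<close>

lemma resolved_sets_generate: "sets space_measure = sigma_sets whole resolved_sets"
proof (rule antisym)
  have sub: "resolved_sets \<subseteq> Pow whole" by (auto simp: resolved_sets_def sets_space_measure)
  interpret S: sigma_algebra whole "sigma_sets whole resolved_sets" by (rule sigma_algebra_sigma_sets[OF sub])
  have lev: "level j q \<in> sigma_sets whole resolved_sets" if "q < H j" for j q
    using that level_resolved by (intro sigma_sets.Basic) (auto simp: resolved_sets_def)
  have id_meas: "(\<lambda>x. x) \<in> borel_measurable (sigma whole resolved_sets)"
  proof (rule borel_measurableI)
    fix U :: "real set" assume U: "open U"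
    have "(\<lambda>x. x) -` U \<inter> space (sigma whole resolved_sets) = (\<Union>j. \<Union>q\<in>{q. q < H j \<and> level j q \<subseteq> U}. level j q)"
    proof (intro equalityI subsetI)
      fix x assume "x \<in> (\<lambda>x. x) -` U \<inter> space (sigma whole resolved_sets)"
      then have x: "x \<in> U" "x \<in> whole" by (auto simp: space_measure_of_conv)
      obtain e where e: "e > 0" "ball x e \<subseteq> U" using U x(1) openE by blast
      obtain k where k: "(1 / 2 :: real) ^ k < e" using real_arch_pow_inv[OF e(1), of "1 / 2"] by auto
      obtain j q where j: "x \<in> level j q" "q + 0 < H j" "k \<le> j" using whole_deep[OF x(2)] by blast
      have "width j \<le> (1 / 2) ^ j" by (rule width_le)
      also have "\<dots> \<le> (1 / 2) ^ k" using j(3) by (intro power_decreasing) auto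
      finally have "width j < e" using k by simp
      then have "level j q \<subseteq> ball x e" using j(1) by (auto simp: level_def dist_real_def)
      then show "x \<in> (\<Union>j. \<Union>q\<in>{q. q < H j \<and> level j q \<subseteq> U}. level j q)" using e j by auto
    next
      fix x assume "x \<in> (\<Union>j. \<Union>q\<in>{q. q < H j \<and> level j q \<subseteq> U}. level j q)"
      then show "x \<in> (\<lambda>x. x) -` U \<inter> space (sigma whole resolved_sets)"
        using level_in_whole by (auto simp: space_measure_of_conv)
    qed
    also have "\<dots> \<in> sigma_sets whole resolved_sets"
      by (intro S.countable_UN S.finite_UN image_subsetI ballI) (auto intro: lev)
    finally show "(\<lambda>x. x) -` U \<inter> space (sigma whole resolved_sets) \<in> sets (sigma whole resolved_sets)"
      by (simp add: sets_measure_of[OF sub])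
  qed
  have "Y \<inter> whole \<in> sigma_sets whole resolved_sets" if "Y \<in> sets borel" for Y
    using measurable_sets[OF id_meas that] by (simp add: sets_measure_of[OF sub] space_measure_of[OF sub])
  note restr = this
  show "sets space_measure \<subseteq> sigma_sets whole resolved_sets"
  proof
    fix Y assume "Y \<in> sets space_measure"
    then have "Y \<in> sets borel" "Y \<inter> whole = Y" by (auto simp: sets_space_measure)
    then show "Y \<in> sigma_sets whole resolved_sets" using restr[of Y] by simp
  qed
  show "sigma_sets whole resolved_sets \<subseteq> sets space_measure"
    using sets.sigma_sets_subset[of resolved_sets space_measure] by (auto simp: resolved_sets_def)
qed

definition step_fun :: "nat \<Rightarrow> nat \<Rightarrow> ((nat \<Rightarrow> real) \<Rightarrow> complex) set" where
  "step_fun n j = {f. (\<forall>x. x \<notin> tower_power n j \<longrightarrow> f x = 0) \<and>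
    (\<forall>q\<in>addresses n j. \<forall>x\<in>cell n j q. \<forall>y\<in>cell n j q. f x = f y)}"

lemma cell_refine:
  assumes q: "q \<in> addresses n k" and "j \<le> k" and x: "x \<in> cell n k q" "x \<in> cell n j q'" and q': "q' \<in> addresses n j"
  shows "cell n k q \<subseteq> cell n j q'"
proof -
  have "level k (q i) \<subseteq> level j (q' i)" if i: "i < n" for i
  proof -
    have "x i \<in> level k (q i)" "x i \<in> level j (q' i)" using x i by (auto simp: cell_def)
    then show ?thesis
      using level_resolved[OF addresses_less[OF q' i] assms(2)] addresses_less[OF q i]
      unfolding resolved_def by blast
  qed
  then show ?thesis unfolding cell_def by (intro PiE_mono) auto
qed

lemma step_fun_mono: assumes "j \<le> k" shows "step_fun n j \<subseteq> step_fun n k"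
proof
  fix f assume f: "f \<in> step_fun n j"
  show "f \<in> step_fun n k"
    unfolding step_fun_def
  proof (intro CollectI conjI allI impI ballI)
    fix x assume "x \<notin> tower_power n k"
    then have "x \<notin> tower_power n j" using tower_power_mono[OF assms] by blast
    then show "f x = 0" using f by (simp add: step_fun_def)
  next
    fix q x y assume q: "q \<in> addresses n k" "x \<in> cell n k q" "y \<in> cell n k q"
    show "f x = f y"
    proof (cases "x \<in> tower_power n j \<or> y \<in> tower_power n j")
      case True
      then obtain z q' where z: "z \<in> cell n k q" "z \<in> cell n j q'" "q' \<in> addresses n j"
        using q unfolding tower_power_cells by blast
      then have "cell n k q \<subseteq> cell n j q'" using cell_refine[OF q(1) assms] by blast
      then show ?thesis using f z(3) q(2,3) unfolding step_fun_def by blast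
    next
      case False
      then show ?thesis using f by (simp add: step_fun_def)
    qed
  qed
qed

lemma step_fun_expand:
  assumes "f \<in> step_fun n j"
  obtains c where "f = (\<lambda>x. \<Sum>q\<in>addresses n j. c q * indicator (cell n j q) x)"
proof -
  define c where "c q = f (SOME x. x \<in> cell n j q)" for q
  have "f x = (\<Sum>q\<in>addresses n j. c q * indicator (cell n j q) x)" for x
  proof (cases "x \<in> tower_power n j")
    case True
    then obtain q where q: "q \<in> addresses n j" "x \<in> cell n j q" unfolding tower_power_cells by blast
    then have "(SOME x. x \<in> cell n j q) \<in> cell n j q" by (metis someI)
    then have "c q = f x" using assms q unfolding step_fun_def c_def by blast
    have "(\<Sum>q'\<in>addresses n j. c q' * indicator (cell n j q') x) = (\<Sum>q'\<in>addresses n j. if q' = q then c q else 0)"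
    proof (rule sum.cong[OF refl])
      fix q' assume q': "q' \<in> addresses n j"
      show "c q' * indicator (cell n j q') x = (if q' = q then c q else 0)"
      proof (cases "q' = q")
        case False
        then have "x \<notin> cell n j q'" using cell_unique q q' by blast
        then show ?thesis using False by simp
      qed (use q in simp)
    qed
    also have "\<dots> = c q" using q(1) by simp
    finally show ?thesis using \<open>c q = f x\<close> by simp
  next
    case False
    then have "(\<Sum>q\<in>addresses n j. c q * indicator (cell n j q) x) = 0"
      unfolding tower_power_cells by (intro sum.neutral) (auto simp: indicator_def)
    then show ?thesis using assms False by (simp add: step_fun_def)
  qed
  then show ?thesis using that by blast
qed

lemma step_fun_L2: "f \<in> step_fun n j \<Longrightarrow> f \<in> L2 (MM n)"
proof -
  assume "f \<in> step_fun n j"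
  then obtain c where f: "f = (\<lambda>x. \<Sum>q\<in>addresses n j. c q * indicator (cell n j q) x)" by (rule step_fun_expand)
  show ?thesis unfolding f by (intro L2_sum L2_scale L2_indicator) (auto simp: cell_sets emeasure_cell)
qed

text \<open>Boxes of resolved sets generate the product sigma-algebra and are closed under
  intersections. Inside a tower power of finite measure each of them is a union of cells of one late
  stage, the latest that its coordinates need.\<close>

theorem step_fun_dense:
  assumes f: "f \<in> L2 (MM n)"
  shows "L2_approximable (MM n) (\<Union>j. step_fun n j) f"
proof (rule L2_approximable_by_generator[where \<Omega> = "tower_power n" and \<C> = "{Pi\<^sub>E {..<n} F | F. \<forall>i<n. F i \<in> resolved_sets}"])
  show "(\<Union>j. step_fun n j) \<subseteq> L2 (MM n)" using step_fun_L2 by blast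
  show "(\<lambda>x. 0) \<in> (\<Union>j. step_fun n j)" by (simp add: step_fun_def)
  show "(\<lambda>x. c * f x) \<in> (\<Union>j. step_fun n j)" if f: "f \<in> (\<Union>j. step_fun n j)" for f c
  proof -
    obtain j where "f \<in> step_fun n j" using f by blast
    then have "(\<lambda>x. c * f x) \<in> step_fun n j" unfolding step_fun_def mem_Collect_eq by (metis mult_zero_right)
    then show ?thesis by blast
  qed
  show "(\<lambda>x. f x + g x) \<in> (\<Union>j. step_fun n j)" if fg: "f \<in> (\<Union>j. step_fun n j)" "g \<in> (\<Union>j. step_fun n j)" for f g
  proof -
    obtain j k where "f \<in> step_fun n j" "g \<in> step_fun n k" using fg by blast
    then have "f \<in> step_fun n (max j k)" "g \<in> step_fun n (max j k)"
      using step_fun_mono[of j "max j k" n] step_fun_mono[of k "max j k" n] by auto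
    then have "(\<lambda>x. f x + g x) \<in> step_fun n (max j k)"
      unfolding step_fun_def mem_Collect_eq by (metis add.right_neutral)
    then show ?thesis by blast
  qed
  show "tower_power n J \<in> sets (MM n)" for J by (rule tower_power_sets)
  show "emeasure (MM n) (tower_power n J) < \<infinity>" for J by (rule tower_power_finite)
  show "incseq (tower_power n)" using tower_power_mono by (simp add: incseq_def)
  show "(\<Union>J. tower_power n J) = space (MM n)" by (rule UN_tower_power)
  show "indicator (tower_power n J) \<in> (\<Union>j. step_fun n j)" for J
  proof -
    have "indicator (tower_power n J) x = (1::complex)" if "q \<in> addresses n J" "x \<in> cell n J q" for q x
    proof -
      have "x \<in> tower_power n J" using that unfolding tower_power_cells by blast
      then show ?thesis by simp
    qed
    then have "(indicator (tower_power n J) :: _ \<Rightarrow> complex) \<in> step_fun n J"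
      unfolding step_fun_def mem_Collect_eq by (metis indicator_simps(2))
    then show ?thesis by blast
  qed
  have whole: "whole \<in> resolved_sets"
    using level_in_whole by (auto simp: resolved_sets_def sets_space_measure resolved_def)
  have sub: "resolved_sets \<subseteq> Pow whole" by (auto simp: resolved_sets_def sets_space_measure)
  show "Int_stable {Pi\<^sub>E {..<n} F | F. \<forall>i<n. F i \<in> resolved_sets}"
  proof (rule Int_stableI, clarify)
    fix F G assume FG: "\<forall>i<n. F i \<in> resolved_sets" "\<forall>i<n. G i \<in> resolved_sets"
    have "F i \<inter> G i \<in> resolved_sets" if i: "i < n" for i
    proof -
      obtain j k where jk: "\<forall>l\<ge>j. resolved l (F i)" "\<forall>l\<ge>k. resolved l (G i)"
        using FG i unfolding resolved_sets_def by blast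
      have "F i \<in> sets space_measure" "G i \<in> sets space_measure"
        using FG that unfolding resolved_sets_def by blast+
      then have "F i \<inter> G i \<in> sets space_measure" by (rule sets.Int)
      moreover have "\<forall>l\<ge>max j k. resolved l (F i \<inter> G i)" using jk by (auto intro: resolved_Int)
      ultimately show ?thesis unfolding resolved_sets_def by blast
    qed
    then show "\<exists>F'. Pi\<^sub>E {..<n} F \<inter> Pi\<^sub>E {..<n} G = Pi\<^sub>E {..<n} F' \<and> (\<forall>i<n. F' i \<in> resolved_sets)"
      by (intro exI[of _ "\<lambda>i. F i \<inter> G i"]) (auto simp: PiE_Int)
  qed
  show gen: "sets (MM n) = sigma_sets (space (MM n)) {Pi\<^sub>E {..<n} F | F. \<forall>i<n. F i \<in> resolved_sets}"
    by (rule tensor_space_sigma_sets) (use resolved_sets_generate sub whole in auto)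
  show "{Pi\<^sub>E {..<n} F | F. \<forall>i<n. F i \<in> resolved_sets} \<subseteq> Pow (space (MM n))"
  proof
    fix C assume "C \<in> {Pi\<^sub>E {..<n} F | F. \<forall>i<n. F i \<in> resolved_sets}"
    then obtain F where F: "C = Pi\<^sub>E {..<n} F" "\<forall>i<n. F i \<in> resolved_sets" by blast
    have "C \<subseteq> ({..<n} \<rightarrow>\<^sub>E whole)" unfolding F(1) using F(2) sub by (intro PiE_mono) auto
    then show "C \<in> Pow (space (MM n))" by (simp add: space_tensor_space)
  qed
  fix C J assume "C \<in> {Pi\<^sub>E {..<n} F | F. \<forall>i<n. F i \<in> resolved_sets}"
  then obtain F where F: "C = Pi\<^sub>E {..<n} F" "\<And>i. i < n \<Longrightarrow> F i \<in> resolved_sets" by blast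
  have "\<forall>i\<in>{..<n}. \<exists>j. \<forall>k\<ge>j. resolved k (F i)" using F(2) by (auto simp: resolved_sets_def)
  then obtain g where g: "\<And>i k. i < n \<Longrightarrow> k \<ge> g i \<Longrightarrow> resolved k (F i)" by (metis lessThan_iff)
  define k where "k = J + (\<Sum>i<n. g i)"
  have res: "resolved k (F i)" if "i < n" for i
  proof -
    have "g i \<le> (\<Sum>i<n. g i)" using that by (intro member_le_sum) auto
    then show ?thesis using g that by (simp add: k_def)
  qed
  have "indicator (C \<inter> tower_power n J) \<in> step_fun n k"
    unfolding step_fun_def
  proof (intro CollectI conjI allI impI ballI)
    fix x assume "x \<notin> tower_power n k"
    then show "indicator (C \<inter> tower_power n J) x = (0::complex)"
      using tower_power_mono[of J k n] by (auto simp: k_def indicator_def)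
  next
    fix q x y assume q: "q \<in> addresses n k" "x \<in> cell n k q" "y \<in> cell n k q"
    have xy: "x i \<in> level k (q i)" "y i \<in> level k (q i)" if "i < n" for i using q that by (auto simp: cell_def)
    have "x i \<in> B \<longleftrightarrow> y i \<in> B" if "i < n" "resolved k B" for i B
      using xy[OF that(1)] that(2) addresses_less[OF q(1) that(1)] unfolding resolved_def by blast
    moreover have "resolved k (tower_set J)" by (rule tower_set_resolved) (simp add: k_def)
    ultimately have "x \<in> C \<inter> tower_power n J \<longleftrightarrow> y \<in> C \<inter> tower_power n J"
      using q(2,3) res unfolding F(1) tower_power_def cell_def by (auto simp: PiE_iff)
    then show "indicator (C \<inter> tower_power n J) x = (indicator (C \<inter> tower_power n J) y :: complex)"
      by (simp add: indicator_def)
  qed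
  then show "indicator (C \<inter> tower_power n J) \<in> (\<Union>j. step_fun n j)" by blast
qed (rule f)

text \<open>A step function combines cells of one stage \<open>j\<close>, all with spectral measure
  proportional to \<open>lam n j\<close>, and every null set of \<open>lam n 0\<close> is null for
  \<open>lam n j\<close>. The type is attained by the only cell of stage 0, where the tower has
  height 1.\<close>

theorem lam_maximal_spectral_type:
  assumes n: "n \<ge> 1" and unbounded: "\<And>j N. \<exists>k\<ge>j. N \<le> r k"
  shows "maximal_spectral_type (MM n) (TT n) (lam n 0)"
  unfolding maximal_spectral_type_def
proof (intro conjI ballI allI impI)
  interpret TA: automorphism "MM n" "TT n" by (rule base.tensor_automorphism)
  show "finite_measure (lam n 0)" "sets (lam n 0) = sets circle_borel" using finite_lam sets_lam n by auto
  fix f \<nu> assume f: "f \<in> L2 (MM n)" and \<nu>: "spectral_measure (MM n) (TT n) f \<nu>"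
  show "absolutely_continuous (lam n 0) \<nu>"
    unfolding absolutely_continuous_def
  proof
    fix Y assume "Y \<in> null_sets (lam n 0)"
    then have Y: "Y \<in> sets circle_borel" "measure (lam n 0) Y = 0"
      using sets_lam[OF n] by (auto simp: null_sets_def measure_def)
    have "measure \<nu> Y = 0"
    proof (rule TA.spectral_measure_null[OF f \<nu> Y(1)])
      fix e :: real assume "e > 0"
      then obtain g where g: "g \<in> (\<Union>j. step_fun n j)" "(\<integral>x. (cmod (f x - g x))\<^sup>2 \<partial>MM n) < e"
        using step_fun_dense[OF f] unfolding L2_approximable_def by blast
      then obtain j c where gc: "g = (\<lambda>x. \<Sum>q\<in>addresses n j. c q * indicator (cell n j q) x)"
        by (metis UN_E step_fun_expand)
      show "\<exists>(I::(nat \<Rightarrow> nat) set) c g w \<sigma>. finite I \<and> finite_measure \<sigma> \<and> sets \<sigma> = sets circle_borel \<and>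
        measure \<sigma> Y = 0 \<and> (\<forall>i\<in>I. g i \<in> L2 (MM n) \<and>
          (\<forall>m. L2_inner (MM n) (koopman_power (MM n) (TT n) m (g i)) (g i) = of_real w * (\<integral>z. z powi m \<partial>\<sigma>))) \<and>
        (\<integral>x. (cmod (f x - (\<Sum>i\<in>I. c i * g i x)))\<^sup>2 \<partial>MM n) < e"
        using lam_null[OF n unbounded Y, of j] cell_coeff[OF n] g(2)
        by (intro exI[of _ "addresses n j"] exI[of _ c] exI[of _ "\<lambda>q. indicator (cell n j q)"]
            exI[of _ "width j ^ n"] exI[of _ "lam n j"] conjI ballI allI L2_indicator)
           (auto simp: gc finite_lam[OF n] sets_lam[OF n] cell_sets emeasure_cell)
    qed
    moreover have "finite_measure \<nu>" "sets \<nu> = sets circle_borel" using \<nu> by (auto simp: spectral_measure_def)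
    ultimately show "Y \<in> null_sets \<nu>"
      using Y(1) finite_measure.emeasure_eq_measure[of \<nu> Y] by (auto simp: null_sets_def)
  qed
next
  have q: "(\<lambda>i\<in>{..<n}. 0) \<in> addresses n 0" by (auto simp: addresses_def)
  show "\<exists>f\<in>L2 (MM n). \<exists>\<nu>. spectral_measure (MM n) (TT n) f \<nu> \<and> absolutely_continuous \<nu> (lam n 0)"
  proof (intro bexI exI conjI)
    show "indicator (cell n 0 (\<lambda>i\<in>{..<n}. 0)) \<in> L2 (MM n)"
      using q by (intro L2_indicator) (auto simp: cell_sets emeasure_cell)
    show "spectral_measure (MM n) (TT n) (indicator (cell n 0 (\<lambda>i\<in>{..<n}. 0))) (lam n 0)"
      unfolding spectral_measure_def using cell_coeff[OF n q] finite_lam[OF n] sets_lam[OF n] by simp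
    show "absolutely_continuous (lam n 0) (lam n 0)" by (simp add: absolutely_continuous_def)
  qed
qed

end

section \<open>Conservativity\<close>

lemma prod_le_exp_neg_sum:
  fixes p :: "nat \<Rightarrow> real"
  assumes "\<And>k. p k \<le> 1"
  shows "(\<Prod>k<K. 1 - p k) \<le> exp (- (\<Sum>k<K. p k))"
proof -
  have "(\<Prod>k<K. 1 - p k) \<le> (\<Prod>k<K. exp (- p k))"
  proof (rule prod_mono)
    fix k
    show "0 \<le> 1 - p k \<and> 1 - p k \<le> exp (- p k)" using assms[of k] exp_ge_add_one_self[of "- p k"] by simp
  qed
  also have "\<dots> = exp (- (\<Sum>k<K. p k))" by (simp add: exp_sum[symmetric] sum_negf)
  finally show ?thesis .
qed

lemma prod_small_if_not_summable:
  fixes p :: "nat \<Rightarrow> real"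
  assumes p: "\<And>k. 0 \<le> p k" "\<And>k. p k \<le> 1" and div: "\<not> summable p" and e: "e > 0"
  shows "\<exists>K. (\<Prod>k<K. 1 - p k) < e"
proof -
  have "\<exists>K. - ln e < (\<Sum>k<K. p k)"
  proof (rule ccontr)
    assume "\<not> ?thesis"
    then have "(\<Sum>k<K. p k) \<le> - ln e" for K by (simp add: not_less)
    then have "summable p" using p(1) by (intro summableI_nonneg_bounded)
    then show False using div by simp
  qed
  then obtain K where "- ln e < (\<Sum>k<K. p k)" by blast
  then have "- (\<Sum>k<K. p k) < ln e" by linarith
  then have "exp (- (\<Sum>k<K. p k)) < exp (ln e)" by (simp only: exp_less_cancel_iff)
  then have "exp (- (\<Sum>k<K. p k)) < e" using e by simp
  with prod_le_exp_neg_sum[of p K, OF p(2)] have "(\<Prod>k<K. 1 - p k) < e" by (rule le_less_trans)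
  then show ?thesis by blast
qed

context lacunary
begin

definition choices :: "nat \<Rightarrow> nat \<Rightarrow> (nat \<Rightarrow> nat) set" where
  "choices n j = ({..<n} \<rightarrow>\<^sub>E {..<r j})"

definition sub_address :: "nat \<Rightarrow> nat \<Rightarrow> (nat \<Rightarrow> nat) \<Rightarrow> (nat \<Rightarrow> nat) \<Rightarrow> nat \<Rightarrow> nat" where
  "sub_address n j q u = (\<lambda>i\<in>{..<n}. P j (u i) + q i)"

lemma finite_choices [simp]: "finite (choices n j)"
  unfolding choices_def by (intro finite_PiE) auto

lemma card_choices: "card (choices n j) = r j ^ n"
  unfolding choices_def by (simp add: card_PiE)

lemma choices_less: "u \<in> choices n j \<Longrightarrow> i < n \<Longrightarrow> u i < r j"
  by (auto simp: choices_def)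

lemma sub_address: "q \<in> addresses n j \<Longrightarrow> u \<in> choices n j \<Longrightarrow> sub_address n j q u \<in> addresses n (Suc j)"
  unfolding addresses_def choices_def sub_address_def
  unfolding restrict_PiE_iff
proof
  fix i assume q: "q \<in> {..<n} \<rightarrow>\<^sub>E {..<H j}" and u: "u \<in> {..<n} \<rightarrow>\<^sub>E {..<r j}" and i: "i \<in> {..<n}"
  have "u i < r j" "q i < H j" using PiE_mem[OF u i] PiE_mem[OF q i] by simp_all
  then show "P j (u i) + q i \<in> {..<H (Suc j)}" by (simp add: block_less)
qed

lemma sub_address_inj:
  assumes q: "q \<in> addresses n j" and u: "u \<in> choices n j" "u' \<in> choices n j"
    and eq: "sub_address n j q u = sub_address n j q u'"
  shows "u = u'"
proof (rule PiE_ext)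
  show "u \<in> {..<n} \<rightarrow>\<^sub>E {..<r j}" "u' \<in> {..<n} \<rightarrow>\<^sub>E {..<r j}" using u by (simp_all add: choices_def)
  fix i assume i: "i \<in> {..<n}"
  then have "P j (u i) + q i = P j (u' i) + q i" using fun_cong[OF eq, of i] by (simp add: sub_address_def)
  then show "u i = u' i" using P_block_unique addresses_less[OF q] i by blast
qed

lemma cell_split:
  assumes q: "q \<in> addresses n j"
  shows "cell n j q = (\<Union>u\<in>choices n j. cell n (Suc j) (sub_address n j q u))"
proof (intro equalityI subsetI)
  fix x assume x: "x \<in> cell n j q"
  have "\<forall>i\<in>{..<n}. \<exists>k. k < r j \<and> x i \<in> level (Suc j) (P j k + q i)"
  proof
    fix i assume i: "i \<in> {..<n}"
    then have "x i \<in> level j (q i)" using x by (auto simp: cell_def)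
    then show "\<exists>k. k < r j \<and> x i \<in> level (Suc j) (P j k + q i)"
      using level_cut[OF addresses_less[OF q]] i by blast
  qed
  then obtain u where u: "\<And>i. i < n \<Longrightarrow> u i < r j \<and> x i \<in> level (Suc j) (P j (u i) + q i)"
    by (metis lessThan_iff)
  have "restrict u {..<n} \<in> choices n j" using u by (auto simp: choices_def)
  moreover have "x \<in> cell n (Suc j) (sub_address n j q (restrict u {..<n}))"
    using u x by (auto simp: cell_def sub_address_def PiE_iff)
  ultimately show "x \<in> (\<Union>u\<in>choices n j. cell n (Suc j) (sub_address n j q u))" by blast
next
  fix x assume "x \<in> (\<Union>u\<in>choices n j. cell n (Suc j) (sub_address n j q u))"
  then obtain u where u: "u \<in> choices n j" "x \<in> cell n (Suc j) (sub_address n j q u)" by blast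
  have "x i \<in> level j (q i)" if i: "i < n" for i
  proof -
    have "x i \<in> level (Suc j) (P j (u i) + q i)" using u(2) i by (auto simp: cell_def sub_address_def PiE_iff)
    then show ?thesis using level_block_subset[OF choices_less[OF u(1) i] addresses_less[OF q i]] by blast
  qed
  then show "x \<in> cell n j q" using u(2) by (auto simp: cell_def PiE_iff)
qed

lemma measure_cell: "q \<in> addresses n j \<Longrightarrow> measure (MM n) (cell n j q) = width j ^ n"
  using emeasure_cell by (simp add: measure_def)

lemma measure_Int_cell_le:
  assumes "W \<in> sets (MM n)" "q \<in> addresses n j"
  shows "measure (MM n) (W \<inter> cell n j q) \<le> width j ^ n"
proof -
  have "measure (MM n) (W \<inter> cell n j q) \<le> measure (MM n) (cell n j q)"
    using assms cell_sets[OF assms(2)] emeasure_cell[OF assms(2)]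
    by (intro measure_mono_fmeasurable) (auto simp: fmeasurable_def)
  then show ?thesis using measure_cell[OF assms(2)] by simp
qed

lemma Int_cell_finite:
  assumes "W \<in> sets (MM n)" "q \<in> addresses n j"
  shows "emeasure (MM n) (W \<inter> cell n j q) < \<infinity>"
proof -
  have "emeasure (MM n) (W \<inter> cell n j q) \<le> emeasure (MM n) (cell n j q)"
    using assms cell_sets by (intro emeasure_mono) auto
  then show ?thesis using emeasure_cell[OF assms(2)] by (simp add: le_less_trans)
qed

text \<open>The diagonal subcells are translates of each other under the powers of \<open>TT n\<close>, so that the traces
  of a wandering set on them can be moved disjointly into one of them.\<close>

lemma wandering_diagonal:
  assumes W: "wandering (MM n) (TT n) W" and n: "n \<ge> 1" and q: "q \<in> addresses n j"
  shows "(\<Sum>i<r j. measure (MM n) (W \<inter> cell n (Suc j) (sub_address n j q (\<lambda>l\<in>{..<n}. i)))) \<le> width (Suc j) ^ n"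
proof -
  interpret TA: automorphism "MM n" "TT n" by (rule base.tensor_automorphism)
  let ?C = "\<lambda>i. cell n (Suc j) (sub_address n j q (\<lambda>l\<in>{..<n}. i))"
  let ?E = "\<lambda>i. TA.V (- int (P j i)) ` (W \<inter> ?C i)"
  have WM: "W \<in> sets (MM n)" using W by (simp add: wandering_def)
  have adr: "sub_address n j q (\<lambda>l\<in>{..<n}. i) \<in> addresses n (Suc j)" if "i < r j" for i
    using that by (intro sub_address q) (auto simp: choices_def)
  have ES: "W \<inter> ?C i \<in> sets (MM n)" if "i < r j" for i using WM cell_sets[OF adr[OF that]] by auto
  have move: "?E i \<subseteq> ?C 0" if i: "i < r j" for i
  proof
    fix x assume "x \<in> ?E i"
    then obtain y where y: "y \<in> ?C i" "x = TA.V (- int (P j i)) y" by blast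
    have ysp: "y \<in> space (MM n)" using y(1) cell_space[OF adr[OF i]] by blast
    have x: "x = (\<lambda>l\<in>{..<n}. base.V (- int (P j i)) (y l))"
      unfolding y(2) by (rule base.iterate_tensor[OF ysp])
    have "base.V (- int (P j i)) (y l) \<in> level (Suc j) (q l)" if l: "l < n" for l
    proof -
      have ql: "q l + P j i < H (Suc j)" using block_less[OF i addresses_less[OF q l]] by (simp add: add.commute)
      have "y l \<in> level (Suc j) (q l + P j i)"
        using y(1) l by (auto simp: cell_def sub_address_def PiE_iff add.commute)
      then obtain z where z: "z \<in> level (Suc j) (q l)" "y l = (T ^^ P j i) z"
        unfolding T_power_image[OF ql, symmetric] by blast
      have "z \<in> whole" using z(1) level_in_whole[of "q l" "Suc j"] ql by auto
      then have "base.V (- int (P j i)) (base.V (int (P j i)) z) = z" by simp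
      then show ?thesis using z by (simp add: base.V_of_nat)
    qed
    then show "x \<in> ?C 0" using r_pos[of j] unfolding x by (auto simp: cell_def sub_address_def PiE_iff)
  qed
  have disj: "disjoint_family_on ?E {..<r j}"
    unfolding disjoint_family_on_def
  proof (intro ballI impI)
    fix i i' :: nat assume "i \<noteq> i'"
    then have "- int (P j i) \<noteq> - int (P j i')" using P_mono[of i i' j] P_mono[of i' i j] H_pos[of j] by linarith
    then have "TA.V (- int (P j i)) ` W \<inter> TA.V (- int (P j i')) ` W = {}"
      using W unfolding wandering_def disjoint_family_on_def by blast
    then show "?E i \<inter> ?E i' = {}" by blast
  qed
  have Em: "emeasure (MM n) (?E i) = emeasure (MM n) (W \<inter> ?C i)" if "i < r j" for i
    by (rule TA.emeasure_V_image[OF ES[OF that]])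
  have "(\<Sum>i<r j. measure (MM n) (W \<inter> ?C i)) = (\<Sum>i<r j. measure (MM n) (?E i))"
    by (intro sum.cong refl) (simp add: measure_def Em)
  also have "\<dots> = measure (MM n) (\<Union>i<r j. ?E i)"
  proof (rule measure_finite_Union[symmetric])
    show "?E ` {..<r j} \<subseteq> sets (MM n)" using ES TA.V_image_sets by blast
    show "emeasure (MM n) (?E i) \<noteq> \<infinity>" if "i \<in> {..<r j}" for i
    proof -
      have i: "i < r j" using that by simp
      show ?thesis unfolding Em[OF i] using Int_cell_finite[OF WM adr[OF i]] by (metis less_irrefl infinity_ennreal_def)
    qed
  qed (use disj in auto)
  also have "\<dots> \<le> measure (MM n) (?C 0)"
  proof (rule measure_mono_fmeasurable)
    show "(\<Union>i<r j. ?E i) \<subseteq> ?C 0" using move by blast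
    show "(\<Union>i<r j. ?E i) \<in> sets (MM n)" using ES TA.V_image_sets by (intro sets.finite_UN) auto
    show "?C 0 \<in> fmeasurable (MM n)"
      using cell_sets[OF adr[of 0]] emeasure_cell[OF adr[of 0]] by (simp add: fmeasurable_def)
  qed
  also have "\<dots> = width (Suc j) ^ n" by (rule measure_cell[OF adr]) simp
  finally show ?thesis .
qed

definition diag_weight :: "nat \<Rightarrow> nat \<Rightarrow> real" where
  "diag_weight n k = real (r k) / real (r k) ^ n"

lemma diag_weight_nonneg: "0 \<le> diag_weight n k"
  by (simp add: diag_weight_def)

lemma diag_weight_le_1: "n \<ge> 1 \<Longrightarrow> diag_weight n k \<le> 1"
proof -
  assume "n \<ge> 1"
  then have "real (r k) ^ 1 \<le> real (r k) ^ n" using r_ge2[of k] by (intro power_increasing) linarith+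
  then show ?thesis by (simp add: diag_weight_def)
qed

text \<open>The diagonal subcells form the fraction \<open>diag_weight n j\<close> of the cell but
  together carry at most the measure of one subcell, hence density at most 1/2 because
  \<open>r j \<ge> 2\<close>. On the other subcells the induction hypothesis for stage
  \<open>Suc j\<close> applies. So each step multiplies the excess over 1/2 by
  \<open>1 - diag_weight n j\<close>.\<close>

lemma wandering_cell_bound:
  assumes W: "wandering (MM n) (TT n) W" and n: "n \<ge> 1"
  shows "q \<in> addresses n j \<Longrightarrow> measure (MM n) (W \<inter> cell n j q) \<le>
    (1 / 2 + 1 / 2 * (\<Prod>k<K. 1 - diag_weight n (j + k))) * width j ^ n"
proof (induction K arbitrary: j q)
  case 0
  have "W \<in> sets (MM n)" using W by (simp add: wandering_def)
  then show ?case using measure_Int_cell_le[OF _ 0] by simp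
next
  case (Suc K)
  note q = Suc.prems
  have WM: "W \<in> sets (MM n)" using W by (simp add: wandering_def)
  let ?D = "choices n j"
  let ?C = "\<lambda>u. cell n (Suc j) (sub_address n j q u)"
  let ?c = "\<lambda>i. \<lambda>l\<in>{..<n}. (i::nat)"
  let ?dg = "?c ` {..<r j}"
  define v where "v = width (Suc j) ^ n"
  define \<pi> where "\<pi> = (\<Prod>k<K. 1 - diag_weight n (Suc j + k))"
  have v: "0 \<le> v" by (simp add: v_def)
  have \<pi>: "0 \<le> \<pi>" unfolding \<pi>_def using diag_weight_le_1[OF n] by (intro prod_nonneg) simp
  have dg: "?dg \<subseteq> ?D" by (auto simp: choices_def split: if_splits)
  have inj: "inj_on ?c {..<r j}"
  proof (rule inj_onI)
    fix i i' assume "?c i = ?c i'"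
    from fun_cong[OF this, of 0] show "i = i'" using n by simp
  qed
  have adr: "sub_address n j q u \<in> addresses n (Suc j)" if "u \<in> ?D" for u using that by (rule sub_address[OF q])
  have "W \<inter> cell n j q = (\<Union>u\<in>?D. W \<inter> ?C u)" unfolding cell_split[OF q] by blast
  then have "measure (MM n) (W \<inter> cell n j q) = measure (MM n) (\<Union>u\<in>?D. W \<inter> ?C u)" by simp
  also have "\<dots> = (\<Sum>u\<in>?D. measure (MM n) (W \<inter> ?C u))"
  proof (rule measure_finite_Union)
    show "(\<lambda>u. W \<inter> ?C u) ` ?D \<subseteq> sets (MM n)" using WM cell_sets[OF adr] by blast
    show "disjoint_family_on (\<lambda>u. W \<inter> ?C u) ?D"
      unfolding disjoint_family_on_def
    proof (intro ballI impI)
      fix u u' assume u: "u \<in> ?D" "u' \<in> ?D" "u \<noteq> u'"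
      then have "sub_address n j q u \<noteq> sub_address n j q u'" using sub_address_inj[OF q] by blast
      then have "?C u \<inter> ?C u' = {}" using cell_unique adr[OF u(1)] adr[OF u(2)] by blast
      then show "W \<inter> ?C u \<inter> (W \<inter> ?C u') = {}" by blast
    qed
    show "emeasure (MM n) (W \<inter> ?C u) \<noteq> \<infinity>" if "u \<in> ?D" for u
      using Int_cell_finite[OF WM adr[OF that]] by (metis less_irrefl infinity_ennreal_def)
  qed simp
  also have "\<dots> = (\<Sum>u\<in>?dg. measure (MM n) (W \<inter> ?C u)) + (\<Sum>u\<in>?D - ?dg. measure (MM n) (W \<inter> ?C u))"
    using dg by (subst sum.subset_diff[of ?dg]) auto
  also have "(\<Sum>u\<in>?dg. measure (MM n) (W \<inter> ?C u)) \<le> v"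
    unfolding v_def sum.reindex[OF inj] comp_def by (rule wandering_diagonal[OF W n q])
  also have "(\<Sum>u\<in>?D - ?dg. measure (MM n) (W \<inter> ?C u)) \<le> (\<Sum>u\<in>?D - ?dg. (1 / 2 + 1 / 2 * \<pi>) * v)"
    unfolding \<pi>_def v_def using adr by (intro sum_mono Suc.IH) auto
  also have "(\<Sum>u\<in>?D - ?dg. (1 / 2 + 1 / 2 * \<pi>) * v) = (real (r j) ^ n - real (r j)) * ((1 / 2 + 1 / 2 * \<pi>) * v)"
  proof -
    have "card (?D - ?dg) = r j ^ n - r j"
      using dg by (simp add: card_Diff_subset card_choices card_image[OF inj])
    moreover have "r j \<le> r j ^ n" using n r_pos[of j] by (simp add: self_le_power Suc_le_eq del: r_pos)
    ultimately show ?thesis by (simp add: of_nat_diff)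
  qed
  finally have total: "measure (MM n) (W \<inter> cell n j q) \<le>
      v + (real (r j) ^ n - real (r j)) * ((1 / 2 + 1 / 2 * \<pi>) * v)" by linarith
  have "2 * v \<le> real (r j) * v" using r_ge2[of j] v by (intro mult_right_mono) auto
  then have "v + (real (r j) ^ n - real (r j)) * ((1 / 2 + 1 / 2 * \<pi>) * v) \<le>
      1 / 2 * (real (r j) ^ n * v) + 1 / 2 * ((real (r j) ^ n - real (r j)) * \<pi> * v)"
    by (simp add: algebra_simps)
  also have "\<dots> = (1 / 2 + 1 / 2 * ((1 - diag_weight n j) * \<pi>)) * (real (r j) ^ n * v)"
  proof -
    have "(1 - diag_weight n j) * real (r j) ^ n = real (r j) ^ n - real (r j)"
      by (simp add: diag_weight_def left_diff_distrib)
    then have "(real (r j) ^ n - real (r j)) * \<pi> * v = (1 - diag_weight n j) * \<pi> * (real (r j) ^ n * v)"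
      by (metis (no_types, opaque_lifting) mult.assoc mult.commute)
    then show ?thesis by (simp add: distrib_right)
  qed
  also have "real (r j) ^ n * v = width j ^ n"
    unfolding v_def width_eq[of j] power_mult_distrib ..
  also have "(1 - diag_weight n j) * \<pi> = (\<Prod>k<Suc K. 1 - diag_weight n (j + k))"
    unfolding \<pi>_def by (subst prod.lessThan_Suc_shift) simp
  finally show ?case using total by linarith
qed

text \<open>Divergence of the sum of the diagonal weights drives the product to 0, and the excess
  over 1/2 disappears.\<close>

lemma wandering_cell_half:
  assumes W: "wandering (MM n) (TT n) W" and n: "n \<ge> 1" and div: "\<not> summable (diag_weight n)"
    and q: "q \<in> addresses n j"
  shows "measure (MM n) (W \<inter> cell n j q) \<le> width j ^ n / 2"
proof (rule field_le_epsilon)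
  fix e :: real assume e: "e > 0"
  have w: "width j ^ n > 0" by simp
  have "\<not> summable (\<lambda>k. diag_weight n (j + k))"
    using div summable_iff_shift[of "diag_weight n" j] by (simp add: add.commute)
  then obtain K where K: "(\<Prod>k<K. 1 - diag_weight n (j + k)) < 2 * e / width j ^ n"
    using prod_small_if_not_summable[of "\<lambda>k. diag_weight n (j + k)" "2 * e / width j ^ n"]
      diag_weight_nonneg diag_weight_le_1[OF n] e w by auto
  have "(\<Prod>k<K. 1 - diag_weight n (j + k)) * width j ^ n \<le> 2 * e"
    using K w by (simp add: field_simps)
  then show "measure (MM n) (W \<inter> cell n j q) \<le> width j ^ n / 2 + e"
    using wandering_cell_bound[OF W n q, of K] by (simp add: distrib_right)
qed

text \<open>Plays the part of the Lebesgue density theorem. On a cell filled at most half by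
  \<open>W\<close>, no constant \<open>c\<close> is close to the indicator, since
  \<open>|1 - c|^2 + |c|^2 \<ge> 1/2\<close>; so every step function of a late stage has squared
  distance at least half the measure of \<open>W\<close>, whereas step functions are dense.\<close>

lemma half_density_null:
  assumes W: "W \<in> sets (MM n)" "W \<subseteq> tower_power n J"
    and half: "\<And>j q. q \<in> addresses n j \<Longrightarrow> measure (MM n) (W \<inter> cell n j q) \<le> width j ^ n / 2"
  shows "measure (MM n) W = 0"
proof -
  have Wfin: "emeasure (MM n) W < \<infinity>"
    using emeasure_mono[OF W(2) tower_power_sets] tower_power_finite[of n J] by (rule le_less_trans)
  have "measure (MM n) W \<le> 2 * e" if e: "e > 0" for e
  proof -
    have "L2_approximable (MM n) (\<Union>j. step_fun n j) (indicator W)"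
      by (intro step_fun_dense L2_indicator W Wfin)
    then obtain g where g: "g \<in> (\<Union>j. step_fun n j)" "(\<integral>x. (cmod (indicator W x - g x))\<^sup>2 \<partial>MM n) < e"
      using e unfolding L2_approximable_def by blast
    obtain k0 where "g \<in> step_fun n k0" using g(1) by blast
    define k where "k = max J k0"
    have gk: "g \<in> step_fun n k" using \<open>g \<in> step_fun n k0\<close> step_fun_mono[of k0 k n] by (auto simp: k_def)
    then obtain c where gc: "g = (\<lambda>x. \<Sum>q\<in>addresses n k. c q * indicator (cell n k q) x)"
      by (rule step_fun_expand)
    have Wk: "W \<subseteq> tower_power n k" using W(2) tower_power_mono[of J k n] by (auto simp: k_def)
    let ?Q = "addresses n k"
    define h where "h q x = (cmod (1 - c q))\<^sup>2 * indicator (W \<inter> cell n k q) x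
        + (cmod (c q))\<^sup>2 * indicator (cell n k q - W) x" for q x
    have point: "(cmod (indicator W x - g x))\<^sup>2 = (\<Sum>q\<in>?Q. h q x)" for x
    proof (cases "x \<in> tower_power n k")
      case True
      then obtain q where q: "q \<in> ?Q" "x \<in> cell n k q" unfolding tower_power_cells by blast
      have out: "x \<notin> cell n k q'" if "q' \<in> ?Q - {q}" for q' using cell_unique q that by blast
      have "(\<Sum>q'\<in>?Q. h q' x) = (\<Sum>q'\<in>{q}. h q' x)"
        using q out by (intro sum.mono_neutral_right) (auto simp: h_def)
      moreover have "g x = (\<Sum>q'\<in>{q}. c q' * indicator (cell n k q') x)"
        unfolding gc using q out by (intro sum.mono_neutral_right) auto
      ultimately show ?thesis using q(2) by (cases "x \<in> W") (simp_all add: h_def)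
    next
      case False
      then have "x \<notin> W" "g x = 0" using Wk gk by (auto simp: step_fun_def)
      moreover have "x \<notin> cell n k q" if "q \<in> ?Q" for q using False that unfolding tower_power_cells by blast
      ultimately show ?thesis by (simp add: h_def)
    qed
    have fin: "emeasure (MM n) (W \<inter> cell n k q) < \<infinity>" "emeasure (MM n) (cell n k q - W) < \<infinity>"
      "W \<inter> cell n k q \<in> sets (MM n)" "cell n k q - W \<in> sets (MM n)" if q: "q \<in> ?Q" for q
    proof -
      show "emeasure (MM n) (W \<inter> cell n k q) < \<infinity>" by (rule Int_cell_finite[OF W(1) q])
      have "emeasure (MM n) (cell n k q - W) \<le> emeasure (MM n) (cell n k q)"
        using cell_sets[OF q] by (intro emeasure_mono) auto
      then show "emeasure (MM n) (cell n k q - W) < \<infinity>" using emeasure_cell[OF q] by (simp add: le_less_trans)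
    qed (use W(1) cell_sets[OF q] in auto)
    have int_h: "integrable (MM n) (h q)"
      "(\<integral>x. h q x \<partial>MM n) = (cmod (1 - c q))\<^sup>2 * measure (MM n) (W \<inter> cell n k q)
        + (cmod (c q))\<^sup>2 * measure (MM n) (cell n k q - W)" if q: "q \<in> ?Q" for q
    proof -
      have i: "integrable (MM n) (\<lambda>x. (cmod (1 - c q))\<^sup>2 * indicator (W \<inter> cell n k q) x)"
        "integrable (MM n) (\<lambda>x. (cmod (c q))\<^sup>2 * indicator (cell n k q - W) x)"
        using fin[OF q] by (intro integrable_mult_right integrable_real_indicator; simp)+
      show "integrable (MM n) (h q)" unfolding h_def using i by (rule Bochner_Integration.integrable_add)
      have s: "W \<inter> cell n k q \<inter> space (MM n) = W \<inter> cell n k q" "(cell n k q - W) \<inter> space (MM n) = cell n k q - W"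
        using cell_space[OF q] by blast+
      show "(\<integral>x. h q x \<partial>MM n) = (cmod (1 - c q))\<^sup>2 * measure (MM n) (W \<inter> cell n k q)
          + (cmod (c q))\<^sup>2 * measure (MM n) (cell n k q - W)"
        unfolding h_def using i by (subst Bochner_Integration.integral_add) (simp_all add: s)
    qed
    have lower: "measure (MM n) (W \<inter> cell n k q) / 2 \<le> (\<integral>x. h q x \<partial>MM n)" if q: "q \<in> ?Q" for q
    proof -
      let ?x = "measure (MM n) (W \<inter> cell n k q)"
      have "measure (MM n) (cell n k q) = ?x + measure (MM n) (cell n k q - W)"
      proof -
        have "measure (MM n) ((W \<inter> cell n k q) \<union> (cell n k q - W)) = ?x + measure (MM n) (cell n k q - W)"
          using fin[OF q] by (intro measure_Union) (auto simp: less_top)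
        moreover have "(W \<inter> cell n k q) \<union> (cell n k q - W) = cell n k q" by blast
        ultimately show ?thesis by simp
      qed
      then have "?x \<le> measure (MM n) (cell n k q - W)"
        using half[OF q] measure_cell[OF q] by linarith
      then have "(cmod (c q))\<^sup>2 * ?x \<le> (cmod (c q))\<^sup>2 * measure (MM n) (cell n k q - W)"
        by (intro mult_left_mono) auto
      moreover have "1 / 2 * ?x \<le> ((cmod (1 - c q))\<^sup>2 + (cmod (c q))\<^sup>2) * ?x"
      proof (rule mult_right_mono)
        have "1 \<le> cmod (1 - c q) + cmod (c q)" using norm_triangle_ineq[of "1 - c q" "c q"] by simp
        then have "1\<^sup>2 \<le> (cmod (1 - c q) + cmod (c q))\<^sup>2" by (intro power_mono) auto
        also have "\<dots> \<le> 2 * ((cmod (1 - c q))\<^sup>2 + (cmod (c q))\<^sup>2)"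
          using sum_squares_bound[of "cmod (1 - c q)" "cmod (c q)"] by (simp add: power2_sum)
        finally show "1 / 2 \<le> (cmod (1 - c q))\<^sup>2 + (cmod (c q))\<^sup>2" by simp
      qed simp
      ultimately show ?thesis unfolding int_h(2)[OF q] by (simp add: distrib_right)
    qed
    have "W = (\<Union>q\<in>?Q. W \<inter> cell n k q)" using Wk unfolding tower_power_cells by blast
    then have "measure (MM n) W = measure (MM n) (\<Union>q\<in>?Q. W \<inter> cell n k q)" by (rule arg_cong)
    also have "\<dots> = (\<Sum>q\<in>?Q. measure (MM n) (W \<inter> cell n k q))"
    proof (rule measure_finite_Union)
      show "(\<lambda>q. W \<inter> cell n k q) ` ?Q \<subseteq> sets (MM n)" using fin(3) by blast
      show "disjoint_family_on (\<lambda>q. W \<inter> cell n k q) ?Q"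
        unfolding disjoint_family_on_def using cell_unique by blast
      show "emeasure (MM n) (W \<inter> cell n k q) \<noteq> \<infinity>" if "q \<in> ?Q" for q using fin(1)[OF that] by (metis less_irrefl infinity_ennreal_def)
    qed simp
    also have "\<dots> = 2 * (\<Sum>q\<in>?Q. measure (MM n) (W \<inter> cell n k q) / 2)"
      by (simp add: sum_divide_distrib[symmetric])
    also have "\<dots> \<le> 2 * (\<Sum>q\<in>?Q. \<integral>x. h q x \<partial>MM n)"
      using lower by (intro mult_left_mono sum_mono) auto
    also have "(\<Sum>q\<in>?Q. \<integral>x. h q x \<partial>MM n) = (\<integral>x. (\<Sum>q\<in>?Q. h q x) \<partial>MM n)"
      using int_h(1) by (rule Bochner_Integration.integral_sum[symmetric])
    also have "\<dots> = (\<integral>x. (cmod (indicator W x - g x))\<^sup>2 \<partial>MM n)" by (simp only: point)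
    finally show ?thesis using g(2) by linarith
  qed
  note bound = this
  have "measure (MM n) W \<le> 0"
  proof (rule field_le_epsilon)
    fix e :: real assume "e > 0"
    then show "measure (MM n) W \<le> 0 + e" using bound[of "e / 2"] by simp
  qed
  then show ?thesis by (simp add: measure_le_0_iff)
qed

text \<open>Subsets of a wandering set are wandering, so intersecting with a tower power provides
  the finite measure that the density argument requires.\<close>

theorem tensor_conservative:
  assumes n: "n \<ge> 1" and div: "\<not> summable (diag_weight n)"
  shows "conservative (MM n) (TT n)"
  unfolding conservative_def
proof
  assume "\<exists>W. wandering (MM n) (TT n) W \<and> emeasure (MM n) W > 0"
  then obtain W where W: "wandering (MM n) (TT n) W" "emeasure (MM n) W > 0" by blast
  have WM: "W \<in> sets (MM n)" using W by (simp add: wandering_def)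
  have "W \<inter> tower_power n J \<in> null_sets (MM n)" for J
  proof (rule null_setsI)
    show WJ: "W \<inter> tower_power n J \<in> sets (MM n)" using WM tower_power_sets by auto
    have "wandering (MM n) (TT n) (W \<inter> tower_power n J)"
      using W(1) WJ unfolding wandering_def disjoint_family_on_def by blast
    from wandering_cell_half[OF this n div]
    have "measure (MM n) (W \<inter> tower_power n J) = 0" by (intro half_density_null[OF WJ]) auto
    moreover have "emeasure (MM n) (W \<inter> tower_power n J) < \<infinity>"
      using emeasure_mono[of "W \<inter> tower_power n J" "tower_power n J" "MM n"] tower_power_sets tower_power_finite[of n J]
      by (meson inf_le2 le_less_trans)
    ultimately show "emeasure (MM n) (W \<inter> tower_power n J) = 0"
      by (simp add: emeasure_eq_ennreal_measure less_top)
  qed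
  then have "(\<Union>J. W \<inter> tower_power n J) \<in> null_sets (MM n)" by (rule null_sets_UN)
  moreover have "(\<Union>J. W \<inter> tower_power n J) = W"
    using sets.sets_into_space[OF WM] unfolding UN_tower_power[symmetric] by blast
  ultimately show False using W(2) by auto
qed

section \<open>Dissipativity\<close>

definition col :: "nat \<Rightarrow> nat \<Rightarrow> real set" where
  "col j i = (\<Union>q<H j. level (Suc j) (P j i + q))"

lemma tower_set_col: "x \<in> tower_set j \<Longrightarrow> \<exists>i<r j. \<exists>q<H j. x \<in> level (Suc j) (P j i + q)"
  unfolding tower_set_def using level_cut by blast

text \<open>By \<open>return_time\<close> at stage \<open>Suc j\<close>, moving from column
  \<open>i\<close> to column \<open>i'\<close> takes a time within \<open>H j\<close> of their gap.
  Gaps are \<open>4 * H j\<close> apart, so \<open>m\<close> determines the pair;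
  \<open>m > H j\<close> excludes the gap 0, which all columns share.\<close>

lemma sidon_columns:
  assumes m: "H j < m" "m \<le> H (Suc j)"
  obtains i i' where "i < r j" "i' < r j"
    "\<And>x. x \<in> tower_set j \<Longrightarrow> (T ^^ m) x \<in> tower_set j \<Longrightarrow> x \<in> col j i \<and> (T ^^ m) x \<in> col j i'"
proof (cases "\<exists>x\<in>tower_set j. (T ^^ m) x \<in> tower_set j")
  case False
  then show ?thesis using that[of 0 0] by auto
next
  case True
  have gap_m: "\<bar>gap j (i', i) - int m\<bar> < int (H j)"
    if i: "i < r j" "q < H j" "x \<in> level (Suc j) (P j i + q)"
      and i': "i' < r j" "q' < H j" "(T ^^ m) x \<in> level (Suc j) (P j i' + q')" for x i q i' q'
  proof -
    have "P j i' + q' = P j i + q + m"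
      using return_time[OF i(3) i'(3) block_less[OF i(1,2)] block_less[OF i'(1,2)]] m by simp
    then have "int (P j i') + int q' = int (P j i) + int q + int m" by linarith
    then show ?thesis using i(2) i'(2) by (simp add: gap_def)
  qed
  obtain x0 where x0: "x0 \<in> tower_set j" "(T ^^ m) x0 \<in> tower_set j" using True by blast
  obtain i0 q0 where i0: "i0 < r j" "q0 < H j" "x0 \<in> level (Suc j) (P j i0 + q0)"
    using tower_set_col[OF x0(1)] by blast
  obtain i0' q0' where i0': "i0' < r j" "q0' < H j" "(T ^^ m) x0 \<in> level (Suc j) (P j i0' + q0')"
    using tower_set_col[OF x0(2)] by blast
  have g0: "\<bar>gap j (i0', i0) - int m\<bar> < int (H j)" by (rule gap_m[OF i0 i0'])
  have ne: "i' \<noteq> i" if "\<bar>gap j (i', i) - int m\<bar> < int (H j)" for i i' using that m(1) by auto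
  show ?thesis
  proof (rule that[OF i0(1) i0'(1)])
    fix x assume x: "x \<in> tower_set j" "(T ^^ m) x \<in> tower_set j"
    obtain i q where i: "i < r j" "q < H j" "x \<in> level (Suc j) (P j i + q)"
      using tower_set_col[OF x(1)] by blast
    obtain i' q' where i': "i' < r j" "q' < H j" "(T ^^ m) x \<in> level (Suc j) (P j i' + q')"
      using tower_set_col[OF x(2)] by blast
    have g: "\<bar>gap j (i', i) - int m\<bar> < int (H j)" by (rule gap_m[OF i i'])
    have "\<bar>gap j (i', i) - gap j (i0', i0)\<bar> < 4 * int (H j)" using g g0 by linarith
    then have "(i', i) = (i0', i0)"
      using ne[OF g] ne[OF g0] i(1) i'(1) i0(1) i0'(1) by (intro gap_sep) (auto simp: off_diagonal_def)
    then show "x \<in> col j i0 \<and> (T ^^ m) x \<in> col j i0'" using i i' unfolding col_def by blast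
  qed
qed

definition same_column :: "nat \<Rightarrow> nat \<Rightarrow> (nat \<Rightarrow> real) set" where
  "same_column n j = (\<Union>i<r j. Pi\<^sub>E {..<n} (\<lambda>_. col j i))"

lemma col_sets [measurable]: "i < r j \<Longrightarrow> col j i \<in> sets space_measure"
  unfolding col_def using block_less by (intro sets.finite_UN level_sets) auto

lemma same_column_sets: "same_column n j \<in> sets (MM n)"
  unfolding same_column_def tensor_space_def by (intro sets.finite_UN sets_PiM_I_finite col_sets) auto

lemma emeasure_disjoint_levels:
  assumes "finite Q" "inj_on f Q" "\<And>q. q \<in> Q \<Longrightarrow> f q < H j"
  shows "emeasure space_measure (\<Union>q\<in>Q. level j (f q)) = ennreal (real (card Q) * width j)"
proof -
  have "emeasure space_measure (\<Union>q\<in>Q. level j (f q)) = (\<Sum>q\<in>Q. emeasure space_measure (level j (f q)))"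
  proof (rule sum_emeasure[symmetric])
    show "(\<lambda>q. level j (f q)) ` Q \<subseteq> sets space_measure" using assms(3) level_sets by blast
    show "disjoint_family_on (\<lambda>q. level j (f q)) Q"
      unfolding disjoint_family_on_def
    proof (intro ballI impI)
      fix q q' assume "q \<in> Q" "q' \<in> Q" "q \<noteq> q'"
      then show "level j (f q) \<inter> level j (f q') = {}"
        using assms(2,3) by (intro level_disjoint) (auto dest: inj_onD)
    qed
  qed (rule assms(1))
  also have "\<dots> = (\<Sum>q\<in>Q. ennreal (width j))"
  proof (rule sum.cong[OF refl])
    fix q assume "q \<in> Q"
    then show "emeasure space_measure (level j (f q)) = ennreal (width j)"
      by (intro emeasure_level assms(3))
  qed
  also have "\<dots> = ennreal (real (card Q) * width j)" by (simp add: ennreal_mult ennreal_of_nat_eq_real_of_nat)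
  finally show ?thesis .
qed

text \<open>An earlier tower consists of complete levels of tower \<open>j\<close>, so each column
  contains the fraction \<open>1 / r j\<close> of it. Adding the \<open>n\<close>-th powers over the
  \<open>r j\<close> columns gives the diagonal weight.\<close>

lemma measure_same_column:
  assumes "J \<le> j"
  shows "emeasure (MM n) (same_column n j \<inter> tower_power n J) \<le>
    ennreal (measure space_measure (tower_set J) ^ n * diag_weight n j)"
proof -
  define Q where "Q = {q. q < H j \<and> level j q \<subseteq> tower_set J}"
  have finQ: "finite Q" by (simp add: Q_def)
  have tQ: "tower_set J = (\<Union>q\<in>Q. level j (id q))"
  proof (intro equalityI subsetI)
    fix x assume x: "x \<in> tower_set J"
    then have "x \<in> tower_set j" using tower_set_mono[OF assms] by blast
    then obtain q where q: "q < H j" "x \<in> level j q" by (auto simp: tower_set_def)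
    then have "level j q \<subseteq> tower_set J"
      using tower_set_resolved[OF assms] x unfolding resolved_def by blast
    then show "x \<in> (\<Union>q\<in>Q. level j (id q))" using q by (auto simp: Q_def)
  qed (auto simp: Q_def)
  define t where "t = real (card Q) * width j"
  have "emeasure space_measure (tower_set J) = ennreal t"
    unfolding tQ t_def using finQ by (rule emeasure_disjoint_levels) (auto simp: Q_def)
  then have t: "measure space_measure (tower_set J) = t" by (simp add: measure_def t_def)
  have colQ: "emeasure space_measure (col j i \<inter> tower_set J) = ennreal (t / r j)" if i: "i < r j" for i
  proof -
    have "col j i \<inter> tower_set J = (\<Union>q\<in>Q. level (Suc j) (P j i + q))"
    proof (intro equalityI subsetI)
      fix x assume x: "x \<in> col j i \<inter> tower_set J"
      then obtain q where q: "q < H j" "x \<in> level (Suc j) (P j i + q)" by (auto simp: col_def)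
      then have "x \<in> level j q" using level_block_subset[OF i q(1)] by blast
      then have "level j q \<subseteq> tower_set J"
        using tower_set_resolved[OF assms] x q(1) unfolding resolved_def by blast
      then show "x \<in> (\<Union>q\<in>Q. level (Suc j) (P j i + q))" using q by (auto simp: Q_def)
    next
      fix x assume "x \<in> (\<Union>q\<in>Q. level (Suc j) (P j i + q))"
      then obtain q where q: "q < H j" "level j q \<subseteq> tower_set J" "x \<in> level (Suc j) (P j i + q)"
        by (auto simp: Q_def)
      then show "x \<in> col j i \<inter> tower_set J"
        using level_block_subset[OF i q(1)] by (auto simp: col_def)
    qed
    also have "emeasure space_measure (\<Union>q\<in>Q. level (Suc j) (P j i + q)) = ennreal (real (card Q) * width (Suc j))"
      using finQ i block_less by (intro emeasure_disjoint_levels) (auto simp: Q_def)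
    finally show ?thesis by (simp add: t_def width.simps(2))
  qed
  have t0: "0 \<le> t" by (simp add: t_def)
  have "same_column n j \<inter> tower_power n J = (\<Union>i<r j. Pi\<^sub>E {..<n} (\<lambda>_. col j i \<inter> tower_set J))"
    unfolding same_column_def tower_power_def by (auto simp: PiE_iff)
  then have "emeasure (MM n) (same_column n j \<inter> tower_power n J) =
      emeasure (MM n) (\<Union>i<r j. Pi\<^sub>E {..<n} (\<lambda>_. col j i \<inter> tower_set J))" by simp
  also have "\<dots> \<le> (\<Sum>i<r j. emeasure (MM n) (Pi\<^sub>E {..<n} (\<lambda>_. col j i \<inter> tower_set J)))"
  proof (rule emeasure_subadditive_finite)
    show "(\<lambda>i. Pi\<^sub>E {..<n} (\<lambda>_. col j i \<inter> tower_set J)) ` {..<r j} \<subseteq> sets (MM n)"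
      unfolding tensor_space_def by (intro image_subsetI sets_PiM_I_finite) auto
  qed simp
  also have "\<dots> = (\<Sum>i<r j. ennreal ((t / r j) ^ n))"
  proof (rule sum.cong[OF refl])
    fix i assume "i \<in> {..<r j}"
    then have i: "i < r j" by simp
    have "emeasure (MM n) (Pi\<^sub>E {..<n} (\<lambda>_. col j i \<inter> tower_set J)) =
        (\<Prod>l<n. emeasure space_measure (col j i \<inter> tower_set J))"
      using i by (intro base.emeasure_box) auto
    then show "emeasure (MM n) (Pi\<^sub>E {..<n} (\<lambda>_. col j i \<inter> tower_set J)) = ennreal ((t / r j) ^ n)"
      using t0 by (simp add: colQ[OF i] ennreal_power)
  qed
  also have "\<dots> = ennreal (real (r j) * (t / r j) ^ n)"
    using t0 by (simp add: ennreal_mult ennreal_of_nat_eq_real_of_nat)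
  also have "real (r j) * (t / r j) ^ n = t ^ n * diag_weight n j"
    by (simp add: diag_weight_def power_divide)
  finally show ?thesis unfolding t .
qed

text \<open>The common time forces the same pair of columns in every coordinate. For negative
  \<open>m\<close> the starting point is the image under \<open>T ^^ k\<close> of its translate, so
  the target column \<open>i'\<close> takes over.\<close>

lemma return_same_column:
  assumes x: "x \<in> tower_power n j" and m: "int (H j) < \<bar>m\<bar>" "\<bar>m\<bar> \<le> int (H (Suc j))"
    and ret: "iterate_int (MM n) (TT n) m x \<in> tower_power n j"
  shows "x \<in> same_column n j"
proof -
  have xs: "x \<in> space (MM n)" using x UN_tower_power by blast
  have xl: "x l \<in> tower_set j" "base.V m (x l) \<in> tower_set j" if "l < n" for l
    using x ret that unfolding base.iterate_tensor[OF xs] by (auto simp: tower_power_def PiE_iff)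
  have xw: "x l \<in> whole" if "l < n" for l using xl(1)[OF that] by (auto simp: whole_def)
  define k where "k = nat \<bar>m\<bar>"
  have k: "H j < k" "k \<le> H (Suc j)" using m by (auto simp: k_def)
  obtain i i' where i: "i < r j" "i' < r j"
    "\<And>x. x \<in> tower_set j \<Longrightarrow> (T ^^ k) x \<in> tower_set j \<Longrightarrow> x \<in> col j i \<and> (T ^^ k) x \<in> col j i'"
    using sidon_columns[OF k] by blast
  have "\<exists>i<r j. \<forall>l<n. x l \<in> col j i"
  proof (cases "0 \<le> m")
    case True
    then have "base.V m = T ^^ k" using base.V_of_nat[of k] by (simp add: k_def)
    then have "x l \<in> col j i" if "l < n" for l using i(3)[of "x l"] xl[OF that] by simp
    then show ?thesis using i(1) by blast
  next
    case False
    then have m': "m = - int k" by (simp add: k_def)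
    have "x l \<in> col j i'" if "l < n" for l
    proof -
      have "(T ^^ k) (base.V m (x l)) = x l"
        using base.V_neg(2)[of "x l" "int k"] xw[OF that] by (simp add: m' base.V_of_nat)
      then show ?thesis using i(3)[of "base.V m (x l)"] xl[OF that] by simp
    qed
    then show ?thesis using i(2) by blast
  qed
  then obtain i where "i < r j" "\<forall>l<n. x l \<in> col j i" by blast
  then have "x \<in> Pi\<^sub>E {..<n} (\<lambda>_. col j i)" using x by (auto simp: tower_power_def PiE_iff)
  then show ?thesis using \<open>i < r j\<close> unfolding same_column_def by blast
qed

lemma ex_stage: "int (H j0) < k \<Longrightarrow> \<exists>j\<ge>j0. int (H j) < k \<and> k \<le> int (H (Suc j))"
proof -
  assume k: "int (H j0) < k"
  define i where "i = (LEAST i. k \<le> int (H i))"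
  have "k \<le> int (H (nat k))" using H_ge[of "nat k"] by linarith
  then have i: "k \<le> int (H i)" unfolding i_def by (rule LeastI)
  have "j0 < i"
  proof (rule ccontr)
    assume "\<not> j0 < i"
    then have "H i \<le> H j0" by (intro H_mono) simp
    then show False using i k by linarith
  qed
  then obtain j where j: "i = Suc j" by (cases i) auto
  have "\<not> k \<le> int (H j)" unfolding i_def using j i_def not_less_Least[of j "\<lambda>i. k \<le> int (H i)"] by simp
  then show ?thesis using i j \<open>j0 < i\<close> by (intro exI[of _ j]) auto
qed

lemma finitely_many_returns:
  assumes x: "x \<in> tower_power n J" and ev: "\<And>j. j \<ge> j0 \<Longrightarrow> x \<notin> same_column n j" and "J \<le> j0"
  shows "finite {m. iterate_int (MM n) (TT n) m x \<in> tower_power n J}"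
proof (rule finite_subset)
  show "{m. iterate_int (MM n) (TT n) m x \<in> tower_power n J} \<subseteq> {- int (H j0)..int (H j0)}"
  proof (rule subsetI, rule ccontr)
    fix m assume ret: "m \<in> {m. iterate_int (MM n) (TT n) m x \<in> tower_power n J}" and "m \<notin> {- int (H j0)..int (H j0)}"
    then have "int (H j0) < \<bar>m\<bar>" by auto
    then obtain j where j: "j \<ge> j0" "int (H j) < \<bar>m\<bar>" "\<bar>m\<bar> \<le> int (H (Suc j))" using ex_stage by blast
    have "tower_power n J \<subseteq> tower_power n j" using j(1) assms(3) by (intro tower_power_mono) simp
    then have "x \<in> same_column n j" using x ret j by (intro return_same_column[of x n j m]) auto
    then show False using ev j(1) by blast
  qed
qed simp

text \<open>Almost every orbit visits each tower power only finitely often. A wandering set meeting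
  such orbits exactly once is found by taking the last visit to the tower power of least index that
  the orbit meets.\<close>

theorem tensor_dissipative:
  assumes summ: "summable (diag_weight n)"
  shows "dissipative (MM n) (TT n)"
proof -
  interpret TA: automorphism "MM n" "TT n" by (rule base.tensor_automorphism)
  let ?\<Omega> = "tower_power n"
  \<comment> \<open>The shift \<open>j + J\<close> restricts to stages from \<open>J\<close> on,
    where the measure bound for a common column holds.\<close>
  define N where "N = (\<Union>J. limsup (\<lambda>j. same_column n (j + J) \<inter> ?\<Omega> J))"
  have "limsup (\<lambda>j. same_column n (j + J) \<inter> ?\<Omega> J) \<in> null_sets (MM n)" for J
  proof (rule borel_cantelli_limsup1)
    let ?t = "measure space_measure (tower_set J) ^ n"
    have em: "emeasure (MM n) (same_column n (j + J) \<inter> ?\<Omega> J) \<le> ennreal (?t * diag_weight n (j + J))" for j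
      by (rule measure_same_column) simp
    show "same_column n (j + J) \<inter> ?\<Omega> J \<in> sets (MM n)" for j
      using same_column_sets tower_power_sets by (rule sets.Int)
    show "emeasure (MM n) (same_column n (j + J) \<inter> ?\<Omega> J) < \<infinity>" for j
      using em[of j] by (rule le_less_trans) simp
    have b: "measure (MM n) (same_column n (j + J) \<inter> ?\<Omega> J) \<le> ?t * diag_weight n (j + J)" for j
      using em[of j] diag_weight_nonneg unfolding measure_def by (intro enn2real_leI) auto
    have sm: "summable (\<lambda>j. ?t * diag_weight n (j + J))"
      using summ by (intro summable_mult) (simp add: summable_iff_shift)
    show "summable (\<lambda>j. measure (MM n) (same_column n (j + J) \<inter> ?\<Omega> J))"
      by (rule summable_comparison_test'[OF sm, of 0]) (use b in simp)
  qed
  then have N: "N \<in> null_sets (MM n)" unfolding N_def by (intro null_sets_UN)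
  have fin: "finite {m. TA.V m x \<in> ?\<Omega> J}" if x: "x \<in> space (MM n) - N" for x J
  proof -
    obtain J0 where "x \<in> ?\<Omega> J0" using x UN_tower_power by blast
    define J' where "J' = max J J0"
    have xJ: "x \<in> ?\<Omega> J'" using \<open>x \<in> ?\<Omega> J0\<close> tower_power_mono[of J0 J' n] by (auto simp: J'_def)
    have "x \<notin> limsup (\<lambda>j. same_column n (j + J') \<inter> ?\<Omega> J')" using x by (auto simp: N_def)
    then obtain l where l: "\<And>j. j \<ge> l \<Longrightarrow> x \<notin> same_column n (j + J') \<inter> ?\<Omega> J'"
      unfolding limsup_INF_SUP by auto
    have "x \<notin> same_column n j" if "j \<ge> l + J'" for j
      using l[of "j - J'"] xJ that by auto
    then have "finite {m. TA.V m x \<in> ?\<Omega> J'}" using xJ by (intro finitely_many_returns[of x n J' "l + J'"]) auto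
    then show ?thesis
      by (rule rev_finite_subset) (use tower_power_mono[of J J' n] in \<open>auto simp: J'_def\<close>)
  qed
  \<comment> \<open>The condition on smaller indices concerns the whole orbit, so two points of
    \<open>W\<close> on one orbit have the same \<open>J\<close>; as last visits to the same set
    they must coincide.\<close>
  define W where "W = {x \<in> space (MM n). \<exists>J. x \<in> ?\<Omega> J \<and> (\<forall>m. \<forall>J'<J. TA.V m x \<notin> ?\<Omega> J') \<and>
      (\<forall>m>0. TA.V m x \<notin> ?\<Omega> J)}"
  have [measurable]: "?\<Omega> J \<in> sets (MM n)" for J by (rule tower_power_sets)
  have WM: "W \<in> sets (MM n)"
    unfolding W_def by measurable
  have excl: False if x: "x \<in> W" and y: "y \<in> W" and eq: "TA.V k x = y" and "k > 0" for x y k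
  proof -
    have xs: "x \<in> space (MM n)" using x by (simp add: W_def)
    obtain J where J: "x \<in> ?\<Omega> J" "\<And>m J'. J' < J \<Longrightarrow> TA.V m x \<notin> ?\<Omega> J'" "\<And>m. m > 0 \<Longrightarrow> TA.V m x \<notin> ?\<Omega> J"
      using x unfolding W_def by blast
    obtain K where K: "y \<in> ?\<Omega> K" "\<And>m J'. J' < K \<Longrightarrow> TA.V m y \<notin> ?\<Omega> J'"
      using y unfolding W_def by blast
    have "TA.V (- k) y = x" using eq xs TA.V_neg(1) by blast
    then have "\<not> J < K" using K(2)[of J "- k"] J(1) by auto
    moreover have "\<not> K < J" using J(2)[of K k] K(1) eq by auto
    ultimately have "J = K" by simp
    then show False using J(3)[OF \<open>k > 0\<close>] K(1) eq by simp
  qed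
  have wander: "wandering (MM n) (TT n) W"
    unfolding wandering_def disjoint_family_on_def
  proof (intro conjI WM ballI impI)
    fix k l :: int assume "k \<noteq> l"
    show "TA.V k ` W \<inter> TA.V l ` W = {}"
    proof (rule equals0I)
      fix z assume "z \<in> TA.V k ` W \<inter> TA.V l ` W"
      then obtain x y where xy: "x \<in> W" "y \<in> W" "z = TA.V k x" "z = TA.V l y" by blast
      have xs: "x \<in> space (MM n)" "y \<in> space (MM n)" using xy by (auto simp: W_def)
      have "TA.V (k - l) x = TA.V (- l) (TA.V k x)" using TA.V_add[OF xs(1), of "- l" k] by simp
      also have "\<dots> = TA.V (- l) (TA.V l y)" using xy(3,4) by simp
      also have "\<dots> = y" by (rule TA.V_neg(1)[OF xs(2)])
      finally have 1: "TA.V (k - l) x = y" .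
      have "TA.V (l - k) y = TA.V (- k) (TA.V l y)" using TA.V_add[OF xs(2), of "- k" l] by simp
      also have "\<dots> = TA.V (- k) (TA.V k x)" using xy(3,4) by simp
      also have "\<dots> = x" by (rule TA.V_neg(1)[OF xs(1)])
      finally have 2: "TA.V (l - k) y = x" .
      show False using excl[OF xy(1,2) 1] excl[OF xy(2,1) 2] \<open>k \<noteq> l\<close> by linarith
    qed
  qed
  have cover: "space (MM n) - (\<Union>m. TA.V m ` W) \<subseteq> N"
  proof (rule subsetI, rule ccontr)
    fix x assume x: "x \<in> space (MM n) - (\<Union>m. TA.V m ` W)" and "x \<notin> N"
    then have xs: "x \<in> space (MM n)" "x \<in> space (MM n) - N" by auto
    define J where "J = (LEAST J. \<exists>m. TA.V m x \<in> ?\<Omega> J)"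
    obtain J0 where "x \<in> ?\<Omega> J0" using xs UN_tower_power by blast
    then have "\<exists>m. TA.V m x \<in> ?\<Omega> J0" by (intro exI[of _ 0]) simp
    then have J: "\<exists>m. TA.V m x \<in> ?\<Omega> J" unfolding J_def by (rule LeastI)
    have min: "TA.V m x \<notin> ?\<Omega> J'" if "J' < J" for m J' using not_less_Least that unfolding J_def by blast
    define R where "R = {m. TA.V m x \<in> ?\<Omega> J}"
    have R: "finite R" "R \<noteq> {}" using fin[OF xs(2)] J by (auto simp: R_def)
    define m0 where "m0 = Max R"
    have m0: "TA.V m0 x \<in> ?\<Omega> J" using Max_in[OF R] by (simp add: m0_def R_def)
    have last: "TA.V m (TA.V m0 x) \<notin> ?\<Omega> J" if "m > 0" for m
    proof
      assume "TA.V m (TA.V m0 x) \<in> ?\<Omega> J"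
      then have "m + m0 \<in> R" using TA.V_add[OF xs(1), of m m0] by (simp add: R_def)
      then show False using Max_ge[OF R(1), of "m + m0"] that by (simp add: m0_def)
    qed
    have "TA.V m (TA.V m0 x) \<notin> ?\<Omega> J'" if "J' < J" for m J'
      using min[OF that, of "m + m0"] TA.V_add[OF xs(1), of m m0] by simp
    then have "TA.V m0 x \<in> W" unfolding W_def using m0 last xs(1) by auto
    moreover have "x = TA.V (- m0) (TA.V m0 x)" using TA.V_neg(1)[OF xs(1)] by simp
    ultimately show False using x by blast
  qed
  have "(\<Union>m. TA.V m ` W) \<in> sets (MM n)" using TA.V_image_sets[OF WM] by (intro sets.countable_UN) auto
  then have "space (MM n) - (\<Union>m. TA.V m ` W) \<in> null_sets (MM n)"
    using N cover by (intro null_sets_subset[OF N _ cover]) auto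
  then show ?thesis unfolding dissipative_def using wander by blast
qed

section \<open>The construction as a Sidon rank one construction\<close>

text \<open>The locale numbers stages and columns from 1, the construction from 0; hence the shifts
  by one.\<close>

definition height :: "nat \<Rightarrow> nat" where "height j = H (j - 1)"

definition cuts :: "nat \<Rightarrow> nat" where "cuts j = r (j - 1)"

text \<open>The distance from the start of a copy to the start of the next one, or for the last
  column to the top of the next tower, minus the height of the copy.\<close>

definition spacers :: "nat \<Rightarrow> nat \<Rightarrow> nat" where
  "spacers j i = (if i < cuts j then P (j - 1) i else H j) - P (j - 1) (i - 1) - H (j - 1)"

definition base_set :: "nat \<Rightarrow> real set" where "base_set j = level (j - 1) 0"

definition column_base :: "nat \<Rightarrow> nat \<Rightarrow> real set" where "column_base j i = level j (P (j - 1) (i - 1))"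

lemma T_power_base: "k < H j \<Longrightarrow> (T ^^ k) ` level j 0 = level j k"
  using T_power_image[of 0 k j] by simp

lemma tower_eq: "tower height base_set T j = tower_set (j - 1)"
  by (simp add: tower_def height_def base_set_def tower_set_def T_power_base)

lemma phase_set_eq: "phase_set height base_set T = whole"
proof -
  have "(\<Union>j\<in>{1..}. tower_set (j - 1)) = (\<Union>j. tower_set j)"
  proof (intro equalityI subsetI)
    fix x assume "x \<in> (\<Union>j. tower_set j)"
    then obtain j where "x \<in> tower_set (Suc j - 1)" by auto
    then show "x \<in> (\<Union>j\<in>{1..}. tower_set (j - 1))" by (intro UN_I[of "Suc j"]) auto
  qed auto
  then show ?thesis by (simp add: phase_set_def tower_eq whole_def)
qed

lemma phase_space_eq: "phase_space height base_set T = space_measure"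
  by (simp add: phase_space_def phase_set_eq space_measure_def)

text \<open>A telescoping sum. The truncated subtractions are exact because consecutive copies start
  at least \<open>28 * H k\<close> apart.\<close>

lemma sum_spacers: "m < r k \<Longrightarrow> (\<Sum>i = 1..m. P k i - P k (i - 1) - H k) + m * H k = P k m"
proof (induction m)
  case (Suc m)
  have "P k m + 28 * H k \<le> P k (Suc m)" by (rule P_mono) simp
  then show ?case using Suc by simp
qed simp

theorem rank_one: "rank_one_construction height cuts spacers base_set column_base T"
proof
  show "1 \<le> height 1" by (simp add: height_def)
  show "1 \<le> cuts j" for j using r_ge2[of "j - 1"] by (simp add: cuts_def)
  have "{j. 2 \<le> cuts j} = UNIV" using r_ge2 by (auto simp: cuts_def)
  then show "infinite {j. 2 \<le> cuts j}" by simp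
  show "bij_betw T (phase_set height base_set T) (phase_set height base_set T)"
    unfolding phase_set_eq by (rule T_bij)
  fix j :: nat assume "1 \<le> j"
  then obtain k where j: "j = Suc k" by (cases j) auto
  \<comment> \<open>The last column is split off, since its spacers reach up to the top of the next
    tower and do not fit the telescoping sum.\<close>
  obtain m where m: "r k = Suc m" using r_pos[of k] by (cases "r k") auto
  have "(\<Sum>i = 1..cuts j. spacers j i) = (\<Sum>i = 1..m. spacers j i) + spacers j (Suc m)"
    by (simp add: cuts_def j m)
  also have "(\<Sum>i = 1..m. spacers j i) = (\<Sum>i = 1..m. P k i - P k (i - 1) - H k)"
    by (intro sum.cong) (auto simp: spacers_def cuts_def j m)
  also have "spacers j (Suc m) = H (Suc k) - P k m - H k" by (simp add: spacers_def cuts_def j m)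
  finally have s: "(\<Sum>i = 1..cuts j. spacers j i) =
      (\<Sum>i = 1..m. P k i - P k (i - 1) - H k) + (H (Suc k) - P k m - H k)" .
  have Pm: "P k m + H k \<le> H (Suc k)" using P_bound[of m k] m by simp
  then show "height (j + 1) = height j * cuts j + (\<Sum>i = 1..cuts j. spacers j i)"
  proof -
    define S where "S = (\<Sum>i = 1..m. P k i - P k (i - 1) - H k)"
    have "S + m * H k = P k m" unfolding S_def using sum_spacers[of m k] m by simp
    then have "H (Suc k) = (H k + m * H k) + (S + (H (Suc k) - P k m - H k))" using Pm by linarith
    also have "H k + m * H k = H k * Suc m" by simp
    finally show ?thesis unfolding s S_def[symmetric] by (simp add: height_def cuts_def j m del: diff_diff_left)
  qed
  show "\<exists>w. half_interval w (base_set j)"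
    by (intro exI[of _ "width k"]) (auto simp: half_interval_def base_set_def j level_def)
  show "disjoint_family_on (\<lambda>k. (T ^^ k) ` base_set j) {..<height j}"
    unfolding disjoint_family_on_def
    by (auto simp: base_set_def height_def T_power_base dest: level_unique)
  show "\<exists>c. \<forall>x\<in>(T ^^ k') ` base_set j. T x = x + c" if "k' + 1 < height j" for k'
  proof (intro exI ballI)
    fix x assume x: "x \<in> (T ^^ k') ` base_set j"
    have k': "k' + 1 < H (j - 1)" using that by (simp add: height_def)
    then have "x \<in> level (j - 1) k'" using x T_power_base[of k' "j - 1"] by (simp add: base_set_def)
    then show "T x = x + (lev (j - 1) (k' + 1) - lev (j - 1) k')" using T_level[OF k'] by simp
  qed
  show "base_set j = (\<Union>i\<in>{1..cuts j}. column_base j i)"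
  proof -
    have "base_set j = (\<Union>i<r k. level (Suc k) (P k i))" using level_cut[of 0 k] by (simp add: base_set_def j)
    also have "\<dots> = (\<Union>i\<in>{1..cuts j}. column_base j i)"
    proof -
      have "{1..cuts j} = Suc ` {..<r k}" by (simp add: cuts_def j image_Suc_lessThan)
      then show ?thesis by (simp add: column_base_def j)
    qed
    finally show ?thesis .
  qed
  show "disjoint_family_on (column_base j) {1..cuts j}"
    unfolding disjoint_family_on_def
  proof (intro ballI impI)
    fix i i' assume i: "i \<in> {1..cuts j}" "i' \<in> {1..cuts j}" "i \<noteq> i'"
    have "P k (i - 1) \<noteq> P k (i' - 1)"
    proof (cases "i - 1 < i' - 1")
      case True
      then show ?thesis using P_mono[OF True, of k] H_pos[of k] by linarith
    next
      case False
      then have "i' - 1 < i - 1" using i by auto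
      then show ?thesis using P_mono[of "i' - 1" "i - 1" k] H_pos[of k] by linarith
    qed
    moreover have "P k (i - 1) < H (Suc k)" "P k (i' - 1) < H (Suc k)"
      using i block_less[of "i - 1" k 0] block_less[of "i' - 1" k 0] by (auto simp: cuts_def j)
    ultimately have "level (Suc k) (P k (i - 1)) \<inter> level (Suc k) (P k (i' - 1)) = {}"
      using level_unique by blast
    then show "column_base j i \<inter> column_base j i' = {}" by (simp add: column_base_def j)
  qed
  show "\<exists>w. \<forall>i\<in>{1..cuts j}. half_interval w (column_base j i)"
    by (intro exI[of _ "width j"]) (auto simp: half_interval_def column_base_def level_def)
  show "base_set (j + 1) = column_base j 1" by (simp add: base_set_def column_base_def)
  show "(T ^^ (height j + spacers j i)) ` column_base j i = column_base j (i + 1)" if i: "1 \<le> i" "i < cuts j" for i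
  proof -
    have "P k (i - 1) + 28 * H k \<le> P k i" using i by (intro P_mono) simp
    then have "P k (i - 1) + (height j + spacers j i) = P k i"
      using i by (simp add: height_def spacers_def cuts_def j)
    moreover have "P k i < H (Suc k)" using block_less[of i k 0] i by (simp add: cuts_def j)
    ultimately show ?thesis
      using T_power_image[of "P k (i - 1)" "height j + spacers j i" "Suc k"] by (simp add: column_base_def j)
  qed
qed

theorem sidon_construction: "sidon height cuts base_set column_base T"
  unfolding sidon_def
proof (intro allI impI)
  fix j m assume "1 \<le> j" and m: "height j < m \<and> m \<le> height (j + 1)"
  then obtain k where j: "j = Suc k" by (cases j) auto
  have km: "H k < m" "m \<le> H (Suc k)" using m by (simp_all add: height_def j)
  obtain i i' where i: "i < r k" "i' < r k"
    "\<And>x. x \<in> tower_set k \<Longrightarrow> (T ^^ m) x \<in> tower_set k \<Longrightarrow> x \<in> col k i \<and> (T ^^ m) x \<in> col k i'"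
    using sidon_columns[OF km] by blast
  \<comment> \<open>The intersection consists of image points, so the single column containing it is
    the target column \<open>i'\<close> and not the column of departure.\<close>
  have "column height column_base T j (Suc i') = col k i'"
    using T_power_image[of "P k i'" _ "Suc k"] block_less[OF i(2)]
    by (simp add: column_def height_def column_base_def j col_def)
  moreover have "(T ^^ m) ` tower_set k \<inter> tower_set k \<subseteq> col k i'" using i(3) by blast
  moreover have "Suc i' \<in> {1..cuts j}" using i(2) by (simp add: cuts_def j)
  ultimately show "\<exists>i\<in>{1..cuts j}. (T ^^ m) ` tower height base_set T j \<inter> tower height base_set T j \<subseteq>
      column height column_base T j i"
    by (intro bexI[of _ "Suc i'"]) (simp_all add: tower_eq j)
qed

theorem tensor_spectrum:
  assumes n: "n \<ge> 1" and unbounded: "\<And>j N. \<exists>k\<ge>j. N \<le> r k"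
  shows "\<not> summable (energy n) \<Longrightarrow> singular_spectrum (MM n) (TT n)"
    and "summable (energy n) \<Longrightarrow> lebesgue_spectrum (MM n) (TT n)"
proof -
  note max = lam_maximal_spectral_type[OF n unbounded]
  show "singular_spectrum (MM n) (TT n)" if "\<not> summable (energy n)"
    unfolding singular_spectrum_def using max lam_singular_lebesgue[OF n that] by blast
  show "lebesgue_spectrum (MM n) (TT n)" if "summable (energy n)"
    unfolding lebesgue_spectrum_def using max lam_equivalent_lebesgue[OF n that unbounded] by blast
qed

end

section \<open>Choice of the cutting numbers\<close>

lemma summable_mono_nonneg:
  fixes f g :: "nat \<Rightarrow> real"
  assumes "summable g" "\<And>j. f j \<le> g j" "\<And>j. 0 \<le> f j"
  shows "summable f"
  by (rule summable_comparison_test'[OF assms(1), of 0]) (use assms in simp)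

text \<open>Rounding changes \<open>x \<ge> 1\<close> at most by the factor 3, which does not affect
  summability; what remains is the series of \<open>j powr (- m / \<alpha>)\<close>. The added 1
  guarantees at least two columns.\<close>

lemma summable_ceiling_powr_iff:
  fixes \<alpha> :: real
  assumes "\<alpha> > 0"
  shows "summable (\<lambda>j. 1 / real (1 + nat \<lceil>real (Suc j) powr (1 / \<alpha>)\<rceil>) ^ m) \<longleftrightarrow> \<alpha> < real m"
proof -
  define x where "x j = real (Suc j) powr (1 / \<alpha>)" for j
  define R where "R j = real (1 + nat \<lceil>x j\<rceil>)" for j
  have x1: "1 \<le> x j" for j using assms by (simp add: x_def ge_one_powr_ge_zero)
  have lower: "x j \<le> R j" and upper: "R j \<le> 3 * x j" for j
    using x1[of j] unfolding R_def by linarith+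
  have "summable (\<lambda>j. 1 / x j ^ m) \<longleftrightarrow> \<alpha> < real m"
  proof -
    have "1 / x j ^ m = real (Suc j) powr (- real m / \<alpha>)" for j
      unfolding x_def by (simp add: powr_realpow[symmetric] powr_powr powr_minus_divide)
    then have "summable (\<lambda>j. 1 / x j ^ m) \<longleftrightarrow> summable (\<lambda>j. real (Suc j) powr (- real m / \<alpha>))" by simp
    also have "\<dots> \<longleftrightarrow> summable (\<lambda>j. real j powr (- real m / \<alpha>))"
      by (rule summable_Suc_iff)
    also have "\<dots> \<longleftrightarrow> - real m / \<alpha> < - 1" by (rule summable_real_powr_iff)
    also have "\<dots> \<longleftrightarrow> \<alpha> < real m" using assms by (simp add: field_simps)
    finally show ?thesis .
  qed
  moreover have "summable (\<lambda>j. 1 / R j ^ m) \<longleftrightarrow> summable (\<lambda>j. 1 / x j ^ m)"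
  proof
    assume "summable (\<lambda>j. 1 / x j ^ m)"
    moreover have "1 / R j ^ m \<le> 1 / x j ^ m" for j
      using lower[of j] x1[of j] by (intro divide_left_mono power_mono mult_pos_pos zero_less_power) auto
    moreover have "0 \<le> 1 / R j ^ m" for j by (simp add: R_def)
    ultimately show "summable (\<lambda>j. 1 / R j ^ m)" by (rule summable_mono_nonneg)
  next
    assume "summable (\<lambda>j. 1 / R j ^ m)"
    then have "summable (\<lambda>j. 3 ^ m * (1 / R j ^ m))" by (rule summable_mult)
    moreover have "1 / x j ^ m \<le> 3 ^ m * (1 / R j ^ m)" for j
    proof -
      have R: "R j > 0" using lower[of j] x1[of j] by linarith
      have "R j ^ m \<le> (3 * x j) ^ m" using upper[of j] R by (intro power_mono) auto
      then have "R j ^ m \<le> 3 ^ m * x j ^ m" by (simp add: power_mult_distrib)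
      then show ?thesis using R x1[of j] by (simp add: field_simps)
    qed
    moreover have "0 \<le> 1 / x j ^ m" for j using x1[of j] by simp
    ultimately show "summable (\<lambda>j. 1 / x j ^ m)" by (rule summable_mono_nonneg)
  qed
  ultimately show ?thesis unfolding R_def x_def by simp
qed

text \<open>For \<open>\<alpha> = 0\<close> every positive exponent must give a convergent series,
  which no power of \<open>j\<close> achieves; geometric growth does.\<close>

lemma exists_cutting_numbers:
  fixes \<alpha> :: real
  assumes "0 \<le> \<alpha>"
  obtains r :: "nat \<Rightarrow> nat" where "\<And>j. 2 \<le> r j" "\<And>m. summable (\<lambda>j. 1 / real (r j) ^ m) \<longleftrightarrow> \<alpha> < real m"
proof (cases "\<alpha> = 0")
  case True
  show ?thesis
  proof (rule that[of "\<lambda>j. 2 ^ Suc j"])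
    show "2 \<le> (2::nat) ^ Suc j" for j by simp
    fix m :: nat
    show "summable (\<lambda>j. 1 / real (2 ^ Suc j) ^ m) \<longleftrightarrow> \<alpha> < real m"
    proof (cases "m = 0")
      case True
      then show ?thesis using \<open>\<alpha> = 0\<close> by (simp add: summable_const_iff)
    next
      case False
      have eq: "1 / real (2 ^ Suc j) ^ m = (1 / 2 ^ m) ^ Suc j" for j
        by (simp add: power_divide power_mult[symmetric] mult.commute power_mult_distrib)
      have "(1::real) < 2 ^ m" using False by (intro one_less_power) auto
      then have "summable (\<lambda>j. (1 / 2 ^ m :: real) ^ j)" by (intro summable_geometric) simp
      then have "summable (\<lambda>j. (1 / 2 ^ m :: real) ^ Suc j)" by (subst summable_Suc_iff)
      then show ?thesis using False \<open>\<alpha> = 0\<close> unfolding eq by simp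
    qed
  qed
next
  case False
  then have "\<alpha> > 0" using assms by simp
  show ?thesis
  proof (rule that[of "\<lambda>j. 1 + nat \<lceil>real (Suc j) powr (1 / \<alpha>)\<rceil>"])
    fix j
    have "1 \<le> real (Suc j) powr (1 / \<alpha>)" using \<open>\<alpha> > 0\<close> by (simp add: ge_one_powr_ge_zero)
    then show "2 \<le> 1 + nat \<lceil>real (Suc j) powr (1 / \<alpha>)\<rceil>" by linarith
  qed (rule summable_ceiling_powr_iff[OF \<open>\<alpha> > 0\<close>])
qed

theorem mainTheorem3:
  fixes \<alpha> :: real
  assumes "0 \<le> \<alpha>"
  shows "\<exists>h r s E B T. rank_one_construction h r s E B T \<and> sidon h r E B T \<and>
    (\<forall>n::nat. 1 \<le> n \<longrightarrow>
      (real n \<le> 1 + \<alpha> / 2 \<longrightarrow>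
         singular_spectrum (tensor_space n (phase_space h E T)) (tensor_power n T)) \<and>
      (real n > 1 + \<alpha> / 2 \<longrightarrow>
         lebesgue_spectrum (tensor_space n (phase_space h E T)) (tensor_power n T)) \<and>
      (real n \<le> 1 + \<alpha> \<longrightarrow>
         conservative (tensor_space n (phase_space h E T)) (tensor_power n T)) \<and>
      (real n > 1 + \<alpha> \<longrightarrow>
         dissipative (tensor_space n (phase_space h E T)) (tensor_power n T)))"
proof -
  obtain r :: "nat \<Rightarrow> nat" where r: "\<And>j. 2 \<le> r j" "\<And>m. summable (\<lambda>j. 1 / real (r j) ^ m) \<longleftrightarrow> \<alpha> < real m"
    using exists_cutting_numbers[OF assms] by blast
  interpret lacunary r using r(1) by unfold_locales
  \<comment> \<open>For an exponent above \<open>\<alpha>\<close> the series converges, so its terms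
    tend to 0 and the cutting numbers cannot stay bounded.\<close>
  have unbounded: "\<exists>k\<ge>j. N \<le> r k" for j N
  proof -
    obtain m :: nat where "\<alpha> < real m" using reals_Archimedean2 by blast
    then have "(\<lambda>j. 1 / real (r j) ^ m) \<longlonglongrightarrow> 0" using r(2) summable_LIMSEQ_zero by blast
    then have "eventually (\<lambda>j. 1 / real (r j) ^ m < 1 / real (Suc N) ^ m) sequentially"
      by (rule order_tendstoD(2)) simp
    then obtain l where l: "\<And>k. k \<ge> l \<Longrightarrow> 1 / real (r k) ^ m < 1 / real (Suc N) ^ m"
      by (auto simp: eventually_sequentially)
    have "N \<le> r (max j l)"
    proof (rule ccontr)
      assume "\<not> N \<le> r (max j l)"
      then have "real (r (max j l)) ^ m \<le> real (Suc N) ^ m" by (intro power_mono) auto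
      then have "1 / real (Suc N) ^ m \<le> 1 / real (r (max j l)) ^ m"
        by (intro divide_left_mono mult_pos_pos) auto
      then show False using l[of "max j l"] by simp
    qed
    then show ?thesis by (intro exI[of _ "max j l"]) simp
  qed
  \<comment> \<open>Both series become pure powers: the energy converges exactly for
    \<open>\<alpha> < 2 * (n - 1)\<close>, the diagonal weights exactly for
    \<open>\<alpha> < n - 1\<close>. At equality they diverge, which puts the end points into the
    singular and the conservative case.\<close>
  have energy_eq: "energy n = (\<lambda>k. 1 / real (r k) ^ (2 * (n - 1)))" if "n \<ge> 1" for n
  proof
    fix k
    have "2 * n = 2 + 2 * (n - 1)" using that by simp
    then have "real (r k) ^ (2 * n) = real (r k) ^ 2 * real (r k) ^ (2 * (n - 1))" by (metis power_add)
    then show "energy n k = 1 / real (r k) ^ (2 * (n - 1))" by (simp add: energy_def)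
  qed
  have diag_eq: "diag_weight n = (\<lambda>k. 1 / real (r k) ^ (n - 1))" if "n \<ge> 1" for n
  proof
    fix k
    have "real (r k) ^ n = real (r k) * real (r k) ^ (n - 1)" using that by (simp add: power_eq_if)
    then show "diag_weight n k = 1 / real (r k) ^ (n - 1)" by (simp add: diag_weight_def)
  qed
  have en: "summable (energy n) \<longleftrightarrow> real n > 1 + \<alpha> / 2" if "n \<ge> 1" for n
    unfolding energy_eq[OF that] r(2) using that by (auto simp: of_nat_diff)
  have dw: "summable (diag_weight n) \<longleftrightarrow> real n > 1 + \<alpha>" if "n \<ge> 1" for n
    unfolding diag_eq[OF that] r(2) using that by (auto simp: of_nat_diff)
  show ?thesis
  proof (intro exI conjI allI impI)
    show "rank_one_construction height cuts spacers base_set column_base T" by (rule rank_one)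
    show "sidon height cuts base_set column_base T" by (rule sidon_construction)
    fix n :: nat assume n: "1 \<le> n"
    show "singular_spectrum (tensor_space n (phase_space height base_set T)) (tensor_power n T)"
      if "real n \<le> 1 + \<alpha> / 2"
      unfolding phase_space_eq using tensor_spectrum(1)[OF n unbounded] en[OF n] that by simp
    show "lebesgue_spectrum (tensor_space n (phase_space height base_set T)) (tensor_power n T)"
      if "1 + \<alpha> / 2 < real n"
      unfolding phase_space_eq using tensor_spectrum(2)[OF n unbounded] en[OF n] that by simp
    show "conservative (tensor_space n (phase_space height base_set T)) (tensor_power n T)"
      if "real n \<le> 1 + \<alpha>"
      unfolding phase_space_eq using tensor_conservative[OF n] dw[OF n] that by simp
    show "dissipative (tensor_space n (phase_space height base_set T)) (tensor_power n T)"
      if "1 + \<alpha> < real n"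
      unfolding phase_space_eq using tensor_dissipative[of n] dw[OF n] that by simp
  qed
qed

end
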